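(* Let $G=\{G_1\rightrightarrows G_0\}$ be a Lie groupoid. For any VB-groupoid $\pi:V\to G$, there exist a linear Lie groupoid bundle $\varpi:K\to G_0$ and a weak representation $(A,\alpha)$ of $G$ on $K$ such that the action groupoid $G\times_A K$ is isomorphic to $V$ as a VB-groupoid over $G$.
   Context: **Notation.** $s,t,u$ are the source, target and unit maps of $G$. $G_n$ is the manifold of composable $n$-tuples $(g_1,\dots,g_n)$, i.e. $s(g_i)=t(g_{i+1})$; $t_2(g,h)=t(g)$. In all groupoids a product $ab$ means "first $b$, then $a$". **VB-groupoids.** A VB-groupoid over $G$ is a map of Lie groupoids $\pi:V\to G$ such that $\pi_0:V_0\to G_0$ and $\pi_1:V_1\to G_1$ are vector bundles and all structure maps of $V$ are vector bundle maps covering the structure maps of $G$. A map of VB-groupoids over $G$ is a map of Lie groupoids whose components on objects and arrows are vector bundle maps covering $\mathrm{id}_{G_0}$ and $\mathrm{id}_{G_1}$. **Linear Lie groupoid bundles.** A linear Lie groupoid bundle over a manifold $M$ is a VB-groupoid over the trivial groupoid $M$ (objects and morphisms $M$, all structure maps $\mathrm{id}_M$). A map of linear Lie groupoid bundles is a map of Lie groupoids whose object and arrow components are vector bundle maps covering one and the same smooth map $\bar f$ of bases. A natural transformation of linear Lie groupoid bundles between two maps covering the same $\bar f$ is a natural transformation that is, as a map from the object bundle of the domain to the arrow bundle of the codomain, a vector bundle map covering $\bar f$. **Weak representations.** A weak representation of $G$ on a linear Lie groupoid bundle $\varpi:K\to G_0$ is a pair $(A,\alpha)$ where: (1) $A:G_1\times_{s,G_0}K\to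 K$ is a map of linear Lie groupoid bundles covering $t:G_1\to G_0$; here $G_1\times_{s,G_0}K$ is the linear Lie groupoid bundle over $G_1$ with objects $\{(g,x)\in G_1\times K_0: s(g)=\varpi_0(x)\}$, arrows $\{(g,v)\in G_1\times K_1: s(g)=\varpi_1(v)\}$, and groupoid structure only in the $K$-factor. Write $g\cdot x=A(g,x)$, $g\cdot v=A(g,v)$. (2) $A$ is unital: $u(\varpi(x))\cdot x=x$ and $u(\varpi(v))\cdot v=v$ for all $x\in K_0$, $v\in K_1$. (3) $\alpha$ is a natural transformation of linear Lie groupoid bundles covering $t_2$ with components $\alpha(g,k,x):g\cdot(k\cdot x)\to(gk)\cdot x$, for $(g,k)\in G_2$, $x\in K_0$, $s(k)=\varpi_0(x)$; naturality means $\alpha(g,k,y)\,(g\cdot(k\cdot v))=((gk)\cdot v)\,\alpha(g,k,x)$ for $v:x\to y$. (4) For all $(g,k,l)\in G_3$ and $x\in K_0$ with $s(l)=\varpi_0(x)$: $\alpha(g,kl,x)\,(g\cdot\alpha(k,l,x))=\alpha(gk,l,x)\,\alpha(g,k,l\cdot x)$; and $\alpha(g,u(\varpi(x)),x)$ and $\alpha(u(t(g)),g,x)$ are identity arrows of $K$ at $g\cdot x$. **Action groupoid.** Let $\tilde s,\tilde t,\tilde u$ be the source, target and unit maps of $K$. $G\times_A K$ is the VB-groupoid over $G$ with objects $K_0$, arrows $\{(g,x,v)\in G_1\times K_0\times K_1: s(g)=\varpi_0(x),\ \tilde t(v)=g\cdot x\}$, source $(g,x,v)\mapsto x$, target $(g,x,v)\mapsto\tilde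 s(v)$, multiplication $(g,x,v)(g',x',v')=(gg',x',\alpha(g,g',x')\,(g\cdot v')\,v)$, units $x\mapsto(u(\varpi(x)),x,\tilde u(x))$, and projection to $G$ given by $\varpi_0$ on objects and $(g,x,v)\mapsto g$ on arrows (with fibrewise vector space structure in $(x,v)$). *)

theory Defs
  imports "HOL-Analysis.Analysis"
begin

section \<open>Smooth maps between subsets of Euclidean spaces\<close>

text \<open>\<open>Ck k S f\<close> is meant for open \<open>S\<close>: all iterated directional derivatives of \<open>f\<close> up to
  order \<open>k\<close> exist as Frechet derivatives and are continuous on \<open>S\<close>.\<close>

primrec Ck :: "nat \<Rightarrow> 'e::euclidean_space set \<Rightarrow> ('e \<Rightarrow> 'f::euclidean_space) \<Rightarrow> bool" where
  "Ck 0 S f \<longleftrightarrow> continuous_on S f"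
| "Ck (Suc k) S f \<longleftrightarrow>
     (\<exists>f'. (\<forall>x\<in>S. (f has_derivative f' x) (at x)) \<and> (\<forall>v. Ck k S (\<lambda>x. f' x v)))"

text \<open>Smoothness on an arbitrary subset means local extendability to a smooth function. It is only
  used on relatively open subsets of linear subspaces, where it is smoothness in the usual sense
  on that finite-dimensional vector space.\<close>

definition smooth_on :: "'e::euclidean_space set \<Rightarrow> ('e \<Rightarrow> 'f::euclidean_space) \<Rightarrow> bool" where
  "smooth_on S f \<longleftrightarrow>
     (\<forall>x\<in>S. \<exists>W h. open W \<and> x \<in> W \<and> (\<forall>k. Ck k W h) \<and> (\<forall>y\<in>S \<inter> W. f y = h y))"


section \<open>Manifolds\<close>

text \<open>A chart takes values in a linear subspace of the Euclidean space \<open>'e\<close>, with image open in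
  that subspace, rather than in \<open>'e\<close> itself: the type \<open>'e\<close> only bounds the dimension. This is what
  makes zero-dimensional manifolds (points, discrete groups, the zero bundle over a point) and
  fibre products available, since \<open>DIM('e)\<close> is positive and cannot depend on a value.\<close>

record ('a, 'e) manifold =
  mtop :: "'a topology"
  atlas :: "('a set \<times> ('a \<Rightarrow> 'e)) set"

abbreviation points :: "('a, 'e, 'z) manifold_scheme \<Rightarrow> 'a set" where
  "points M \<equiv> topspace (mtop M)"

text \<open>The model space of a chart \<open>(U, \<phi>)\<close> with \<open>U\<close> nonempty can be recovered as
  \<open>span (\<phi> ` U)\<close>, because a nonempty open subset of a vector space spans it.\<close>

definition is_chart :: "'a topology \<Rightarrow> 'a set \<Rightarrow> ('a \<Rightarrow> 'e::euclidean_space) \<Rightarrow> bool" where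
  "is_chart X U \<phi> \<longleftrightarrow>
     openin X U \<and>
     openin (top_of_set (span (\<phi> ` U))) (\<phi> ` U) \<and>
     homeomorphic_map (subtopology X U) (top_of_set (\<phi> ` U)) \<phi>"

definition smooth_transition ::
    "('a set \<times> ('a \<Rightarrow> 'e::euclidean_space)) \<Rightarrow> ('a set \<times> ('a \<Rightarrow> 'e)) \<Rightarrow> bool" where
  "smooth_transition = (\<lambda>(U, \<phi>) (V, \<psi>). smooth_on (\<phi> ` (U \<inter> V)) (\<psi> \<circ> inv_into U \<phi>))"

definition smooth_manifold :: "('a, 'e::euclidean_space) manifold \<Rightarrow> bool" where
  "smooth_manifold M \<longleftrightarrow>
     Hausdorff_space (mtop M) \<and> second_countable (mtop M) \<and>
     (\<forall>(U, \<phi>)\<in>atlas M. is_chart (mtop M) U \<phi>) \<and>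
     points M = (\<Union>(U, \<phi>)\<in>atlas M. U) \<and>
     (\<forall>c\<in>atlas M. \<forall>d\<in>atlas M. smooth_transition c d)"

definition maximal_atlas ::
    "('a, 'e::euclidean_space) manifold \<Rightarrow> ('a set \<times> ('a \<Rightarrow> 'e)) set" where
  "maximal_atlas M =
     {(U, \<phi>). is_chart (mtop M) U \<phi> \<and>
        (\<forall>d\<in>atlas M. smooth_transition (U, \<phi>) d \<and> smooth_transition d (U, \<phi>))}"

definition smooth_map ::
    "('a, 'e::euclidean_space) manifold \<Rightarrow> ('b, 'f::euclidean_space) manifold \<Rightarrow> ('a \<Rightarrow> 'b) \<Rightarrow> bool" where
  "smooth_map M N f \<longleftrightarrow>
     continuous_map (mtop M) (mtop N) f \<and>
     (\<forall>(U, \<phi>)\<in>atlas M. \<forall>(V, \<psi>)\<in>atlas N.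
        smooth_on (\<phi> ` (U \<inter> f -` V)) (\<psi> \<circ> f \<circ> inv_into U \<phi>))"

definition diffeomorphism ::
    "('a, 'e::euclidean_space) manifold \<Rightarrow> ('b, 'f::euclidean_space) manifold \<Rightarrow> ('a \<Rightarrow> 'b) \<Rightarrow> bool" where
  "diffeomorphism M N f \<longleftrightarrow>
     smooth_map M N f \<and>
     (\<exists>h. smooth_map N M h \<and> (\<forall>x\<in>points M. h (f x) = x) \<and> (\<forall>y\<in>points N. f (h y) = y))"

text \<open>\<open>D\<close> is the differential of \<open>f\<close> at \<open>x\<close> in the charts \<open>\<phi>\<close> and \<open>\<psi>\<close>. As a map on all of \<open>'e\<close> it is
  only determined on the model space \<open>span (\<phi> ` U)\<close>.\<close>

definition submersion ::
    "('a, 'e::euclidean_space) manifold \<Rightarrow> ('b, 'f::euclidean_space) manifold \<Rightarrow> ('a \<Rightarrow> 'b) \<Rightarrow> bool" where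
  "submersion M N f \<longleftrightarrow>
     smooth_map M N f \<and>
     (\<forall>x\<in>points M. \<forall>(U, \<phi>)\<in>atlas M. \<forall>(V, \<psi>)\<in>atlas N. x \<in> U \<longrightarrow> f x \<in> V \<longrightarrow>
        (\<exists>D. ((\<psi> \<circ> f \<circ> inv_into U \<phi>) has_derivative D) (at (\<phi> x) within \<phi> ` (U \<inter> f -` V)) \<and>
             D ` span (\<phi> ` U) = span (\<psi> ` V)))"

definition prod_manifold ::
    "('a, 'e::euclidean_space) manifold \<Rightarrow> ('b, 'f::euclidean_space) manifold \<Rightarrow> ('a \<times> 'b, 'e \<times> 'f) manifold" where
  "prod_manifold M N =
     \<lparr>mtop = prod_topology (mtop M) (mtop N),
      atlas = {(U \<times> V, map_prod \<phi> \<psi>) |U \<phi> V \<psi>. (U, \<phi>) \<in> atlas M \<and> (V, \<psi>) \<in> atlas N}\<rparr>"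

text \<open>The structure of an embedded submanifold, given by all slice charts of \<open>M\<close> for \<open>S\<close>. The result is
  a manifold if and only if \<open>S\<close> is an embedded submanifold (otherwise the slice charts do not cover
  \<open>S\<close>). In particular it applies to open subsets and to fibre products along submersions.\<close>

definition submanifold :: "('a, 'e::euclidean_space) manifold \<Rightarrow> 'a set \<Rightarrow> ('a, 'e) manifold" where
  "submanifold M S =
     \<lparr>mtop = subtopology (mtop M) S,
      atlas = {(U \<inter> S, \<phi>) |U \<phi>. (U, \<phi>) \<in> maximal_atlas M \<and>
                 (\<exists>L. subspace L \<and> \<phi> ` (U \<inter> S) = \<phi> ` U \<inter> L)}\<rparr>"

definition linear_manifold :: "'e::euclidean_space set \<Rightarrow> ('e, 'e) manifold" where
  "linear_manifold L = \<lparr>mtop = top_of_set L, atlas = {(L, id)}\<rparr>"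


section \<open>Vector bundles\<close>

definition real_vector_space_on :: "'a set \<Rightarrow> ('a \<Rightarrow> 'a \<Rightarrow> 'a) \<Rightarrow> (real \<Rightarrow> 'a \<Rightarrow> 'a) \<Rightarrow> bool" where
  "real_vector_space_on S add smul \<longleftrightarrow>
     (\<forall>x\<in>S. \<forall>y\<in>S. add x y \<in> S) \<and> (\<forall>c. \<forall>x\<in>S. smul c x \<in> S) \<and>
     (\<forall>x\<in>S. \<forall>y\<in>S. \<forall>z\<in>S. add (add x y) z = add x (add y z)) \<and>
     (\<forall>x\<in>S. \<forall>y\<in>S. add x y = add y x) \<and>
     (\<exists>z\<in>S. (\<forall>x\<in>S. add z x = x) \<and> (\<forall>x\<in>S. \<exists>y\<in>S. add x y = z)) \<and>
     (\<forall>c. \<forall>x\<in>S. \<forall>y\<in>S. smul c (add x y) = add (smul c x) (smul c y)) \<and>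
     (\<forall>c d. \<forall>x\<in>S. smul (c + d) x = add (smul c x) (smul d x)) \<and>
     (\<forall>c d. \<forall>x\<in>S. smul c (smul d x) = smul (c * d) x) \<and>
     (\<forall>x\<in>S. smul 1 x = x)"

record ('a, 'e, 'b, 'f) vbundle =
  total :: "('a, 'e) manifold"
  base :: "('b, 'f) manifold"
  proj :: "'a \<Rightarrow> 'b"
  vadd :: "'a \<Rightarrow> 'a \<Rightarrow> 'a"
  vscale :: "real \<Rightarrow> 'a \<Rightarrow> 'a"

definition fibre :: "('a, 'e, 'b, 'f) vbundle \<Rightarrow> 'b \<Rightarrow> 'a set" where
  "fibre E b = {e \<in> points (total E). proj E e = b}"

text \<open>A local trivialization over \<open>U\<close> is \<open>e \<mapsto> (proj E e, \<tau> e)\<close> with values in \<open>U \<times> L\<close>, where the vector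
  space \<open>L\<close> is the typical fibre; its dimension is the local rank.\<close>

definition vector_bundle ::
    "('a, 'e::euclidean_space, 'b, 'f::euclidean_space) vbundle \<Rightarrow> bool" where
  "vector_bundle E \<longleftrightarrow>
     smooth_manifold (total E) \<and> smooth_manifold (base E) \<and>
     smooth_map (total E) (base E) (proj E) \<and>
     (\<forall>b\<in>points (base E). real_vector_space_on (fibre E b) (vadd E) (vscale E)) \<and>
     (\<forall>b\<in>points (base E). \<exists>U (L :: 'e set) \<tau>.
        openin (mtop (base E)) U \<and> b \<in> U \<and> subspace L \<and>
        diffeomorphism (submanifold (total E) {e \<in> points (total E). proj E e \<in> U})
          (prod_manifold (submanifold (base E) U) (linear_manifold L)) (\<lambda>e. (proj E e, \<tau> e)) \<and>
        (\<forall>c\<in>U. (\<forall>e\<in>fibre E c. \<forall>e'\<in>fibre E c. \<tau> (vadd E e e') = \<tau> e + \<tau> e') \<and>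
                (\<forall>r. \<forall>e\<in>fibre E c. \<tau> (vscale E r e) = r *\<^sub>R \<tau> e)))"

text \<open>\<open>f\<close> is a vector bundle map from \<open>E\<close> to \<open>F\<close> covering the smooth map \<open>f'\<close>.\<close>

definition vb_map ::
    "('a, 'e::euclidean_space, 'b, 'f::euclidean_space) vbundle
     \<Rightarrow> ('c, 'h::euclidean_space, 'd, 'k::euclidean_space) vbundle \<Rightarrow> ('a \<Rightarrow> 'c) \<Rightarrow> ('b \<Rightarrow> 'd) \<Rightarrow> bool" where
  "vb_map E F f f' \<longleftrightarrow>
     smooth_map (total E) (total F) f \<and> smooth_map (base E) (base F) f' \<and>
     (\<forall>e\<in>points (total E). proj F (f e) = f' (proj E e)) \<and>
     (\<forall>b\<in>points (base E). \<forall>e\<in>fibre E b. \<forall>e'\<in>fibre E b. f (vadd E e e') = vadd F (f e) (f e')) \<and>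
     (\<forall>r. \<forall>e\<in>points (total E). f (vscale E r e) = vscale F r (f e))"

definition pullback_vb ::
    "('n, 'h::euclidean_space) manifold \<Rightarrow> ('n \<Rightarrow> 'b) \<Rightarrow> ('a, 'e::euclidean_space, 'b, 'f) vbundle
     \<Rightarrow> ('n \<times> 'a, 'h \<times> 'e, 'n, 'h) vbundle" where
  "pullback_vb N p E =
     \<lparr>total = submanifold (prod_manifold N (total E))
                {(n, e). n \<in> points N \<and> e \<in> points (total E) \<and> p n = proj E e},
      base = N,
      proj = fst,
      vadd = (\<lambda>(n, e) (n', e'). (n, vadd E e e')),
      vscale = (\<lambda>r (n, e). (n, vscale E r e))\<rparr>"


section \<open>Lie groupoids\<close>

text \<open>\<open>mult G g h\<close> is the product \<open>g h\<close>, meaning first \<open>h\<close>, then \<open>g\<close>. It is relevant only when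
  \<open>src G g = tgt G h\<close>.\<close>

record ('o, 'e, 'a, 'f) groupoid =
  Obj :: "('o, 'e) manifold"
  Arr :: "('a, 'f) manifold"
  src :: "'a \<Rightarrow> 'o"
  tgt :: "'a \<Rightarrow> 'o"
  unit :: "'o \<Rightarrow> 'a"
  mult :: "'a \<Rightarrow> 'a \<Rightarrow> 'a"

definition composable_pairs ::
    "('o, 'e::euclidean_space, 'a, 'f::euclidean_space) groupoid \<Rightarrow> ('a \<times> 'a, 'f \<times> 'f) manifold" where
  "composable_pairs G =
     submanifold (prod_manifold (Arr G) (Arr G))
       {(g, h). g \<in> points (Arr G) \<and> h \<in> points (Arr G) \<and> src G g = tgt G h}"

definition is_inverse :: "('o, 'e, 'a, 'f) groupoid \<Rightarrow> 'a \<Rightarrow> 'a \<Rightarrow> bool" where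
  "is_inverse G g h \<longleftrightarrow>
     h \<in> points (Arr G) \<and> src G h = tgt G g \<and> tgt G h = src G g \<and>
     mult G h g = unit G (src G g) \<and> mult G g h = unit G (tgt G g)"

definition ginv :: "('o, 'e, 'a, 'f) groupoid \<Rightarrow> 'a \<Rightarrow> 'a" where
  "ginv G g = (THE h. is_inverse G g h)"

definition algebraic_groupoid :: "('o, 'e, 'a, 'f) groupoid \<Rightarrow> bool" where
  "algebraic_groupoid G \<longleftrightarrow>
     (\<forall>g\<in>points (Arr G). src G g \<in> points (Obj G) \<and> tgt G g \<in> points (Obj G)) \<and>
     (\<forall>x\<in>points (Obj G). unit G x \<in> points (Arr G) \<and> src G (unit G x) = x \<and> tgt G (unit G x) = x) \<and>
     (\<forall>g\<in>points (Arr G). \<forall>h\<in>points (Arr G). src G g = tgt G h \<longrightarrow>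
        mult G g h \<in> points (Arr G) \<and> src G (mult G g h) = src G h \<and> tgt G (mult G g h) = tgt G g) \<and>
     (\<forall>g\<in>points (Arr G). \<forall>h\<in>points (Arr G). \<forall>k\<in>points (Arr G).
        src G g = tgt G h \<longrightarrow> src G h = tgt G k \<longrightarrow> mult G (mult G g h) k = mult G g (mult G h k)) \<and>
     (\<forall>g\<in>points (Arr G). mult G g (unit G (src G g)) = g \<and> mult G (unit G (tgt G g)) g = g) \<and>
     (\<forall>g\<in>points (Arr G). \<exists>h. is_inverse G g h)"

definition lie_groupoid ::
    "('o, 'e::euclidean_space, 'a, 'f::euclidean_space) groupoid \<Rightarrow> bool" where
  "lie_groupoid G \<longleftrightarrow>
     algebraic_groupoid G \<and>
     smooth_manifold (Obj G) \<and> smooth_manifold (Arr G) \<and>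
     submersion (Arr G) (Obj G) (src G) \<and> submersion (Arr G) (Obj G) (tgt G) \<and>
     smooth_map (Obj G) (Arr G) (unit G) \<and>
     smooth_map (composable_pairs G) (Arr G) (\<lambda>(g, h). mult G g h) \<and>
     smooth_map (Arr G) (Arr G) (ginv G)"

definition lie_groupoid_map ::
    "('o, 'e::euclidean_space, 'a, 'f::euclidean_space) groupoid
     \<Rightarrow> ('p, 'h::euclidean_space, 'b, 'k::euclidean_space) groupoid
     \<Rightarrow> ('o \<Rightarrow> 'p) \<Rightarrow> ('a \<Rightarrow> 'b) \<Rightarrow> bool" where
  "lie_groupoid_map G H f0 f1 \<longleftrightarrow>
     smooth_map (Obj G) (Obj H) f0 \<and> smooth_map (Arr G) (Arr H) f1 \<and>
     (\<forall>g\<in>points (Arr G). src H (f1 g) = f0 (src G g) \<and> tgt H (f1 g) = f0 (tgt G g)) \<and>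
     (\<forall>x\<in>points (Obj G). f1 (unit G x) = unit H (f0 x)) \<and>
     (\<forall>g\<in>points (Arr G). \<forall>h\<in>points (Arr G). src G g = tgt G h \<longrightarrow>
        f1 (mult G g h) = mult H (f1 g) (f1 h))"

text \<open>\<open>\<eta>\<close> is a natural transformation from \<open>(f0, f1)\<close> to \<open>(h0, h1)\<close>, as functors \<open>D \<rightarrow> C\<close>.\<close>

definition natural_transformation ::
    "('o, 'e, 'a, 'f) groupoid \<Rightarrow> ('p, 'h, 'b, 'k) groupoid
     \<Rightarrow> ('o \<Rightarrow> 'p) \<Rightarrow> ('a \<Rightarrow> 'b) \<Rightarrow> ('o \<Rightarrow> 'p) \<Rightarrow> ('a \<Rightarrow> 'b) \<Rightarrow> ('o \<Rightarrow> 'b) \<Rightarrow> bool" where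
  "natural_transformation D C f0 f1 h0 h1 \<eta> \<longleftrightarrow>
     (\<forall>x\<in>points (Obj D).
        \<eta> x \<in> points (Arr C) \<and> src C (\<eta> x) = f0 x \<and> tgt C (\<eta> x) = h0 x) \<and>
     (\<forall>a\<in>points (Arr D). mult C (\<eta> (tgt D a)) (f1 a) = mult C (h1 a) (\<eta> (src D a)))"

definition trivial_groupoid :: "('m, 'd) manifold \<Rightarrow> ('m, 'd, 'm, 'd) groupoid" where
  "trivial_groupoid M =
     \<lparr>Obj = M, Arr = M, src = id, tgt = id, unit = id, mult = (\<lambda>a b. a)\<rparr>"


section \<open>VB-groupoids\<close>

record ('v0, 'e0, 'm0, 'd0, 'v1, 'e1, 'm1, 'd1) vbg =
  objb :: "('v0, 'e0, 'm0, 'd0) vbundle"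
  arrb :: "('v1, 'e1, 'm1, 'd1) vbundle"
  vsrc :: "'v1 \<Rightarrow> 'v0"
  vtgt :: "'v1 \<Rightarrow> 'v0"
  vunit :: "'v0 \<Rightarrow> 'v1"
  vmult :: "'v1 \<Rightarrow> 'v1 \<Rightarrow> 'v1"

definition total_groupoid ::
    "('v0, 'e0, 'm0, 'd0, 'v1, 'e1, 'm1, 'd1) vbg \<Rightarrow> ('v0, 'e0, 'v1, 'e1) groupoid" where
  "total_groupoid V =
     \<lparr>Obj = total (objb V), Arr = total (arrb V),
      src = vsrc V, tgt = vtgt V, unit = vunit V, mult = vmult V\<rparr>"

text \<open>The bundle of composable pairs of \<open>V\<close> over the manifold of composable pairs of \<open>G\<close>.\<close>

definition composable_bundle ::
    "('o, 'd0::euclidean_space, 'a, 'd1::euclidean_space) groupoid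
     \<Rightarrow> ('v0, 'e0::euclidean_space, 'o, 'd0, 'v1, 'e1::euclidean_space, 'a, 'd1) vbg
     \<Rightarrow> ('v1 \<times> 'v1, 'e1 \<times> 'e1, 'a \<times> 'a, 'd1 \<times> 'd1) vbundle" where
  "composable_bundle G V =
     \<lparr>total = composable_pairs (total_groupoid V),
      base = composable_pairs G,
      proj = map_prod (proj (arrb V)) (proj (arrb V)),
      vadd = (\<lambda>(v, w) (v', w'). (vadd (arrb V) v v', vadd (arrb V) w w')),
      vscale = (\<lambda>r (v, w). (vscale (arrb V) r v, vscale (arrb V) r w))\<rparr>"

definition vb_groupoid ::
    "('o, 'd0::euclidean_space, 'a, 'd1::euclidean_space) groupoid
     \<Rightarrow> ('v0, 'e0::euclidean_space, 'o, 'd0, 'v1, 'e1::euclidean_space, 'a, 'd1) vbg \<Rightarrow> bool" where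
  "vb_groupoid G V \<longleftrightarrow>
     lie_groupoid G \<and> lie_groupoid (total_groupoid V) \<and>
     vector_bundle (objb V) \<and> base (objb V) = Obj G \<and>
     vector_bundle (arrb V) \<and> base (arrb V) = Arr G \<and>
     lie_groupoid_map (total_groupoid V) G (proj (objb V)) (proj (arrb V)) \<and>
     vb_map (arrb V) (objb V) (vsrc V) (src G) \<and>
     vb_map (arrb V) (objb V) (vtgt V) (tgt G) \<and>
     vb_map (objb V) (arrb V) (vunit V) (unit G) \<and>
     vb_map (composable_bundle G V) (arrb V) (\<lambda>(v, w). vmult V v w) (\<lambda>(g, h). mult G g h) \<and>
     vb_map (arrb V) (arrb V) (ginv (total_groupoid V)) (ginv G)"

text \<open>\<open>(f0, f1)\<close> is a map of Lie groupoids whose components are vector bundle maps covering \<open>b0\<close>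
  and \<open>b1\<close>.\<close>

definition vbg_map ::
    "('v0, 'e0::euclidean_space, 'm0, 'd0::euclidean_space, 'v1, 'e1::euclidean_space, 'm1, 'd1::euclidean_space) vbg
     \<Rightarrow> ('w0, 'h0::euclidean_space, 'n0, 'k0::euclidean_space, 'w1, 'h1::euclidean_space, 'n1, 'k1::euclidean_space) vbg
     \<Rightarrow> ('v0 \<Rightarrow> 'w0) \<Rightarrow> ('v1 \<Rightarrow> 'w1) \<Rightarrow> ('m0 \<Rightarrow> 'n0) \<Rightarrow> ('m1 \<Rightarrow> 'n1) \<Rightarrow> bool" where
  "vbg_map V W f0 f1 b0 b1 \<longleftrightarrow>
     lie_groupoid_map (total_groupoid V) (total_groupoid W) f0 f1 \<and>
     vb_map (objb V) (objb W) f0 b0 \<and> vb_map (arrb V) (arrb W) f1 b1"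

definition vb_groupoid_isomorphic ::
    "('o, 'd0::euclidean_space, 'a, 'd1::euclidean_space) groupoid
     \<Rightarrow> ('v0, 'e0::euclidean_space, 'o, 'd0, 'v1, 'e1::euclidean_space, 'a, 'd1) vbg
     \<Rightarrow> ('w0, 'h0::euclidean_space, 'o, 'd0, 'w1, 'h1::euclidean_space, 'a, 'd1) vbg \<Rightarrow> bool" where
  "vb_groupoid_isomorphic G V W \<longleftrightarrow>
     vb_groupoid G V \<and> vb_groupoid G W \<and>
     (\<exists>f0 f1 h0 h1. vbg_map V W f0 f1 id id \<and> vbg_map W V h0 h1 id id \<and>
        (\<forall>x\<in>points (total (objb V)). h0 (f0 x) = x) \<and> (\<forall>y\<in>points (total (objb W)). f0 (h0 y) = y) \<and>
        (\<forall>x\<in>points (total (arrb V)). h1 (f1 x) = x) \<and> (\<forall>y\<in>points (total (arrb W)). f1 (h1 y) = y))"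


section \<open>Linear Lie groupoid bundles\<close>

definition linear_lie_groupoid_bundle ::
    "('m, 'd::euclidean_space) manifold
     \<Rightarrow> ('k0, 'e0::euclidean_space, 'm, 'd, 'k1, 'e1::euclidean_space, 'm, 'd) vbg \<Rightarrow> bool" where
  "linear_lie_groupoid_bundle M K \<longleftrightarrow> vb_groupoid (trivial_groupoid M) K"

abbreviation llgb_map where
  "llgb_map K K' f0 f1 b \<equiv> vbg_map K K' f0 f1 b b"

definition llgb_natural_transformation ::
    "('v0, 'e0::euclidean_space, 'm, 'd::euclidean_space, 'v1, 'e1::euclidean_space, 'm, 'd) vbg
     \<Rightarrow> ('w0, 'h0::euclidean_space, 'n, 'k::euclidean_space, 'w1, 'h1::euclidean_space, 'n, 'k) vbg
     \<Rightarrow> ('v0 \<Rightarrow> 'w0) \<Rightarrow> ('v1 \<Rightarrow> 'w1) \<Rightarrow> ('v0 \<Rightarrow> 'w0) \<Rightarrow> ('v1 \<Rightarrow> 'w1)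
     \<Rightarrow> ('m \<Rightarrow> 'n) \<Rightarrow> ('v0 \<Rightarrow> 'w1) \<Rightarrow> bool" where
  "llgb_natural_transformation K K' f0 f1 h0 h1 b \<eta> \<longleftrightarrow>
     llgb_map K K' f0 f1 b \<and> llgb_map K K' h0 h1 b \<and>
     natural_transformation (total_groupoid K) (total_groupoid K') f0 f1 h0 h1 \<eta> \<and>
     vb_map (objb K) (arrb K') \<eta> b"

text \<open>The pullback \<open>N \<times> K\<close> along \<open>p\<close> of a linear Lie groupoid bundle \<open>K\<close>, with groupoid structure only
  in the \<open>K\<close>-factor.\<close>

definition pullback_llgb ::
    "('n, 'h::euclidean_space) manifold \<Rightarrow> ('n \<Rightarrow> 'm)
     \<Rightarrow> ('k0, 'e0::euclidean_space, 'm, 'd, 'k1, 'e1::euclidean_space, 'm, 'd) vbg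
     \<Rightarrow> ('n \<times> 'k0, 'h \<times> 'e0, 'n, 'h, 'n \<times> 'k1, 'h \<times> 'e1, 'n, 'h) vbg" where
  "pullback_llgb N p K =
     \<lparr>objb = pullback_vb N p (objb K),
      arrb = pullback_vb N p (arrb K),
      vsrc = map_prod id (vsrc K),
      vtgt = map_prod id (vtgt K),
      vunit = map_prod id (vunit K),
      vmult = (\<lambda>(n, v) (n', v'). (n, vmult K v v'))\<rparr>"


section \<open>Weak representations and their action groupoids\<close>

text \<open>\<open>A0\<close> and \<open>A1\<close> are the object and arrow components of the action \<open>A\<close>.\<close>

definition weak_representation ::
    "('o, 'd0::euclidean_space, 'a, 'd1::euclidean_space) groupoid
     \<Rightarrow> ('k0, 'e0::euclidean_space, 'o, 'd0, 'k1, 'e1::euclidean_space, 'o, 'd0) vbg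
     \<Rightarrow> ('a \<times> 'k0 \<Rightarrow> 'k0) \<Rightarrow> ('a \<times> 'k1 \<Rightarrow> 'k1) \<Rightarrow> ('a \<Rightarrow> 'a \<Rightarrow> 'k0 \<Rightarrow> 'k1) \<Rightarrow> bool" where
  "weak_representation G K A0 A1 \<alpha> \<longleftrightarrow>
     llgb_map (pullback_llgb (Arr G) (src G) K) K A0 A1 (tgt G) \<and>
     (\<forall>x\<in>points (total (objb K)). A0 (unit G (proj (objb K) x), x) = x) \<and>
     (\<forall>v\<in>points (total (arrb K)). A1 (unit G (proj (arrb K) v), v) = v) \<and>
     llgb_natural_transformation (pullback_llgb (composable_pairs G) (\<lambda>(g, k). src G k) K) K
       (\<lambda>((g, k), x). A0 (g, A0 (k, x))) (\<lambda>((g, k), v). A1 (g, A1 (k, v)))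
       (\<lambda>((g, k), x). A0 (mult G g k, x)) (\<lambda>((g, k), v). A1 (mult G g k, v))
       (\<lambda>(g, k). tgt G g) (\<lambda>((g, k), x). \<alpha> g k x) \<and>
     (\<forall>g\<in>points (Arr G). \<forall>k\<in>points (Arr G). \<forall>l\<in>points (Arr G). \<forall>x\<in>points (total (objb K)).
        src G g = tgt G k \<longrightarrow> src G k = tgt G l \<longrightarrow> src G l = proj (objb K) x \<longrightarrow>
        vmult K (\<alpha> g (mult G k l) x) (A1 (g, \<alpha> k l x)) =
        vmult K (\<alpha> (mult G g k) l x) (\<alpha> g k (A0 (l, x)))) \<and>
     (\<forall>g\<in>points (Arr G). \<forall>x\<in>points (total (objb K)). src G g = proj (objb K) x \<longrightarrow>
        \<alpha> g (unit G (proj (objb K) x)) x = vunit K (A0 (g, x)) \<and>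
        \<alpha> (unit G (tgt G g)) g x = vunit K (A0 (g, x)))"

definition action_groupoid ::
    "('o, 'd0::euclidean_space, 'a, 'd1::euclidean_space) groupoid
     \<Rightarrow> ('k0, 'e0::euclidean_space, 'o, 'd0, 'k1, 'e1::euclidean_space, 'o, 'd0) vbg
     \<Rightarrow> ('a \<times> 'k0 \<Rightarrow> 'k0) \<Rightarrow> ('a \<times> 'k1 \<Rightarrow> 'k1) \<Rightarrow> ('a \<Rightarrow> 'a \<Rightarrow> 'k0 \<Rightarrow> 'k1)
     \<Rightarrow> ('k0, 'e0, 'o, 'd0, 'a \<times> 'k0 \<times> 'k1, 'd1 \<times> 'e0 \<times> 'e1, 'a, 'd1) vbg" where
  "action_groupoid G K A0 A1 \<alpha> =
     \<lparr>objb = objb K,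
      arrb =
        \<lparr>total = submanifold (prod_manifold (Arr G) (prod_manifold (total (objb K)) (total (arrb K))))
                   {(g, x, v). g \<in> points (Arr G) \<and> x \<in> points (total (objb K)) \<and>
                      v \<in> points (total (arrb K)) \<and> src G g = proj (objb K) x \<and> vtgt K v = A0 (g, x)},
         base = Arr G,
         proj = (\<lambda>(g, x, v). g),
         vadd = (\<lambda>(g, x, v) (g', x', v'). (g, vadd (objb K) x x', vadd (arrb K) v v')),
         vscale = (\<lambda>r (g, x, v). (g, vscale (objb K) r x, vscale (arrb K) r v))\<rparr>,
      vsrc = (\<lambda>(g, x, v). x),
      vtgt = (\<lambda>(g, x, v). vsrc K v),
      vunit = (\<lambda>x. (unit G (proj (objb K) x), x, vunit K x)),
      vmult = (\<lambda>(g, x, v) (g', x', v').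
        (mult G g g', x', vmult K (vmult K (\<alpha> g g' x') (A1 (g, v'))) v))\<rparr>"

end

theory Submission
  imports Defs
begin

text \<open>Let \<open>K\<close> be the restriction of \<open>V\<close> to the units of \<open>G\<close>. A cleavage is a smooth map \<open>\<sigma>\<close>, linear on
  fibres, that sends an arrow \<open>g\<close> of \<open>G\<close> and a vector \<open>x\<close> over the source of \<open>g\<close> to an arrow \<open>\<sigma> (g, x)\<close>
  of \<open>V\<close> over \<open>g\<close> with source \<open>x\<close>, and to an identity arrow if \<open>g\<close> is a unit. The source map of \<open>V\<close> is
  fibrewise surjective, so it has linear right inverses locally; as convex combinations of cleavages
  are cleavages, a partition of unity gives a global one.

  With \<open>s\<close> and \<open>t\<close> the source and target maps of \<open>V\<close>, put \<open>g \<cdot> x = t (\<sigma> (g, x))\<close>,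
  \<open>g \<cdot> v = \<sigma> (g, t v) v \<sigma> (g, s v)\<^sup>-\<^sup>1\<close> and \<open>\<alpha> (g, k, x) = \<sigma> (g k, x) \<sigma> (k, x)\<^sup>-\<^sup>1 \<sigma> (g, k \<cdot> x)\<^sup>-\<^sup>1\<close>; the
  axioms of a weak representation become cancellations of words in \<open>V\<close>. The isomorphism from the action
  groupoid to \<open>V\<close> is \<open>\<Psi> (g, x, v) = v\<^sup>-\<^sup>1 \<sigma> (g, x)\<close>, with inverse \<open>J w = (p w, s w, \<sigma> (p w, s w) w\<^sup>-\<^sup>1)\<close>
  for the projection \<open>p\<close> of \<open>V\<close>. Since \<open>J\<close> and \<open>\<Psi>\<close> are smooth as maps from and to the ambient product,
  their composite exhibits the arrows of the action groupoid as a local smooth retract of that product,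
  hence as an embedded submanifold, and all of the structure of \<open>V\<close> is carried over along \<open>\<Psi>\<close>.\<close>

section \<open>Smooth maps between Euclidean spaces\<close>

text \<open>The obstacle is that a VB-groupoid supplies smooth structure maps on total spaces and
  little else: it is not given that the source map is onto on fibres, that the composable pairs, the
  restriction to the units or the arrows of the action groupoid are submanifolds, or that maps on
  such sets extend. Two consequences of the inverse function theorem fill this gap: the local form
  of a submersion, and the fact that a local smooth retract is embedded. Smoothness is therefore
  treated pointwise, relative to arbitrary subsets.

  The value of a cleavage at units is what makes the action unital and \<alpha> an identity when one
  argument is a unit. It survives averaging because the coefficients sum to one. Near a unit arrow
  the lift has to be right at all nearby units; near any other arrow there is no condition, the
  units being closed.

  A cleavage is in general not multiplicative:
  \<open>\<sigma> (g, k \<cdot> x) \<sigma> (k, x)\<close> and \<open>\<sigma> (g k, x)\<close> are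
  two arrows over \<open>g k\<close> with the same source, and \<alpha> is the arrow of
  \<open>K\<close> between their targets that measures the difference. This is why the
  representation is only weak.\<close>

definition Cinf :: "'e::euclidean_space set \<Rightarrow> ('e \<Rightarrow> 'f::euclidean_space) \<Rightarrow> bool" where
  "Cinf S f \<longleftrightarrow> (\<forall>k. Ck k S f)"

section \<open>Calculus of \<open>Ck\<close> and \<open>Cinf\<close> maps\<close>

lemma Ck_subset: "Ck k S f \<Longrightarrow> T \<subseteq> S \<Longrightarrow> Ck k T f"
proof (induction k arbitrary: f)
  case 0 then show ?case by (auto intro: continuous_on_subset)
next
  case (Suc k)
  then show ?case by (simp, meson subsetD)
qed

lemma Ck_SucD: "Ck (Suc k) S f \<Longrightarrow> Ck k S f"
proof (induction k arbitrary: f)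
  case 0
  then obtain f' where "\<forall>x\<in>S. (f has_derivative f' x) (at x)" by auto
  then show ?case
    by (metis Ck.simps(1) continuous_at_imp_continuous_on has_derivative_continuous)
next
  case (Suc k)
  then obtain f' where f': "\<forall>x\<in>S. (f has_derivative f' x) (at x)" "\<forall>v. Ck (Suc k) S (\<lambda>x. f' x v)"
    by auto
  then have "\<forall>v. Ck k S (\<lambda>x. f' x v)" using Suc.IH by blast
  with f' show ?case by auto
qed

text \<open>Derivatives are taken in the full space, so equality on \<open>S\<close> transfers them
  only because \<open>S\<close> is open.\<close>

lemma Ck_cong:
  assumes "open S" "\<And>x. x \<in> S \<Longrightarrow> f x = g x" "Ck k S f"
  shows "Ck k S g"
proof (cases k)
  case 0 then show ?thesis using assms by (simp cong: continuous_on_cong)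
next
  case (Suc n)
  then obtain f' where f': "\<forall>x\<in>S. (f has_derivative f' x) (at x)" "\<forall>v. Ck n S (\<lambda>x. f' x v)"
    using assms by auto
  have "\<forall>x\<in>S. (g has_derivative f' x) (at x)"
    using assms f' by (metis has_derivative_transform_within_open)
  with f' Suc show ?thesis by auto
qed

lemma Ck_const: "Ck k S (\<lambda>x. c)"
proof (induction k arbitrary: c)
  case (Suc k)
  show ?case using Suc[of 0] by (auto intro!: exI[of _ "\<lambda>x v. 0"])
qed auto

lemma Ck_bounded_linear:
  assumes "bounded_linear f" shows "Ck k S f"
proof (cases k)
  case 0 then show ?thesis using assms by (simp add: linear_continuous_on)
next
  case (Suc n)
  then show ?thesis using assms
    by (auto intro!: exI[of _ "\<lambda>x. f"] Ck_const bounded_linear_imp_has_derivative)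
qed

lemma Ck_bounded_linear_comp:
  assumes "bounded_linear L" "Ck k S f" shows "Ck k S (\<lambda>x. L (f x))"
  using assms(2)
proof (induction k arbitrary: f)
  case 0 then show ?case using assms(1)
    by (simp add: bounded_linear.continuous_on)
next
  case (Suc k)
  then obtain f' where f': "\<forall>x\<in>S. (f has_derivative f' x) (at x)" "\<forall>v. Ck k S (\<lambda>x. f' x v)"
    by auto
  then show ?case using Suc.IH
    by (auto intro!: exI[of _ "\<lambda>x v. L (f' x v)"] bounded_linear.has_derivative[OF assms(1)])
qed

lemma Ck_add:
  assumes "Ck k S f" "Ck k S g" shows "Ck k S (\<lambda>x. f x + g x)"
  using assms
proof (induction k arbitrary: f g)
  case 0 then show ?case by (auto intro: continuous_on_add)
next
  case (Suc k)
  then obtain f' where f': "\<forall>x\<in>S. (f has_derivative f' x) (at x)" "\<forall>v. Ck k S (\<lambda>x. f' x v)"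
    by auto
  obtain g' where g': "\<forall>x\<in>S. (g has_derivative g' x) (at x)" "\<forall>v. Ck k S (\<lambda>x. g' x v)"
    using Suc by auto
  show ?case using f' g' Suc.IH
    by (auto intro!: exI[of _ "\<lambda>x v. f' x v + g' x v"] has_derivative_add)
qed

lemma Ck_sum:
  assumes "\<And>i. i \<in> I \<Longrightarrow> Ck k S (f i)" shows "Ck k S (\<lambda>x. \<Sum>i\<in>I. f i x)"
  using assms
  by (induction I rule: infinite_finite_induct) (auto intro: Ck_const Ck_add)

text \<open>In the product rule each factor also appears undifferentiated, so the induction uses
  both factors at the lower order as well.\<close>

lemma Ck_scaleR:
  assumes "Ck k S f" "Ck k S g" shows "Ck k S (\<lambda>x. f x *\<^sub>R g x)"
  using assms
proof (induction k arbitrary: f g)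
  case 0 then show ?case by (auto intro: continuous_on_scaleR)
next
  case (Suc k)
  then obtain f' where f': "\<forall>x\<in>S. (f has_derivative f' x) (at x)" "\<forall>v. Ck k S (\<lambda>x. f' x v)"
    by auto
  obtain g' where g': "\<forall>x\<in>S. (g has_derivative g' x) (at x)" "\<forall>v. Ck k S (\<lambda>x. g' x v)"
    using Suc by auto
  have "\<forall>v. Ck k S (\<lambda>x. f x *\<^sub>R g' x v + f' x v *\<^sub>R g x)"
    using f' g' Suc.prems[THEN Ck_SucD] by (auto intro!: Ck_add Suc.IH)
  then show ?case using f' g'
    by (auto intro!: exI[of _ "\<lambda>x v. f x *\<^sub>R g' x v + f' x v *\<^sub>R g x"] has_derivative_scaleR)
qed

lemma linear_eq_sum_Basis:
  assumes "linear L" shows "L v = (\<Sum>b\<in>Basis. (v \<bullet> b) *\<^sub>R L b)"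
proof -
  have "L v = L (\<Sum>b\<in>Basis. (v \<bullet> b) *\<^sub>R b)" by (simp add: euclidean_representation)
  also have "\<dots> = (\<Sum>b\<in>Basis. (v \<bullet> b) *\<^sub>R L b)"
    using assms by (simp add: linear_sum linear_cmul o_def)
  finally show ?thesis .
qed

lemma Ck_inner_const: "Ck k S f \<Longrightarrow> Ck k S (\<lambda>x. f x \<bullet> b)"
  by (rule Ck_bounded_linear_comp[OF bounded_linear_inner_left])

text \<open>A linear map is a combination of its finitely many values on the basis, so a family of
  linear maps may be treated through these columns. The chain rule and the inversion of families of
  linear maps both rest on this.\<close>

lemma Ck_linear_family:
  assumes "\<And>x. x \<in> S \<Longrightarrow> linear (A x)" "open S"
    and "\<And>b. b \<in> Basis \<Longrightarrow> Ck k S (\<lambda>x. A x b)" "Ck k S f"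
  shows "Ck k S (\<lambda>x. A x (f x))"
proof -
  have *: "Ck k S (\<lambda>x. \<Sum>b\<in>Basis. (f x \<bullet> b) *\<^sub>R A x b)"
    using assms by (intro Ck_sum Ck_scaleR Ck_inner_const)
  show ?thesis
    by (rule Ck_cong[OF assms(2) _ *]) (simp add: linear_eq_sum_Basis[OF assms(1), symmetric])
qed

text \<open>The derivative of the composite is a family of linear maps, depending on
  \<open>f x\<close>, applied to a vector that also varies with \<open>x\<close>; this is the
  situation of \<open>Ck_linear_family\<close>.\<close>

lemma Ck_compose:
  assumes "open S" "open T" "f ` S \<subseteq> T" "Ck k T g" "Ck k S f"
  shows "Ck k S (\<lambda>x. g (f x))"
  using assms(4,5)
proof (induction k arbitrary: g)
  case 0 then show ?case using assms(3) by (auto intro: continuous_on_compose2)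
next
  case (Suc k)
  then obtain f' where f': "\<forall>x\<in>S. (f has_derivative f' x) (at x)" "\<forall>v. Ck k S (\<lambda>x. f' x v)"
    by auto
  obtain g' where g': "\<forall>x\<in>T. (g has_derivative g' x) (at x)" "\<forall>v. Ck k T (\<lambda>x. g' x v)"
    using Suc by auto
  have "Ck k S (\<lambda>x. g' (f x) (f' x v))" for v
  proof (rule Ck_linear_family[where A="\<lambda>x. g' (f x)" and f="\<lambda>x. f' x v"])
    show "linear (g' (f x))" if "x \<in> S" for x
      using that g' assms(3) has_derivative_linear by blast
    show "Ck k S (\<lambda>x. g' (f x) b)" for b
      using Suc.IH[of "\<lambda>y. g' y b"] g'(2) Ck_SucD[OF Suc.prems(2)] by simp
  qed (use assms f' in auto)
  moreover have "((\<lambda>x. g (f x)) has_derivative (\<lambda>v. g' (f x) (f' x v))) (at x)" if "x \<in> S" for x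
    by (rule has_derivative_compose[of f "f' x" x UNIV g "g' (f x)"]) (use f' g' assms(3) that in auto)
  ultimately show ?case
    by (simp only: Ck.simps) (rule exI[of _ "\<lambda>x v. g' (f x) (f' x v)"], simp)
qed

lemma Cinf_subset: "Cinf S f \<Longrightarrow> T \<subseteq> S \<Longrightarrow> Cinf T f"
  by (auto simp: Cinf_def intro: Ck_subset)

lemma Cinf_const: "Cinf S (\<lambda>x. c)"
  by (simp add: Cinf_def Ck_const)

lemma Cinf_bounded_linear: "bounded_linear f \<Longrightarrow> Cinf S f"
  by (simp add: Cinf_def Ck_bounded_linear)

lemma Cinf_linear: "linear f \<Longrightarrow> Cinf S f"
  by (simp add: Cinf_bounded_linear linear_conv_bounded_linear)

lemma Cinf_bounded_linear_comp: "bounded_linear L \<Longrightarrow> Cinf S f \<Longrightarrow> Cinf S (\<lambda>x. L (f x))"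
  by (simp add: Cinf_def Ck_bounded_linear_comp)

lemma Cinf_linear_comp: "linear L \<Longrightarrow> Cinf S f \<Longrightarrow> Cinf S (\<lambda>x. L (f x))"
  by (simp add: Cinf_bounded_linear_comp linear_conv_bounded_linear)

lemma Cinf_id: "Cinf S (\<lambda>x. x)"
  by (rule Cinf_bounded_linear) (rule bounded_linear_ident)

lemma Cinf_add: "Cinf S f \<Longrightarrow> Cinf S g \<Longrightarrow> Cinf S (\<lambda>x. f x + g x)"
  by (simp add: Cinf_def Ck_add)

lemma Cinf_minus: "Cinf S f \<Longrightarrow> Cinf S (\<lambda>x. - f x)"
  by (rule Cinf_linear_comp) (auto simp: linear_iff)

lemma Cinf_diff: "Cinf S f \<Longrightarrow> Cinf S g \<Longrightarrow> Cinf S (\<lambda>x. f x - g x)"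
  using Cinf_add[OF _ Cinf_minus, of S f g] by simp

lemma Cinf_scaleR: "Cinf S f \<Longrightarrow> Cinf S g \<Longrightarrow> Cinf S (\<lambda>x. f x *\<^sub>R g x)"
  by (simp add: Cinf_def Ck_scaleR)

lemma Cinf_mult:
  fixes f g :: "'e::euclidean_space \<Rightarrow> real"
  shows "Cinf S f \<Longrightarrow> Cinf S g \<Longrightarrow> Cinf S (\<lambda>x. f x * g x)"
  using Cinf_scaleR[of S f g] by simp

lemma Cinf_sum: "(\<And>i. i \<in> I \<Longrightarrow> Cinf S (f i)) \<Longrightarrow> Cinf S (\<lambda>x. \<Sum>i\<in>I. f i x)"
  by (simp add: Cinf_def Ck_sum)

lemma Cinf_compose:
  "open S \<Longrightarrow> open T \<Longrightarrow> f ` S \<subseteq> T \<Longrightarrow> Cinf T g \<Longrightarrow> Cinf S f \<Longrightarrow> Cinf S (\<lambda>x. g (f x))"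
  unfolding Cinf_def using Ck_compose by metis

lemma Cinf_Pair:
  assumes "Cinf S f" "Cinf S g" shows "Cinf S (\<lambda>x. (f x, g x))"
proof -
  have "Cinf S (\<lambda>x. (f x, 0) + (0, g x))"
    by (intro Cinf_add Cinf_linear_comp[where L="\<lambda>y. (y, 0)"] Cinf_linear_comp[where L="\<lambda>y. (0, y)"] assms)
      (auto simp: linear_iff)
  then show ?thesis by simp
qed

lemma Cinf_fst: "Cinf S f \<Longrightarrow> Cinf S (\<lambda>x. fst (f x))"
  by (rule Cinf_bounded_linear_comp[OF bounded_linear_fst])

lemma Cinf_snd: "Cinf S f \<Longrightarrow> Cinf S (\<lambda>x. snd (f x))"
  by (rule Cinf_bounded_linear_comp[OF bounded_linear_snd])

lemma Cinf_inner_const: "Cinf S f \<Longrightarrow> Cinf S (\<lambda>x. f x \<bullet> b)"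
  by (simp add: Cinf_def Ck_inner_const)

lemma Cinf_linear_family:
  assumes "\<And>x. x \<in> S \<Longrightarrow> linear (A x)" "open S"
    and "\<And>b. b \<in> Basis \<Longrightarrow> Cinf S (\<lambda>x. A x b)" "Cinf S f"
  shows "Cinf S (\<lambda>x. A x (f x))"
  unfolding Cinf_def
  using Ck_linear_family[of S A _ f] assms by (auto simp: Cinf_def)

lemma Cinf_continuous_on: "Cinf S f \<Longrightarrow> continuous_on S f"
  unfolding Cinf_def using Ck.simps(1) by blast

text \<open>In \<open>Ck\<close> the derivative is chosen anew for each order. On an open set it is
  unique, so one choice serves all orders at once.\<close>

lemma Cinf_derivative:
  assumes "Cinf S f" "open S"
  obtains f' where "\<And>x. x \<in> S \<Longrightarrow> (f has_derivative f' x) (at x)" "\<And>v. Cinf S (\<lambda>x. f' x v)"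
proof
  have 1: "\<exists>f'. (\<forall>x\<in>S. (f has_derivative f' x) (at x)) \<and> (\<forall>v. Ck k S (\<lambda>x. f' x v))" for k
    using assms(1) Ck.simps(2) unfolding Cinf_def by blast
  show d: "(f has_derivative frechet_derivative f (at x)) (at x)" if "x \<in> S" for x
    using 1 that by (meson differentiableI frechet_derivative_works)
  show "Cinf S (\<lambda>x. frechet_derivative f (at x) v)" for v
    unfolding Cinf_def
  proof
    fix k
    obtain f' where f': "\<forall>x\<in>S. (f has_derivative f' x) (at x)" "\<forall>v. Ck k S (\<lambda>x. f' x v)"
      using 1 by blast
    show "Ck k S (\<lambda>x. frechet_derivative f (at x) v)"
      by (rule Ck_cong[OF assms(2) _ f'(2)[rule_format, of v]])
        (metis f'(1) d has_derivative_unique)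
  qed
qed

section \<open>The inverse function theorem for \<open>Cinf\<close> maps\<close>

text \<open>The available inverse function theorem wants the derivative as a continuous map into
  bounded linear functions; \<open>Fb\<close> repackages it, and continuity is checked on basis
  vectors. The derivative of the inverse stays in the conclusion because its smoothness is what
  raises the order of the inverse later.\<close>

lemma Cinf_local_inverse_differentiable:
  fixes f :: "'a::euclidean_space \<Rightarrow> 'a"
  assumes f: "Cinf U f" "open U" "x0 \<in> U" "(f has_derivative D) (at x0)" "inj D"
  obtains U' V g f' where "open U'" "U' \<subseteq> U" "x0 \<in> U'" "open V" "f x0 \<in> V" "homeomorphism U' V f g"
    "\<And>x. x \<in> U \<Longrightarrow> (f has_derivative f' x) (at x)" "\<And>v. Cinf U (\<lambda>x. f' x v)"
    "\<And>y. y \<in> V \<Longrightarrow> (g has_derivative inv (f' (g y))) (at y)" "\<And>y. y \<in> V \<Longrightarrow> bij (f' (g y))"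
proof -
  obtain f' where f': "\<And>x. x \<in> U \<Longrightarrow> (f has_derivative f' x) (at x)" "\<And>v. Cinf U (\<lambda>x. f' x v)"
    using Cinf_derivative[OF f(1,2)] by blast
  have D: "f' x0 = D" using f'(1)[OF f(3)] f(4) by (rule has_derivative_unique)
  define Fb where "Fb p = Blinfun (f' p)" for p
  have Fb: "blinfun_apply (Fb p) = f' p" if "p \<in> U" for p
    unfolding Fb_def using f'(1)[OF that] by (simp add: bounded_linear_Blinfun_apply has_derivative_bounded_linear)
  have contF: "continuous_on U Fb"
  proof (rule continuous_on_blinfun_componentwise)
    fix b :: 'a
    have "continuous_on U (\<lambda>x. f' x b)" by (rule Cinf_continuous_on[OF f'(2)])
    then show "continuous_on U (\<lambda>x. blinfun_apply (Fb x) b)"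
      by (rule continuous_on_eq) (simp add: Fb)
  qed
  have "linear D" using f(4) by (rule has_derivative_linear)
  then obtain i where i: "linear i" "i \<circ> D = id"
    using linear_injective_left_inverse f(5) by blast
  have inv: "Blinfun i o\<^sub>L Fb x0 = id_blinfun"
    using i by (intro blinfun_eqI) (simp add: Fb[OF f(3)] D bounded_linear_Blinfun_apply linear_conv_bounded_linear pointfree_idE)
  have df: "(f has_derivative blinfun_apply (Fb x)) (at x)" if "x \<in> U" for x
    using f'(1)[OF that] Fb[OF that] by simp
  obtain U' V g g' where U': "open U'" "U' \<subseteq> U" "x0 \<in> U'" "open V" "f x0 \<in> V" "homeomorphism U' V f g"
     and g: "\<And>y. y \<in> V \<Longrightarrow> (g has_derivative (g' y)) (at y)" "\<And>y. y \<in> V \<Longrightarrow> g' y = inv (blinfun_apply (Fb (g y)))"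
     "\<And>y. y \<in> V \<Longrightarrow> bij (blinfun_apply (Fb (g y)))"
    using inverse_function_theorem[OF f(2) df contF f(3) inv] by metis
  have gU: "g y \<in> U" if "y \<in> V" for y
    using U'(2,6) that by (auto simp: homeomorphism_def)
  show ?thesis
  proof (rule that[OF U' f'])
    show "(g has_derivative inv (f' (g y))) (at y)" if "y \<in> V" for y
      using g(1)[OF that] g(2)[OF that] Fb[OF gU[OF that]] by simp
    show "bij (f' (g y))" if "y \<in> V" for y
      using g(3)[OF that] Fb[OF gU[OF that]] by simp
  qed
qed

text \<open>The map \<open>(x, w) \<mapsto> (x, A x w)\<close> and the inverse function theorem give differentiability of the inverses.\<close>

lemma differentiable_inv_family:
  fixes A :: "'a::euclidean_space \<Rightarrow> 'e::euclidean_space \<Rightarrow> 'e"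
  assumes S: "open S" "\<And>x. x \<in> S \<Longrightarrow> linear (A x)" "\<And>x. x \<in> S \<Longrightarrow> bij (A x)"
    and C: "\<And>v. Cinf S (\<lambda>x. A x v)"
    and x: "x \<in> S"
  shows "(\<lambda>x. inv (A x) v) differentiable (at x)"
proof -
  define F where "F = (\<lambda>p. (fst p, A (fst p) (snd p)))"
  have F: "Cinf (S \<times> UNIV) F"
    unfolding F_def
  proof (intro Cinf_Pair Cinf_fst Cinf_id Cinf_linear_family[where A="\<lambda>p. A (fst p)" and f=snd] Cinf_bounded_linear[OF bounded_linear_snd])
    show "Cinf (S \<times> UNIV) (\<lambda>x. A (fst x) b)" for b :: 'e
      by (rule Cinf_compose[where g="\<lambda>x. A x b", OF _ S(1) _ C])
        (auto intro: open_Times S Cinf_fst Cinf_id)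
  qed (auto simp: S open_Times)
  have op: "open (S \<times> (UNIV::'e set))" by (simp add: S open_Times)
  obtain F' where F': "\<And>p. p \<in> S \<times> UNIV \<Longrightarrow> (F has_derivative F' p) (at p)"
    and CF': "\<And>v. Cinf (S \<times> UNIV) (\<lambda>x. F' x v)"
    using Cinf_derivative[OF F op] by blast
  define w where "w = inv (A x) v"
  have Aw: "A x w = v" unfolding w_def using S(3)[OF x] by (simp add: bij_is_surj surj_f_inv_f)
  have xw: "(x, w) \<in> S \<times> UNIV" using x by simp
  have linF: "linear (F' (x, w))" using F'[OF xw] has_derivative_linear by blast
  \<comment> \<open>Restricting \<open>F\<close> to a slice and projecting to the first factor show
    that its differential is block triangular, with the identity and \<open>A x\<close> on the
    diagonal; hence it is injective.\<close>
  have snd0: "F' (x, w) (0, k) = (0, A x k)" for k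
  proof -
    have "((\<lambda>t. F (x, t)) has_derivative (\<lambda>k. F' (x, w) (0, k))) (at w)"
      by (rule has_derivative_compose[of "\<lambda>t. (x, t)" "\<lambda>k. (0, k)" w UNIV F "F' (x, w)"])
        (auto intro!: has_derivative_Pair has_derivative_const has_derivative_ident F'[OF xw])
    moreover have "((\<lambda>t. F (x, t)) has_derivative (\<lambda>k. (0, A x k))) (at w)"
      unfolding F_def fst_conv snd_conv using S(2)[OF x]
      by (intro has_derivative_Pair has_derivative_const linear_imp_has_derivative)
    ultimately show ?thesis by (metis has_derivative_unique)
  qed
  have fst: "fst (F' (x, w) p) = fst p" for p
  proof -
    have "((\<lambda>p. fst (F p)) has_derivative (\<lambda>p. fst (F' (x, w) p))) (at (x, w))"
      by (rule has_derivative_fst[OF F'[OF xw]])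
    moreover have "((\<lambda>p. fst (F p)) has_derivative (\<lambda>p. fst p)) (at (x, w))"
      unfolding F_def by (auto intro: has_derivative_fst has_derivative_ident)
    ultimately show ?thesis by (metis has_derivative_unique)
  qed
  have "inj (F' (x, w))"
  proof (rule linear_injective_0[OF linF, THEN iffD2], intro allI impI)
    fix p assume p: "F' (x, w) p = 0"
    then have "fst p = 0" using fst[of p] by simp
    then have "A x (snd p) = 0" using snd0[of "snd p"] p by (metis prod.collapse snd_zero snd_conv)
    then have "snd p = 0" using S(2,3)[OF x] by (metis bij_is_inj linear_injective_0)
    with \<open>fst p = 0\<close> show "p = 0" by (simp add: prod_eq_iff)
  qed
  then obtain U' W g F'' where U': "open U'" "U' \<subseteq> S \<times> UNIV" "(x, w) \<in> U'" "open W" "F (x, w) \<in> W"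
      and h: "homeomorphism U' W F g" and g: "\<And>y. y \<in> W \<Longrightarrow> (g has_derivative inv (F'' (g y))) (at y)"
    using Cinf_local_inverse_differentiable[OF F op xw F'[OF xw]] by metis
  have FW: "(x, v) \<in> W" using U'(5) Aw by (simp add: F_def)
  \<comment> \<open>The local inverse of \<open>F\<close> leaves the first component alone, so its
    second component solves the linear equation with matrix \<open>A y\<close>.\<close>
  have eq: "inv (A y) v = snd (g (y, v))" if "(y, v) \<in> W" for y
  proof -
    have 1: "F (g (y, v)) = (y, v)" "g (y, v) \<in> U'" using h that by (auto simp: homeomorphism_def)
    then have "fst (g (y, v)) = y" "A y (snd (g (y, v))) = v" "y \<in> S"
      using U'(2) by (auto simp: F_def mem_Times_iff)
    then show ?thesis using S(3) by (metis bij_is_inj inv_f_f)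
  qed
  have "open {y. (y, v) \<in> W}"
  proof -
    have "{y. (y, v) \<in> W} = (\<lambda>y. (y, v)) -` W" by auto
    then show ?thesis using U'(4) by (auto intro!: open_vimage continuous_intros)
  qed
  moreover have "(\<lambda>y. snd (g (y, v))) differentiable (at x)"
  proof (rule differentiableI)
    show "((\<lambda>y. snd (g (y, v))) has_derivative (\<lambda>k. snd (inv (F'' (g (x, v))) (k, 0)))) (at x)"
      by (rule has_derivative_snd, rule has_derivative_compose[of "\<lambda>y. (y, v)" "\<lambda>k. (k, 0)" x UNIV g "inv (F'' (g (x, v)))"])
        (auto intro!: has_derivative_Pair has_derivative_const has_derivative_ident g[OF FW])
  qed
  ultimately show ?thesis
    unfolding differentiable_def
    by (metis (mono_tags, lifting) FW eq has_derivative_transform_within_open mem_Collect_eq)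
qed

text \<open>Differentiating \<open>A x (inv (A x) v) = v\<close> expresses the derivative of the
  inverse through the inverse itself and the derivative of \<open>A\<close>, so the order can be
  raised by induction. That the inverse is differentiable at all comes first: only then does the
  product rule apply.\<close>

lemma Cinf_inv_family:
  fixes A :: "'a::euclidean_space \<Rightarrow> 'e::euclidean_space \<Rightarrow> 'e"
  assumes S: "open S" "\<And>x. x \<in> S \<Longrightarrow> linear (A x)" "\<And>x. x \<in> S \<Longrightarrow> bij (A x)"
    and C: "\<And>v. Cinf S (\<lambda>x. A x v)"
  shows "Cinf S (\<lambda>x. inv (A x) v)"
proof -
  let ?B = "\<lambda>x. inv (A x)"
  have linB: "linear (?B x)" if "x \<in> S" for x
    using S that by (metis bij_is_inj inj_linear_imp_inv_bounded_linear linear_conv_bounded_linear)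
  have AB: "A x (?B x v) = v" "?B x (A x v) = v" if "x \<in> S" for x v
    using S(3)[OF that] by (simp_all add: bij_is_surj bij_is_inj surj_f_inv_f)
  have "\<exists>a. (\<forall>x\<in>S. ((\<lambda>x. A x b) has_derivative a x) (at x)) \<and> (\<forall>v. Cinf S (\<lambda>x. a x v))" for b
    using Cinf_derivative[OF C S(1), of b] by metis
  then obtain a where a: "\<And>b x. x \<in> S \<Longrightarrow> ((\<lambda>x. A x b) has_derivative a b x) (at x)"
    "\<And>b v. Cinf S (\<lambda>x. a b x v)" by metis
  have der: "((\<lambda>x. ?B x v) has_derivative (\<lambda>u. - (\<Sum>b\<in>Basis. (?B x v \<bullet> b) *\<^sub>R ?B x (a b x u)))) (at x)"
    if x: "x \<in> S" for x v
  proof -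
    obtain w' where w': "((\<lambda>x. ?B x v) has_derivative w') (at x)"
      using differentiable_inv_family[OF S C x] unfolding differentiable_def by blast
    have d1: "((\<lambda>x. \<Sum>b\<in>Basis. (?B x v \<bullet> b) *\<^sub>R A x b) has_derivative
        (\<lambda>u. \<Sum>b\<in>Basis. (?B x v \<bullet> b) *\<^sub>R a b x u + (w' u \<bullet> b) *\<^sub>R A x b)) (at x)"
      by (intro has_derivative_sum has_derivative_scaleR a x has_derivative_inner_left w')
    have d2: "((\<lambda>x. \<Sum>b\<in>Basis. (?B x v \<bullet> b) *\<^sub>R A x b) has_derivative (\<lambda>u. 0)) (at x)"
    proof (rule has_derivative_transform_within_open[OF has_derivative_const[of v] S(1) x])
      show "v = (\<Sum>b\<in>Basis. (?B y v \<bullet> b) *\<^sub>R A y b)" if "y \<in> S" for y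
        using linear_eq_sum_Basis[OF S(2)[OF that], of "?B y v"] AB(1)[OF that] by simp
    qed
    have z: "(\<Sum>b\<in>Basis. (?B x v \<bullet> b) *\<^sub>R a b x u + (w' u \<bullet> b) *\<^sub>R A x b) = 0" for u
      by (rule fun_cong[OF has_derivative_unique[OF d1 d2]])
    have "w' u = - (\<Sum>b\<in>Basis. (?B x v \<bullet> b) *\<^sub>R ?B x (a b x u))" for u
    proof -
      have "A x (w' u) = - (\<Sum>b\<in>Basis. (?B x v \<bullet> b) *\<^sub>R a b x u)"
        using z[of u] by (simp add: sum.distrib linear_eq_sum_Basis[OF S(2)[OF x], of "w' u"] eq_neg_iff_add_eq_0 add.commute)
      then have "w' u = ?B x (- (\<Sum>b\<in>Basis. (?B x v \<bullet> b) *\<^sub>R a b x u))"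
        using AB[OF x] by metis
      then show ?thesis using linB[OF x] by (simp add: linear_neg linear_sum linear_cmul)
    qed
    then show ?thesis using w' by (metis (no_types, lifting) ext)
  qed
  have "Ck k S (\<lambda>x. ?B x v)" for k v
  proof (induction k arbitrary: v)
    case 0
    have "continuous_on S (\<lambda>x. ?B x v)"
      by (intro continuous_at_imp_continuous_on ballI has_derivative_continuous[OF der])
    then show ?case by simp
  next
    case (Suc k)
    have "Ck k S (\<lambda>x. - (\<Sum>b\<in>Basis. (?B x v \<bullet> b) *\<^sub>R ?B x (a b x u)))" for u
    proof (rule Ck_bounded_linear_comp[where L=uminus])
      show "Ck k S (\<lambda>x. \<Sum>b\<in>Basis. (?B x v \<bullet> b) *\<^sub>R ?B x (a b x u))"
      proof (intro Ck_sum Ck_scaleR Ck_inner_const Suc.IH)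
        show "Ck k S (\<lambda>x. ?B x (a b x u))" for b
          by (rule Ck_linear_family[where A="?B" and f="\<lambda>x. a b x u"])
            (use a(2) linB S Suc.IH in \<open>auto simp: Cinf_def\<close>)
      qed
    qed (simp add: bounded_linear_minus bounded_linear_ident)
    then show ?case using der
      by (simp only: Ck.simps) (rule exI[of _ "\<lambda>x u. - (\<Sum>b\<in>Basis. (?B x v \<bullet> b) *\<^sub>R ?B x (a b x u))"], simp)
  qed
  then show ?thesis by (simp add: Cinf_def)
qed

text \<open>Since \<open>D g = inv (D f) \<circ> g\<close>, the class of \<open>g\<close> can be raised one order at a time.\<close>

lemma Cinf_inverse_function:
  fixes f :: "'a::euclidean_space \<Rightarrow> 'a"
  assumes f: "Cinf U f" "open U" "x0 \<in> U" "(f has_derivative D) (at x0)" "inj D"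
  obtains U' V g where "open U'" "U' \<subseteq> U" "x0 \<in> U'" "open V" "f x0 \<in> V" "homeomorphism U' V f g" "Cinf V g"
proof -
  obtain U' V g f' where U': "open U'" "U' \<subseteq> U" "x0 \<in> U'" "open V" "f x0 \<in> V" "homeomorphism U' V f g"
    and f': "\<And>x. x \<in> U \<Longrightarrow> (f has_derivative f' x) (at x)" "\<And>v. Cinf U (\<lambda>x. f' x v)"
    and g: "\<And>y. y \<in> V \<Longrightarrow> (g has_derivative inv (f' (g y))) (at y)" "\<And>y. y \<in> V \<Longrightarrow> bij (f' (g y))"
    using Cinf_local_inverse_differentiable[OF f] by metis
  have gV: "g ` V = U'" "f ` U' = V" "\<And>x. x \<in> U' \<Longrightarrow> g (f x) = x" using U'(6) by (auto simp: homeomorphism_def)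
  have C: "Cinf U' (\<lambda>x. inv (f' x) v)" for v
  proof (rule Cinf_inv_family[OF U'(1)])
    show "linear (f' x)" if "x \<in> U'" for x
      using f'(1) that U'(2) has_derivative_linear by blast
    show "bij (f' x)" if "x \<in> U'" for x
      using g(2) gV that by (metis imageI)
    show "Cinf U' (\<lambda>x. f' x v)" for v
      using f'(2) U'(2) by (rule Cinf_subset)
  qed
  have "Ck k V g" for k
  proof (induction k)
    case 0
    then show ?case using U'(6) by (simp add: homeomorphism_def)
  next
    case (Suc k)
    have "Ck k V (\<lambda>y. inv (f' (g y)) v)" for v
      by (rule Ck_compose[where g="\<lambda>x. inv (f' x) v" and f=g, OF U'(4,1)])
        (use gV Suc C in \<open>auto simp: Cinf_def\<close>)
    then show ?case using g(1)
      by (simp only: Ck.simps) (rule exI[of _ "\<lambda>y. inv (f' (g y))"], simp)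
  qed
  then have "Cinf V g" by (simp add: Cinf_def)
  then show ?thesis using that U' by blast
qed

section \<open>Smooth cut-off functions\<close>

lemma Cinf_inverse_real: "Cinf {x::real. x \<noteq> 0} inverse"
proof -
  have "Ck k {x::real. x \<noteq> 0} inverse" for k
  proof (induction k)
    case 0
    then show ?case by (auto intro!: continuous_intros)
  next
    case (Suc k)
    have 1: "Ck k {x::real. x \<noteq> 0} (\<lambda>x. - (inverse x * v * inverse x))" for v
      using Ck_bounded_linear_comp[OF bounded_linear_minus[OF bounded_linear_ident]
          Ck_scaleR[OF Suc Ck_scaleR[OF Ck_const[of k _ v] Suc]]]
      by (simp add: mult.assoc)
    have 2: "(inverse has_derivative (\<lambda>v. - (inverse x * v * inverse x))) (at x)" if "x \<noteq> 0" for x :: real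
      by (rule has_derivative_inverse'[OF that])
    show ?case using 1 2
      by (simp only: Ck.simps) (rule exI[of _ "\<lambda>x v. - (inverse x * v * inverse x)"], simp)
  qed
  then show ?thesis by (simp add: Cinf_def)
qed

text \<open>The functions \<open>x^(-n) exp (-1/x)\<close> on the positive reals, extended by zero.
  The exponent is a parameter because the linear span of the whole family is closed under
  differentiation, while no single member is.\<close>

definition flat :: "nat \<Rightarrow> real \<Rightarrow> real" where
  "flat n x = (if x \<le> 0 then 0 else (1 / x) ^ n * exp (- (1 / x)))"

lemma flat_tendsto_0: "(flat n \<longlongrightarrow> 0) (at_right 0)"
proof -
  have "((\<lambda>t::real. t ^ n * exp (- t)) \<longlongrightarrow> 0) at_top"
    using tendsto_power_div_exp_0[of n] by (simp add: exp_minus divide_inverse)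
  moreover have "LIM x at_right 0. (1::real) / x :> at_top"
    using filterlim_inverse_at_top_right by (simp add: inverse_eq_divide)
  ultimately have "((\<lambda>x::real. (1 / x) ^ n * exp (- (1 / x))) \<longlongrightarrow> 0) (at_right 0)"
    by (rule filterlim_compose)
  then show ?thesis
  proof (rule Lim_transform_eventually)
    show "\<forall>\<^sub>F x in at_right 0. (1 / x) ^ n * exp (- (1 / x)) = flat n x"
      using eventually_at_right_less[of "0::real"] by eventually_elim (simp add: flat_def)
  qed
qed

lemma flat_tendsto_0': "(flat n \<longlongrightarrow> 0) (at 0)"
proof -
  have "(flat n \<longlongrightarrow> 0) (at_left 0)"
    by (rule tendsto_eventually) (use eventually_at_left_real[of "-1" 0] in \<open>auto elim!: eventually_mono simp: flat_def\<close>)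
  then show ?thesis using flat_tendsto_0 by (rule filterlim_split_at_real)
qed

lemma flat_has_field_derivative:
  "(flat n has_field_derivative (flat (n + 2) x - real n * flat (n + 1) x)) (at x)"
proof -
  consider "x < 0" | "x = 0" | "x > 0" by linarith
  then show ?thesis
  proof cases
    case 1
    have "((\<lambda>x. 0) has_field_derivative 0) (at x)" by simp
    then have "(flat n has_field_derivative 0) (at x)"
      by (rule has_field_derivative_transform_within_open[where S="{..<0}"]) (use 1 in \<open>auto simp: flat_def\<close>)
    then show ?thesis using 1 by (simp add: flat_def)
  next
    case 2
    \<comment> \<open>At the origin the difference quotient of \<open>flat n\<close> is exactly
      \<open>flat (Suc n)\<close>, which tends to zero.\<close>
    have "((\<lambda>y. (flat n y - flat n 0) / (y - 0)) \<longlongrightarrow> 0) (at 0)"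
    proof (rule Lim_transform_eventually[OF flat_tendsto_0'[of "Suc n"]])
      have "flat (Suc n) y = (flat n y - flat n 0) / (y - 0)" for y
        by (simp add: flat_def)
      then show "\<forall>\<^sub>F y in at 0. flat (Suc n) y = (flat n y - flat n 0) / (y - 0)" by simp
    qed
    then show ?thesis using 2 by (simp add: has_field_derivative_iff flat_def)
  next
    case 3
    have i: "((\<lambda>x. 1 / x) has_field_derivative - ((1 / x)\<^sup>2)) (at x)"
      using 3 by (auto intro!: derivative_eq_intros simp: power2_eq_square)
    have e: "((\<lambda>x. exp (- (1 / x))) has_field_derivative exp (- (1 / x)) * - (- ((1 / x)\<^sup>2))) (at x)"
      by (intro DERIV_fun_exp DERIV_minus i)
    have "((\<lambda>x. (1 / x) ^ n) has_field_derivative - (real n * (1 / x) ^ (n + 1))) (at x)"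
      by (rule DERIV_cong[OF DERIV_power[OF i, of n]]) (cases n, auto simp: power2_eq_square)
    from DERIV_mult[OF this e]
    have "((\<lambda>x. (1 / x) ^ n * exp (- (1 / x))) has_field_derivative (flat (n + 2) x - real n * flat (n + 1) x)) (at x)"
      by (rule DERIV_cong) (use 3 in \<open>simp add: flat_def algebra_simps power2_eq_square\<close>)
    then show ?thesis
      by (rule has_field_derivative_transform_within_open[where S="{0<..}"]) (use 3 in \<open>auto simp: flat_def\<close>)
  qed
qed

lemma Cinf_flat: "Cinf S (flat n)"
proof -
  have "Ck k UNIV (flat n)" for k n
  proof (induction k arbitrary: n)
    case 0
    have "continuous_on UNIV (flat n)"
      by (intro continuous_at_imp_continuous_on ballI DERIV_isCont[OF flat_has_field_derivative])
    then show ?case by simp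
  next
    case (Suc k)
    have "Ck k UNIV (\<lambda>x. v *\<^sub>R (1 *\<^sub>R flat (n + 2) x + (- real n) *\<^sub>R flat (n + 1) x))" for v :: real
      by (intro Ck_scaleR Ck_add Suc Ck_const)
    moreover have "(flat n has_derivative (\<lambda>v. v *\<^sub>R (1 *\<^sub>R flat (n + 2) x + (- real n) *\<^sub>R flat (n + 1) x))) (at x)" for x
      using flat_has_field_derivative[of n x] by (simp add: has_field_derivative_def mult_commute_abs)
    ultimately show ?case
      by (simp only: Ck.simps) (rule exI[of _ "\<lambda>x v. v *\<^sub>R (1 *\<^sub>R flat (n + 2) x + (- real n) *\<^sub>R flat (n + 1) x)"], simp)
  qed
  then show ?thesis unfolding Cinf_def using Ck_subset by blast
qed

text \<open>The function is \<open>p / (p + n)\<close>, where \<open>p\<close> is positive exactly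
  within distance \<open>2 * r\<close> and \<open>n\<close> exactly beyond distance
  \<open>r\<close>, so the denominator never vanishes. The squared distance is used because the
  distance itself is not smooth at \<open>a\<close>.\<close>

lemma Cinf_bump:
  fixes a :: "'e::euclidean_space"
  assumes "r > 0"
  obtains b :: "'e \<Rightarrow> real" where "Cinf UNIV b" "\<And>x. 0 \<le> b x \<and> b x \<le> 1"
    "\<And>x. dist x a < r \<Longrightarrow> b x = 1" "\<And>x. dist x a \<ge> 2 * r \<Longrightarrow> b x = 0"
proof -
  define q where "q x = (x - a) \<bullet> (x - a)" for x :: 'e
  define p where "p x = flat 0 (4 * r\<^sup>2 - q x)" for x
  define n where "n x = flat 0 (q x - r\<^sup>2)" for x
  have q: "q x = (dist x a)\<^sup>2" for x by (simp add: q_def dist_norm power2_norm_eq_inner)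
  have flat: "flat 0 x \<ge> 0" "flat 0 x > 0 \<longleftrightarrow> x > 0" for x by (auto simp: flat_def)
  have pos: "p x + n x > 0" for x
  proof -
    have "r\<^sup>2 < 4 * r\<^sup>2" using assms by simp
    then have "4 * r\<^sup>2 - q x > 0 \<or> q x - r\<^sup>2 > 0" by linarith
    then show ?thesis using flat unfolding p_def n_def by (metis add_nonneg_pos add_pos_nonneg)
  qed
  have Cq: "Cinf UNIV q"
  proof -
    have "Cinf UNIV (\<lambda>x. \<Sum>b\<in>Basis. ((x - a) \<bullet> b) *\<^sub>R ((x - a) \<bullet> b))"
      by (intro Cinf_sum Cinf_scaleR Cinf_inner_const Cinf_diff Cinf_id Cinf_const)
    moreover have "q = (\<lambda>x. \<Sum>b\<in>Basis. ((x - a) \<bullet> b) *\<^sub>R ((x - a) \<bullet> b))"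
      by (rule ext) (simp only: q_def real_scaleR_def, rule euclidean_inner)
    ultimately show ?thesis by simp
  qed
  have Cp: "Cinf UNIV p" unfolding p_def
    by (rule Cinf_compose[where g="flat 0" and T=UNIV]) (auto intro!: Cinf_flat Cinf_diff Cinf_const Cq)
  have Cn: "Cinf UNIV n" unfolding n_def
    by (rule Cinf_compose[where g="flat 0" and T=UNIV]) (auto intro!: Cinf_flat Cinf_diff Cinf_const Cq)
  have Ci: "Cinf UNIV (\<lambda>x. inverse (p x + n x))"
    by (rule Cinf_compose[where g=inverse and T="{x. x \<noteq> 0}"])
      (use pos in \<open>auto intro!: Cinf_inverse_real Cinf_add Cp Cn open_Collect_neq continuous_intros simp: less_imp_neq[symmetric]\<close>)
  show ?thesis
  proof (rule that[of "\<lambda>x. p x * inverse (p x + n x)"])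
    show "Cinf UNIV (\<lambda>x. p x * inverse (p x + n x))" by (intro Cinf_mult Cp Ci)
    fix x
    have nn: "p x \<ge> 0" "n x \<ge> 0" by (simp_all add: p_def n_def flat)
    then show "0 \<le> p x * inverse (p x + n x) \<and> p x * inverse (p x + n x) \<le> 1"
      using pos[of x] by (simp add: field_simps)
    show "p x * inverse (p x + n x) = 1" if "dist x a < r"
    proof -
      have "q x \<le> r\<^sup>2" unfolding q using that by (simp add: power_mono)
      then have "n x = 0" by (simp add: n_def flat_def)
      then show ?thesis using pos[of x] by simp
    qed
    show "p x * inverse (p x + n x) = 0" if "dist x a \<ge> 2 * r"
    proof -
      have "(2 * r)\<^sup>2 \<le> q x" unfolding q using that assms by (intro power_mono) auto
      then have "p x = 0" by (simp add: p_def flat_def power_mult_distrib)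
      then show ?thesis by simp
    qed
  qed
qed

section \<open>Smoothness relative to a subset of a manifold\<close>

text \<open>From a point of \<open>A\<close> a short step in any direction of \<open>T\<close> stays
  in \<open>A\<close>, so every direction is a multiple of a difference of two points of
  \<open>A\<close>. This identifies the model space of a chart, of a slice and of a product.\<close>

lemma span_openin_subspace:
  fixes A :: "'e::euclidean_space set"
  assumes "openin (top_of_set T) A" "subspace T" "A \<noteq> {}"
  shows "span A = T"
proof
  have "A \<subseteq> T" using openin_subset[OF assms(1)] by simp
  then show "span A \<subseteq> T" using assms(2) span_minimal by blast
  show "T \<subseteq> span A"
  proof
    fix u assume u: "u \<in> T"
    obtain a where a: "a \<in> A" using assms(3) by blast
    obtain Q where Q: "open Q" "A = T \<inter> Q" using assms(1) by (auto simp: openin_open)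
    have "open ((\<lambda>t. a + t *\<^sub>R u) -` Q)"
      using Q(1) by (auto intro!: open_vimage continuous_intros)
    moreover have "0 \<in> (\<lambda>t. a + t *\<^sub>R u) -` Q" using a Q by simp
    ultimately obtain e where e: "e > 0" "ball 0 e \<subseteq> (\<lambda>t. a + t *\<^sub>R u) -` Q"
      by (meson open_contains_ball)
    then have "e / 2 \<in> (\<lambda>t. a + t *\<^sub>R u) -` Q" by (auto simp: subset_iff)
    then have "a + (e / 2) *\<^sub>R u \<in> A"
      using Q a u assms(2) by (auto simp: subspace_add subspace_scale)
    then have "(a + (e / 2) *\<^sub>R u) - a \<in> span A" using a span_base span_diff by blast
    then have "(2 / e) *\<^sub>R ((e / 2) *\<^sub>R u) \<in> span A" by (metis add_diff_cancel_left' span_scale)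
    then show "u \<in> span A" using e(1) by simp
  qed
qed

text \<open>As \<open>U\<close> is open, the homeomorphism clause reduces to statements about
  preimages and images of open sets. Images are cut out by open sets of the whole Euclidean space,
  the form in which neighbourhoods are shrunk later.\<close>

lemma is_chart_iff:
  "is_chart X U \<phi> \<longleftrightarrow> openin X U \<and> openin (top_of_set (span (\<phi> ` U))) (\<phi> ` U) \<and> inj_on \<phi> U \<and>
     (\<forall>Q. open Q \<longrightarrow> openin X {y \<in> U. \<phi> y \<in> Q}) \<and>
     (\<forall>O'. openin X O' \<longrightarrow> O' \<subseteq> U \<longrightarrow> (\<exists>Q. open Q \<and> \<phi> ` O' = \<phi> ` U \<inter> Q))"
  (is "_ \<longleftrightarrow> ?A \<and> ?B \<and> ?C")
proof -
  have "homeomorphic_map (subtopology X U) (top_of_set (\<phi> ` U)) \<phi> \<longleftrightarrow> ?C" if U: "openin X U"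
  proof -
    have US: "U \<subseteq> topspace X" using U openin_subset by blast
    have ts: "topspace (subtopology X U) = U" using US by auto
    have op: "openin (subtopology X U) O' \<longleftrightarrow> openin X O' \<and> O' \<subseteq> U" for O'
      by (rule openin_open_subtopology[OF U])
    show ?thesis
    proof
      assume h: "homeomorphic_map (subtopology X U) (top_of_set (\<phi> ` U)) \<phi>"
      then have c: "continuous_map (subtopology X U) (top_of_set (\<phi> ` U)) \<phi>"
        and o: "open_map (subtopology X U) (top_of_set (\<phi> ` U)) \<phi>" and i: "inj_on \<phi> U"
        unfolding homeomorphic_eq_everything_map ts by auto
      have "openin X {y \<in> U. \<phi> y \<in> Q}" if "open Q" for Q
      proof -
        have "openin (top_of_set (\<phi> ` U)) (\<phi> ` U \<inter> Q)" using that by (simp add: openin_open_Int)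
        then have "openin (subtopology X U) {y \<in> U. \<phi> y \<in> \<phi> ` U \<inter> Q}"
          using c unfolding continuous_map_def ts by blast
        moreover have "{y \<in> U. \<phi> y \<in> \<phi> ` U \<inter> Q} = {y \<in> U. \<phi> y \<in> Q}" by auto
        ultimately show ?thesis using op by simp
      qed
      moreover have "\<exists>Q. open Q \<and> \<phi> ` O' = \<phi> ` U \<inter> Q" if "openin X O'" "O' \<subseteq> U" for O'
        using o that op unfolding open_map_def openin_open by blast
      ultimately show ?C using i by blast
    next
      assume C: ?C
      have "continuous_map (subtopology X U) (top_of_set (\<phi> ` U)) \<phi>"
        unfolding continuous_map_def ts
      proof (intro conjI allI impI)
        show "\<phi> \<in> U \<rightarrow> topspace (top_of_set (\<phi> ` U))" by auto
        fix W assume "openin (top_of_set (\<phi> ` U)) W"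
        then obtain Q where Q: "open Q" "W = \<phi> ` U \<inter> Q" by (auto simp: openin_open)
        then have "{y \<in> U. \<phi> y \<in> W} = {y \<in> U. \<phi> y \<in> Q}" by auto
        then show "openin (subtopology X U) {x \<in> U. \<phi> x \<in> W}" using C Q(1) op by auto
      qed
      moreover have "open_map (subtopology X U) (top_of_set (\<phi> ` U)) \<phi>"
        unfolding open_map_def op openin_open using C by blast
      ultimately show "homeomorphic_map (subtopology X U) (top_of_set (\<phi> ` U)) \<phi>"
        by (rule bijective_open_imp_homeomorphic_map) (use C US ts in simp_all)
    qed
  qed
  then show ?thesis unfolding is_chart_def by blast
qed

lemma is_chartD:
  assumes "is_chart X U \<phi>"
  shows "openin X U" "U \<subseteq> topspace X" "inj_on \<phi> U"
    "open Q \<Longrightarrow> openin X {y \<in> U. \<phi> y \<in> Q}"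
    "openin X O' \<Longrightarrow> O' \<subseteq> U \<Longrightarrow> \<exists>Q. open Q \<and> \<phi> ` O' = \<phi> ` U \<inter> Q"
    "\<exists>Q. open Q \<and> \<phi> ` U = span (\<phi> ` U) \<inter> Q"
  using assms openin_subset unfolding is_chart_iff by (auto simp: openin_open)

lemma is_chart_nbhd:
  assumes "is_chart X U \<phi>" "openin X O'" "x \<in> O'" "x \<in> U"
  obtains Q where "open Q" "\<phi> x \<in> Q" "\<And>y. y \<in> U \<Longrightarrow> \<phi> y \<in> Q \<Longrightarrow> y \<in> O'"
proof -
  have "openin X (O' \<inter> U)" using assms is_chartD(1) by blast
  then obtain Q where Q: "open Q" "\<phi> ` (O' \<inter> U) = \<phi> ` U \<inter> Q"
    using is_chartD(5)[OF assms(1), of "O' \<inter> U"] by auto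
  show ?thesis
  proof (rule that[OF Q(1)])
    show "\<phi> x \<in> Q" using Q assms by blast
    show "y \<in> O'" if "y \<in> U" "\<phi> y \<in> Q" for y
    proof -
      have "\<phi> y \<in> \<phi> ` (O' \<inter> U)" using Q that by blast
      then show ?thesis using is_chartD(3)[OF assms(1)] that(1) by (auto dest: inj_onD)
    qed
  qed
qed

section \<open>Smooth dependence of one coordinate function on another\<close>

text \<open>The representing function \<open>h\<close> lives on an open set of the ambient Euclidean
  space and has to match \<psi> only at points of \<open>S\<close>. No inverse of \<phi> occurs,
  which lets the relation compose and restrict freely.\<close>

definition locally_smooth :: "'a set \<Rightarrow> ('a \<Rightarrow> 'e::euclidean_space) \<Rightarrow> ('a \<Rightarrow> 'f::euclidean_space) \<Rightarrow> 'a \<Rightarrow> bool" where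
  "locally_smooth S \<phi> \<psi> x \<longleftrightarrow> (\<exists>W h. open W \<and> \<phi> x \<in> W \<and> Cinf W h \<and> (\<forall>y\<in>S. \<phi> y \<in> W \<longrightarrow> \<psi> y = h (\<phi> y)))"

lemma locally_smooth_mono: "locally_smooth S \<phi> \<psi> x \<Longrightarrow> T \<subseteq> S \<Longrightarrow> locally_smooth T \<phi> \<psi> x"
  unfolding locally_smooth_def by blast

lemma locally_smooth_cong: "locally_smooth S \<phi> \<psi> x \<Longrightarrow> (\<And>y. y \<in> S \<Longrightarrow> \<psi> y = \<psi>' y) \<Longrightarrow> locally_smooth S \<phi> \<psi>' x"
  unfolding locally_smooth_def by metis

lemma locally_smooth_Cinf: "open W \<Longrightarrow> \<phi> x \<in> W \<Longrightarrow> Cinf W h \<Longrightarrow> (\<And>y. y \<in> S \<Longrightarrow> \<phi> y \<in> W \<Longrightarrow> \<psi> y = h (\<phi> y)) \<Longrightarrow> locally_smooth S \<phi> \<psi> x"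
  unfolding locally_smooth_def by blast

lemma locally_smooth_refl: "locally_smooth S \<phi> \<phi> x"
  by (rule locally_smooth_Cinf[of UNIV _ _ "\<lambda>x. x"]) (auto intro: Cinf_id)

lemma locally_smooth_trans:
  assumes "locally_smooth S \<phi> \<psi> x" "locally_smooth S \<psi> \<zeta> x" "x \<in> S" shows "locally_smooth S \<phi> \<zeta> x"
proof -
  obtain W h where h: "open W" "\<phi> x \<in> W" "Cinf W h" "\<forall>y\<in>S. \<phi> y \<in> W \<longrightarrow> \<psi> y = h (\<phi> y)"
    using assms unfolding locally_smooth_def by blast
  obtain W' k where k: "open W'" "\<psi> x \<in> W'" "Cinf W' k" "\<forall>y\<in>S. \<psi> y \<in> W' \<longrightarrow> \<zeta> y = k (\<psi> y)"
    using assms unfolding locally_smooth_def by blast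
  have op: "open (W \<inter> h -` W')"
    using h(1,3) k(1) by (auto intro!: continuous_open_preimage Cinf_continuous_on)
  show ?thesis
  proof (rule locally_smooth_Cinf[OF op])
    show "\<phi> x \<in> W \<inter> h -` W'" using h k assms(3) by simp
    show "Cinf (W \<inter> h -` W') (\<lambda>y. k (h y))"
      by (rule Cinf_compose[OF op k(1) _ k(3) Cinf_subset[OF h(3)]]) auto
    show "\<zeta> y = k (h (\<phi> y))" if "y \<in> S" "\<phi> y \<in> W \<inter> h -` W'" for y
      using that h(4) k(4) by auto
  qed
qed

lemma locally_smooth_Pair:
  assumes "locally_smooth S \<phi> \<psi> x" "locally_smooth S \<phi> \<zeta> x" shows "locally_smooth S \<phi> (\<lambda>y. (\<psi> y, \<zeta> y)) x"
proof -
  obtain W h where h: "open W" "\<phi> x \<in> W" "Cinf W h" "\<forall>y\<in>S. \<phi> y \<in> W \<longrightarrow> \<psi> y = h (\<phi> y)"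
    using assms unfolding locally_smooth_def by blast
  obtain W' k where k: "open W'" "\<phi> x \<in> W'" "Cinf W' k" "\<forall>y\<in>S. \<phi> y \<in> W' \<longrightarrow> \<zeta> y = k (\<phi> y)"
    using assms unfolding locally_smooth_def by blast
  show ?thesis
    by (rule locally_smooth_Cinf[of "W \<inter> W'" _ _ "\<lambda>y. (h y, k y)"])
      (use h k in \<open>auto intro!: Cinf_Pair intro: Cinf_subset\<close>)
qed

lemma smooth_on_iff_locally_smooth:
  assumes "inj_on \<phi> U" "S \<subseteq> U"
  shows "smooth_on (\<phi> ` S) (\<psi> \<circ> inv_into U \<phi>) \<longleftrightarrow> (\<forall>x\<in>S. locally_smooth S \<phi> \<psi> x)"
proof -
  have "(\<forall>y\<in>\<phi> ` S \<inter> W. (\<psi> \<circ> inv_into U \<phi>) y = h y) \<longleftrightarrow> (\<forall>y\<in>S. \<phi> y \<in> W \<longrightarrow> \<psi> y = h (\<phi> y))" for W h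
  proof -
    have "inv_into U \<phi> (\<phi> y) = y" if "y \<in> S" for y using assms that by (auto simp: inv_into_f_f)
    moreover have "(\<forall>y\<in>\<phi> ` S \<inter> W. (\<psi> \<circ> inv_into U \<phi>) y = h y) \<longleftrightarrow>
        (\<forall>y\<in>S. \<phi> y \<in> W \<longrightarrow> (\<psi> \<circ> inv_into U \<phi>) (\<phi> y) = h (\<phi> y))" by blast
    ultimately show ?thesis by simp
  qed
  then show ?thesis unfolding smooth_on_def locally_smooth_def Cinf_def by auto
qed

lemma smooth_transition_iff:
  assumes "is_chart X U \<phi>"
  shows "smooth_transition (U, \<phi>) (V, \<psi>) \<longleftrightarrow> (\<forall>x\<in>U \<inter> V. locally_smooth (U \<inter> V) \<phi> \<psi> x)"
  unfolding smooth_transition_def using smooth_on_iff_locally_smooth[OF is_chartD(3)[OF assms], of "U \<inter> V" \<psi>] by simp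

text \<open>In the chart, a neighbourhood of \<open>x\<close> contains everything whose coordinate
  lies in a suitable open \<open>Q\<close>; cutting the domain of the representing function down to
  \<open>Q\<close> confines it to that neighbourhood.\<close>

lemma locally_smooth_local:
  assumes "is_chart X U \<phi>" "openin X O'" "x \<in> O'" "x \<in> U" "S \<subseteq> U" "locally_smooth (S \<inter> O') \<phi> \<psi> x"
  shows "locally_smooth S \<phi> \<psi> x"
proof -
  obtain Q where Q: "open Q" "\<phi> x \<in> Q" "\<And>y. y \<in> U \<Longrightarrow> \<phi> y \<in> Q \<Longrightarrow> y \<in> O'"
    using is_chart_nbhd[OF assms(1-4)] by blast
  obtain W h where h: "open W" "\<phi> x \<in> W" "Cinf W h" "\<forall>y\<in>S \<inter> O'. \<phi> y \<in> W \<longrightarrow> \<psi> y = h (\<phi> y)"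
    using assms(6) unfolding locally_smooth_def by blast
  show ?thesis
    by (rule locally_smooth_Cinf[of "W \<inter> Q" _ _ h]) (use h Q assms(5) in \<open>auto intro: Cinf_subset\<close>)
qed

section \<open>The maximal atlas\<close>

lemma maximal_atlasD: "(U, \<phi>) \<in> maximal_atlas M \<Longrightarrow> is_chart (mtop M) U \<phi>"
  by (simp add: maximal_atlas_def)

lemma atlas_subset_maximal: "smooth_manifold M \<Longrightarrow> c \<in> atlas M \<Longrightarrow> c \<in> maximal_atlas M"
  unfolding smooth_manifold_def maximal_atlas_def by (cases c) fastforce

lemma atlas_cover:
  assumes "smooth_manifold M" "x \<in> points M"
  obtains U \<phi> where "(U, \<phi>) \<in> atlas M" "x \<in> U"
  using assms unfolding smooth_manifold_def by auto

text \<open>Membership in the maximal atlas compares a chart with charts of the atlas only, so two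
  such charts are compared through an atlas chart around the point.\<close>

lemma maximal_atlas_locally_smooth:
  assumes M: "smooth_manifold M" and U: "(U, \<phi>) \<in> maximal_atlas M" and V: "(V, \<psi>) \<in> maximal_atlas M"
    and x: "x \<in> U" "x \<in> V"
  shows "locally_smooth (U \<inter> V) \<phi> \<psi> x"
proof -
  have cU: "is_chart (mtop M) U \<phi>" using U by (rule maximal_atlasD)
  have "x \<in> points M" using is_chartD(2)[OF cU] x by blast
  then obtain O' \<zeta> where d: "(O', \<zeta>) \<in> atlas M" "x \<in> O'" using atlas_cover[OF M] by blast
  have cO: "is_chart (mtop M) O' \<zeta>" using d M unfolding smooth_manifold_def by auto
  have "smooth_transition (U, \<phi>) (O', \<zeta>)" "smooth_transition (O', \<zeta>) (V, \<psi>)"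
    using U V d unfolding maximal_atlas_def by auto
  then have "locally_smooth (U \<inter> O') \<phi> \<zeta> x" "locally_smooth (O' \<inter> V) \<zeta> \<psi> x"
    using smooth_transition_iff[OF cU] smooth_transition_iff[OF cO] x d by blast+
  then have "locally_smooth (U \<inter> V \<inter> O') \<phi> \<zeta> x" "locally_smooth (U \<inter> V \<inter> O') \<zeta> \<psi> x"
    by (auto elim: locally_smooth_mono)
  then have "locally_smooth (U \<inter> V \<inter> O') \<phi> \<psi> x" by (rule locally_smooth_trans) (use x d in simp)
  then show ?thesis using locally_smooth_local[OF cU is_chartD(1)[OF cO] d(2) x(1), of "U \<inter> V" \<psi>] by simp
qed

text \<open>Compatibility with all charts of the atlas follows if, near each point, the candidate is
  compatible with a single chart already in the maximal atlas.\<close>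

lemma maximal_atlasI:
  assumes "smooth_manifold M" "is_chart (mtop M) U \<phi>"
    "\<And>x. x \<in> U \<Longrightarrow> \<exists>V \<psi>. (V, \<psi>) \<in> maximal_atlas M \<and> x \<in> V \<and> locally_smooth (U \<inter> V) \<phi> \<psi> x \<and> locally_smooth (U \<inter> V) \<psi> \<phi> x"
  shows "(U, \<phi>) \<in> maximal_atlas M"
proof -
  have "smooth_transition (U, \<phi>) d \<and> smooth_transition d (U, \<phi>)" if d: "d \<in> atlas M" for d
  proof -
    obtain O' \<zeta> where [simp]: "d = (O', \<zeta>)" by (cases d)
    have dm: "(O', \<zeta>) \<in> maximal_atlas M" using atlas_subset_maximal[OF assms(1) d] by simp
    have cO: "is_chart (mtop M) O' \<zeta>" using maximal_atlasD[OF dm] .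
    have "locally_smooth (U \<inter> O') \<phi> \<zeta> x \<and> locally_smooth (U \<inter> O') \<zeta> \<phi> x" if x: "x \<in> U \<inter> O'" for x
    proof -
      obtain V \<psi> where V: "(V, \<psi>) \<in> maximal_atlas M" "x \<in> V" "locally_smooth (U \<inter> V) \<phi> \<psi> x" "locally_smooth (U \<inter> V) \<psi> \<phi> x"
        using assms(3) x by blast
      have oV: "openin (mtop M) V" using is_chartD(1) maximal_atlasD V(1) by blast
      have "locally_smooth (V \<inter> O') \<psi> \<zeta> x" "locally_smooth (V \<inter> O') \<zeta> \<psi> x"
        using maximal_atlas_locally_smooth[OF assms(1) V(1) dm V(2)] maximal_atlas_locally_smooth[OF assms(1) dm V(1) _ V(2)] x
        by (auto simp: Int_commute)
      then have "locally_smooth (U \<inter> O' \<inter> V) \<psi> \<zeta> x" "locally_smooth (U \<inter> O' \<inter> V) \<zeta> \<psi> x" "locally_smooth (U \<inter> O' \<inter> V) \<phi> \<psi> x" "locally_smooth (U \<inter> O' \<inter> V) \<psi> \<phi> x"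
        using V(3,4) by (auto elim: locally_smooth_mono)
      then have "locally_smooth (U \<inter> O' \<inter> V) \<phi> \<zeta> x" "locally_smooth (U \<inter> O' \<inter> V) \<zeta> \<phi> x"
        using locally_smooth_trans[of "U \<inter> O' \<inter> V" \<phi> \<psi> x \<zeta>] locally_smooth_trans[of "U \<inter> O' \<inter> V" \<zeta> \<psi> x \<phi>] x V(2) by simp_all
      then show ?thesis
        using locally_smooth_local[OF assms(2) oV V(2), of "U \<inter> O'" \<zeta>] locally_smooth_local[OF cO oV V(2), of "U \<inter> O'" \<phi>] x by simp
    qed
    then show ?thesis
      using smooth_transition_iff[OF assms(2)] smooth_transition_iff[OF cO] by (auto simp: Int_commute)
  qed
  then show ?thesis using assms(2) unfolding maximal_atlas_def by blast
qed

text \<open>Smoothness of a map near \<open>x\<close> relative to an arbitrary subset \<open>S\<close>. Unlike \<open>smooth_map\<close> on a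
  \<open>submanifold\<close>, it makes sense and composes without knowing that \<open>S\<close> is a submanifold.\<close>

definition smooth_at :: "('a, 'e::euclidean_space) manifold \<Rightarrow> 'a set \<Rightarrow> ('b, 'f::euclidean_space) manifold \<Rightarrow> ('a \<Rightarrow> 'b) \<Rightarrow> 'a \<Rightarrow> bool" where
  "smooth_at M S N f x \<longleftrightarrow>
    (\<exists>U \<phi> V \<psi> O'. (U, \<phi>) \<in> maximal_atlas M \<and> (V, \<psi>) \<in> maximal_atlas N \<and> openin (mtop M) O' \<and> x \<in> O' \<and> O' \<subseteq> U \<and>
      f x \<in> V \<and> f ` (S \<inter> O') \<subseteq> V \<and> locally_smooth (S \<inter> O') \<phi> (\<lambda>y. \<psi> (f y)) x)"

lemma smooth_atI:
  assumes "(U, \<phi>) \<in> maximal_atlas M" "(V, \<psi>) \<in> maximal_atlas N" "openin (mtop M) O'" "x \<in> O'" "O' \<subseteq> U"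
    "f x \<in> V" "f ` (S \<inter> O') \<subseteq> V" "locally_smooth (S \<inter> O') \<phi> (\<lambda>y. \<psi> (f y)) x"
  shows "smooth_at M S N f x"
  unfolding smooth_at_def using assms by blast

lemma smooth_atE:
  assumes "smooth_at M S N f x"
  obtains U \<phi> V \<psi> O' where "(U, \<phi>) \<in> maximal_atlas M" "(V, \<psi>) \<in> maximal_atlas N" "openin (mtop M) O'" "x \<in> O'" "O' \<subseteq> U"
    "f x \<in> V" "f ` (S \<inter> O') \<subseteq> V" "locally_smooth (S \<inter> O') \<phi> (\<lambda>y. \<psi> (f y)) x"
  using assms unfolding smooth_at_def by blast

section \<open>Calculus of \<open>smooth_at\<close>\<close>

text \<open>The definition of \<open>smooth_at\<close> provides one pair of charts; here any
  prescribed pair around \<open>x\<close> and \<open>f x\<close> is seen to serve. The price is a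
  smaller neighbourhood, because the image of \<open>S\<close> must stay in the prescribed
  \<open>V\<close>.\<close>

lemma smooth_at_charts:
  assumes M: "smooth_manifold M" and N: "smooth_manifold N" and f: "smooth_at M S N f x" and xS: "x \<in> S"
    and U: "(U, \<phi>) \<in> maximal_atlas M" "x \<in> U" and V: "(V, \<psi>) \<in> maximal_atlas N" "f x \<in> V"
  obtains O' where "openin (mtop M) O'" "x \<in> O'" "O' \<subseteq> U" "f ` (S \<inter> O') \<subseteq> V" "locally_smooth (S \<inter> O') \<phi> (\<lambda>y. \<psi> (f y)) x"
proof -
  obtain U' \<phi>' V' \<psi>' O' where h: "(U', \<phi>') \<in> maximal_atlas M" "(V', \<psi>') \<in> maximal_atlas N" "openin (mtop M) O'"
    "x \<in> O'" "O' \<subseteq> U'" "f x \<in> V'" "f ` (S \<inter> O') \<subseteq> V'" "locally_smooth (S \<inter> O') \<phi>' (\<lambda>y. \<psi>' (f y)) x"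
    using f unfolding smooth_at_def by blast
  have c: "is_chart (mtop M) U \<phi>" "is_chart (mtop M) U' \<phi>'" "is_chart (mtop N) V \<psi>" "is_chart (mtop N) V' \<psi>'"
    using h U V maximal_atlasD by auto
  obtain Q where Q: "open Q" "\<psi>' (f x) \<in> Q" "\<And>y. y \<in> V' \<Longrightarrow> \<psi>' y \<in> Q \<Longrightarrow> y \<in> V"
    using is_chart_nbhd[OF c(4) is_chartD(1)[OF c(3)] V(2) h(6)] by blast
  obtain W k where k: "open W" "\<phi>' x \<in> W" "Cinf W k" "\<forall>y\<in>S \<inter> O'. \<phi>' y \<in> W \<longrightarrow> \<psi>' (f y) = k (\<phi>' y)"
    using h(8) unfolding locally_smooth_def by blast
  have op: "open (W \<inter> k -` Q)"
    using k Q by (auto intro!: continuous_open_preimage Cinf_continuous_on)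
  \<comment> \<open>Where the representing function \<open>k\<close> takes values in
    \<open>Q\<close>, the image point lies in \<open>V\<close>.\<close>
  define O1 where "O1 = O' \<inter> U \<inter> {y \<in> U'. \<phi>' y \<in> W \<inter> k -` Q}"
  have O1: "openin (mtop M) O1" "x \<in> O1" "O1 \<subseteq> U" "O1 \<subseteq> O'"
    using is_chartD(4)[OF c(2) op] is_chartD(1)[OF c(1)] h U k Q xS
    by (auto simp: O1_def intro!: openin_Int)
  have fV: "f ` (S \<inter> O1) \<subseteq> V"
  proof
    fix z assume "z \<in> f ` (S \<inter> O1)"
    then obtain y where y: "y \<in> S" "y \<in> O1" "z = f y" by blast
    then have "\<psi>' (f y) \<in> Q" "f y \<in> V'" using k(4) h(7) unfolding O1_def by auto
    then show "z \<in> V" using Q(3) y by blast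
  qed
  have "locally_smooth (S \<inter> O1) \<phi> (\<lambda>y. \<psi> (f y)) x"
  proof -
    have a: "locally_smooth (S \<inter> O1) \<phi> \<phi>' x"
      by (rule locally_smooth_mono[OF maximal_atlas_locally_smooth[OF M U(1) h(1) U(2)]]) (use O1 h in auto)
    have b: "locally_smooth (S \<inter> O1) \<phi>' (\<lambda>y. \<psi>' (f y)) x"
      by (rule locally_smooth_mono[OF h(8)]) (use O1 in auto)
    have "locally_smooth (V' \<inter> V) \<psi>' \<psi> (f x)" by (rule maximal_atlas_locally_smooth[OF N h(2) V(1) h(6) V(2)])
    then obtain W2 k2 where k2: "open W2" "\<psi>' (f x) \<in> W2" "Cinf W2 k2" "\<forall>y\<in>V' \<inter> V. \<psi>' y \<in> W2 \<longrightarrow> \<psi> y = k2 (\<psi>' y)"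
      unfolding locally_smooth_def by blast
    have c: "locally_smooth (S \<inter> O1) (\<lambda>y. \<psi>' (f y)) (\<lambda>y. \<psi> (f y)) x"
    proof (rule locally_smooth_Cinf[OF k2(1) _ k2(3)])
      fix y assume y: "y \<in> S \<inter> O1" "\<psi>' (f y) \<in> W2"
      have "f y \<in> V' \<inter> V" using y fV h(7) O1(4) by blast
      then show "\<psi> (f y) = k2 (\<psi>' (f y))" using k2(4) y(2) by blast
    qed (use k2 in auto)
    have xx: "x \<in> S \<inter> O1" using O1 xS by blast
    show ?thesis by (rule locally_smooth_trans[OF locally_smooth_trans[OF a b xx] c xx])
  qed
  then show ?thesis using that[OF O1(1-3) fV] by blast
qed

lemma smooth_at_compose:
  assumes M: "smooth_manifold M" "smooth_manifold N" "smooth_manifold P"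
    and f: "smooth_at M S N f x" and g: "smooth_at N T P g (f x)" and x: "x \<in> S" and T: "f ` S \<subseteq> T"
  shows "smooth_at M S P (\<lambda>y. g (f y)) x"
proof -
  obtain V \<psi> Z \<zeta> O' where h: "(V, \<psi>) \<in> maximal_atlas N" "(Z, \<zeta>) \<in> maximal_atlas P" "openin (mtop N) O'"
    "f x \<in> O'" "O' \<subseteq> V" "g (f x) \<in> Z" "g ` (T \<inter> O') \<subseteq> Z" "locally_smooth (T \<inter> O') \<psi> (\<lambda>y. \<zeta> (g y)) (f x)"
    using g unfolding smooth_at_def by blast
  obtain U \<phi> where U: "(U, \<phi>) \<in> maximal_atlas M" "x \<in> U"
    using f unfolding smooth_at_def by blast
  obtain O2 where O2: "openin (mtop M) O2" "x \<in> O2" "O2 \<subseteq> U" "f ` (S \<inter> O2) \<subseteq> V" "locally_smooth (S \<inter> O2) \<phi> (\<lambda>y. \<psi> (f y)) x"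
    using smooth_at_charts[OF M(1,2) f x U h(1)] h(4,5) by blast
  obtain W k where k: "open W" "\<phi> x \<in> W" "Cinf W k" "\<forall>y\<in>S \<inter> O2. \<phi> y \<in> W \<longrightarrow> \<psi> (f y) = k (\<phi> y)"
    using O2(5) unfolding locally_smooth_def by blast
  obtain Q where Q: "open Q" "\<psi> (f x) \<in> Q" "\<And>y. y \<in> V \<Longrightarrow> \<psi> y \<in> Q \<Longrightarrow> y \<in> O'"
    using is_chart_nbhd[OF maximal_atlasD[OF h(1)] h(3,4)] h(4,5) by blast
  have op: "open (W \<inter> k -` Q)"
    using k Q by (auto intro!: continuous_open_preimage Cinf_continuous_on)
  define O1 where "O1 = O2 \<inter> {y \<in> U. \<phi> y \<in> W \<inter> k -` Q}"
  have O1: "openin (mtop M) O1" "x \<in> O1" "O1 \<subseteq> U" "O1 \<subseteq> O2"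
    using is_chartD(4)[OF maximal_atlasD[OF U(1)] op] O2 U k Q x by (auto simp: O1_def intro!: openin_Int)
  have fO: "f y \<in> T \<inter> O'" if "y \<in> S \<inter> O1" for y
  proof -
    have "\<psi> (f y) \<in> Q" "f y \<in> V" using that k(4) O2(4) unfolding O1_def by auto
    then show ?thesis using Q(3) T that by blast
  qed
  obtain W2 k2 where k2: "open W2" "\<psi> (f x) \<in> W2" "Cinf W2 k2" "\<forall>y\<in>T \<inter> O'. \<psi> y \<in> W2 \<longrightarrow> \<zeta> (g y) = k2 (\<psi> y)"
    using h(8) unfolding locally_smooth_def by blast
  have "locally_smooth (S \<inter> O1) (\<lambda>y. \<psi> (f y)) (\<lambda>y. \<zeta> (g (f y))) x"
    by (rule locally_smooth_Cinf[OF k2(1) _ k2(3)]) (use k2 fO in auto)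
  moreover have "locally_smooth (S \<inter> O1) \<phi> (\<lambda>y. \<psi> (f y)) x" by (rule locally_smooth_mono[OF O2(5)]) (use O1 in auto)
  ultimately have "locally_smooth (S \<inter> O1) \<phi> (\<lambda>y. \<zeta> (g (f y))) x"
    using locally_smooth_trans[of "S \<inter> O1" \<phi> "\<lambda>y. \<psi> (f y)" x "\<lambda>y. \<zeta> (g (f y))"] O1(2) x by simp
  moreover have "(\<lambda>y. g (f y)) ` (S \<inter> O1) \<subseteq> Z" using fO h(7) by blast
  ultimately show ?thesis unfolding smooth_at_def using U(1) h(2,6) O1 by blast
qed

lemma smooth_at_mono: "smooth_at M S N f x \<Longrightarrow> T \<subseteq> S \<Longrightarrow> smooth_at M T N f x"
  by (erule smooth_atE, rule smooth_atI, assumption+) (auto elim: locally_smooth_mono)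

lemma smooth_at_local:
  assumes "smooth_at M (S \<inter> O') N f x" "openin (mtop M) O'" "x \<in> O'"
  shows "smooth_at M S N f x"
proof -
  obtain U \<phi> V \<psi> O2 where h: "(U, \<phi>) \<in> maximal_atlas M" "(V, \<psi>) \<in> maximal_atlas N" "openin (mtop M) O2"
    "x \<in> O2" "O2 \<subseteq> U" "f x \<in> V" "f ` (S \<inter> O' \<inter> O2) \<subseteq> V" "locally_smooth (S \<inter> O' \<inter> O2) \<phi> (\<lambda>y. \<psi> (f y)) x"
    using assms(1) unfolding smooth_at_def by blast
  have "openin (mtop M) (O' \<inter> O2)" using h assms by blast
  then show ?thesis by (rule smooth_atI[OF h(1,2)]) (use h assms in \<open>auto simp: Int_assoc\<close>)
qed

lemma smooth_at_cong:
  assumes "smooth_at M S N f x" "\<And>y. y \<in> S \<Longrightarrow> f y = g y" "x \<in> S"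
  shows "smooth_at M S N g x"
proof -
  obtain U \<phi> V \<psi> O2 where h: "(U, \<phi>) \<in> maximal_atlas M" "(V, \<psi>) \<in> maximal_atlas N" "openin (mtop M) O2"
    "x \<in> O2" "O2 \<subseteq> U" "f x \<in> V" "f ` (S \<inter> O2) \<subseteq> V" "locally_smooth (S \<inter> O2) \<phi> (\<lambda>y. \<psi> (f y)) x"
    using assms(1) unfolding smooth_at_def by blast
  have "locally_smooth (S \<inter> O2) \<phi> (\<lambda>y. \<psi> (g y)) x" by (rule locally_smooth_cong[OF h(8)]) (use assms in auto)
  moreover have "g ` (S \<inter> O2) \<subseteq> V" "g x \<in> V" using h(6,7) assms(2,3) by auto
  ultimately show ?thesis using smooth_atI[OF h(1-5), of g S] by blast
qed

lemma smooth_at_points: "smooth_at M S N f x \<Longrightarrow> x \<in> points M \<and> f x \<in> points N"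
proof (erule smooth_atE)
  fix U \<phi> V \<psi> O' assume h: "(U, \<phi>) \<in> maximal_atlas M" "(V, \<psi>) \<in> maximal_atlas N" "x \<in> O'" "O' \<subseteq> U" "f x \<in> V"
  then show "x \<in> points M \<and> f x \<in> points N"
    using is_chartD(2)[OF maximal_atlasD[OF h(1)]] is_chartD(2)[OF maximal_atlasD[OF h(2)]] by auto
qed

lemma smooth_at_id:
  assumes "smooth_manifold M" "x \<in> points M" shows "smooth_at M S M (\<lambda>y. y) x"
proof -
  obtain U \<phi> where U: "(U, \<phi>) \<in> atlas M" "x \<in> U" using atlas_cover[OF assms] .
  have "(U, \<phi>) \<in> maximal_atlas M" using atlas_subset_maximal[OF assms(1) U(1)] .
  then show ?thesis
    using U(2) by (intro smooth_atI[of U \<phi> M U \<phi> M U]) (auto intro: locally_smooth_refl is_chartD(1)[OF maximal_atlasD])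
qed

lemma smooth_at_const:
  assumes "smooth_manifold M" "x \<in> points M" "smooth_manifold N" "c \<in> points N" shows "smooth_at M S N (\<lambda>y. c) x"
proof -
  obtain U \<phi> where U: "(U, \<phi>) \<in> atlas M" "x \<in> U" using atlas_cover[OF assms(1,2)] .
  have "(U, \<phi>) \<in> maximal_atlas M" using atlas_subset_maximal[OF assms(1) U(1)] .
  moreover obtain V \<psi> where V: "(V, \<psi>) \<in> atlas N" "c \<in> V" using atlas_cover[OF assms(3,4)] .
  moreover have "(V, \<psi>) \<in> maximal_atlas N" using atlas_subset_maximal[OF assms(3) V(1)] .
  moreover have "locally_smooth S' \<phi> (\<lambda>y. \<psi> c) x" for S' by (rule locally_smooth_Cinf[OF open_UNIV _ Cinf_const[where c="\<psi> c"]]) auto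
  ultimately show ?thesis
    by (intro smooth_atI[of U \<phi> M V \<psi> N U]) (use U(2) in \<open>auto intro: is_chartD(1)[OF maximal_atlasD]\<close>)
qed

lemma smooth_at_continuous_map:
  assumes "\<And>x. x \<in> S \<Longrightarrow> smooth_at M S N f x"
  shows "continuous_map (subtopology (mtop M) S) (mtop N) f"
  unfolding continuous_map_def
proof (intro conjI allI impI)
  show "f \<in> topspace (subtopology (mtop M) S) \<rightarrow> points N"
    using assms smooth_at_points by fastforce
  fix T assume T: "openin (mtop N) T"
  show "openin (subtopology (mtop M) S) {x \<in> topspace (subtopology (mtop M) S). f x \<in> T}"
  proof (subst openin_subopen, intro ballI)
    fix x assume x: "x \<in> {x \<in> topspace (subtopology (mtop M) S). f x \<in> T}"
    then have xS: "x \<in> S" "f x \<in> T" "x \<in> points M" by auto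
    obtain U \<phi> V \<psi> O2 where h: "(U, \<phi>) \<in> maximal_atlas M" "(V, \<psi>) \<in> maximal_atlas N" "openin (mtop M) O2"
      "x \<in> O2" "O2 \<subseteq> U" "f x \<in> V" "f ` (S \<inter> O2) \<subseteq> V" "locally_smooth (S \<inter> O2) \<phi> (\<lambda>y. \<psi> (f y)) x"
      using assms[OF xS(1)] unfolding smooth_at_def by blast
    obtain Q where Q: "open Q" "\<psi> (f x) \<in> Q" "\<And>y. y \<in> V \<Longrightarrow> \<psi> y \<in> Q \<Longrightarrow> y \<in> T"
      using is_chart_nbhd[OF maximal_atlasD[OF h(2)] T xS(2) h(6)] by blast
    obtain W k where k: "open W" "\<phi> x \<in> W" "Cinf W k" "\<forall>y\<in>S \<inter> O2. \<phi> y \<in> W \<longrightarrow> \<psi> (f y) = k (\<phi> y)"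
      using h(8) unfolding locally_smooth_def by blast
    have op: "open (W \<inter> k -` Q)"
      using k Q by (auto intro!: continuous_open_preimage Cinf_continuous_on)
    define O1 where "O1 = O2 \<inter> {y \<in> U. \<phi> y \<in> W \<inter> k -` Q}"
    have O1: "openin (mtop M) O1" "x \<in> O1"
      using is_chartD(4)[OF maximal_atlasD[OF h(1)] op] h k Q xS by (auto simp: O1_def intro!: openin_Int)
    have "f y \<in> T" if "y \<in> S \<inter> O1" for y
    proof -
      have "\<psi> (f y) \<in> Q" "f y \<in> V" using that k(4) h(7) unfolding O1_def by auto
      then show ?thesis using Q(3) by blast
    qed
    moreover have "openin (subtopology (mtop M) S) (S \<inter> O1)"
      using O1(1) by (simp add: openin_subtopology_Int2)
    moreover have "S \<inter> O1 \<subseteq> points M" using openin_subset[OF O1(1)] by blast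
    ultimately show "\<exists>T'. openin (subtopology (mtop M) S) T' \<and> x \<in> T' \<and> T' \<subseteq> {x \<in> topspace (subtopology (mtop M) S). f x \<in> T}"
      using xS O1(2) by (intro exI[of _ "S \<inter> O1"]) auto
  qed
qed

text \<open>The charts \<open>(U, \<phi>)\<close> tested here lie in the maximal atlas, which covers slice charts of submanifolds.\<close>

lemma smooth_at_imp_smooth_on:
  assumes M: "smooth_manifold M" and N: "smooth_manifold N" and f: "\<And>x. x \<in> S \<Longrightarrow> smooth_at M S N f x"
    and U: "(U, \<phi>) \<in> maximal_atlas M" and V: "(V, \<psi>) \<in> maximal_atlas N" and S': "S' = U \<inter> S \<inter> f -` V" and U': "S' \<subseteq> U'" "U' \<subseteq> U"
  shows "smooth_on (\<phi> ` S') (\<psi> \<circ> f \<circ> inv_into U' \<phi>)"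
proof -
  have "inj_on \<phi> U'" using is_chartD(3) maximal_atlasD U U' inj_on_subset by blast
  moreover have "locally_smooth S' \<phi> (\<psi> \<circ> f) x" if x: "x \<in> S'" for x
  proof -
    have xx: "x \<in> S" "x \<in> U" "f x \<in> V" using x S' by auto
    obtain O' where O': "openin (mtop M) O'" "x \<in> O'" "O' \<subseteq> U" "f ` (S \<inter> O') \<subseteq> V" "locally_smooth (S \<inter> O') \<phi> (\<lambda>y. \<psi> (f y)) x"
      using smooth_at_charts[OF M N f[OF xx(1)] xx(1) U xx(2) V xx(3)] by blast
    have "locally_smooth (S' \<inter> O') \<phi> (\<psi> \<circ> f) x"
      unfolding o_def by (rule locally_smooth_mono[OF O'(5)]) (use S' in auto)
    with _ show ?thesis by (rule locally_smooth_local[OF maximal_atlasD[OF U] O'(1,2) xx(2)]) (use S' in auto)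
  qed
  ultimately show ?thesis using smooth_on_iff_locally_smooth[of \<phi> U' S' "\<psi> \<circ> f"] U' by (simp add: o_assoc)
qed

text \<open>The bridge between the chartwise notion of the definitions and the pointwise one. The
  forward direction uses continuity of \<open>f\<close> to find the neighbourhood on which the chart
  expression makes sense.\<close>

lemma smooth_map_iff:
  assumes M: "smooth_manifold M" and N: "smooth_manifold N"
  shows "smooth_map M N f \<longleftrightarrow> (\<forall>x\<in>points M. smooth_at M (points M) N f x)"
proof
  assume f: "smooth_map M N f"
  show "\<forall>x\<in>points M. smooth_at M (points M) N f x"
  proof
    fix x assume x: "x \<in> points M"
    then have fx: "f x \<in> points N" using f unfolding smooth_map_def continuous_map_def by auto
    obtain U \<phi> where U: "(U, \<phi>) \<in> atlas M" "x \<in> U" using atlas_cover[OF M x] .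
    obtain V \<psi> where V: "(V, \<psi>) \<in> atlas N" "f x \<in> V" using atlas_cover[OF N fx] .
    have m: "(U, \<phi>) \<in> maximal_atlas M" "(V, \<psi>) \<in> maximal_atlas N"
      using U V M N atlas_subset_maximal by blast+
    have cU: "is_chart (mtop M) U \<phi>" and cV: "is_chart (mtop N) V \<psi>" using m maximal_atlasD by auto
    have "smooth_on (\<phi> ` (U \<inter> f -` V)) (\<psi> \<circ> f \<circ> inv_into U \<phi>)"
      using f U V unfolding smooth_map_def by fast
    then have l: "locally_smooth (U \<inter> f -` V) \<phi> (\<psi> \<circ> f) x"
      using smooth_on_iff_locally_smooth[OF is_chartD(3)[OF cU], of "U \<inter> f -` V" "\<psi> \<circ> f"] U V by (auto simp: o_assoc)
    have "openin (mtop M) {y \<in> points M. f y \<in> V}"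
      using f is_chartD(1)[OF cV] unfolding smooth_map_def continuous_map_def by blast
    then have "openin (mtop M) (U \<inter> {y \<in> points M. f y \<in> V})"
      using is_chartD(1)[OF cU] by blast
    moreover have e: "U \<inter> {y \<in> points M. f y \<in> V} = U \<inter> f -` V" using is_chartD(2)[OF cU] by auto
    ultimately have o: "openin (mtop M) (U \<inter> f -` V)" by simp
    have "locally_smooth (points M \<inter> (U \<inter> f -` V)) \<phi> (\<lambda>y. \<psi> (f y)) x"
      using locally_smooth_mono[OF l[unfolded o_def], of "points M \<inter> (U \<inter> f -` V)"] by blast
    with _ _ _ _ show "smooth_at M (points M) N f x"
      by (rule smooth_atI[OF m o]) (use U(2) V(2) in auto)
  qed
next
  assume f: "\<forall>x\<in>points M. smooth_at M (points M) N f x"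
  have "continuous_map (subtopology (mtop M) (points M)) (mtop N) f"
    by (rule smooth_at_continuous_map) (use f in blast)
  moreover have "smooth_on (\<phi> ` (U \<inter> f -` V)) (\<psi> \<circ> f \<circ> inv_into U \<phi>)"
    if U: "(U, \<phi>) \<in> atlas M" and V: "(V, \<psi>) \<in> atlas N" for U \<phi> V \<psi>
  proof (rule smooth_at_imp_smooth_on[OF M N _ atlas_subset_maximal[OF M U] atlas_subset_maximal[OF N V]])
    show "U \<inter> f -` V = U \<inter> points M \<inter> f -` V"
      using is_chartD(2)[OF maximal_atlasD[OF atlas_subset_maximal[OF M U]]] by auto
  qed (use f in auto)
  ultimately show "smooth_map M N f" unfolding smooth_map_def by auto
qed

text \<open>Each slice chart of \<open>S\<close> is a chart from the maximal atlas of
  \<open>M\<close> restricted to \<open>S\<close>, so the slice chart expressions are among those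
  already covered by smoothness relative to \<open>S\<close>.\<close>

lemma smooth_map_submanifoldI:
  assumes M: "smooth_manifold M" and N: "smooth_manifold N" and f: "\<And>x. x \<in> S \<Longrightarrow> smooth_at M S N f x"
  shows "smooth_map (submanifold M S) N f"
proof -
  have "smooth_on (\<phi> ` (U \<inter> S \<inter> f -` V)) (\<psi> \<circ> f \<circ> inv_into (U \<inter> S) \<phi>)"
    if U: "(U, \<phi>) \<in> maximal_atlas M" and V: "(V, \<psi>) \<in> atlas N" for U \<phi> V \<psi>
    by (rule smooth_at_imp_smooth_on[OF M N _ U atlas_subset_maximal[OF N V]]) (use f in auto)
  then show ?thesis
    using smooth_at_continuous_map[of S M N f, OF f] unfolding smooth_map_def submanifold_def by fastforce
qed

section \<open>New charts from old ones\<close>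

text \<open>The new chart differs from the old one by a diffeomorphism of open sets of the ambient
  Euclidean space. \<open>T\<close> is the new model space: the last hypothesis makes the image
  relatively open in a linear subspace, as \<open>is_chart\<close> demands.\<close>

lemma maximal_atlas_change:
  assumes M: "smooth_manifold M" and U: "(U, \<phi>) \<in> maximal_atlas M" and O': "openin (mtop M) O'" "O' \<subseteq> U"
    and W: "open W" "\<phi> ` O' \<subseteq> W" "open W'" "Cinf W \<Phi>" "Cinf W' \<Psi>" "homeomorphism W W' \<Phi> \<Psi>"
    and T: "subspace T" "\<And>w. w \<in> W \<Longrightarrow> w \<in> span (\<phi> ` U) \<longleftrightarrow> \<Phi> w \<in> T"
  shows "(O', \<lambda>y. \<Phi> (\<phi> y)) \<in> maximal_atlas M"
proof -
  let ?c = "\<lambda>y. \<Phi> (\<phi> y)"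
  have cU: "is_chart (mtop M) U \<phi>" using U by (rule maximal_atlasD)
  have h: "\<And>w. w \<in> W \<Longrightarrow> \<Psi> (\<Phi> w) = w" "\<And>w. w \<in> W' \<Longrightarrow> \<Phi> (\<Psi> w) = w" "\<And>w. w \<in> W \<Longrightarrow> \<Phi> w \<in> W'" "\<And>w. w \<in> W' \<Longrightarrow> \<Psi> w \<in> W"
    using W(6) by (auto simp: homeomorphism_def)
  have inW: "\<And>y. y \<in> O' \<Longrightarrow> \<phi> y \<in> W" using W(2) by blast
  have opre: "open (W \<inter> \<Phi> -` Q)" if "open Q" for Q
    using W(1,4) that by (auto intro!: continuous_open_preimage Cinf_continuous_on)
  have opim: "open (W' \<inter> \<Psi> -` Q)" if "open Q" for Q
    using W(3,5) that by (auto intro!: continuous_open_preimage Cinf_continuous_on)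
  obtain Q1 where Q1: "open Q1" "\<phi> ` U = span (\<phi> ` U) \<inter> Q1" using is_chartD(6)[OF cU] by blast
  obtain Q2 where Q2: "open Q2" "\<phi> ` O' = \<phi> ` U \<inter> Q2" using is_chartD(5)[OF cU O'] by blast
  have im: "?c ` O' = T \<inter> (W' \<inter> \<Psi> -` (Q1 \<inter> Q2))"
  proof
    show "?c ` O' \<subseteq> T \<inter> (W' \<inter> \<Psi> -` (Q1 \<inter> Q2))"
    proof (rule image_subsetI)
      fix y assume y: "y \<in> O'"
      then have "\<phi> y \<in> W" "\<phi> y \<in> Q2" "\<phi> y \<in> \<phi> ` U" using inW Q2(2) O'(2) by blast+
      moreover then have "\<phi> y \<in> Q1" "\<phi> y \<in> span (\<phi> ` U)" using Q1(2) by blast+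
      ultimately show "?c y \<in> T \<inter> (W' \<inter> \<Psi> -` (Q1 \<inter> Q2))" using h T(2) by simp
    qed
    show "T \<inter> (W' \<inter> \<Psi> -` (Q1 \<inter> Q2)) \<subseteq> ?c ` O'"
    proof
      fix w assume w: "w \<in> T \<inter> (W' \<inter> \<Psi> -` (Q1 \<inter> Q2))"
      then have "\<Psi> w \<in> W" "\<Phi> (\<Psi> w) = w" using h by auto
      then have "\<Psi> w \<in> span (\<phi> ` U)" using T(2)[of "\<Psi> w"] w by simp
      then have "\<Psi> w \<in> \<phi> ` U" using w Q1(2) by blast
      then have "\<Psi> w \<in> \<phi> ` O'" using w Q2(2) by blast
      then show "w \<in> ?c ` O'" using \<open>\<Phi> (\<Psi> w) = w\<close> by force
    qed
  qed
  have "is_chart (mtop M) O' ?c"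
    unfolding is_chart_iff
  proof (intro conjI allI impI)
    show "openin (top_of_set (span (?c ` O'))) (?c ` O')"
    proof (cases "O' = {}")
      case False
      have "open (W' \<inter> \<Psi> -` (Q1 \<inter> Q2))" using opim Q1 Q2 by blast
      then have o: "openin (top_of_set T) (?c ` O')" unfolding im by (simp add: openin_open_Int)
      then have "span (?c ` O') = T" using T(1) False by (intro span_openin_subspace) auto
      then show ?thesis using o by simp
    qed simp
    show "inj_on ?c O'"
    proof (rule inj_onI)
      fix x y assume xy: "x \<in> O'" "y \<in> O'" "?c x = ?c y"
      then have "\<phi> x = \<phi> y" using h(1) inW by metis
      then show "x = y" using is_chartD(3)[OF cU] O'(2) xy by (auto dest: inj_onD)
    qed
    fix Q :: "'b set" assume Q: "open Q"
    have "openin (mtop M) (O' \<inter> {y \<in> U. \<phi> y \<in> W \<inter> \<Phi> -` Q})"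
      using O'(1) is_chartD(4)[OF cU opre[OF Q]] by blast
    moreover have "O' \<inter> {y \<in> U. \<phi> y \<in> W \<inter> \<Phi> -` Q} = {y \<in> O'. ?c y \<in> Q}"
      using inW O'(2) by auto
    ultimately show "openin (mtop M) {y \<in> O'. ?c y \<in> Q}" by simp
  next
    fix O2 assume O2: "openin (mtop M) O2" "O2 \<subseteq> O'"
    then obtain Q3 where Q3: "open Q3" "\<phi> ` O2 = \<phi> ` U \<inter> Q3" using is_chartD(5)[OF cU O2(1)] O'(2) by blast
    have "?c ` O2 = ?c ` O' \<inter> (W' \<inter> \<Psi> -` Q3)"
    proof
      show "?c ` O2 \<subseteq> ?c ` O' \<inter> (W' \<inter> \<Psi> -` Q3)"
      proof (rule image_subsetI)
        fix y assume y: "y \<in> O2"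
        then have "y \<in> O'" "\<phi> y \<in> Q3" using O2(2) Q3(2) by blast+
        then show "?c y \<in> ?c ` O' \<inter> (W' \<inter> \<Psi> -` Q3)" using h inW by simp
      qed
      show "?c ` O' \<inter> (W' \<inter> \<Psi> -` Q3) \<subseteq> ?c ` O2"
      proof
        fix w assume "w \<in> ?c ` O' \<inter> (W' \<inter> \<Psi> -` Q3)"
        then obtain y where y: "y \<in> O'" "w = ?c y" "\<Psi> w \<in> Q3" by blast
        then have "\<phi> y \<in> \<phi> ` U \<inter> Q3" using h(1)[OF inW] O'(2) by auto
        then obtain z where "z \<in> O2" "\<phi> y = \<phi> z" using Q3(2) by blast
          then show "w \<in> ?c ` O2" using y(2) by auto
      qed
    qed
    then show "\<exists>Q. open Q \<and> ?c ` O2 = ?c ` O' \<inter> Q" using opim[OF Q3(1)] by blast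
  qed (use O' in auto)
  moreover have "\<exists>V \<psi>. (V, \<psi>) \<in> maximal_atlas M \<and> x \<in> V \<and> locally_smooth (O' \<inter> V) ?c \<psi> x \<and> locally_smooth (O' \<inter> V) \<psi> ?c x"
    if x: "x \<in> O'" for x
  proof (intro exI conjI)
    show "locally_smooth (O' \<inter> U) ?c \<phi> x" by (rule locally_smooth_Cinf[OF W(3) _ W(5)]) (use h inW x in auto)
    show "locally_smooth (O' \<inter> U) \<phi> ?c x" by (rule locally_smooth_Cinf[OF W(1) _ W(4)]) (use h inW x in auto)
  qed (use U O' x in auto)
  ultimately show ?thesis using maximal_atlasI[OF M] by blast
qed

lemma maximal_atlas_restrict:
  assumes "smooth_manifold M" "(U, \<phi>) \<in> maximal_atlas M" "openin (mtop M) O'" "O' \<subseteq> U"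
  shows "(O', \<phi>) \<in> maximal_atlas M"
  using maximal_atlas_change[OF assms, of UNIV UNIV "\<lambda>x. x" "\<lambda>x. x" "span (\<phi> ` U)"]
  by (simp add: Cinf_id homeomorphism_def subspace_span)

section \<open>Products of manifolds\<close>

lemma second_countable_prod_topology:
  assumes "second_countable X" "second_countable Y"
  shows "second_countable (prod_topology X Y)"
proof -
  obtain A where A: "countable A" "\<forall>V\<in>A. openin X V" "\<forall>U x. openin X U \<and> x \<in> U \<longrightarrow> (\<exists>V\<in>A. x \<in> V \<and> V \<subseteq> U)"
    using assms(1) unfolding second_countable_def by blast
  obtain B where B: "countable B" "\<forall>V\<in>B. openin Y V" "\<forall>U x. openin Y U \<and> x \<in> U \<longrightarrow> (\<exists>V\<in>B. x \<in> V \<and> V \<subseteq> U)"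
    using assms(2) unfolding second_countable_def by blast
  show ?thesis
    unfolding second_countable_def
  proof (intro exI[of _ "(\<lambda>(a, b). a \<times> b) ` (A \<times> B)"] conjI ballI allI impI)
    show "countable ((\<lambda>(a, b). a \<times> b) ` (A \<times> B))" using A B by blast
    show "openin (prod_topology X Y) V" if "V \<in> (\<lambda>(a, b). a \<times> b) ` (A \<times> B)" for V
      using that A(2) B(2) by (auto simp: openin_prod_Times_iff)
    fix U z assume U: "openin (prod_topology X Y) U \<and> z \<in> U"
    obtain x y where z: "z = (x, y)" by (cases z)
    then obtain C D where CD: "openin X C" "openin Y D" "x \<in> C" "y \<in> D" "C \<times> D \<subseteq> U"
      using U unfolding openin_prod_topology_alt by blast
    obtain a b where "a \<in> A" "x \<in> a" "a \<subseteq> C" "b \<in> B" "y \<in> b" "b \<subseteq> D" using A(3) B(3) CD by meson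
    then show "\<exists>V\<in>(\<lambda>(a, b). a \<times> b) ` (A \<times> B). z \<in> V \<and> V \<subseteq> U"
      using z CD(5) by (intro bexI[of _ "a \<times> b"]) auto
  qed
qed

lemma is_chart_prod:
  assumes "is_chart X U \<phi>" "is_chart Y V \<psi>"
  shows "is_chart (prod_topology X Y) (U \<times> V) (map_prod \<phi> \<psi>)"
proof -
  have im: "map_prod \<phi> \<psi> ` (U \<times> V) = \<phi> ` U \<times> \<psi> ` V" by auto
  have o: "openin (prod_topology X Y) (U \<times> V)" using assms by (auto simp: openin_prod_Times_iff is_chart_def)
  have "openin (top_of_set (span (\<phi> ` U \<times> \<psi> ` V))) (\<phi> ` U \<times> \<psi> ` V)"
  proof (cases "U = {} \<or> V = {}")
    case False
    have "openin (top_of_set (span (\<phi> ` U) \<times> span (\<psi> ` V))) (\<phi> ` U \<times> \<psi> ` V)"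
      using assms by (auto simp: is_chart_def intro: openin_Times)
    \<comment> \<open>Spans and products do not commute for arbitrary sets. Here they do because the
      product is a nonempty open subset of the product of the two model spaces.\<close>
    moreover from this have "span (\<phi> ` U \<times> \<psi> ` V) = span (\<phi> ` U) \<times> span (\<psi> ` V)"
      using False by (intro span_openin_subspace) (auto intro: subspace_Times)
    ultimately show ?thesis by simp
  qed auto
  moreover have "homeomorphic_map (subtopology (prod_topology X Y) (U \<times> V)) (top_of_set (\<phi> ` U \<times> \<psi> ` V)) (map_prod \<phi> \<psi>)"
  proof -
    obtain \<phi>' where 1: "homeomorphic_maps (subtopology X U) (top_of_set (\<phi> ` U)) \<phi> \<phi>'"
      using assms(1) by (auto simp: is_chart_def homeomorphic_map_maps)
    obtain \<psi>' where 2: "homeomorphic_maps (subtopology Y V) (top_of_set (\<psi> ` V)) \<psi> \<psi>'"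
      using assms(2) by (auto simp: is_chart_def homeomorphic_map_maps)
    have "homeomorphic_maps (prod_topology (subtopology X U) (subtopology Y V)) (prod_topology (top_of_set (\<phi> ` U)) (top_of_set (\<psi> ` V)))
       (\<lambda>(x, y). (\<phi> x, \<psi> y)) (\<lambda>(x, y). (\<phi>' x, \<psi>' y))"
      using 1 2 unfolding homeomorphic_maps_prod by simp
    then have "homeomorphic_map (prod_topology (subtopology X U) (subtopology Y V)) (prod_topology (top_of_set (\<phi> ` U)) (top_of_set (\<psi> ` V))) (map_prod \<phi> \<psi>)"
      unfolding homeomorphic_map_maps map_prod_def by blast
    then show ?thesis
      by (simp add: subtopology_Times flip: euclidean_product_topology)
  qed
  ultimately show ?thesis using o unfolding is_chart_def im by blast
qed

lemma locally_smooth_map_prod: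
  assumes "locally_smooth S \<phi> \<phi>' x" "locally_smooth T \<psi> \<psi>' y"
  shows "locally_smooth (S \<times> T) (map_prod \<phi> \<psi>) (map_prod \<phi>' \<psi>') (x, y)"
proof -
  obtain W h where h: "open W" "\<phi> x \<in> W" "Cinf W h" "\<forall>y\<in>S. \<phi> y \<in> W \<longrightarrow> \<phi>' y = h (\<phi> y)"
    using assms unfolding locally_smooth_def by blast
  obtain W' k where k: "open W'" "\<psi> y \<in> W'" "Cinf W' k" "\<forall>y\<in>T. \<psi> y \<in> W' \<longrightarrow> \<psi>' y = k (\<psi> y)"
    using assms unfolding locally_smooth_def by blast
  have op: "open (W \<times> W')" using h k by (simp add: open_Times)
  show ?thesis
  proof (rule locally_smooth_Cinf[OF op])
    show "Cinf (W \<times> W') (\<lambda>p. (h (fst p), k (snd p)))"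
      by (intro Cinf_Pair Cinf_compose[OF op h(1) _ h(3)] Cinf_compose[OF op k(1) _ k(3)] Cinf_fst Cinf_snd Cinf_id) auto
  qed (use h k in auto)
qed

lemma smooth_manifold_prod:
  assumes M: "smooth_manifold M" and N: "smooth_manifold N"
  shows "smooth_manifold (prod_manifold M N)"
proof -
  have lsmM: "locally_smooth (U \<inter> V) \<phi> \<psi> x" if "(U, \<phi>) \<in> atlas M" "(V, \<psi>) \<in> atlas M" "x \<in> U" "x \<in> V" for U \<phi> V \<psi> x
    using maximal_atlas_locally_smooth[OF M] atlas_subset_maximal[OF M] that by blast
  have lsmN: "locally_smooth (U \<inter> V) \<phi> \<psi> x" if "(U, \<phi>) \<in> atlas N" "(V, \<psi>) \<in> atlas N" "x \<in> U" "x \<in> V" for U \<phi> V \<psi> x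
    using maximal_atlas_locally_smooth[OF N] atlas_subset_maximal[OF N] that by blast
  have cM: "is_chart (mtop M) U \<phi>" if "(U, \<phi>) \<in> atlas M" for U \<phi> using M that unfolding smooth_manifold_def by auto
  have cN: "is_chart (mtop N) U \<phi>" if "(U, \<phi>) \<in> atlas N" for U \<phi> using N that unfolding smooth_manifold_def by auto
  have pM: "points M = (\<Union>(U, \<phi>)\<in>atlas M. U)" using M unfolding smooth_manifold_def by auto
  have pN: "points N = (\<Union>(U, \<phi>)\<in>atlas N. U)" using N unfolding smooth_manifold_def by auto
  let ?A = "{(U \<times> V, map_prod \<phi> \<psi>) |U \<phi> V \<psi>. (U, \<phi>) \<in> atlas M \<and> (V, \<psi>) \<in> atlas N}"
  have tr: "smooth_transition c d" if "c \<in> ?A" "d \<in> ?A" for c d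
  proof -
    obtain U \<phi> V \<psi> where c: "c = (U \<times> V, map_prod \<phi> \<psi>)" "(U, \<phi>) \<in> atlas M" "(V, \<psi>) \<in> atlas N" using \<open>c \<in> ?A\<close> by blast
    obtain U' \<phi>' V' \<psi>' where d: "d = (U' \<times> V', map_prod \<phi>' \<psi>')" "(U', \<phi>') \<in> atlas M" "(V', \<psi>') \<in> atlas N" using \<open>d \<in> ?A\<close> by blast
    have eq: "U \<times> V \<inter> U' \<times> V' = (U \<inter> U') \<times> (V \<inter> V')" by auto
    show ?thesis
      unfolding c(1) d(1) smooth_transition_iff[OF is_chart_prod[OF cM[OF c(2)] cN[OF c(3)]]] eq
      using lsmM[OF c(2) d(2)] lsmN[OF c(3) d(3)] by (auto intro!: locally_smooth_map_prod)
  qed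
  have "Hausdorff_space (prod_topology (mtop M) (mtop N))"
    using M N by (simp add: smooth_manifold_def Hausdorff_space_prod_topology)
  moreover have "second_countable (prod_topology (mtop M) (mtop N))"
    using M N by (simp add: smooth_manifold_def second_countable_prod_topology)
  moreover have "\<forall>(U, \<phi>)\<in>?A. is_chart (prod_topology (mtop M) (mtop N)) U \<phi>"
    using is_chart_prod cM cN by fast
  moreover have "points M \<times> points N = (\<Union>(U, \<phi>)\<in>?A. U)"
    unfolding pM pN by fast
  ultimately show ?thesis using tr unfolding smooth_manifold_def prod_manifold_def by simp
qed

lemma points_prod [simp]: "points (prod_manifold M N) = points M \<times> points N"
  by (simp add: prod_manifold_def)

lemma smooth_at_fst:
  assumes M: "smooth_manifold M" and N: "smooth_manifold N" and x: "x \<in> points M \<times> points N"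
  shows "smooth_at (prod_manifold M N) S M fst x"
proof -
  obtain a b where ab: "x = (a, b)" "a \<in> points M" "b \<in> points N" using x by blast
  obtain U \<phi> where U: "(U, \<phi>) \<in> atlas M" "a \<in> U" using atlas_cover[OF M ab(2)] .
  obtain V \<psi> where V: "(V, \<psi>) \<in> atlas N" "b \<in> V" using atlas_cover[OF N ab(3)] .
  have "(U \<times> V, map_prod \<phi> \<psi>) \<in> atlas (prod_manifold M N)" using U V by (auto simp: prod_manifold_def)
  then have m: "(U \<times> V, map_prod \<phi> \<psi>) \<in> maximal_atlas (prod_manifold M N)"
    by (rule atlas_subset_maximal[OF smooth_manifold_prod[OF M N]])
  show ?thesis
  proof (rule smooth_atI[OF m atlas_subset_maximal[OF M U(1)] is_chartD(1)[OF maximal_atlasD[OF m]]])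
    show "locally_smooth (S \<inter> U \<times> V) (map_prod \<phi> \<psi>) (\<lambda>y. \<phi> (fst y)) x"
      by (rule locally_smooth_Cinf[OF open_UNIV _ Cinf_bounded_linear[OF bounded_linear_fst]]) auto
  qed (use U V ab in auto)
qed

lemma smooth_at_snd:
  assumes M: "smooth_manifold M" and N: "smooth_manifold N" and x: "x \<in> points M \<times> points N"
  shows "smooth_at (prod_manifold M N) S N snd x"
proof -
  obtain a b where ab: "x = (a, b)" "a \<in> points M" "b \<in> points N" using x by blast
  obtain U \<phi> where U: "(U, \<phi>) \<in> atlas M" "a \<in> U" using atlas_cover[OF M ab(2)] .
  obtain V \<psi> where V: "(V, \<psi>) \<in> atlas N" "b \<in> V" using atlas_cover[OF N ab(3)] .
  have "(U \<times> V, map_prod \<phi> \<psi>) \<in> atlas (prod_manifold M N)" using U V by (auto simp: prod_manifold_def)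
  then have m: "(U \<times> V, map_prod \<phi> \<psi>) \<in> maximal_atlas (prod_manifold M N)"
    by (rule atlas_subset_maximal[OF smooth_manifold_prod[OF M N]])
  show ?thesis
  proof (rule smooth_atI[OF m atlas_subset_maximal[OF N V(1)] is_chartD(1)[OF maximal_atlasD[OF m]]])
    show "locally_smooth (S \<inter> U \<times> V) (map_prod \<phi> \<psi>) (\<lambda>y. \<psi> (snd y)) x"
      by (rule locally_smooth_Cinf[OF open_UNIV _ Cinf_bounded_linear[OF bounded_linear_snd]]) auto
  qed (use U V ab in auto)
qed

lemma smooth_at_Pair:
  assumes M: "smooth_manifold M" and N: "smooth_manifold N" and P: "smooth_manifold P"
    and f: "smooth_at M S N f x" and g: "smooth_at M S P g x" and x: "x \<in> S"
  shows "smooth_at M S (prod_manifold N P) (\<lambda>y. (f y, g y)) x"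
proof -
  obtain U \<phi> where U: "(U, \<phi>) \<in> maximal_atlas M" "x \<in> U" by (rule smooth_atE[OF f]) blast
  obtain V \<psi> where V: "(V, \<psi>) \<in> atlas N" "f x \<in> V" using atlas_cover[OF N] smooth_at_points[OF f] by blast
  obtain V' \<psi>' where V': "(V', \<psi>') \<in> atlas P" "g x \<in> V'" using atlas_cover[OF P] smooth_at_points[OF g] by blast
  have "(V \<times> V', map_prod \<psi> \<psi>') \<in> atlas (prod_manifold N P)" using V V' by (auto simp: prod_manifold_def)
  then have m: "(V \<times> V', map_prod \<psi> \<psi>') \<in> maximal_atlas (prod_manifold N P)"
    by (rule atlas_subset_maximal[OF smooth_manifold_prod[OF N P]])
  obtain O1 where 1: "openin (mtop M) O1" "x \<in> O1" "O1 \<subseteq> U" "f ` (S \<inter> O1) \<subseteq> V" "locally_smooth (S \<inter> O1) \<phi> (\<lambda>y. \<psi> (f y)) x"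
    using smooth_at_charts[OF M N f x U atlas_subset_maximal[OF N V(1)] V(2)] .
  obtain O2 where 2: "openin (mtop M) O2" "x \<in> O2" "O2 \<subseteq> U" "g ` (S \<inter> O2) \<subseteq> V'" "locally_smooth (S \<inter> O2) \<phi> (\<lambda>y. \<psi>' (g y)) x"
    using smooth_at_charts[OF M P g x U atlas_subset_maximal[OF P V'(1)] V'(2)] .
  show ?thesis
  proof (rule smooth_atI[OF U(1) m, of "O1 \<inter> O2"])
    have "locally_smooth (S \<inter> (O1 \<inter> O2)) \<phi> (\<lambda>y. (\<psi> (f y), \<psi>' (g y))) x"
      by (intro locally_smooth_Pair locally_smooth_mono[OF 1(5)] locally_smooth_mono[OF 2(5)]) auto
    then show "locally_smooth (S \<inter> (O1 \<inter> O2)) \<phi> (\<lambda>y. map_prod \<psi> \<psi>' (f y, g y)) x" by simp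
  qed (use 1 2 V V' in auto)
qed

section \<open>Linear manifolds and maps with values in Euclidean spaces\<close>

lemma smooth_manifold_linear:
  assumes "subspace L" shows "smooth_manifold (linear_manifold L)"
proof -
  have L: "span L = L" using assms span_eq_iff by blast
  have "is_chart (top_of_set L) L id" unfolding is_chart_def
  proof (intro conjI)
    show "homeomorphic_map (subtopology (top_of_set L) L) (top_of_set (id ` L)) id"
      by (simp add: subtopology_subtopology)
  qed (auto simp: L)
  moreover have "smooth_transition (L, id) (L, id)"
    using smooth_transition_iff[OF \<open>is_chart (top_of_set L) L id\<close>, of L id] by (simp add: locally_smooth_refl)
  moreover have "second_countable (top_of_set L)"
  proof (rule second_countable_subtopology)
    obtain B :: "'a set set" where "countable B" "\<And>C. C \<in> B \<Longrightarrow> open C" "\<And>S. open S \<Longrightarrow> \<exists>U. U \<subseteq> B \<and> S = \<Union>U"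
      using univ_second_countable by blast
    then show "second_countable (euclidean :: 'a topology)"
      unfolding second_countable_def open_openin[symmetric] by (metis Union_upper UnionE subset_iff)
  qed
  ultimately show ?thesis
    unfolding smooth_manifold_def linear_manifold_def by (simp add: Hausdorff_space_subtopology)
qed

abbreviation euc :: "('e::euclidean_space, 'e) manifold" where
  "euc \<equiv> linear_manifold UNIV"

lemma smooth_manifold_euc: "smooth_manifold euc"
  by (rule smooth_manifold_linear) simp

lemma points_linear [simp]: "points (linear_manifold L) = L"
  by (simp add: linear_manifold_def)

lemma linear_chart: "subspace L \<Longrightarrow> (L, id) \<in> maximal_atlas (linear_manifold L)"
  by (rule atlas_subset_maximal[OF smooth_manifold_linear]) (auto simp: linear_manifold_def)

lemma prod_euc: "prod_manifold euc euc = euc"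
  by (simp add: prod_manifold_def linear_manifold_def prod.map_id0)

lemma smooth_at_linear_manifold:
  assumes M: "smooth_manifold M" and L: "subspace L" and x: "x \<in> S"
  shows "smooth_at M S (linear_manifold L) f x \<longleftrightarrow>
    (\<exists>U \<phi> O'. (U, \<phi>) \<in> maximal_atlas M \<and> openin (mtop M) O' \<and> x \<in> O' \<and> O' \<subseteq> U \<and> f ` (S \<inter> O') \<subseteq> L \<and> locally_smooth (S \<inter> O') \<phi> f x)"
    (is "?l \<longleftrightarrow> ?r")
proof
  assume f: ?l
  obtain U \<phi> where U: "(U, \<phi>) \<in> maximal_atlas M" "x \<in> U" by (rule smooth_atE[OF f]) blast
  have "f x \<in> L" using smooth_at_points[OF f] by simp
  then have fL: "f x \<in> L" .
  obtain O' where "openin (mtop M) O'" "x \<in> O'" "O' \<subseteq> U" "f ` (S \<inter> O') \<subseteq> L" "locally_smooth (S \<inter> O') \<phi> (\<lambda>y. id (f y)) x"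
    using smooth_at_charts[OF M smooth_manifold_linear[OF L] f x U linear_chart[OF L] fL] .
  then show ?r using U(1) unfolding id_def by blast
next
  assume ?r
  then obtain U \<phi> O' where h: "(U, \<phi>) \<in> maximal_atlas M" "openin (mtop M) O'" "x \<in> O'" "O' \<subseteq> U" "f ` (S \<inter> O') \<subseteq> L" "locally_smooth (S \<inter> O') \<phi> f x"
    by blast
  show ?l by (rule smooth_atI[OF h(1) linear_chart[OF L] h(2-4)]) (use h x in auto)
qed

lemma smooth_at_linear_euc:
  assumes M: "smooth_manifold M" and L: "subspace L" and x: "x \<in> S"
  shows "smooth_at M S (linear_manifold L) f x \<Longrightarrow> smooth_at M S euc f x"
    "smooth_at M S euc f x \<Longrightarrow> f ` S \<subseteq> L \<Longrightarrow> smooth_at M S (linear_manifold L) f x"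
  unfolding smooth_at_linear_manifold[OF M L x] smooth_at_linear_manifold[OF M subspace_UNIV x] by blast+

lemma smooth_at_euc_Cinf:
  assumes "open W" "x \<in> W" "Cinf W h"
  shows "smooth_at euc S euc h x"
proof (rule smooth_atI[OF linear_chart linear_chart, of _ _ UNIV])
  show "locally_smooth (S \<inter> UNIV) id (\<lambda>y. id (h y)) x"
    by (rule locally_smooth_Cinf[OF assms(1) _ assms(3)]) (use assms in auto)
qed (auto simp: linear_manifold_def)

lemma smooth_at_chart:
  assumes M: "smooth_manifold M" and U: "(U, \<phi>) \<in> maximal_atlas M" "x \<in> U"
  shows "smooth_at M S euc \<phi> x"
  by (rule smooth_atI[OF U(1) linear_chart is_chartD(1)[OF maximal_atlasD[OF U(1)]] U(2)])
    (simp_all add: locally_smooth_refl)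

lemma smooth_at_chart_inv:
  assumes M: "smooth_manifold M" and U: "(U, \<phi>) \<in> maximal_atlas M" and x: "x \<in> \<phi> ` U" and S: "S \<subseteq> \<phi> ` U"
  shows "smooth_at euc S M (inv_into U \<phi>) x"
proof -
  have inj: "inj_on \<phi> U" using is_chartD(3) maximal_atlasD[OF U] by blast
  show ?thesis
  proof (rule smooth_atI[OF linear_chart U, of UNIV])
    show "locally_smooth (S \<inter> UNIV) id (\<lambda>y. \<phi> (inv_into U \<phi> y)) x"
      by (rule locally_smooth_cong[OF locally_smooth_refl]) (use S in \<open>auto simp: f_inv_into_f\<close>)
    show "inv_into U \<phi> x \<in> U" using x by (rule inv_into_into)
    show "inv_into U \<phi> ` (S \<inter> UNIV) \<subseteq> U" using S by (intro image_subsetI inv_into_into) auto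
  qed (auto simp: linear_manifold_def)
qed

lemma smooth_at_compose_Cinf:
  assumes M: "smooth_manifold M" and f: "smooth_at M S euc f x" and x: "x \<in> S" and "open W" "f x \<in> W" "Cinf W h"
  shows "smooth_at M S euc (\<lambda>y. h (f y)) x"
  by (rule smooth_at_compose[OF M smooth_manifold_euc smooth_manifold_euc f smooth_at_euc_Cinf[OF assms(4-6)] x]) auto

lemma smooth_at_Pair_euc:
  assumes M: "smooth_manifold M" and f: "smooth_at M S euc f x" and g: "smooth_at M S euc g x" and x: "x \<in> S"
  shows "smooth_at M S euc (\<lambda>y. (f y, g y)) x"
  using smooth_at_Pair[OF M smooth_manifold_euc smooth_manifold_euc f g x] unfolding prod_euc .

lemma smooth_at_add:
  assumes M: "smooth_manifold M" and f: "smooth_at M S euc f x" and g: "smooth_at M S euc g x" and x: "x \<in> S"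
  shows "smooth_at M S euc (\<lambda>y. f y + g y) x"
  using smooth_at_compose_Cinf[OF M smooth_at_Pair_euc[OF M f g x] x open_UNIV UNIV_I Cinf_add[OF Cinf_fst Cinf_snd, OF Cinf_id Cinf_id]]
  by simp

lemma smooth_at_scaleR:
  assumes M: "smooth_manifold M" and f: "smooth_at M S euc f x" and g: "smooth_at M S euc g x" and x: "x \<in> S"
  shows "smooth_at M S euc (\<lambda>y. f y *\<^sub>R g y) x"
  using smooth_at_compose_Cinf[OF M smooth_at_Pair_euc[OF M f g x] x open_UNIV UNIV_I Cinf_scaleR[OF Cinf_fst Cinf_snd, OF Cinf_id Cinf_id]]
  by simp

lemma smooth_at_sum:
  assumes M: "smooth_manifold M" and x: "x \<in> S" "x \<in> points M" and f: "\<And>i. i \<in> I \<Longrightarrow> smooth_at M S euc (f i) x"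
  shows "smooth_at M S euc (\<lambda>y. \<Sum>i\<in>I. f i y) x"
  using f
proof (induction I rule: infinite_finite_induct)
  case (insert i I)
  then show ?case using smooth_at_add[OF M _ _ x(1), of "f i"] by simp
qed (use smooth_at_const[OF M x(2) smooth_manifold_euc] in auto)

section \<open>Embedded submanifolds\<close>

text \<open>Exactly the condition that the slice charts collected in \<open>submanifold\<close>
  cover \<open>S\<close>.\<close>

definition embedded :: "('a, 'e::euclidean_space) manifold \<Rightarrow> 'a set \<Rightarrow> bool" where
  "embedded M S \<longleftrightarrow> S \<subseteq> points M \<and>
     (\<forall>x\<in>S. \<exists>U \<phi> L. (U, \<phi>) \<in> maximal_atlas M \<and> x \<in> U \<and> subspace L \<and> \<phi> ` (U \<inter> S) = \<phi> ` U \<inter> L)"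

lemma points_submanifold: "S \<subseteq> points M \<Longrightarrow> points (submanifold M S) = S"
  by (auto simp: submanifold_def)

lemma embedded_points: "embedded M S \<Longrightarrow> points (submanifold M S) = S"
  by (simp add: embedded_def points_submanifold)

text \<open>The model space of the slice is the intersection of \<open>L\<close> with the model
  space of the chart: the image of the slice is open in it and therefore spans it.\<close>

lemma slice_is_chart:
  assumes c: "is_chart X U \<phi>" and L: "subspace L" "\<phi> ` (U \<inter> S) = \<phi> ` U \<inter> L"
  shows "is_chart (subtopology X S) (U \<inter> S) \<phi>"
  unfolding is_chart_iff
proof (intro conjI allI impI)
  show "openin (subtopology X S) (U \<inter> S)" using is_chartD(1)[OF c] by (simp add: openin_subtopology_Int)
  show "openin (top_of_set (span (\<phi> ` (U \<inter> S)))) (\<phi> ` (U \<inter> S))"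
  proof (cases "U \<inter> S = {}")
    case False
    obtain Q where Q: "open Q" "\<phi> ` U = span (\<phi> ` U) \<inter> Q" using is_chartD(6)[OF c] by blast
    then have "\<phi> ` (U \<inter> S) = (span (\<phi> ` U) \<inter> L) \<inter> Q" using L(2) by blast
    then have o: "openin (top_of_set (span (\<phi> ` U) \<inter> L)) (\<phi> ` (U \<inter> S))" using Q(1) by (simp add: openin_open_Int)
    then have "span (\<phi> ` (U \<inter> S)) = span (\<phi> ` U) \<inter> L"
      using False L(1) by (intro span_openin_subspace) (auto intro: subspace_inter subspace_span)
    then show ?thesis using o by simp
  qed simp
  show "inj_on \<phi> (U \<inter> S)" using is_chartD(3)[OF c] inj_on_subset by blast
  fix Q :: "'b set" assume "open Q"
  then have "openin (subtopology X S) ({y \<in> U. \<phi> y \<in> Q} \<inter> S)" using is_chartD(4)[OF c] openin_subtopology_Int by blast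
  moreover have "{y \<in> U. \<phi> y \<in> Q} \<inter> S = {y \<in> U \<inter> S. \<phi> y \<in> Q}" by auto
  ultimately show "openin (subtopology X S) {y \<in> U \<inter> S. \<phi> y \<in> Q}" by simp
next
  fix O' assume O': "openin (subtopology X S) O'" "O' \<subseteq> U \<inter> S"
  then obtain O2 where O2: "openin X O2" "O' = O2 \<inter> S" unfolding openin_subtopology by blast
  then obtain Q where Q: "open Q" "\<phi> ` (O2 \<inter> U) = \<phi> ` U \<inter> Q"
    using is_chartD(5)[OF c, of "O2 \<inter> U"] is_chartD(1)[OF c] by blast
  have "\<phi> ` O' = \<phi> ` (U \<inter> S) \<inter> Q"
  proof
    show "\<phi> ` O' \<subseteq> \<phi> ` (U \<inter> S) \<inter> Q" using O' O2 Q by blast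
    show "\<phi> ` (U \<inter> S) \<inter> Q \<subseteq> \<phi> ` O'"
    proof
      fix w assume "w \<in> \<phi> ` (U \<inter> S) \<inter> Q"
      then obtain y where y: "y \<in> U" "y \<in> S" "w = \<phi> y" "\<phi> y \<in> Q" by blast
      then have "\<phi> y \<in> \<phi> ` (O2 \<inter> U)" using Q by blast
      then have "y \<in> O2" using is_chartD(3)[OF c] y(1) by (auto dest: inj_onD)
      then show "w \<in> \<phi> ` O'" using y O2 by blast
    qed
  qed
  then show "\<exists>Q. open Q \<and> \<phi> ` O' = \<phi> ` (U \<inter> S) \<inter> Q" using Q(1) by blast
qed

lemma smooth_manifold_submanifold:
  assumes M: "smooth_manifold M" and S: "embedded M S"
  shows "smooth_manifold (submanifold M S)"
proof -
  let ?A = "{(U \<inter> S, \<phi>) |U \<phi>. (U, \<phi>) \<in> maximal_atlas M \<and> (\<exists>L. subspace L \<and> \<phi> ` (U \<inter> S) = \<phi> ` U \<inter> L)}"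
  have c: "is_chart (subtopology (mtop M) S) (U \<inter> S) \<phi>"
    if "(U, \<phi>) \<in> maximal_atlas M" "\<exists>L. subspace L \<and> \<phi> ` (U \<inter> S) = \<phi> ` U \<inter> L" for U \<phi>
    using slice_is_chart[OF maximal_atlasD[OF that(1)]] that(2) by blast
  have t: "smooth_transition a b" if ab: "a \<in> ?A" "b \<in> ?A" for a b
  proof -
    obtain U \<phi> where a: "a = (U \<inter> S, \<phi>)" "(U, \<phi>) \<in> maximal_atlas M" "\<exists>L. subspace L \<and> \<phi> ` (U \<inter> S) = \<phi> ` U \<inter> L"
      using ab by blast
    obtain V \<psi> where b: "b = (V \<inter> S, \<psi>)" "(V, \<psi>) \<in> maximal_atlas M" using ab by blast
    have "locally_smooth (U \<inter> S \<inter> (V \<inter> S)) \<phi> \<psi> x" if "x \<in> U \<inter> S \<inter> (V \<inter> S)" for x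
      by (rule locally_smooth_mono[OF maximal_atlas_locally_smooth[OF M a(2) b(2)]]) (use that in auto)
    then show ?thesis unfolding a(1) b(1) smooth_transition_iff[OF c[OF a(2,3)]] by blast
  qed
  have "S = (\<Union>(U, \<phi>)\<in>?A. U)"
  proof
    show "S \<subseteq> (\<Union>(U, \<phi>)\<in>?A. U)"
    proof
      fix x assume x: "x \<in> S"
      then obtain U \<phi> L where "(U, \<phi>) \<in> maximal_atlas M" "x \<in> U" "subspace L" "\<phi> ` (U \<inter> S) = \<phi> ` U \<inter> L"
        using S unfolding embedded_def by blast
      then have "(U \<inter> S, \<phi>) \<in> ?A" by blast
      then show "x \<in> (\<Union>(U, \<phi>)\<in>?A. U)" using x \<open>x \<in> U\<close> by blast
    qed
  qed auto
  moreover have "points M \<inter> S = S" using S unfolding embedded_def by blast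
  moreover have "\<forall>(U, \<phi>)\<in>?A. is_chart (subtopology (mtop M) S) U \<phi>" using c by auto
  ultimately show ?thesis
    using M t unfolding smooth_manifold_def submanifold_def
    by (simp add: Hausdorff_space_subtopology second_countable_subtopology)
qed

lemma embedded_open:
  assumes M: "smooth_manifold M" and S: "openin (mtop M) S" shows "embedded M S"
  unfolding embedded_def
proof (intro conjI ballI)
  show SS: "S \<subseteq> points M" using openin_subset[OF S] .
  fix x assume x: "x \<in> S"
  obtain U \<phi> where U: "(U, \<phi>) \<in> atlas M" "x \<in> U" using atlas_cover[OF M] x SS by blast
  note m = atlas_subset_maximal[OF M U(1)]
  have o: "openin (mtop M) (U \<inter> S)" using is_chartD(1)[OF maximal_atlasD[OF m]] S by blast
  show "\<exists>U \<phi> L. (U, \<phi>) \<in> maximal_atlas M \<and> x \<in> U \<and> subspace L \<and> \<phi> ` (U \<inter> S) = \<phi> ` U \<inter> L"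
  proof (intro exI conjI)
    show "(U \<inter> S, \<phi>) \<in> maximal_atlas M" by (rule maximal_atlas_restrict[OF M m o]) simp
    show "subspace (UNIV :: 'b set)" by simp
  qed (use U x in auto)
qed

lemma submanifold_chart:
  assumes M: "smooth_manifold M" and S: "embedded M S" and x: "x \<in> S"
  obtains U \<phi> where "(U, \<phi>) \<in> maximal_atlas M" "x \<in> U" "(U \<inter> S, \<phi>) \<in> maximal_atlas (submanifold M S)"
proof -
  obtain U \<phi> L where U: "(U, \<phi>) \<in> maximal_atlas M" "x \<in> U" "subspace L" "\<phi> ` (U \<inter> S) = \<phi> ` U \<inter> L"
    using S x unfolding embedded_def by blast
  then have "(U \<inter> S, \<phi>) \<in> atlas (submanifold M S)" unfolding submanifold_def by auto
  then show ?thesis using that U atlas_subset_maximal[OF smooth_manifold_submanifold[OF M S]] by blast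
qed

section \<open>Smooth maps out of and into embedded submanifolds\<close>

text \<open>A slice chart uses the same coordinate function as the ambient chart it comes from, so
  both sides test the same representing function; only the open neighbourhoods have to be
  translated.\<close>

lemma smooth_at_from_submanifold:
  assumes M: "smooth_manifold M" and N: "smooth_manifold N" and S: "embedded M S" and T: "T \<subseteq> S" and x: "x \<in> T"
  shows "smooth_at (submanifold M S) T N f x \<longleftrightarrow> smooth_at M T N f x"
proof -
  have xS: "x \<in> S" using T x by blast
  obtain U \<phi> where U: "(U, \<phi>) \<in> maximal_atlas M" "x \<in> U" "(U \<inter> S, \<phi>) \<in> maximal_atlas (submanifold M S)"
    using submanifold_chart[OF M S xS] .
  have xU: "x \<in> U \<inter> S" using U xS by blast
  note MS = smooth_manifold_submanifold[OF M S]
  show ?thesis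
  proof
    assume f: "smooth_at (submanifold M S) T N f x"
    obtain V \<psi> where V: "(V, \<psi>) \<in> maximal_atlas N" "f x \<in> V" by (rule smooth_atE[OF f]) blast
    obtain O' where O': "openin (mtop (submanifold M S)) O'" "x \<in> O'" "O' \<subseteq> U \<inter> S" "f ` (T \<inter> O') \<subseteq> V" "locally_smooth (T \<inter> O') \<phi> (\<lambda>y. \<psi> (f y)) x"
      using smooth_at_charts[OF MS N f x U(3) xU V] .
    then obtain O2 where O2: "openin (mtop M) O2" "O' = O2 \<inter> S"
      by (auto simp: submanifold_def openin_subtopology)
    have e: "T \<inter> (O2 \<inter> U) = T \<inter> O'" using O2 O'(3) T by blast
    show "smooth_at M T N f x"
    proof (rule smooth_atI[OF U(1) V(1), of "O2 \<inter> U"])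
      show "openin (mtop M) (O2 \<inter> U)" using O2(1) is_chartD(1)[OF maximal_atlasD[OF U(1)]] by blast
    qed (use O' O2 U V e in auto)
  next
    assume f: "smooth_at M T N f x"
    obtain V \<psi> where V: "(V, \<psi>) \<in> maximal_atlas N" "f x \<in> V" by (rule smooth_atE[OF f]) blast
    obtain O' where O': "openin (mtop M) O'" "x \<in> O'" "O' \<subseteq> U" "f ` (T \<inter> O') \<subseteq> V" "locally_smooth (T \<inter> O') \<phi> (\<lambda>y. \<psi> (f y)) x"
      using smooth_at_charts[OF M N f x U(1,2) V] .
    have e: "T \<inter> (O' \<inter> S) = T \<inter> O'" using T by blast
    show "smooth_at (submanifold M S) T N f x"
    proof (rule smooth_atI[OF U(3) V(1), of "O' \<inter> S"])
      show "openin (mtop (submanifold M S)) (O' \<inter> S)" using O'(1) by (auto simp: submanifold_def openin_subtopology)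
    qed (use O' xS V e in auto)
  qed
qed

lemma smooth_at_into_submanifold:
  assumes M: "smooth_manifold M" and N: "smooth_manifold N" and S: "embedded N S" and x: "x \<in> T" and f: "f ` T \<subseteq> S"
  shows "smooth_at M T (submanifold N S) f x \<longleftrightarrow> smooth_at M T N f x"
proof -
  have xS: "f x \<in> S" using x f by blast
  obtain V \<psi> where V: "(V, \<psi>) \<in> maximal_atlas N" "f x \<in> V" "(V \<inter> S, \<psi>) \<in> maximal_atlas (submanifold N S)"
    using submanifold_chart[OF N S xS] .
  have fV: "f x \<in> V \<inter> S" using V xS by blast
  note NS = smooth_manifold_submanifold[OF N S]
  show ?thesis
  proof
    assume f': "smooth_at M T (submanifold N S) f x"
    obtain U \<phi> where U: "(U, \<phi>) \<in> maximal_atlas M" "x \<in> U" by (rule smooth_atE[OF f']) blast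
    obtain O' where O': "openin (mtop M) O'" "x \<in> O'" "O' \<subseteq> U" "f ` (T \<inter> O') \<subseteq> V \<inter> S" "locally_smooth (T \<inter> O') \<phi> (\<lambda>y. \<psi> (f y)) x"
      using smooth_at_charts[OF M NS f' x U V(3) fV] .
    show "smooth_at M T N f x"
      by (rule smooth_atI[OF U(1) V(1) O'(1-3)]) (use O' V in auto)
  next
    assume f': "smooth_at M T N f x"
    obtain U \<phi> where U: "(U, \<phi>) \<in> maximal_atlas M" "x \<in> U" by (rule smooth_atE[OF f']) blast
    obtain O' where O': "openin (mtop M) O'" "x \<in> O'" "O' \<subseteq> U" "f ` (T \<inter> O') \<subseteq> V" "locally_smooth (T \<inter> O') \<phi> (\<lambda>y. \<psi> (f y)) x"
      using smooth_at_charts[OF M N f' x U V(1,2)] .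
    show "smooth_at M T (submanifold N S) f x"
      by (rule smooth_atI[OF U(1) V(3) O'(1-3)]) (use O' fV f in auto)
  qed
qed

text \<open>Such a projection has two uses: precomposed, it extends what is known on a model space
  to the ambient Euclidean space; postcomposed, it forces values back into the model space.\<close>

lemma linear_projection_exists:
  fixes T :: "'e::euclidean_space set"
  assumes "subspace T"
  obtains p where "linear p" "\<And>v. p v \<in> T" "\<And>v. v \<in> T \<Longrightarrow> p v = v"
proof -
  have "\<exists>g. g ` UNIV \<subseteq> T \<and> linear g \<and> (\<forall>v\<in>T. g (id v) = v)"
    by (rule linear_exists_left_inverse_on[OF linear_id assms]) simp
  then show ?thesis using that by (auto simp: subset_iff)
qed

text \<open>The representing function of \<open>f\<close> is defined on an open set but may leave
  the model space of the target chart away from \<open>S\<close>. Composed with a projection onto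
  that space it can be pulled back by the chart, on a small enough neighbourhood.\<close>

lemma smooth_at_extend:
  assumes M: "smooth_manifold M" and N: "smooth_manifold N" and f: "smooth_at M S N f x" and x: "x \<in> S"
  obtains O' h where "openin (mtop M) O'" "x \<in> O'" "\<And>y. y \<in> O' \<Longrightarrow> smooth_at M O' N h y" "\<And>y. y \<in> S \<Longrightarrow> y \<in> O' \<Longrightarrow> h y = f y"
proof -
  obtain U \<phi> V \<psi> O1 where h: "(U, \<phi>) \<in> maximal_atlas M" "(V, \<psi>) \<in> maximal_atlas N" "openin (mtop M) O1" "x \<in> O1" "O1 \<subseteq> U"
    "f x \<in> V" "f ` (S \<inter> O1) \<subseteq> V" "locally_smooth (S \<inter> O1) \<phi> (\<lambda>y. \<psi> (f y)) x"
    using f by (rule smooth_atE)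
  have cU: "is_chart (mtop M) U \<phi>" and cV: "is_chart (mtop N) V \<psi>" using h maximal_atlasD by auto
  obtain W k where k: "open W" "\<phi> x \<in> W" "Cinf W k" "\<And>y. y \<in> S \<Longrightarrow> y \<in> O1 \<Longrightarrow> \<phi> y \<in> W \<Longrightarrow> \<psi> (f y) = k (\<phi> y)"
    using h(8) unfolding locally_smooth_def by blast
  obtain p where p: "linear p" "\<And>v. p v \<in> span (\<psi> ` V)" "\<And>v. v \<in> span (\<psi> ` V) \<Longrightarrow> p v = v"
    using linear_projection_exists[OF subspace_span] by metis
  obtain Q where Q: "open Q" "\<psi> ` V = span (\<psi> ` V) \<inter> Q" using is_chartD(6)[OF cV] by blast
  have Cpk: "Cinf W (\<lambda>w. p (k w))" by (rule Cinf_linear_comp[OF p(1) k(3)])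
  have op: "open (W \<inter> (\<lambda>w. p (k w)) -` Q)"
    using k(1) Q(1) Cpk by (auto intro!: continuous_open_preimage Cinf_continuous_on)
  define O2 where "O2 = O1 \<inter> {y \<in> U. \<phi> y \<in> W \<inter> (\<lambda>w. p (k w)) -` Q}"
  define h' where "h' y = inv_into V \<psi> (p (k (\<phi> y)))" for y
  have o2: "openin (mtop M) O2" unfolding O2_def using h(3) is_chartD(4)[OF cU op] by blast
  have fspan: "\<psi> (f y) \<in> span (\<psi> ` V)" "\<psi> (f y) \<in> Q" if "y \<in> S" "y \<in> O1" for y
  proof -
    have "f y \<in> V" using h(7) that by blast
    then have "\<psi> (f y) \<in> \<psi> ` V" by blast
    then show "\<psi> (f y) \<in> span (\<psi> ` V)" "\<psi> (f y) \<in> Q" using Q(2) by blast+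
  qed
  have inV: "p (k (\<phi> y)) \<in> \<psi> ` V" if "y \<in> O2" for y
    using that p(2) Q(2) unfolding O2_def by blast
  show ?thesis
  proof (rule that[OF o2, of h'])
    have "p (k (\<phi> x)) = \<psi> (f x)" using k(4)[OF x h(4) k(2)] p(3) fspan[OF x h(4)] by simp
    then show "x \<in> O2" using fspan[OF x h(4)] h(4,5) k(2) unfolding O2_def by auto
    show "h' y = f y" if y: "y \<in> S" "y \<in> O2" for y
    proof -
      have y1: "y \<in> O1" "\<phi> y \<in> W" using y unfolding O2_def by auto
      have "p (k (\<phi> y)) = \<psi> (f y)" using k(4)[OF y(1) y1] p(3) fspan[OF y(1) y1(1)] by simp
      moreover have "f y \<in> V" using h(7) y(1) y1 by blast
      ultimately show ?thesis unfolding h'_def using is_chartD(3)[OF cV] by simp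
    qed
    show "smooth_at M O2 N h' y" if y: "y \<in> O2" for y
    proof (rule smooth_atI[OF h(1,2) o2 y])
      show "locally_smooth (O2 \<inter> O2) \<phi> (\<lambda>y. \<psi> (h' y)) y"
        by (rule locally_smooth_Cinf[OF k(1) _ Cpk]) (use y inV in \<open>auto simp: O2_def h'_def f_inv_into_f\<close>)
      show "h' y \<in> V" unfolding h'_def using inV[OF y] by (rule inv_into_into)
      show "h' ` (O2 \<inter> O2) \<subseteq> V" unfolding h'_def using inV by (auto intro!: inv_into_into)
    qed (auto simp: O2_def)
  qed
qed

text \<open>If \<open>h\<close> is the retraction in a chart and
  \<open>P\<close> its (idempotent) differential, then \<open>w \<mapsto> P (h w) + (1 - P) (w - h w)\<close> has differential \<open>1\<close> and
  straightens the set onto the range of \<open>P\<close>.\<close>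

lemma embedded_retract:
  assumes M: "smooth_manifold M" and S: "S \<subseteq> points M"
    and r: "\<And>x. x \<in> S \<Longrightarrow> \<exists>O' r. openin (mtop M) O' \<and> x \<in> O' \<and> smooth_at M O' M r x \<and> r ` O' \<subseteq> S \<and> (\<forall>y\<in>O' \<inter> S. r y = y)"
  shows "embedded M S"
  unfolding embedded_def
proof (intro conjI ballI)
  fix x assume x: "x \<in> S"
  obtain O' r where O': "openin (mtop M) O'" "x \<in> O'" and rs: "smooth_at M O' M r x" and r: "r ` O' \<subseteq> S" "\<And>y. y \<in> O' \<Longrightarrow> y \<in> S \<Longrightarrow> r y = y"
    using r[OF x] by blast
  obtain U \<phi> where U: "(U, \<phi>) \<in> atlas M" "x \<in> U" using atlas_cover[OF M] x S by blast
  note m = atlas_subset_maximal[OF M U(1)]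
  have cU: "is_chart (mtop M) U \<phi>" using m by (rule maximal_atlasD)
  have inj: "inj_on \<phi> U" using is_chartD(3)[OF cU] .
  have rx: "r x = x" using r(2) O'(2) x by blast
  have rxU: "r x \<in> U" using rx U by simp
  define T where "T = span (\<phi> ` U)"
  have T: "subspace T" unfolding T_def by simp
  obtain O1 where O1: "openin (mtop M) O1" "x \<in> O1" "O1 \<subseteq> U" "r ` (O' \<inter> O1) \<subseteq> U" "locally_smooth (O' \<inter> O1) \<phi> (\<lambda>y. \<phi> (r y)) x"
    using smooth_at_charts[OF M M rs O'(2) m U(2) m rxU] .
  obtain W k where k: "open W" "\<phi> x \<in> W" "Cinf W k" "\<And>y. y \<in> O' \<inter> O1 \<Longrightarrow> \<phi> y \<in> W \<Longrightarrow> \<phi> (r y) = k (\<phi> y)"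
    using O1(5) unfolding locally_smooth_def by blast
  obtain Q0 where Q0: "open Q0" "\<phi> ` U = T \<inter> Q0" using is_chartD(6)[OF cU] unfolding T_def by blast
  obtain Q1 where Q1: "open Q1" "\<phi> x \<in> Q1" "\<And>y. y \<in> U \<Longrightarrow> \<phi> y \<in> Q1 \<Longrightarrow> y \<in> O' \<inter> O1"
    using is_chart_nbhd[OF cU _ _ U(2), of "O' \<inter> O1"] O' O1 by blast
  obtain p where p: "linear p" "\<And>v. p v \<in> T" "\<And>v. v \<in> T \<Longrightarrow> p v = v"
    using linear_projection_exists[OF T] by metis
  have contp: "continuous_on UNIV p" using p(1) by (simp add: linear_continuous_on linear_conv_bounded_linear)
  \<comment> \<open>Points are first projected to the model space \<open>T\<close>, so that the
    coordinate form \<open>h\<close> of the retraction is defined on an open set of the ambient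
    Euclidean space.\<close>
  define W0 where "W0 = p -` (W \<inter> Q0 \<inter> Q1)"
  have W0: "open W0" unfolding W0_def using k(1) Q0(1) Q1(1) contp by (auto intro!: open_vimage)
  define h where "h w = k (p w)" for w
  have Ch: "Cinf W0 h"
    unfolding h_def by (rule Cinf_compose[OF W0 k(1) _ k(3) Cinf_linear[OF p(1)]]) (auto simp: W0_def)
  have hW0: "\<exists>y. y \<in> U \<and> y \<in> O' \<inter> O1 \<and> p w = \<phi> y \<and> h w = \<phi> (r y) \<and> r y \<in> U \<and> r y \<in> S" if "w \<in> W0" for w
  proof -
    have "p w \<in> \<phi> ` U" using that p(2) Q0(2) unfolding W0_def by blast
    then obtain y where y: "y \<in> U" "p w = \<phi> y" by blast
    then have "y \<in> O' \<inter> O1" "\<phi> y \<in> W" using Q1(3) that unfolding W0_def by auto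
    then show ?thesis using y k(4) O1(4) r(1) unfolding h_def by (intro exI[of _ y]) auto
  qed
  have hT: "h w \<in> T" if "w \<in> W0" for w
    using hW0[OF that] unfolding T_def by (auto intro: span_base)
  \<comment> \<open>Idempotence of the retraction passes to \<open>h\<close> where both applications
    are defined; differentiating it makes \<open>P\<close> idempotent.\<close>
  have hh: "h (h w) = h w" if w: "w \<in> W0" "h w \<in> W0" for w
  proof -
    obtain y where y: "h w = \<phi> (r y)" "r y \<in> U" "r y \<in> S" using hW0[OF w(1)] by blast
    obtain z where z: "z \<in> U" "z \<in> O' \<inter> O1" "p (h w) = \<phi> z" "h (h w) = \<phi> (r z)" using hW0[OF w(2)] by blast
    have "\<phi> z = \<phi> (r y)" using z(3) p(3)[OF hT[OF w(1)]] y(1) by simp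
    then have "z = r y" using inj z(1) y(2) by (auto dest: inj_onD)
    then have "r z = z" using y(3) z(2) r(2) by blast
    then show ?thesis using z(3,4) p(3)[OF hT[OF w(1)]] by simp
  qed
  have hS: "h (\<phi> y) = \<phi> y" if y: "y \<in> S" "y \<in> U" "\<phi> y \<in> W0" for y
  proof -
    obtain z where z: "z \<in> U" "z \<in> O' \<inter> O1" "p (\<phi> y) = \<phi> z" "h (\<phi> y) = \<phi> (r z)" using hW0[OF y(3)] by blast
    have "\<phi> y \<in> T" using y(2) unfolding T_def by (auto intro: span_base)
    then have "z = y" using p(3) z(1,3) y(2) inj by (auto dest: inj_onD)
    then show ?thesis using z r(2) y(1) by simp
  qed
  have \<phi>xT: "\<phi> x \<in> T" using U(2) unfolding T_def by (auto intro: span_base)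
  have xQ0: "\<phi> x \<in> Q0" using U(2) Q0(2) by blast
  have xW0: "\<phi> x \<in> W0" unfolding W0_def using p(3)[OF \<phi>xT] k(2) xQ0 Q1(2) by simp
  have hx: "h (\<phi> x) = \<phi> x" using hS[OF x U(2) xW0] .
  define W1 where "W1 = W0 \<inter> h -` W0"
  have W1: "open W1" unfolding W1_def
    using W0 Ch by (auto intro!: continuous_open_preimage Cinf_continuous_on)
  have xW1: "\<phi> x \<in> W1" using xW0 hx by (simp add: W1_def)
  obtain h' where h': "\<And>w. w \<in> W0 \<Longrightarrow> (h has_derivative h' w) (at w)" using Cinf_derivative[OF Ch W0] by metis
  define P where "P = h' (\<phi> x)"
  have dP: "(h has_derivative P) (at (\<phi> x))" using h'[OF xW0] by (simp add: P_def)
  have linP: "linear P" using dP by (rule has_derivative_linear)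
  have PP: "P (P v) = P v" for v
  proof -
    have "((\<lambda>w. h (h w)) has_derivative (\<lambda>v. P (P v))) (at (\<phi> x))"
      by (rule has_derivative_compose[OF dP]) (simp add: hx dP)
    then have "(h has_derivative (\<lambda>v. P (P v))) (at (\<phi> x))"
      by (rule has_derivative_transform_within_open[OF _ W1 xW1]) (simp add: W1_def hh)
    then show ?thesis using dP has_derivative_unique by metis
  qed
  have PT: "P v \<in> T" for v
  proof -
    have "((\<lambda>w. p (h w)) has_derivative (\<lambda>v. p (P v))) (at (\<phi> x))"
      by (rule bounded_linear.has_derivative[OF _ dP]) (use p(1) in \<open>simp add: linear_conv_bounded_linear\<close>)
    then have "(h has_derivative (\<lambda>v. p (P v))) (at (\<phi> x))"
      by (rule has_derivative_transform_within_open[OF _ W0 xW0]) (simp add: hT p(3))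
    then have "P v = p (P v)" using dP has_derivative_unique by metis
    then show ?thesis using p(2) by metis
  qed
  define \<Phi> where "\<Phi> w = P (h w) + ((w - h w) - P (w - h w))" for w
  have C\<Phi>: "Cinf W1 \<Phi>"
    unfolding \<Phi>_def using Cinf_subset[OF Ch, of W1]
    by (intro Cinf_add Cinf_diff Cinf_linear_comp[OF linP] Cinf_id) (auto simp: W1_def)
  have d\<Phi>: "(\<Phi> has_derivative (\<lambda>v. P (P v) + ((v - P v) - P (v - P v)))) (at (\<phi> x))"
    unfolding \<Phi>_def using dP linP
    by (intro has_derivative_add has_derivative_diff bounded_linear.has_derivative[where f=P] has_derivative_ident)
      (simp_all add: linear_conv_bounded_linear)
  have "(\<lambda>v. P (P v) + ((v - P v) - P (v - P v))) = (\<lambda>v. v)"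
    by (rule ext) (simp add: linear_diff[OF linP] PP)
  then have inj\<Phi>: "inj (\<lambda>v. P (P v) + ((v - P v) - P (v - P v)))" by (simp add: inj_def)
  obtain U' V' g where U': "open U'" "U' \<subseteq> W1" "\<phi> x \<in> U'" "open V'" "\<Phi> (\<phi> x) \<in> V'" and hom: "homeomorphism U' V' \<Phi> g" and Cg: "Cinf V' g"
    using Cinf_inverse_function[OF C\<Phi> W1 xW1 d\<Phi> inj\<Phi>] .
  \<comment> \<open>On \<open>U2\<close> both \<open>w\<close> and \<open>h w\<close> lie where
    \<Phi> is injective, and these two points are compared at the end.\<close>
  define U2 where "U2 = U' \<inter> h -` U'"
  have U2: "open U2" unfolding U2_def
    using U' Ch by (auto intro!: continuous_open_preimage Cinf_continuous_on elim!: Cinf_subset simp: W1_def)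
  have xU2: "\<phi> x \<in> U2" using U'(3) hx by (simp add: U2_def)
  define V2 where "V2 = V' \<inter> g -` U2"
  have V2: "open V2" unfolding V2_def
    using U' Cg U2 by (auto intro!: continuous_open_preimage Cinf_continuous_on)
  have hom2: "homeomorphism U2 V2 \<Phi> g"
  proof (rule homeomorphism_of_subsets[OF hom])
    show "\<Phi> ` U2 = V2" using hom unfolding V2_def U2_def homeomorphism_def by force
  qed (auto simp: U2_def)
  define O2 where "O2 = {y \<in> U. \<phi> y \<in> U2}"
  have O2: "openin (mtop M) O2" unfolding O2_def by (rule is_chartD(4)[OF cU U2])
  have U2W: "w \<in> W0" "h w \<in> W0" "w \<in> U'" "h w \<in> U'" if "w \<in> U2" for w
    using that U'(2) by (auto simp: U2_def W1_def)
  have new: "(O2, \<lambda>y. \<Phi> (\<phi> y)) \<in> maximal_atlas M"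
  proof (rule maximal_atlas_change[OF M m O2 _ U2 _ V2 _ _ hom2 T])
    show "Cinf U2 \<Phi>" using C\<Phi> U'(2) by (auto elim!: Cinf_subset simp: U2_def)
    show "Cinf V2 g" using Cg by (auto elim!: Cinf_subset simp: V2_def)
    show "w \<in> span (\<phi> ` U) \<longleftrightarrow> \<Phi> w \<in> T" if w: "w \<in> U2" for w
    proof -
      \<comment> \<open>The straightening changes \<open>w\<close> by a vector of \<open>T\<close>
        only, so the model space is preserved.\<close>
      have "\<Phi> w - w = P (h w) - h w - P (w - h w)" by (simp add: \<Phi>_def)
      also have "\<dots> \<in> T" using PT hT[OF U2W(1)[OF w]] T by (simp add: subspace_diff)
      finally have "\<Phi> w - w \<in> T" .
      then show ?thesis using T unfolding T_def[symmetric]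
        by (metis add.commute diff_add_cancel diff_diff_eq2 subspace_add subspace_diff)
    qed
  qed (auto simp: O2_def)
  have im: "(\<lambda>y. \<Phi> (\<phi> y)) ` (O2 \<inter> S) = (\<lambda>y. \<Phi> (\<phi> y)) ` O2 \<inter> range P"
  proof
    show "(\<lambda>y. \<Phi> (\<phi> y)) ` (O2 \<inter> S) \<subseteq> (\<lambda>y. \<Phi> (\<phi> y)) ` O2 \<inter> range P"
    proof (rule image_subsetI)
      fix y assume y: "y \<in> O2 \<inter> S"
      then have "h (\<phi> y) = \<phi> y" using hS U2W(1) unfolding O2_def by blast
      then have "\<Phi> (\<phi> y) = P (\<phi> y)" by (simp add: \<Phi>_def linear_0[OF linP])
      then show "\<Phi> (\<phi> y) \<in> (\<lambda>y. \<Phi> (\<phi> y)) ` O2 \<inter> range P" using y by (metis (no_types, lifting) Int_iff imageI rangeI)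
    qed
    show "(\<lambda>y. \<Phi> (\<phi> y)) ` O2 \<inter> range P \<subseteq> (\<lambda>y. \<Phi> (\<phi> y)) ` (O2 \<inter> S)"
    proof
      fix w assume "w \<in> (\<lambda>y. \<Phi> (\<phi> y)) ` O2 \<inter> range P"
      then obtain y v where y: "y \<in> O2" "w = \<Phi> (\<phi> y)" "w = P v" by blast
      have yU: "y \<in> U" "\<phi> y \<in> U2" using y(1) unfolding O2_def by auto
      note u = U2W[OF yU(2)]
      \<comment> \<open>If the new chart value is fixed by \<open>P\<close>, then \<Phi> takes the
        same value at \<open>h (\<phi> y)\<close> and at \<open>\<phi> y\<close>. By injectivity
        \<open>\<phi> y\<close> is a fixed point of \<open>h\<close>, that is, \<open>y\<close> lies
        in the image of the retraction.\<close>
      have "P w = w" using y(3) PP by simp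
      then have "P (\<Phi> (\<phi> y)) = \<Phi> (\<phi> y)" using y(2) by simp
      moreover have "P (\<Phi> (\<phi> y)) = P (h (\<phi> y))"
        unfolding \<Phi>_def by (simp add: linear_add[OF linP] linear_diff[OF linP] PP)
      moreover have "\<Phi> (h (\<phi> y)) = P (h (\<phi> y))"
        unfolding \<Phi>_def by (simp add: hh[OF u(1,2)] linear_0[OF linP])
      ultimately have "\<Phi> (h (\<phi> y)) = \<Phi> (\<phi> y)" by simp
      then have "h (\<phi> y) = \<phi> y" using hom u(3,4) unfolding homeomorphism_def by metis
      moreover obtain z where z: "z \<in> U" "p (\<phi> y) = \<phi> z" "h (\<phi> y) = \<phi> (r z)" "r z \<in> U" "r z \<in> S"
        using hW0[OF u(1)] by blast
      ultimately have "y = r z" using inj yU(1) by (auto dest: inj_onD)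
      then show "w \<in> (\<lambda>y. \<Phi> (\<phi> y)) ` (O2 \<inter> S)" using z(5) y by blast
    qed
  qed
  show "\<exists>U \<phi> L. (U, \<phi>) \<in> maximal_atlas M \<and> x \<in> U \<and> subspace L \<and> \<phi> ` (U \<inter> S) = \<phi> ` U \<inter> L"
  proof (intro exI conjI)
    show "subspace (range P)" using linP by (simp add: linear_subspace_image)
    show "x \<in> O2" using U(2) xU2 by (simp add: O2_def)
  qed (rule new im)+
qed (rule S)

section \<open>Submersions\<close>

text \<open>A derivative within a relatively open part of \<open>E\<close> is determined only in the
  directions of \<open>E\<close>. Along the line through \<open>a\<close> in direction
  \<open>u\<close> the claim becomes uniqueness of an ordinary derivative.\<close>

lemma has_derivative_eq_along:
  fixes f g :: "'e::euclidean_space \<Rightarrow> 'f::euclidean_space"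
  assumes f: "(f has_derivative D) (at a within E \<inter> Q)" and g: "(g has_derivative D') (at a within E \<inter> Q)"
    and E: "subspace E" "open Q" "a \<in> E" "a \<in> Q" and eq: "\<And>w. w \<in> E \<Longrightarrow> w \<in> Q \<Longrightarrow> f w = g w" and u: "u \<in> E"
  shows "D u = D' u"
proof -
  define c where "c t = a + t *\<^sub>R u" for t :: real
  define T where "T = c -` Q"
  have T: "open T" unfolding T_def c_def using E(2) by (auto intro!: open_vimage continuous_intros)
  have T0: "0 \<in> T" using E(4) by (simp add: T_def c_def)
  have im: "c ` T \<subseteq> E \<inter> Q" using E(1,3) u by (auto simp: T_def c_def subspace_add subspace_scale)
  have dc: "(c has_derivative (\<lambda>t. t *\<^sub>R u)) (at 0 within T)"
    unfolding c_def by (auto intro!: derivative_eq_intros)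
  have ca: "c 0 = a" by (simp add: c_def)
  have 1: "((\<lambda>t. f (c t)) has_derivative (\<lambda>t. D (t *\<^sub>R u))) (at 0 within T)"
    by (rule has_derivative_in_compose[OF dc]) (rule has_derivative_subset[OF _ im], simp add: ca f)
  have 2: "((\<lambda>t. g (c t)) has_derivative (\<lambda>t. D' (t *\<^sub>R u))) (at 0 within T)"
    by (rule has_derivative_in_compose[OF dc]) (rule has_derivative_subset[OF _ im], simp add: ca g)
  have "((\<lambda>t. f (c t)) has_derivative (\<lambda>t. D' (t *\<^sub>R u))) (at 0)"
    by (rule has_derivative_transform_within_open[OF _ T T0, of "\<lambda>t. g (c t)"])
      (use 2 at_within_open[OF T0 T] in simp, use eq im in \<open>metis IntE image_subset_iff\<close>)
  then have "(\<lambda>t. D (t *\<^sub>R u)) = (\<lambda>t. D' (t *\<^sub>R u))"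
    using 1 at_within_open[OF T0 T] has_derivative_unique by metis
  then show ?thesis by (metis scaleR_one)
qed

text \<open>The local form of a submersion as a transport: \<open>\<rho> (y, n)\<close> moves
  \<open>y\<close> to a point over \<open>n\<close> and leaves \<open>y\<close> alone when
  \<open>n = f y\<close>. Fixing the first argument yields local sections, and substituting a second
  map for \<open>n\<close> yields fibre products.\<close>

lemma submersion_transport:
  fixes M :: "('a, 'e::euclidean_space) manifold" and N :: "('b, 'f::euclidean_space) manifold"
  assumes M: "smooth_manifold M" and N: "smooth_manifold N" and f: "submersion M N f" and x: "x \<in> points M"
  obtains O' \<rho> where "openin (mtop (prod_manifold M N)) O'" "(x, f x) \<in> O'" "smooth_at (prod_manifold M N) O' M \<rho> (x, f x)"
    "\<And>y n. (y, n) \<in> O' \<Longrightarrow> \<rho> (y, n) \<in> points M \<and> f (\<rho> (y, n)) = n" "\<And>y. (y, f y) \<in> O' \<Longrightarrow> \<rho> (y, f y) = y"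
proof -
  have sf: "smooth_map M N f" using f by (simp add: submersion_def)
  then have sfx: "smooth_at M (points M) N f x" using smooth_map_iff[OF M N] x by blast
  have fx: "f x \<in> points N" using smooth_at_points[OF sfx] by simp
  obtain U \<phi> where U: "(U, \<phi>) \<in> atlas M" "x \<in> U" using atlas_cover[OF M x] .
  obtain V \<psi> where V: "(V, \<psi>) \<in> atlas N" "f x \<in> V" using atlas_cover[OF N fx] .
  note mU = atlas_subset_maximal[OF M U(1)] and mV = atlas_subset_maximal[OF N V(1)]
  have cU: "is_chart (mtop M) U \<phi>" and cV: "is_chart (mtop N) V \<psi>" using mU mV maximal_atlasD by auto
  have injU: "inj_on \<phi> U" and injV: "inj_on \<psi> V" using is_chartD(3)[OF cU] is_chartD(3)[OF cV] .
  define E where "E = span (\<phi> ` U)"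
  define E' where "E' = span (\<psi> ` V)"
  have E: "subspace E" "subspace E'" by (simp_all add: E_def E'_def)
  have inE: "\<phi> y \<in> E" if "y \<in> U" for y using that by (auto simp: E_def intro: span_base)
  have inE': "\<psi> y \<in> E'" if "y \<in> V" for y using that by (auto simp: E'_def intro: span_base)
  obtain O1 where O1: "openin (mtop M) O1" "x \<in> O1" "O1 \<subseteq> U" "f ` (points M \<inter> O1) \<subseteq> V" "locally_smooth (points M \<inter> O1) \<phi> (\<lambda>y. \<psi> (f y)) x"
    using smooth_at_charts[OF M N sfx x mU U(2) mV V(2)] .
  have O1p: "points M \<inter> O1 = O1" using openin_subset[OF O1(1)] by blast
  have O1V: "f y \<in> V" if "y \<in> O1" for y using O1(4) that unfolding O1p by blast
  obtain W H where H: "open W" "\<phi> x \<in> W" "Cinf W H" "\<And>y. y \<in> O1 \<Longrightarrow> \<phi> y \<in> W \<Longrightarrow> \<psi> (f y) = H (\<phi> y)"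
    using O1(5) unfolding locally_smooth_def O1p by blast
  obtain Q0 where Q0: "open Q0" "\<phi> ` U = E \<inter> Q0" using is_chartD(6)[OF cU] unfolding E_def by blast
  obtain Q' where Q': "open Q'" "\<psi> ` V = E' \<inter> Q'" using is_chartD(6)[OF cV] unfolding E'_def by blast
  obtain Q1 where Q1: "open Q1" "\<phi> x \<in> Q1" "\<And>y. y \<in> U \<Longrightarrow> \<phi> y \<in> Q1 \<Longrightarrow> y \<in> O1"
    using is_chart_nbhd[OF cU O1(1,2) U(2)] by blast
  define Q where "Q = Q0 \<inter> Q1 \<inter> W"
  have xQ: "\<phi> x \<in> Q" using U(2) Q0(2) Q1(2) H(2) by (auto simp: Q_def)
  have Q: "open Q" using Q0 Q1 H by (auto simp: Q_def)
  have onQ: "\<exists>y. y \<in> O1 \<and> w = \<phi> y \<and> H w = \<psi> (f y)" if w: "w \<in> E" "w \<in> Q" for w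
  proof -
    obtain y where "y \<in> U" "w = \<phi> y" using w Q0(2) unfolding Q_def by blast
    then show ?thesis using Q1(3) H(4) w by (intro exI[of _ y]) (auto simp: Q_def)
  qed
  obtain D where D: "((\<psi> \<circ> f \<circ> inv_into U \<phi>) has_derivative D) (at (\<phi> x) within \<phi> ` (U \<inter> f -` V))" "D ` E = E'"
    using f x U V unfolding submersion_def E_def E'_def by fast
  obtain H' where H': "\<And>w. w \<in> W \<Longrightarrow> (H has_derivative H' w) (at w)" using Cinf_derivative[OF H(3,1)] by metis
  define B where "B = H' (\<phi> x)"
  have dB: "(H has_derivative B) (at (\<phi> x))" using H'[OF H(2)] by (simp add: B_def)
  have linB: "linear B" using dB by (rule has_derivative_linear)
  \<comment> \<open>\<open>D\<close> differentiates the chart expression within the model space,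
    \<open>B\<close> its ambient extension; the two can be compared only along
    \<open>E\<close>.\<close>
  have BD: "B u = D u" if u: "u \<in> E" for u
  proof (rule has_derivative_eq_along[OF _ _ E(1) Q inE[OF U(2)] xQ _ u])
    show "(H has_derivative B) (at (\<phi> x) within E \<inter> Q)" using dB by (rule has_derivative_at_withinI)
    show "((\<psi> \<circ> f \<circ> inv_into U \<phi>) has_derivative D) (at (\<phi> x) within E \<inter> Q)"
    proof (rule has_derivative_subset[OF D(1)])
      show "E \<inter> Q \<subseteq> \<phi> ` (U \<inter> f -` V)" using onQ O1(3) O1V by fastforce
    qed
    show "H w = (\<psi> \<circ> f \<circ> inv_into U \<phi>) w" if w: "w \<in> E" "w \<in> Q" for w
      using onQ[OF w] O1(3) injU by auto
  qed
  \<comment> \<open>\<open>R\<close> will be a right inverse of the differential with values in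
    \<open>E\<close>: moving the source point in its directions adjusts the image point.\<close>
  have "\<exists>g. g ` UNIV \<subseteq> E \<and> linear g \<and> (\<forall>v\<in>B ` E. B (g v) = v)"
    by (rule linear_exists_right_inverse_on[OF linB E(1)])
  moreover have "B ` E = E'" using D(2) BD by force
  ultimately obtain R where R: "\<And>v. R v \<in> E" "linear R" "\<And>v. v \<in> E' \<Longrightarrow> B (R v) = v" by (metis UNIV_I image_subset_iff)
  obtain p where p: "linear p" "\<And>v. p v \<in> E" "\<And>v. v \<in> E \<Longrightarrow> p v = v"
    using linear_projection_exists[OF E(1)] by metis
  obtain q where q: "linear q" "\<And>v. q v \<in> E'" "\<And>v. v \<in> E' \<Longrightarrow> q v = v"
    using linear_projection_exists[OF E(2)] by metis
  define r where "r z = p (fst z) + R (q (snd z))" for z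
  have linr: "linear r" unfolding r_def
    by (intro linear_compose_add linear_compose[OF linear_fst p(1), unfolded o_def] linear_compose[OF linear_compose[OF linear_snd q(1)] R(2), unfolded o_def])
  have rE: "r z \<in> E" for z unfolding r_def using p(2) R(1) E(1) by (simp add: subspace_add)
  have contr: "continuous_on UNIV r" using linr by (simp add: linear_continuous_on linear_conv_bounded_linear)
  define W2 where "W2 = r -` W"
  have W2: "open W2" unfolding W2_def using H(1) contr by (auto intro!: open_vimage)
  have rx: "r (\<phi> x, 0) = \<phi> x" by (simp add: r_def p(3) inE U(2) linear_0[OF q(1)] linear_0[OF R(2)])
  have xW2: "(\<phi> x, 0) \<in> W2" by (simp add: W2_def rx H(2))
  \<comment> \<open>On the model spaces this is \<open>(w, z) \<mapsto> (w, H (w + R z))\<close>.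
    The summand \<open>snd z - q (snd z)\<close> adds the identity on the kernel of
    \<open>q\<close>, so that the differential is injective on the whole Euclidean space.\<close>
  define \<Phi> where "\<Phi> z = (fst z, H (r z) + (snd z - q (snd z)))" for z
  have C\<Phi>: "Cinf W2 \<Phi>" unfolding \<Phi>_def
    by (intro Cinf_Pair Cinf_add Cinf_diff Cinf_linear_comp[OF q(1)] Cinf_fst Cinf_snd Cinf_id Cinf_compose[OF W2 H(1) _ H(3)] Cinf_linear[OF linr])
      (auto simp: W2_def)
  have d\<Phi>: "(\<Phi> has_derivative (\<lambda>z. (fst z, B (r z) + (snd z - q (snd z))))) (at (\<phi> x, 0))"
    unfolding \<Phi>_def
  proof (intro has_derivative_Pair has_derivative_add has_derivative_diff has_derivative_fst has_derivative_snd has_derivative_ident)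
    show "((\<lambda>z. H (r z)) has_derivative (\<lambda>z. B (r z))) (at (\<phi> x, 0))"
      by (rule has_derivative_compose[OF linear_imp_has_derivative[OF linr]]) (simp add: rx dB)
    show "((\<lambda>z. q (snd z)) has_derivative (\<lambda>z. q (snd z))) (at (\<phi> x, 0::'f))"
      using linear_imp_has_derivative[OF linear_compose[OF linear_snd q(1)]] by (simp add: o_def)
  qed
  have inj\<Phi>: "inj (\<lambda>z. (fst z, B (r z) + (snd z - q (snd z))))"
  proof (rule injI)
    fix z z' assume eq: "(fst z, B (r z) + (snd z - q (snd z))) = (fst z', B (r z') + (snd z' - q (snd z')))"
    have "B (r w) = B (p (fst w)) + q (snd w)" for w
      by (simp add: r_def linear_add[OF linB] R(3) q(2))
    with eq show "z = z'" by (auto simp: prod_eq_iff)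
  qed
  obtain U' V' g where U': "open U'" "U' \<subseteq> W2" "(\<phi> x, 0) \<in> U'" "open V'" "\<Phi> (\<phi> x, 0) \<in> V'" and hom: "homeomorphism U' V' \<Phi> g" and Cg: "Cinf V' g"
    using Cinf_inverse_function[OF C\<Phi> W2 xW2 d\<Phi> inj\<Phi>] .
  have \<Phi>x: "\<Phi> (\<phi> x, 0) = (\<phi> x, \<psi> (f x))"
    by (simp add: \<Phi>_def rx linear_0[OF q(1)] H(4)[OF O1(2) H(2)])
  have gx: "g (\<phi> x, \<psi> (f x)) = (\<phi> x, 0)" using hom U'(3) \<Phi>x unfolding homeomorphism_def by metis
  \<comment> \<open>The first two conditions make the transported point representable in the charts.
    The last two concern the source coordinate alone and ensure that \<open>y\<close> itself is
    recovered from \<open>(y, f y)\<close>.\<close>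
  define V2 where "V2 = V' \<inter> (\<lambda>z. r (g z)) -` Q \<inter> (\<lambda>z. (fst z, 0)) -` U' \<inter> fst -` Q"
  have Crg: "Cinf V' (\<lambda>z. r (g z))" by (rule Cinf_linear_comp[OF linr Cg])
  have V2: "open V2" unfolding V2_def
  proof (rule open_Int[OF open_Int])
    show "open (V' \<inter> (\<lambda>z. r (g z)) -` Q)"
      by (rule continuous_open_preimage[OF Cinf_continuous_on[OF Crg] U'(4) Q])
    show "open ((\<lambda>z. (fst z, 0::'f)) -` U' :: ('e \<times> 'f) set)"
      by (rule open_vimage[OF U'(1)]) (intro continuous_intros)
    show "open (fst -` Q :: ('e \<times> 'f) set)"
      by (rule open_vimage[OF Q]) (intro continuous_intros)
  qed
  have xV2: "(\<phi> x, \<psi> (f x)) \<in> V2" using U'(3,5) \<Phi>x gx rx xQ by (simp add: V2_def)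
  define O' where "O' = {z \<in> U \<times> V. (\<phi> (fst z), \<psi> (snd z)) \<in> V2}"
  define \<rho> where "\<rho> z = inv_into U \<phi> (r (g (\<phi> (fst z), \<psi> (snd z))))" for z
  have "(U \<times> V, map_prod \<phi> \<psi>) \<in> atlas (prod_manifold M N)" using U V by (auto simp: prod_manifold_def)
  then have m: "(U \<times> V, map_prod \<phi> \<psi>) \<in> maximal_atlas (prod_manifold M N)"
    by (rule atlas_subset_maximal[OF smooth_manifold_prod[OF M N]])
  have O'eq: "O' = {z \<in> U \<times> V. map_prod \<phi> \<psi> z \<in> V2}" by (simp add: O'_def map_prod_def case_prod_unfold)
  have oO': "openin (mtop (prod_manifold M N)) O'" unfolding O'eq by (rule is_chartD(4)[OF maximal_atlasD[OF m] V2])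
  have key: "\<rho> (y, n) \<in> U \<and> \<phi> (\<rho> (y, n)) = r (g (\<phi> y, \<psi> n)) \<and> f (\<rho> (y, n)) = n" if yn: "(y, n) \<in> O'" for y n
  proof -
    define z where "z = g (\<phi> y, \<psi> n)"
    have 1: "y \<in> U" "n \<in> V" "(\<phi> y, \<psi> n) \<in> V2" using yn by (auto simp: O'_def)
    then have 2: "\<Phi> z = (\<phi> y, \<psi> n)" "r z \<in> Q" using hom by (auto simp: z_def V2_def homeomorphism_def)
    obtain v where v: "v \<in> O1" "r z = \<phi> v" "H (r z) = \<psi> (f v)" using onQ[OF rE 2(2)] by blast
    have vU: "v \<in> U" using v(1) O1(3) by blast
    have \<rho>v: "\<rho> (y, n) = v" unfolding \<rho>_def using v(2) vU injU by (simp add: z_def[symmetric])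
    \<comment> \<open>All chart values involved lie in \<open>E'\<close>; this puts
      \<open>snd z\<close> into \<open>E'\<close>, so the auxiliary summand vanishes and only the
      equation for \<open>f\<close> remains.\<close>
    have e: "\<psi> n = \<psi> (f v) + (snd z - q (snd z))" using 2(1) v(3) by (simp add: \<Phi>_def)
    then have "snd z = q (snd z) + (\<psi> n - \<psi> (f v))" by (simp add: algebra_simps)
    moreover have "q (snd z) + (\<psi> n - \<psi> (f v)) \<in> E'"
      using q(2) inE'[OF 1(2)] inE'[OF O1V[OF v(1)]] E(2) by (simp add: subspace_add subspace_diff)
    ultimately have "snd z \<in> E'" by simp
    then have "\<psi> n = \<psi> (f v)" using e q(3) by simp
    then have "f v = n" using injV 1(2) O1V[OF v(1)] by (auto dest: inj_onD)
    then show ?thesis using \<rho>v vU v(2) by (simp add: z_def)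
  qed
  show ?thesis
  proof (rule that[OF oO', of \<rho>])
    show xO: "(x, f x) \<in> O'" using U V xV2 by (simp add: O'_def)
    show "smooth_at (prod_manifold M N) O' M \<rho> (x, f x)"
    proof (rule smooth_atI[OF m mU oO' xO])
      show "locally_smooth (O' \<inter> O') (map_prod \<phi> \<psi>) (\<lambda>y. \<phi> (\<rho> y)) (x, f x)"
      proof (rule locally_smooth_Cinf[OF V2 _ Cinf_subset[OF Crg, of V2]])
        fix z assume "z \<in> O' \<inter> O'"
        then show "\<phi> (\<rho> z) = r (g (map_prod \<phi> \<psi> z))" using key[of "fst z" "snd z"] by (cases z) simp
      qed (use xV2 in \<open>auto simp: V2_def\<close>)
      show "\<rho> ` (O' \<inter> O') \<subseteq> U" using key by auto
      show "\<rho> (x, f x) \<in> U" using key[OF xO] by blast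
    qed (auto simp: O'_def)
    show "\<rho> (y, n) \<in> points M \<and> f (\<rho> (y, n)) = n" if "(y, n) \<in> O'" for y n
      using key[OF that] is_chartD(2)[OF cU] by blast
    show "\<rho> (y, f y) = y" if yn: "(y, f y) \<in> O'" for y
    proof -
      have 1: "y \<in> U" "f y \<in> V" "(\<phi> y, 0) \<in> U'" "\<phi> y \<in> Q" using yn by (auto simp: O'_def V2_def)
      have ry: "r (\<phi> y, 0) = \<phi> y" by (simp add: r_def p(3) inE 1 linear_0[OF q(1)] linear_0[OF R(2)])
      have 2: "\<Phi> (\<phi> y, 0) = (\<phi> y, H (\<phi> y))" by (simp add: \<Phi>_def ry linear_0[OF q(1)])
      obtain y' where "y' \<in> O1" "\<phi> y = \<phi> y'" "H (\<phi> y) = \<psi> (f y')" using onQ[OF inE[OF 1(1)] 1(4)] by blast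
      moreover then have "y' = y" using injU 1(1) O1(3) by (auto dest: inj_onD)
      ultimately have "\<Phi> (\<phi> y, 0) = (\<phi> y, \<psi> (f y))" using 2 by simp
      then have "g (\<phi> y, \<psi> (f y)) = (\<phi> y, 0)" using hom 1(3) unfolding homeomorphism_def by metis
      then show ?thesis unfolding \<rho>_def using ry injU 1(1) by simp
    qed
  qed
qed

section \<open>Fibre products, local sections and a criterion for submersions\<close>

lemma smooth_at_open_preimage:
  assumes f: "\<And>y. y \<in> T \<Longrightarrow> smooth_at M T N f y" and T: "openin (mtop M) T" and O': "openin (mtop N) O'"
  shows "openin (mtop M) {y \<in> T. f y \<in> O'}"
proof -
  have c: "continuous_map (subtopology (mtop M) T) (mtop N) f" by (rule smooth_at_continuous_map[OF f])
  have "topspace (subtopology (mtop M) T) = T" using openin_subset[OF T] by auto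
  then have "openin (subtopology (mtop M) T) {y \<in> T. f y \<in> O'}" using c O' unfolding continuous_map_def by auto
  then show ?thesis using openin_open_subtopology[OF T] by blast
qed

lemma smooth_map_smooth_at:
  "smooth_manifold M \<Longrightarrow> smooth_manifold N \<Longrightarrow> smooth_map M N f \<Longrightarrow> x \<in> points M \<Longrightarrow> smooth_at M S N f x"
  using smooth_map_iff smooth_at_mono[of M "points M" N f x "S \<inter> points M"] smooth_at_local[of M S "points M" N f x]
  by (metis inf_le2 openin_topspace)

lemma smooth_map_id: "smooth_manifold M \<Longrightarrow> smooth_map M M (\<lambda>x. x)"
  by (simp add: smooth_map_iff smooth_at_id)

text \<open>The retraction sends \<open>(m, p)\<close> to \<open>(\<rho> (m, k p), p)\<close>: the
  first component is transported to the fibre over \<open>k p\<close>, which does nothing when the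
  two images already agree.\<close>

lemma embedded_fibre_product:
  fixes M :: "('a, 'e::euclidean_space) manifold" and P :: "('p, 'h::euclidean_space) manifold"
  assumes M: "smooth_manifold M" and N: "smooth_manifold N" and P: "smooth_manifold P"
    and f: "submersion M N f" and k: "smooth_map P N k"
  shows "embedded (prod_manifold M P) {(m, p). m \<in> points M \<and> p \<in> points P \<and> f m = k p}" (is "embedded _ ?S")
proof (rule embedded_retract)
  note MP = smooth_manifold_prod[OF M P] and MN = smooth_manifold_prod[OF M N]
  show "smooth_manifold (prod_manifold M P)" by (rule MP)
  show "?S \<subseteq> points (prod_manifold M P)" by auto
  fix x assume x: "x \<in> ?S"
  obtain m0 p0 where mp: "x = (m0, p0)" "m0 \<in> points M" "p0 \<in> points P" "f m0 = k p0" using x by auto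
  obtain O1 \<rho> where O1: "openin (mtop (prod_manifold M N)) O1" "(m0, f m0) \<in> O1" "smooth_at (prod_manifold M N) O1 M \<rho> (m0, f m0)"
    "\<And>y n. (y, n) \<in> O1 \<Longrightarrow> \<rho> (y, n) \<in> points M \<and> f (\<rho> (y, n)) = n" "\<And>y. (y, f y) \<in> O1 \<Longrightarrow> \<rho> (y, f y) = y"
    using submersion_transport[OF M N f mp(2)] by metis
  define q where "q z = (fst z, k (snd z))" for z :: "'a \<times> 'p"
  have kz: "smooth_at (prod_manifold M P) S N (\<lambda>z. k (snd z)) z" if "z \<in> points M \<times> points P" "z \<in> S" for z S
    by (rule smooth_at_compose[OF MP P N smooth_at_snd[OF M P that(1)] smooth_map_smooth_at[OF P N k, where S=UNIV] that(2)])
      (use that in auto)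
  have sq: "smooth_at (prod_manifold M P) S (prod_manifold M N) q z" if "z \<in> points M \<times> points P" "z \<in> S" for z S
    unfolding q_def by (rule smooth_at_Pair[OF MP M N smooth_at_fst[OF M P that(1)] kz[OF that] that(2)])
  define O' where "O' = {z \<in> points (prod_manifold M P). q z \<in> O1}"
  have O': "openin (mtop (prod_manifold M P)) O'"
    unfolding O'_def by (rule smooth_at_open_preimage[OF _ openin_topspace O1(1)]) (auto intro!: sq)
  have xO': "x \<in> O'" using mp O1(2) by (simp add: O'_def q_def)
  have xp: "x \<in> points M \<times> points P" using mp by simp
  have "smooth_at (prod_manifold M P) O' M (\<lambda>z. \<rho> (q z)) x"
    by (rule smooth_at_compose[OF MP MN M sq[OF xp xO'] _ xO', of O1]) (use O1(3) mp in \<open>auto simp: q_def O'_def\<close>)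
  then have "smooth_at (prod_manifold M P) O' (prod_manifold M P) (\<lambda>z. (\<rho> (q z), snd z)) x"
    by (rule smooth_at_Pair[OF MP M P _ smooth_at_snd[OF M P xp] xO'])
  moreover have "(\<lambda>z. (\<rho> (q z), snd z)) ` O' \<subseteq> ?S"
    using O1(4) by (force simp: O'_def q_def)
  moreover have "\<forall>y\<in>O' \<inter> ?S. (\<rho> (q y), snd y) = y"
  proof
    fix y assume y: "y \<in> O' \<inter> ?S"
    obtain a b where ab: "y = (a, b)" by (cases y)
    then have "f a = k b" "(a, k b) \<in> O1" using y by (auto simp: O'_def q_def)
    then have "\<rho> (a, k b) = a" using O1(5)[of a] by simp
    then show "(\<rho> (q y), snd y) = y" by (simp add: ab q_def)
  qed
  ultimately show "\<exists>O' r. openin (mtop (prod_manifold M P)) O' \<and> x \<in> O' \<and> smooth_at (prod_manifold M P) O' (prod_manifold M P) r x \<and>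
       r ` O' \<subseteq> ?S \<and> (\<forall>y\<in>O' \<inter> ?S. r y = y)"
    using O' xO' by blast
qed

text \<open>Transport of the fixed point \<open>x\<close> to the variable point \<open>n\<close> is
  a section through \<open>x\<close>.\<close>

lemma submersion_local_section:
  assumes M: "smooth_manifold M" and N: "smooth_manifold N" and f: "submersion M N f" and x: "x \<in> points M"
  obtains O' c where "openin (mtop N) O'" "f x \<in> O'" "smooth_at N O' M c (f x)" "c (f x) = x"
    "\<And>n. n \<in> O' \<Longrightarrow> c n \<in> points M \<and> f (c n) = n"
proof -
  obtain O1 \<rho> where O1: "openin (mtop (prod_manifold M N)) O1" "(x, f x) \<in> O1" "smooth_at (prod_manifold M N) O1 M \<rho> (x, f x)"
    "\<And>y n. (y, n) \<in> O1 \<Longrightarrow> \<rho> (y, n) \<in> points M \<and> f (\<rho> (y, n)) = n" "\<And>y. (y, f y) \<in> O1 \<Longrightarrow> \<rho> (y, f y) = y"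
    using submersion_transport[OF M N f x] by metis
  note MN = smooth_manifold_prod[OF M N]
  have fx: "f x \<in> points N" using O1(1,2) openin_subset by fastforce
  have s: "smooth_at N S (prod_manifold M N) (\<lambda>n. (x, n)) z" if "z \<in> points N" "z \<in> S" for z S
    by (rule smooth_at_Pair[OF N M N smooth_at_const[OF N that(1) M x] smooth_at_id[OF N that(1)] that(2)])
  define O' where "O' = {n \<in> points N. (x, n) \<in> O1}"
  have O': "openin (mtop N) O'"
    unfolding O'_def by (rule smooth_at_open_preimage[OF _ openin_topspace O1(1)]) (auto intro!: s)
  have fO': "f x \<in> O'" using fx O1(2) by (simp add: O'_def)
  show ?thesis
  proof (rule that[OF O' fO', of "\<lambda>n. \<rho> (x, n)"])
    show "smooth_at N O' M (\<lambda>n. \<rho> (x, n)) (f x)"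
      by (rule smooth_at_compose[OF N MN M s[OF fx fO'] O1(3) fO']) (auto simp: O'_def)
  qed (use O1 in \<open>auto simp: O'_def\<close>)
qed

text \<open>The chain rule for \<open>f (c n) = n\<close> exhibits the differential of the section
  as a right inverse of that of \<open>f\<close>. Sections are easier to carry along bijections than
  differentials in charts, so all new submersions are obtained from this criterion.\<close>

lemma submersionI:
  fixes M :: "('a, 'e::euclidean_space) manifold" and N :: "('b, 'f::euclidean_space) manifold"
  assumes M: "smooth_manifold M" and N: "smooth_manifold N" and f: "smooth_map M N f"
    and c: "\<And>x. x \<in> points M \<Longrightarrow> \<exists>O' c. openin (mtop N) O' \<and> f x \<in> O' \<and> smooth_at N O' M c (f x) \<and> c (f x) = x \<and> (\<forall>n\<in>O'. f (c n) = n)"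
  shows "submersion M N f"
  unfolding submersion_def
proof (intro conjI ballI, rule f, clarify)
  fix x U \<phi> V \<psi> assume x: "x \<in> points M" and U': "(U, \<phi>) \<in> atlas M" and V': "(V, \<psi>) \<in> atlas N" and xU: "x \<in> U" and fV: "f x \<in> V"
  note U = atlas_subset_maximal[OF M U'] and V = atlas_subset_maximal[OF N V']
  have cU: "is_chart (mtop M) U \<phi>" and cV: "is_chart (mtop N) V \<psi>" using U V maximal_atlasD by auto
  have injU: "inj_on \<phi> U" and injV: "inj_on \<psi> V" using is_chartD(3)[OF cU] is_chartD(3)[OF cV] .
  define E where "E = span (\<phi> ` U)"
  define E' where "E' = span (\<psi> ` V)"
  have E: "subspace E" "subspace E'" by (simp_all add: E_def E'_def)
  have inE: "\<phi> y \<in> E" if "y \<in> U" for y using that by (auto simp: E_def intro: span_base)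
  have inE': "\<psi> y \<in> E'" if "y \<in> V" for y using that by (auto simp: E'_def intro: span_base)
  have sfx: "smooth_at M UNIV N f x" by (rule smooth_map_smooth_at[OF M N f x])
  obtain O1 where O1: "openin (mtop M) O1" "x \<in> O1" "O1 \<subseteq> U" "f ` (UNIV \<inter> O1) \<subseteq> V" "locally_smooth (UNIV \<inter> O1) \<phi> (\<lambda>y. \<psi> (f y)) x"
    using smooth_at_charts[OF M N sfx UNIV_I U xU V fV] .
  obtain W H where H: "open W" "\<phi> x \<in> W" "Cinf W H" "\<And>y. y \<in> O1 \<Longrightarrow> \<phi> y \<in> W \<Longrightarrow> \<psi> (f y) = H (\<phi> y)"
    using O1(5) unfolding locally_smooth_def by auto
  obtain O' c where c: "openin (mtop N) O'" "f x \<in> O'" "smooth_at N O' M c (f x)" "c (f x) = x" "\<And>n. n \<in> O' \<Longrightarrow> f (c n) = n"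
    using c[OF x] by blast
  have cx: "c (f x) \<in> U" using c(4) xU by simp
  obtain O2 where O2: "openin (mtop N) O2" "f x \<in> O2" "O2 \<subseteq> V" "c ` (O' \<inter> O2) \<subseteq> U" "locally_smooth (O' \<inter> O2) \<psi> (\<lambda>y. \<phi> (c y)) (f x)"
    using smooth_at_charts[OF N M c(3,2) V fV U cx] .
  obtain W' K where K: "open W'" "\<psi> (f x) \<in> W'" "Cinf W' K" "\<And>y. y \<in> O' \<inter> O2 \<Longrightarrow> \<psi> y \<in> W' \<Longrightarrow> \<phi> (c y) = K (\<psi> y)"
    using O2(5) unfolding locally_smooth_def by blast
  obtain Q0 where Q0: "open Q0" "\<phi> ` U = E \<inter> Q0" using is_chartD(6)[OF cU] unfolding E_def by blast
  obtain Q0' where Q0': "open Q0'" "\<psi> ` V = E' \<inter> Q0'" using is_chartD(6)[OF cV] unfolding E'_def by blast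
  obtain Q1 where Q1: "open Q1" "\<phi> x \<in> Q1" "\<And>y. y \<in> U \<Longrightarrow> \<phi> y \<in> Q1 \<Longrightarrow> y \<in> O1"
    using is_chart_nbhd[OF cU O1(1,2) xU] by blast
  obtain Q1' where Q1': "open Q1'" "\<psi> (f x) \<in> Q1'" "\<And>y. y \<in> V \<Longrightarrow> \<psi> y \<in> Q1' \<Longrightarrow> y \<in> O' \<inter> O2"
    using is_chart_nbhd[OF cV _ _ fV, of "O' \<inter> O2"] c(1,2) O2(1,2) by blast
  define Q where "Q = Q0 \<inter> Q1 \<inter> W"
  have xQ0: "\<phi> x \<in> Q0" "\<psi> (f x) \<in> Q0'" using xU fV Q0(2) Q0'(2) by blast+
  have Q: "open Q" "\<phi> x \<in> Q" using Q0(1) Q1(1,2) H(1,2) xQ0 by (auto simp: Q_def)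
  \<comment> \<open>Chosen so that \<open>K\<close> carries the relevant part of \<open>E'\<close>
    into the part of \<open>E\<close> on which \<open>H\<close> represents \<open>f\<close>.\<close>
  define Q' where "Q' = Q0' \<inter> Q1' \<inter> (W' \<inter> K -` Q)"
  have Kx: "K (\<psi> (f x)) = \<phi> x" using K(4)[of "f x"] c(2,4) O2(2) K(2) by simp
  have Q': "open Q'" "\<psi> (f x) \<in> Q'"
  proof -
    show "open Q'" unfolding Q'_def
      by (rule open_Int[OF open_Int[OF Q0'(1) Q1'(1)] continuous_open_preimage[OF Cinf_continuous_on[OF K(3)] K(1) Q(1)]])
    show "\<psi> (f x) \<in> Q'" using xQ0 Q1'(2) K(2) Kx Q(2) by (simp add: Q'_def)
  qed
  have onQ: "\<exists>y. y \<in> O1 \<and> w = \<phi> y \<and> H w = \<psi> (f y)" if w: "w \<in> E" "w \<in> Q" for w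
  proof -
    obtain y where "y \<in> U" "w = \<phi> y" using w Q0(2) unfolding Q_def by blast
    then show ?thesis using Q1(3) H(4) w by (intro exI[of _ y]) (auto simp: Q_def)
  qed
  have onQ': "K w \<in> E \<and> K w \<in> Q \<and> H (K w) = w" if w: "w \<in> E'" "w \<in> Q'" for w
  proof -
    obtain n where n: "n \<in> V" "w = \<psi> n" using w Q0'(2) unfolding Q'_def by blast
    then have nO: "n \<in> O' \<inter> O2" using Q1'(3) w by (auto simp: Q'_def)
    then have 1: "c n \<in> U" "\<phi> (c n) = K w" "f (c n) = n" using O2(4) K(4) w n c(5) by (auto simp: Q'_def)
    have "K w \<in> E" "K w \<in> Q" using inE[OF 1(1)] 1(2) w by (auto simp: Q'_def)
    then obtain y where y: "y \<in> O1" "K w = \<phi> y" "H (K w) = \<psi> (f y)" using onQ by blast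
    then have "y = c n" using 1(1,2) injU O1(3) by (auto dest: inj_onD)
    then show ?thesis using y 1 n \<open>K w \<in> E\<close> \<open>K w \<in> Q\<close> by simp
  qed
  obtain H' where H': "\<And>w. w \<in> W \<Longrightarrow> (H has_derivative H' w) (at w)" using Cinf_derivative[OF H(3,1)] by metis
  obtain K' where K': "\<And>w. w \<in> W' \<Longrightarrow> (K has_derivative K' w) (at w)" using Cinf_derivative[OF K(3,1)] by metis
  define B where "B = H' (\<phi> x)"
  define C where "C = K' (\<psi> (f x))"
  have dB: "(H has_derivative B) (at (\<phi> x))" using H'[OF H(2)] by (simp add: B_def)
  have dC: "(K has_derivative C) (at (\<psi> (f x)))" using K'[OF K(2)] by (simp add: C_def)
  obtain p where p: "linear p" "\<And>v. p v \<in> E" "\<And>v. v \<in> E \<Longrightarrow> p v = v"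
    using linear_projection_exists[OF E(1)] by metis
  obtain q where q: "linear q" "\<And>v. q v \<in> E'" "\<And>v. v \<in> E' \<Longrightarrow> q v = v"
    using linear_projection_exists[OF E(2)] by metis
  \<comment> \<open>On \<open>E\<close> the values of \<open>H\<close> lie in \<open>E'\<close>, so
    composing with the projection \<open>q\<close> changes nothing there, and the differential along
    \<open>E\<close> inherits this.\<close>
  have BE: "B u \<in> E'" if u: "u \<in> E" for u
  proof -
    have "q (B u) = B u"
    proof (rule has_derivative_eq_along[OF _ _ E(1) Q(1) inE[OF xU] Q(2) _ u])
      show "(H has_derivative B) (at (\<phi> x) within E \<inter> Q)" using dB by (rule has_derivative_at_withinI)
      show "((\<lambda>w. q (H w)) has_derivative (\<lambda>u. q (B u))) (at (\<phi> x) within E \<inter> Q)"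
        by (rule has_derivative_at_withinI, rule bounded_linear.has_derivative[OF _ dB]) (use q(1) in \<open>simp add: linear_conv_bounded_linear\<close>)
      show "q (H w) = H w" if "w \<in> E" "w \<in> Q" for w
        using onQ[OF that] q(3) inE' O1(4) by auto
    qed
    then show ?thesis using q(2) by metis
  qed
  have CE: "C u \<in> E" if u: "u \<in> E'" for u
  proof -
    have "p (C u) = C u"
    proof (rule has_derivative_eq_along[OF _ _ E(2) Q'(1) inE'[OF fV] Q'(2) _ u])
      show "(K has_derivative C) (at (\<psi> (f x)) within E' \<inter> Q')" using dC by (rule has_derivative_at_withinI)
      show "((\<lambda>w. p (K w)) has_derivative (\<lambda>u. p (C u))) (at (\<psi> (f x)) within E' \<inter> Q')"
        by (rule has_derivative_at_withinI, rule bounded_linear.has_derivative[OF _ dC]) (use p(1) in \<open>simp add: linear_conv_bounded_linear\<close>)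
      show "p (K w) = K w" if "w \<in> E'" "w \<in> Q'" for w
        using onQ'[OF that] p(3) by auto
    qed
    then show ?thesis using p(2) by metis
  qed
  have BC: "B (C u) = u" if u: "u \<in> E'" for u
  proof (rule has_derivative_eq_along[OF _ _ E(2) Q'(1) inE'[OF fV] Q'(2) _ u])
    show "((\<lambda>w. H (K w)) has_derivative (\<lambda>u. B (C u))) (at (\<psi> (f x)) within E' \<inter> Q')"
      by (rule has_derivative_at_withinI, rule has_derivative_compose[OF dC]) (simp add: Kx dB)
    show "((\<lambda>w. w) has_derivative (\<lambda>u. u)) (at (\<psi> (f x)) within E' \<inter> Q')" by (rule has_derivative_ident)
    show "H (K w) = w" if "w \<in> E'" "w \<in> Q'" for w using onQ'[OF that] by blast
  qed
  have "((\<psi> \<circ> f \<circ> inv_into U \<phi>) has_derivative B) (at (\<phi> x) within \<phi> ` (U \<inter> f -` V))"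
  proof -
    obtain d where d: "d > 0" "ball (\<phi> x) d \<subseteq> Q" using Q by (meson open_contains_ball)
    show ?thesis
    proof (rule has_derivative_transform_within[OF has_derivative_at_withinI[OF dB] d(1)])
      show "\<phi> x \<in> \<phi> ` (U \<inter> f -` V)" using xU fV by blast
      fix w assume w: "w \<in> \<phi> ` (U \<inter> f -` V)" "dist w (\<phi> x) < d"
      then obtain y where y: "y \<in> U" "w = \<phi> y" by blast
      then have "w \<in> E" "w \<in> Q" using inE d(2) w(2) by (auto simp: dist_commute)
      then obtain z where "z \<in> O1" "w = \<phi> z" "H w = \<psi> (f z)" using onQ by blast
      then show "H w = (\<psi> \<circ> f \<circ> inv_into U \<phi>) w" using injU O1(3) by auto
    qed
  qed
  moreover have "B ` E = E'"
  proof
    show "B ` E \<subseteq> E'" using BE by blast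
    show "E' \<subseteq> B ` E" using BC CE by (metis image_eqI subsetI)
  qed
  ultimately show "\<exists>D. ((\<psi> \<circ> f \<circ> inv_into U \<phi>) has_derivative D) (at (\<phi> x) within \<phi> ` (U \<inter> f -` V)) \<and> D ` span (\<phi> ` U) = span (\<psi> ` V)"
    unfolding E_def E'_def by blast
qed

text \<open>Each column of the family extends to an open set of the Euclidean space of a chart.
  Reassembled, the extended columns form a smooth family of linear maps, to which
  \<open>Cinf_inv_family\<close> applies once the domain is shrunk to invertible members.\<close>

lemma smooth_at_inv_family:
  fixes A :: "'a \<Rightarrow> 'f::euclidean_space \<Rightarrow> 'f"
  assumes M: "smooth_manifold M" and x: "x \<in> S" "x \<in> points M" and lin: "\<And>y. y \<in> S \<Longrightarrow> linear (A y)" and bij: "bij (A x)"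
    and A: "\<And>v. smooth_at M S euc (\<lambda>y. A y v) x"
  obtains O' where "openin (mtop M) O'" "x \<in> O'" "\<And>y. y \<in> S \<Longrightarrow> y \<in> O' \<Longrightarrow> bij (A y)" "\<And>v. smooth_at M S euc (\<lambda>y. inv (A y) v) x"
proof -
  obtain U \<phi> where U': "(U, \<phi>) \<in> atlas M" "x \<in> U" using atlas_cover[OF M x(2)] .
  note U = atlas_subset_maximal[OF M U'(1)]
  have cU: "is_chart (mtop M) U \<phi>" using U by (rule maximal_atlasD)
  define R where "R b O1 W h \<longleftrightarrow> openin (mtop M) O1 \<and> x \<in> O1 \<and> O1 \<subseteq> U \<and> open W \<and> \<phi> x \<in> W \<and> Cinf W h \<and> (\<forall>y\<in>S \<inter> O1. \<phi> y \<in> W \<longrightarrow> A y b = h (\<phi> y))" for b O1 W h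
  have ex: "\<exists>O1 W h. R b O1 W h" for b
  proof -
    have V: "(UNIV, id) \<in> maximal_atlas (euc :: ('f, 'f) manifold)" by (rule linear_chart) simp
    obtain O1 where "openin (mtop M) O1" "x \<in> O1" "O1 \<subseteq> U" "locally_smooth (S \<inter> O1) \<phi> (\<lambda>y. id (A y b)) x"
      using smooth_at_charts[OF M smooth_manifold_euc A[of b] x(1) U U'(2) V UNIV_I] .
    moreover then obtain W h where "open W" "\<phi> x \<in> W" "Cinf W h" "\<forall>y\<in>S \<inter> O1. \<phi> y \<in> W \<longrightarrow> A y b = h (\<phi> y)"
      unfolding locally_smooth_def id_apply by blast
    ultimately show ?thesis unfolding R_def by blast
  qed
  obtain O1 W h where h: "\<And>b. openin (mtop M) (O1 b)" "\<And>b. x \<in> O1 b" "\<And>b. O1 b \<subseteq> U" "\<And>b. open (W b)" "\<And>b. \<phi> x \<in> W b" "\<And>b. Cinf (W b) (h b)"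
    "\<And>b y. y \<in> S \<Longrightarrow> y \<in> O1 b \<Longrightarrow> \<phi> y \<in> W b \<Longrightarrow> A y b = h b (\<phi> y)"
  proof -
    have "\<exists>t. \<forall>b. R b (fst (t b)) (fst (snd (t b))) (snd (snd (t b)))"
    proof (rule choice, rule allI)
      fix b
      obtain O1 W h where "R b O1 W h" using ex by blast
      then show "\<exists>t. R b (fst t) (fst (snd t)) (snd (snd t))" by (intro exI[of _ "(O1, W, h)"]) simp
    qed
    then obtain t where "\<forall>b. R b (fst (t b)) (fst (snd (t b))) (snd (snd (t b)))" by (rule exE)
    then show thesis
      by (intro that[of "\<lambda>b. fst (t b)" "\<lambda>b. fst (snd (t b))" "\<lambda>b. snd (snd (t b))"]) (auto simp: R_def)
  qed
  define O2 where "O2 = (\<Inter>b\<in>Basis. O1 b)"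
  define W2 where "W2 = (\<Inter>b\<in>Basis. W b)"
  have O2: "openin (mtop M) O2" unfolding O2_def by (rule openin_Inter) (use h(1) nonempty_Basis in auto)
  have W2: "open W2" unfolding W2_def using h(4) by (auto intro!: open_INT)
  have xO2: "x \<in> O2" "\<phi> x \<in> W2" using h(2,5) by (auto simp: O2_def W2_def)
  have O2U: "O2 \<subseteq> U" unfolding O2_def by (rule INF_lower2[OF SOME_Basis h(3)])
  define B where "B w v = (\<Sum>b\<in>Basis. (v \<bullet> b) *\<^sub>R h b w)" for w v
  have linB: "linear (B w)" for w unfolding B_def
    by (rule linearI) (simp_all add: inner_add_left sum.distrib scaleR_add_left scaleR_sum_right)
  have AB: "A y = B (\<phi> y)" if y: "y \<in> S" "y \<in> O2" "\<phi> y \<in> W2" for y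
  proof (rule ext)
    fix v
    have "A y v = (\<Sum>b\<in>Basis. (v \<bullet> b) *\<^sub>R A y b)" by (rule linear_eq_sum_Basis[OF lin[OF y(1)]])
    also have "\<dots> = B (\<phi> y) v" unfolding B_def using y h(7) by (intro sum.cong) (auto simp: O2_def W2_def)
    finally show "A y v = B (\<phi> y) v" .
  qed
  have Ch: "Cinf W2 (h b)" if "b \<in> Basis" for b using Cinf_subset[OF h(6)[of b], of W2] that by (auto simp: W2_def)
  have "inj (B (\<phi> x))" using bij AB[OF x(1) xO2] by (simp add: bij_is_inj)
  then obtain e where e: "e > 0" "\<And>v. e * norm v \<le> norm (B (\<phi> x) v)"
    using linear_inj_bounded_below_pos[OF linB] by blast
  \<comment> \<open>\<open>n w\<close> bounds the norm of \<open>B w - B (\<phi> x)\<close> as an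
    operator. While it stays below the lower bound \<open>e\<close> of \<open>B (\<phi> x)\<close>,
    the perturbed map remains injective.\<close>
  define n where "n w = (\<Sum>b\<in>Basis. norm (h b w - h b (\<phi> x)))" for w
  define W3 where "W3 = W2 \<inter> n -` {..<e}"
  have "continuous_on W2 n" unfolding n_def
    by (intro continuous_intros Cinf_continuous_on Ch)
  then have W3: "open W3" unfolding W3_def by (rule continuous_open_preimage[OF _ W2]) simp
  have xW3: "\<phi> x \<in> W3" using xO2 e(1) by (simp add: W3_def n_def)
  have bijB: "bij (B w)" if w: "w \<in> W3" for w
  proof -
    have "v = 0" if v: "B w v = 0" for v
    proof (rule ccontr)
      assume v0: "v \<noteq> 0"
      have "B w v - B (\<phi> x) v = (\<Sum>b\<in>Basis. (v \<bullet> b) *\<^sub>R (h b w - h b (\<phi> x)))"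
        by (simp add: B_def sum_subtractf scaleR_diff_right)
      then have "norm (B (\<phi> x) v) = norm (\<Sum>b\<in>Basis. (v \<bullet> b) *\<^sub>R (h b w - h b (\<phi> x)))"
        using v by (metis diff_0 norm_minus_cancel)
      then have "norm (B (\<phi> x) v) \<le> (\<Sum>b\<in>Basis. norm ((v \<bullet> b) *\<^sub>R (h b w - h b (\<phi> x))))"
        using norm_sum[of "\<lambda>b. (v \<bullet> b) *\<^sub>R (h b w - h b (\<phi> x))" Basis] by simp
      also have "\<dots> \<le> (\<Sum>b\<in>Basis. norm v * norm (h b w - h b (\<phi> x)))"
        by (intro sum_mono) (simp add: Basis_le_norm mult_right_mono)
      also have "\<dots> = norm v * n w" by (simp add: n_def sum_distrib_left)
      also have "\<dots> < norm v * e" using w v0 by (simp add: W3_def)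
      finally show False using e(2)[of v] by (simp add: mult.commute)
    qed
    then have "inj (B w)" using linear_injective_0[OF linB] by blast
    then show ?thesis using linear_injective_imp_surjective[OF linB] by (simp add: bij_def)
  qed
  have Cinv: "Cinf W3 (\<lambda>w. inv (B w) v)" for v
  proof (rule Cinf_inv_family[OF W3 linB bijB])
    show "Cinf W3 (\<lambda>w. B w v)" for v unfolding B_def
      by (intro Cinf_sum Cinf_scaleR Cinf_const Cinf_subset[OF Ch]) (auto simp: W3_def)
  qed
  define O3 where "O3 = O2 \<inter> {y \<in> U. \<phi> y \<in> W3}"
  have O3: "openin (mtop M) O3" unfolding O3_def using O2 is_chartD(4)[OF cU W3] by blast
  have xO3: "x \<in> O3" using xO2 xW3 U' by (simp add: O3_def)
  have AB3: "A y = B (\<phi> y)" if "y \<in> S" "y \<in> O3" for y using AB that by (auto simp: O3_def W3_def)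
  show ?thesis
  proof (rule that[OF O3 xO3])
    show "bij (A y)" if "y \<in> S" "y \<in> O3" for y using AB3[OF that] bijB that by (auto simp: O3_def)
    show "smooth_at M S euc (\<lambda>y. inv (A y) v) x" for v
    proof (rule smooth_atI[OF U linear_chart O3 xO3])
      show "locally_smooth (S \<inter> O3) \<phi> (\<lambda>y. id (inv (A y) v)) x"
        by (rule locally_smooth_Cinf[where \<phi>=\<phi> and x=x, OF W3 xW3 Cinv[of v]]) (use AB3 in auto)
    qed (auto simp: O3_def)
  qed
qed

section \<open>Partitions of unity\<close>

text \<open>For the extension by zero to be smooth, the set \<open>C\<close> must be closed in all
  of \<open>M\<close> and not just in the chart domain. It is the image under the inverse chart of a
  compact piece of the model space, and compact sets are closed in a Hausdorff space.\<close>

lemma smooth_bump: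
  assumes M: "smooth_manifold M" and O': "openin (mtop M) O'" and x: "x \<in> O'"
  obtains f :: "'a \<Rightarrow> real" and C O2 where "\<And>y. y \<in> points M \<Longrightarrow> smooth_at M (points M) euc f y"
    "openin (mtop M) O2" "x \<in> O2" "\<And>y. y \<in> O2 \<Longrightarrow> f y = 1"
    "closedin (mtop M) C" "C \<subseteq> O'" "\<And>y. y \<notin> C \<Longrightarrow> f y = 0"
proof -
  have xp: "x \<in> points M" using x openin_subset[OF O'] by blast
  obtain U0 \<phi> where U0: "(U0, \<phi>) \<in> atlas M" "x \<in> U0" using atlas_cover[OF M xp] .
  define U where "U = U0 \<inter> O'"
  note m0 = atlas_subset_maximal[OF M U0(1)]
  have oU: "openin (mtop M) U" unfolding U_def using is_chartD(1)[OF maximal_atlasD[OF m0]] O' by blast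
  have m: "(U, \<phi>) \<in> maximal_atlas M" by (rule maximal_atlas_restrict[OF M m0 oU]) (simp add: U_def)
  have cU: "is_chart (mtop M) U \<phi>" using m by (rule maximal_atlasD)
  have inj: "inj_on \<phi> U" by (rule is_chartD(3)[OF cU])
  have xU: "x \<in> U" using U0 x by (simp add: U_def)
  define E where "E = span (\<phi> ` U)"
  obtain Q where Q: "open Q" "\<phi> ` U = E \<inter> Q" using is_chartD(6)[OF cU] unfolding E_def by blast
  have "\<phi> x \<in> Q" using xU Q(2) by blast
  then obtain d where d: "d > 0" "cball (\<phi> x) d \<subseteq> Q" using Q(1) open_contains_cball by blast
  obtain b :: "_ \<Rightarrow> real" where b: "Cinf UNIV b" "\<And>y. dist y (\<phi> x) < d / 2 \<Longrightarrow> b y = 1" "\<And>y. dist y (\<phi> x) \<ge> 2 * (d / 2) \<Longrightarrow> b y = 0"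
    using Cinf_bump[of "d / 2" "\<phi> x"] d(1) by (metis half_gt_zero)
  define K where "K = cball (\<phi> x) d \<inter> E"
  have K: "compact K" unfolding K_def E_def by (intro compact_Int_closed compact_cball closed_subspace subspace_span)
  have KU: "K \<subseteq> \<phi> ` U" using d(2) Q(2) by (auto simp: K_def)
  define C where "C = inv_into U \<phi> ` K"
  have CU: "C \<subseteq> U" unfolding C_def using KU by (intro image_subsetI inv_into_into) blast
  have "continuous_map (subtopology (mtop euc) (\<phi> ` U)) (mtop M) (inv_into U \<phi>)"
    by (rule smooth_at_continuous_map) (rule smooth_at_chart_inv[OF M m], auto)
  moreover have "compactin (subtopology (mtop euc) (\<phi> ` U)) K"
    using K KU by (simp add: compactin_subtopology linear_manifold_def)
  ultimately have "compactin (mtop M) C" unfolding C_def by (rule image_compactin[rotated])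
  then have C: "closedin (mtop M) C" by (rule compactin_imp_closedin[rotated]) (use M in \<open>simp add: smooth_manifold_def\<close>)
  define f where "f y = (if y \<in> U then b (\<phi> y) else 0)" for y
  have f0: "f y = 0" if y: "y \<notin> C" for y
  proof (cases "y \<in> U")
    case True
    have "\<phi> y \<notin> K" using y True inj unfolding C_def by (metis image_eqI inv_into_f_f)
    moreover have "\<phi> y \<in> E" using True by (auto simp: E_def intro: span_base)
    ultimately have "dist (\<phi> y) (\<phi> x) \<ge> 2 * (d / 2)" by (simp add: K_def dist_commute)
    then show ?thesis using b(3) by (simp add: f_def)
  qed (simp add: f_def)
  define O2 where "O2 = {y \<in> U. \<phi> y \<in> ball (\<phi> x) (d / 2)}"
  show ?thesis
  proof (rule that[of f O2 C])
    fix y assume y: "y \<in> points M"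
    show "smooth_at M (points M) euc f y"
    proof (cases "y \<in> U")
      case True
      have "smooth_at M (points M \<inter> U) euc (\<lambda>y. b (\<phi> y)) y"
        by (rule smooth_at_compose_Cinf[OF M smooth_at_chart[OF M m True] _ open_UNIV UNIV_I b(1)]) (use y True in simp)
      then have "smooth_at M (points M \<inter> U) euc f y"
        by (rule smooth_at_cong) (use y True in \<open>auto simp: f_def\<close>)
      then show ?thesis by (rule smooth_at_local[OF _ oU True])
    next
      case False
      have o: "openin (mtop M) (points M - C)" using C by (simp add: closedin_def)
      have yC: "y \<in> points M - C" using y False CU by blast
      have "smooth_at M (points M \<inter> (points M - C)) euc (\<lambda>y. 0::real) y"
        by (rule smooth_at_const[OF M y smooth_manifold_euc]) simp
      then have "smooth_at M (points M \<inter> (points M - C)) euc f y"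
        by (rule smooth_at_cong) (use f0 yC in auto)
      then show ?thesis by (rule smooth_at_local[OF _ o yC])
    qed
  next
    show "openin (mtop M) O2" unfolding O2_def by (rule is_chartD(4)[OF cU open_ball])
    show "x \<in> O2" using xU d(1) by (simp add: O2_def)
    show "f y = 1" if "y \<in> O2" for y using that b(2) by (simp add: O2_def f_def dist_commute)
    show "closedin (mtop M) C" by (rule C)
    show "C \<subseteq> O'" using CU by (auto simp: U_def)
    show "f y = 0" if "y \<notin> C" for y using f0[OF that] .
  qed
qed

text \<open>With bumps \<open>f n\<close> whose sets \<open>{f n = 1}\<close> cover \<open>M\<close>, the functions \<open>f n \<Prod>i<n. (1 - f i)\<close> form a
  partition of unity; local finiteness is automatic, since near a point some factor \<open>1 - f i\<close> vanishes.\<close>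

lemma smooth_partition:
  assumes M: "smooth_manifold M" and ne: "points M \<noteq> {}"
    and cover: "\<And>x. x \<in> points M \<Longrightarrow> \<exists>O'. openin (mtop M) O' \<and> x \<in> O' \<and> P O'"
  obtains f :: "nat \<Rightarrow> 'a \<Rightarrow> real" and C V where
    "\<And>n y. y \<in> points M \<Longrightarrow> smooth_at M (points M) euc (f n) y"
    "\<And>n. openin (mtop M) (V n)" "\<And>n. P (V n)" "\<And>n. closedin (mtop M) (C n)" "\<And>n. C n \<subseteq> V n"
    "\<And>n y. y \<notin> C n \<Longrightarrow> f n y = 0"
    "\<And>x. x \<in> points M \<Longrightarrow> \<exists>O' N. openin (mtop M) O' \<and> x \<in> O' \<and> (\<forall>y\<in>O'. (\<forall>n\<ge>N. f n y = 0) \<and> (\<Sum>i<N. f i y) = 1)"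
proof -
  define R where "R x g O2 C V \<longleftrightarrow> (\<forall>y\<in>points M. smooth_at M (points M) euc (g :: 'a \<Rightarrow> real) y) \<and> openin (mtop M) O2 \<and> x \<in> O2 \<and> (\<forall>y\<in>O2. g y = 1) \<and>
      openin (mtop M) V \<and> P V \<and> closedin (mtop M) C \<and> C \<subseteq> V \<and> (\<forall>y. y \<notin> C \<longrightarrow> g y = 0)" for x g O2 C V
  have ex: "\<exists>t. R x (fst t) (fst (snd t)) (fst (snd (snd t))) (snd (snd (snd t)))" if x: "x \<in> points M" for x
  proof -
    obtain V where V: "openin (mtop M) V" "x \<in> V" "P V" using cover[OF x] by blast
    obtain g :: "'a \<Rightarrow> real" and C O2 where "\<And>y. y \<in> points M \<Longrightarrow> smooth_at M (points M) euc g y"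
      "openin (mtop M) O2" "x \<in> O2" "\<And>y. y \<in> O2 \<Longrightarrow> g y = 1"
      "closedin (mtop M) C" "C \<subseteq> V" "\<And>y. y \<notin> C \<Longrightarrow> g y = 0"
      using smooth_bump[OF M V(1,2)] by metis
    then have "R x g O2 C V" unfolding R_def using V by blast
    then show ?thesis by (intro exI[of _ "(g, O2, C, V)"]) simp
  qed
  have "\<forall>x\<in>points M. \<exists>t. R x (fst t) (fst (snd t)) (fst (snd (snd t))) (snd (snd (snd t)))" using ex by blast
  then obtain t where t: "\<forall>x\<in>points M. R x (fst (t x)) (fst (snd (t x))) (fst (snd (snd (t x)))) (snd (snd (snd (t x))))"
    by (rule bchoice[THEN exE])
  define W where "W x = fst (snd (t x))" for x
  have W: "openin (mtop M) (W x)" "x \<in> W x" if "x \<in> points M" for x using t that by (auto simp: R_def W_def)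
  \<comment> \<open>Countably many of the sets where a bump equals one still cover; they are
    enumerated by the naturals, with repetitions allowed, which requires a nonempty index
    set.\<close>
  have "Lindelof_space (mtop M)" using M by (simp add: smooth_manifold_def second_countable_imp_Lindelof_space)
  moreover have "\<Union> (W ` points M) = points M"
  proof
    show "\<Union> (W ` points M) \<subseteq> points M" using openin_subset[OF W(1)] by blast
    show "points M \<subseteq> \<Union> (W ` points M)" using W(2) by blast
  qed
  ultimately obtain \<V> where "countable \<V>" "\<V> \<subseteq> W ` points M" "\<Union>\<V> = points M"
    unfolding Lindelof_space_def using W(1) by (metis (no_types, lifting) imageE)
  then obtain X where X: "countable X" "X \<subseteq> points M" "\<Union> (W ` X) = points M"
    by (metis countable_subset_image)
  have Xne: "X \<noteq> {}" using X(3) ne by (metis Union_empty image_empty)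
  define s where "s = from_nat_into X"
  have s: "range s = X" unfolding s_def using range_from_nat_into[OF Xne X(1)] .
  have sM: "s n \<in> points M" for n using s X(2) by blast
  define g where "g n = fst (t (s n))" for n
  define V where "V n = snd (snd (snd (t (s n))))" for n
  define C where "C n = fst (snd (snd (t (s n))))" for n
  have Rn: "R (s n) (g n) (W (s n)) (C n) (V n)" for n using t sM[of n] by (simp add: g_def V_def C_def W_def)
  have g: "\<And>y. y \<in> points M \<Longrightarrow> smooth_at M (points M) euc (g n) y" "\<And>y. y \<in> W (s n) \<Longrightarrow> g n y = 1" "\<And>y. y \<notin> C n \<Longrightarrow> g n y = 0" for n
    using Rn[of n] unfolding R_def by blast+
  define p where "p n y = (\<Prod>i<n. (1 - g i y))" for n y
  define f where "f n y = g n y * p n y" for n y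
  have sp: "smooth_at M (points M) euc (p n) y" if y: "y \<in> points M" for n y
  proof (induction n)
    case 0
    have "p 0 = (\<lambda>y. 1)" by (rule ext) (simp add: p_def)
    then show ?case using smooth_at_const[OF M y smooth_manifold_euc, of "1::real"] by simp
  next
    case (Suc n)
    have "smooth_at M (points M) euc (\<lambda>y. 1 + (- 1) *\<^sub>R g n y) y"
      by (intro smooth_at_add[OF M] smooth_at_scaleR[OF M] smooth_at_const[OF M y smooth_manifold_euc] g(1) y) simp_all
    then have "smooth_at M (points M) euc (\<lambda>y. p n y *\<^sub>R (1 + (- 1) *\<^sub>R g n y)) y"
      by (rule smooth_at_scaleR[OF M Suc _ y])
    then show ?case by (rule smooth_at_cong) (use y in \<open>auto simp: p_def\<close>)
  qed
  \<comment> \<open>The sum telescopes, since \<open>f i\<close> is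
    \<open>p i - p (Suc i)\<close>.\<close>
  have sums: "(\<Sum>i<n. f i y) = 1 - p n y" for n y
    by (induction n) (auto simp: f_def p_def algebra_simps)
  show ?thesis
  proof (rule that[of f V C])
    fix n
    show "smooth_at M (points M) euc (f n) y" if y: "y \<in> points M" for y
      using smooth_at_scaleR[OF M g(1)[OF y] sp[OF y] y, of n n] by (rule smooth_at_cong) (use y in \<open>auto simp: f_def\<close>)
    show "f n y = 0" if "y \<notin> C n" for y using g(3)[OF that] by (simp add: f_def)
    show "openin (mtop M) (V n)" "P (V n)" "closedin (mtop M) (C n)" "C n \<subseteq> V n" using Rn[of n] unfolding R_def by blast+
  next
    fix x assume x: "x \<in> points M"
    then obtain z where z: "z \<in> X" "x \<in> W z" using X(3) by blast
    then obtain n where n: "z = s n" using s by blast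
    have p0: "p m y = 0" if "y \<in> W (s n)" "m \<ge> Suc n" for y m
    proof -
      have "1 - g n y = 0" using g(2)[OF that(1)] by simp
      moreover have "n \<in> {..<m}" using that(2) by simp
      ultimately show ?thesis unfolding p_def by (meson finite_lessThan prod_zero)
    qed
    show "\<exists>O' N. openin (mtop M) O' \<and> x \<in> O' \<and> (\<forall>y\<in>O'. (\<forall>n\<ge>N. f n y = 0) \<and> (\<Sum>i<N. f i y) = 1)"
    proof (intro exI conjI ballI allI impI)
      show "openin (mtop M) (W (s n))" using W(1)[OF sM] .
      show "x \<in> W (s n)" using z n by simp
      fix y assume y: "y \<in> W (s n)"
      show "f m y = 0" if "m \<ge> Suc n" for m using p0[OF y that] by (simp add: f_def)
      show "(\<Sum>i<Suc n. f i y) = 1" unfolding sums using p0[OF y, of "Suc n"] by simp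
    qed
  qed
qed

lemma smooth_at_nbhd:
  assumes M: "smooth_manifold M" and N: "smooth_manifold N" and f: "smooth_at M S N f x" and x: "x \<in> S"
    and O': "openin (mtop N) O'" "f x \<in> O'"
  obtains O1 where "openin (mtop M) O1" "x \<in> O1" "f ` (S \<inter> O1) \<subseteq> O'"
proof -
  obtain U \<phi> where U: "(U, \<phi>) \<in> maximal_atlas M" "x \<in> U" by (rule smooth_atE[OF f]) blast
  obtain V \<psi> where V: "(V, \<psi>) \<in> maximal_atlas N" "f x \<in> V" by (rule smooth_atE[OF f]) blast
  have "openin (mtop N) (V \<inter> O')" using O'(1) is_chartD(1)[OF maximal_atlasD[OF V(1)]] by blast
  then have V': "(V \<inter> O', \<psi>) \<in> maximal_atlas N" by (rule maximal_atlas_restrict[OF N V(1)]) simp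
  have fV: "f x \<in> V \<inter> O'" using V O' by blast
  obtain O1 where "openin (mtop M) O1" "x \<in> O1" "O1 \<subseteq> U" "f ` (S \<inter> O1) \<subseteq> V \<inter> O'" "locally_smooth (S \<inter> O1) \<phi> (\<lambda>y. \<psi> (f y)) x"
    using smooth_at_charts[OF M N f x U V' fV] .
  then show ?thesis using that by blast
qed

lemma smooth_map_into_submanifoldI:
  assumes M: "smooth_manifold M" and N: "smooth_manifold N" and S: "embedded N S"
    and f: "\<And>x. x \<in> points M \<Longrightarrow> smooth_at M (points M) N f x" "\<And>x. x \<in> points M \<Longrightarrow> f x \<in> S"
  shows "smooth_map M (submanifold N S) f"
  unfolding smooth_map_iff[OF M smooth_manifold_submanifold[OF N S]]
  using smooth_at_into_submanifold[OF M N S, of _ "points M" f] f by blast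

section \<open>Vector bundles\<close>

text \<open>A trivialization as in \<open>vector_bundle\<close>, unpacked: the inverse \<theta> is
  named, and smoothness is pointwise, relative to subsets of the total space and of the product of
  the base with a Euclidean space. In this form it composes directly with other pointwise smooth
  maps.\<close>

definition vb_triv :: "('a, 'e::euclidean_space, 'b, 'f::euclidean_space) vbundle \<Rightarrow> 'b set \<Rightarrow> 'e set \<Rightarrow> ('a \<Rightarrow> 'e) \<Rightarrow> ('b \<times> 'e \<Rightarrow> 'a) \<Rightarrow> bool" where
  "vb_triv E U L \<tau> \<theta> \<longleftrightarrow> openin (mtop (base E)) U \<and> subspace L \<and>
    (\<forall>e\<in>points (total E). proj E e \<in> U \<longrightarrow>
       smooth_at (total E) {e \<in> points (total E). proj E e \<in> U} euc \<tau> e \<and> \<tau> e \<in> L \<and> \<theta> (proj E e, \<tau> e) = e) \<and>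
    (\<forall>b\<in>U. \<forall>l\<in>L. \<theta> (b, l) \<in> points (total E) \<and> proj E (\<theta> (b, l)) = b \<and> \<tau> (\<theta> (b, l)) = l \<and>
       smooth_at (prod_manifold (base E) euc) (U \<times> L) (total E) \<theta> (b, l)) \<and>
    (\<forall>c\<in>U. (\<forall>e\<in>fibre E c. \<forall>e'\<in>fibre E c. \<tau> (vadd E e e') = \<tau> e + \<tau> e') \<and>
                (\<forall>r. \<forall>e\<in>fibre E c. \<tau> (vscale E r e) = r *\<^sub>R \<tau> e))"

lemma vb_trivD:
  assumes "vb_triv E U L \<tau> \<theta>"
  shows "openin (mtop (base E)) U" "subspace L"
    "e \<in> points (total E) \<Longrightarrow> proj E e \<in> U \<Longrightarrow> smooth_at (total E) {e \<in> points (total E). proj E e \<in> U} euc \<tau> e"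
    "e \<in> points (total E) \<Longrightarrow> proj E e \<in> U \<Longrightarrow> \<tau> e \<in> L"
    "e \<in> points (total E) \<Longrightarrow> proj E e \<in> U \<Longrightarrow> \<theta> (proj E e, \<tau> e) = e"
    "b \<in> U \<Longrightarrow> l \<in> L \<Longrightarrow> \<theta> (b, l) \<in> points (total E)"
    "b \<in> U \<Longrightarrow> l \<in> L \<Longrightarrow> proj E (\<theta> (b, l)) = b"
    "b \<in> U \<Longrightarrow> l \<in> L \<Longrightarrow> \<tau> (\<theta> (b, l)) = l"
    "b \<in> U \<Longrightarrow> l \<in> L \<Longrightarrow> smooth_at (prod_manifold (base E) euc) (U \<times> L) (total E) \<theta> (b, l)"
    "e \<in> points (total E) \<Longrightarrow> e' \<in> points (total E) \<Longrightarrow> proj E e \<in> U \<Longrightarrow> proj E e = proj E e' \<Longrightarrow> \<tau> (vadd E e e') = \<tau> e + \<tau> e'"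
    "e \<in> points (total E) \<Longrightarrow> proj E e \<in> U \<Longrightarrow> \<tau> (vscale E r e) = r *\<^sub>R \<tau> e"
  using assms unfolding vb_triv_def fibre_def by auto

lemma vector_bundleD:
  assumes "vector_bundle E"
  shows "smooth_manifold (total E)" "smooth_manifold (base E)" "smooth_map (total E) (base E) (proj E)"
    "b \<in> points (base E) \<Longrightarrow> real_vector_space_on (fibre E b) (vadd E) (vscale E)"
  using assms unfolding vector_bundle_def by auto

lemma vector_bundle_proj:
  assumes "vector_bundle E" "e \<in> points (total E)"
  shows "proj E e \<in> points (base E)" "smooth_at (total E) S (base E) (proj E) e"
proof -
  show "smooth_at (total E) S (base E) (proj E) e"
    by (rule smooth_map_smooth_at[OF vector_bundleD(1,2,3)[OF assms(1)] assms(2)])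
  then show "proj E e \<in> points (base E)" by (rule smooth_at_points[THEN conjunct2])
qed

text \<open>The diffeomorphism of the definition lives on an open submanifold and a linear manifold.
  Maps out of and into these are smooth exactly when they are smooth for the surrounding manifolds,
  so both layers can be stripped; \<open>vector_bundleI\<close> restores them.\<close>

lemma vector_bundle_triv:
  fixes E :: "('a, 'e::euclidean_space, 'b, 'f::euclidean_space) vbundle"
  assumes E: "vector_bundle E" and b: "b \<in> points (base E)"
  obtains U L \<tau> \<theta> where "b \<in> U" "vb_triv E U L \<tau> \<theta>"
proof -
  note T = vector_bundleD(1)[OF E] and B = vector_bundleD(2)[OF E]
  obtain U and L :: "'e set" and \<tau> where U: "openin (mtop (base E)) U" "b \<in> U" "subspace L"
    "diffeomorphism (submanifold (total E) {e \<in> points (total E). proj E e \<in> U})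
          (prod_manifold (submanifold (base E) U) (linear_manifold L)) (\<lambda>e. (proj E e, \<tau> e))"
    "\<forall>c\<in>U. (\<forall>e\<in>fibre E c. \<forall>e'\<in>fibre E c. \<tau> (vadd E e e') = \<tau> e + \<tau> e') \<and>
                (\<forall>r. \<forall>e\<in>fibre E c. \<tau> (vscale E r e) = r *\<^sub>R \<tau> e)"
    using bspec[OF E[unfolded vector_bundle_def, THEN conjunct2, THEN conjunct2, THEN conjunct2, THEN conjunct2] b]
    by blast
  define D where "D = {e \<in> points (total E). proj E e \<in> U}"
  have oD: "openin (mtop (total E)) D"
    unfolding D_def by (rule smooth_at_open_preimage[OF vector_bundle_proj(2)[OF E] openin_topspace U(1)])
  note eD = embedded_open[OF T oD] and eU = embedded_open[OF B U(1)]
  note TD = smooth_manifold_submanifold[OF T eD] and BU = smooth_manifold_submanifold[OF B eU] and LL = smooth_manifold_linear[OF U(3)]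
  note pr = smooth_manifold_prod[OF BU LL] and pe = smooth_manifold_prod[OF B smooth_manifold_euc]
  note pD = embedded_points[OF eD] and pU = embedded_points[OF eU]
  obtain \<theta> where th: "smooth_map (submanifold (total E) D) (prod_manifold (submanifold (base E) U) (linear_manifold L)) (\<lambda>e. (proj E e, \<tau> e))"
    "smooth_map (prod_manifold (submanifold (base E) U) (linear_manifold L)) (submanifold (total E) D) \<theta>"
    "\<And>e. e \<in> D \<Longrightarrow> \<theta> (proj E e, \<tau> e) = e" "\<And>c l. c \<in> U \<Longrightarrow> l \<in> L \<Longrightarrow> (proj E (\<theta> (c, l)), \<tau> (\<theta> (c, l))) = (c, l)"
    using U(4) unfolding diffeomorphism_def D_def[symmetric] by (auto simp: pD pU)
  have UB: "U \<subseteq> points (base E)" using openin_subset[OF U(1)] .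
  have thD: "\<theta> (c, l) \<in> D" if "c \<in> U" "l \<in> L" for c l
    using smooth_at_points[OF smooth_map_smooth_at[OF pr TD th(2), of "(c, l)"]] that by (simp add: pD pU)
  have st: "smooth_at (total E) D euc \<tau> e" and tL: "\<tau> e \<in> L" if e: "e \<in> D" for e
  proof -
    have 1: "smooth_at (submanifold (total E) D) D (prod_manifold (submanifold (base E) U) (linear_manifold L)) (\<lambda>e. (proj E e, \<tau> e)) e"
      by (rule smooth_map_smooth_at[OF TD pr th(1)]) (simp add: pD e)
    then have 2: "(proj E e, \<tau> e) \<in> U \<times> L" using smooth_at_points by (fastforce simp: pU)
    then show "\<tau> e \<in> L" by simp
    have "smooth_at (submanifold (total E) D) D (linear_manifold L) (\<lambda>e. snd (proj E e, \<tau> e)) e"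
      by (rule smooth_at_compose[OF TD pr LL 1 smooth_at_snd[OF BU LL] e, of UNIV]) (use 2 in \<open>simp_all add: pU\<close>)
    then have "smooth_at (submanifold (total E) D) D euc \<tau> e" using smooth_at_linear_euc(1)[OF TD U(3) e] by simp
    then show "smooth_at (total E) D euc \<tau> e" by (rule smooth_at_from_submanifold[OF T smooth_manifold_euc eD order_refl e, THEN iffD1])
  qed
  have sth: "smooth_at (prod_manifold (base E) euc) (U \<times> L) (total E) \<theta> (c, l)" if c: "c \<in> U" "l \<in> L" for c l
  proof -
    have cl: "(c, l) \<in> U \<times> L" "(c, l) \<in> points (base E) \<times> points euc" using c UB by auto
    have "smooth_at (prod_manifold (submanifold (base E) U) (linear_manifold L)) (U \<times> L) (submanifold (total E) D) \<theta> (c, l)"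
      by (rule smooth_map_smooth_at[OF pr TD th(2)]) (simp add: pU c)
    then have 1: "smooth_at (prod_manifold (submanifold (base E) U) (linear_manifold L)) (U \<times> L) (total E) \<theta> (c, l)"
      using smooth_at_into_submanifold[OF pr T eD cl(1), of \<theta>] thD by auto
    have 2: "smooth_at (prod_manifold (base E) euc) (U \<times> L) (submanifold (base E) U) fst (c, l)"
      using smooth_at_into_submanifold[OF pe B eU cl(1), of fst] smooth_at_fst[OF B smooth_manifold_euc cl(2), of "U \<times> L"] by auto
    have 3: "smooth_at (prod_manifold (base E) euc) (U \<times> L) (linear_manifold L) snd (c, l)"
      by (rule smooth_at_linear_euc(2)[OF pe U(3) cl(1) smooth_at_snd[OF B smooth_manifold_euc cl(2)]]) auto
    have "smooth_at (prod_manifold (base E) euc) (U \<times> L) (total E) (\<lambda>z. \<theta> (fst z, snd z)) (c, l)"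
      by (rule smooth_at_compose[OF pe pr T smooth_at_Pair[OF pe BU LL 2 3 cl(1)] _ cl(1)]) (use 1 in auto)
    then show ?thesis by simp
  qed
  have "vb_triv E U L \<tau> \<theta>"
    unfolding vb_triv_def D_def[symmetric]
  proof (intro conjI)
    show "\<forall>e\<in>points (total E). proj E e \<in> U \<longrightarrow> smooth_at (total E) D euc \<tau> e \<and> \<tau> e \<in> L \<and> \<theta> (proj E e, \<tau> e) = e"
      using st tL th(3) by (auto simp: D_def)
    show "\<forall>b\<in>U. \<forall>l\<in>L. \<theta> (b, l) \<in> points (total E) \<and> proj E (\<theta> (b, l)) = b \<and> \<tau> (\<theta> (b, l)) = l \<and> smooth_at (prod_manifold (base E) euc) (U \<times> L) (total E) \<theta> (b, l)"
      using sth th(4) thD by (auto simp: D_def)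
  qed (use U in auto)
  then show ?thesis using that U(2) by blast
qed

lemma vector_bundleI:
  fixes E :: "('a, 'e::euclidean_space, 'b, 'f::euclidean_space) vbundle"
  assumes T: "smooth_manifold (total E)" and B: "smooth_manifold (base E)" and p: "smooth_map (total E) (base E) (proj E)"
    and vs: "\<And>b. b \<in> points (base E) \<Longrightarrow> real_vector_space_on (fibre E b) (vadd E) (vscale E)"
    and tr: "\<And>b. b \<in> points (base E) \<Longrightarrow> \<exists>U L \<tau> \<theta>. b \<in> U \<and> vb_triv E U L \<tau> \<theta>"
  shows "vector_bundle E"
proof -
  have "\<exists>U (L :: 'e set) \<tau>. openin (mtop (base E)) U \<and> b \<in> U \<and> subspace L \<and>
        diffeomorphism (submanifold (total E) {e \<in> points (total E). proj E e \<in> U})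
          (prod_manifold (submanifold (base E) U) (linear_manifold L)) (\<lambda>e. (proj E e, \<tau> e)) \<and>
        (\<forall>c\<in>U. (\<forall>e\<in>fibre E c. \<forall>e'\<in>fibre E c. \<tau> (vadd E e e') = \<tau> e + \<tau> e') \<and>
                (\<forall>r. \<forall>e\<in>fibre E c. \<tau> (vscale E r e) = r *\<^sub>R \<tau> e))"
    if b: "b \<in> points (base E)" for b
  proof -
    obtain U L \<tau> \<theta> where bU: "b \<in> U" and t: "vb_triv E U L \<tau> \<theta>" using tr[OF b] by blast
    note d = vb_trivD[OF t]
    define D where "D = {e \<in> points (total E). proj E e \<in> U}"
    have sp: "smooth_at (total E) S (base E) (proj E) e" if "e \<in> points (total E)" for S e
      using smooth_map_smooth_at[OF T B p that] .
    have oD: "openin (mtop (total E)) D"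
      unfolding D_def by (rule smooth_at_open_preimage[OF sp openin_topspace d(1)])
    have UB: "U \<subseteq> points (base E)" using openin_subset[OF d(1)] .
    note eD = embedded_open[OF T oD] and eU = embedded_open[OF B d(1)]
    note TD = smooth_manifold_submanifold[OF T eD] and BU = smooth_manifold_submanifold[OF B eU] and LL = smooth_manifold_linear[OF d(2)]
    note pr = smooth_manifold_prod[OF BU LL] and pe = smooth_manifold_prod[OF B smooth_manifold_euc]
    note pD = embedded_points[OF eD] and pU = embedded_points[OF eU]
    have "smooth_map (submanifold (total E) D) (prod_manifold (submanifold (base E) U) (linear_manifold L)) (\<lambda>e. (proj E e, \<tau> e))"
    proof (rule smooth_map_submanifoldI[OF T pr])
      fix e assume e: "e \<in> D"
      then have e': "e \<in> points (total E)" "proj E e \<in> U" by (auto simp: D_def)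
      show "smooth_at (total E) D (prod_manifold (submanifold (base E) U) (linear_manifold L)) (\<lambda>e. (proj E e, \<tau> e)) e"
      proof (rule smooth_at_Pair[OF T BU LL _ _ e])
        show "smooth_at (total E) D (submanifold (base E) U) (proj E) e"
          using smooth_at_into_submanifold[OF T B eU e, of "proj E"] sp[OF e'(1)] by (auto simp: D_def)
        show "smooth_at (total E) D (linear_manifold L) \<tau> e"
          by (rule smooth_at_linear_euc(2)[OF T d(2) e]) (use d(3)[OF e'] d(4) in \<open>auto simp: D_def\<close>)
      qed
    qed
    moreover have "smooth_map (prod_manifold (submanifold (base E) U) (linear_manifold L)) (submanifold (total E) D) \<theta>"
    proof (rule smooth_map_into_submanifoldI[OF pr T eD])
      fix z assume "z \<in> points (prod_manifold (submanifold (base E) U) (linear_manifold L))"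
      then obtain c l where z: "z = (c, l)" "c \<in> U" "l \<in> L" by (auto simp: pU)
      have zUL: "z \<in> points (submanifold (base E) U) \<times> points (linear_manifold L)" "z \<in> U \<times> L" using z by (auto simp: pU)
      show "\<theta> z \<in> D" using d(6,7) z by (auto simp: D_def)
      have 1: "smooth_at (prod_manifold (submanifold (base E) U) (linear_manifold L)) (U \<times> L) (base E) fst z"
        using smooth_at_into_submanifold[OF pr B eU zUL(2), of fst] smooth_at_fst[OF BU LL zUL(1), of "U \<times> L"] by auto
      have 2: "smooth_at (prod_manifold (submanifold (base E) U) (linear_manifold L)) (U \<times> L) euc snd z"
        by (rule smooth_at_linear_euc(1)[OF pr d(2) zUL(2) smooth_at_snd[OF BU LL zUL(1)]])
      have "smooth_at (prod_manifold (submanifold (base E) U) (linear_manifold L)) (U \<times> L) (total E) (\<lambda>z. \<theta> (fst z, snd z)) z"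
        by (rule smooth_at_compose[OF pr pe T smooth_at_Pair[OF pr B smooth_manifold_euc 1 2 zUL(2)] _ zUL(2)]) (use d(9) z in auto)
      then show "smooth_at (prod_manifold (submanifold (base E) U) (linear_manifold L)) (points (prod_manifold (submanifold (base E) U) (linear_manifold L))) (total E) \<theta> z"
        by (simp add: pU)
    qed
    ultimately have "diffeomorphism (submanifold (total E) D) (prod_manifold (submanifold (base E) U) (linear_manifold L)) (\<lambda>e. (proj E e, \<tau> e))"
      unfolding diffeomorphism_def pD using d(5,7,8) by (intro conjI exI[of _ \<theta>]) (auto simp: pU, auto simp: D_def)
    then show ?thesis unfolding D_def using bU d(1,2) t[unfolded vb_triv_def] by blast
  qed
  then show ?thesis unfolding vector_bundle_def using T B p vs by blast
qed

section \<open>Smooth fibrewise operations\<close>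

lemma smooth_at_vb_coord:
  assumes E: "vector_bundle E" and t: "vb_triv E U L \<tau> \<theta>" and M: "smooth_manifold M"
    and f: "smooth_at M S (total E) f x" and x: "x \<in> S" and fU: "\<And>y. y \<in> S \<Longrightarrow> f y \<in> points (total E) \<and> proj E (f y) \<in> U"
  shows "smooth_at M S euc (\<lambda>y. \<tau> (f y)) x"
  by (rule smooth_at_compose[OF M vector_bundleD(1)[OF E] smooth_manifold_euc f vb_trivD(3)[OF t] x]) (use fU x in auto)

lemma smooth_at_vb_point:
  assumes E: "vector_bundle E" and t: "vb_triv E U L \<tau> \<theta>" and M: "smooth_manifold M"
    and b: "smooth_at M S (base E) b x" and l: "smooth_at M S euc l x" and x: "x \<in> S" and bU: "\<And>y. y \<in> S \<Longrightarrow> b y \<in> U \<and> l y \<in> L"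
  shows "smooth_at M S (total E) (\<lambda>y. \<theta> (b y, l y)) x"
  by (rule smooth_at_compose[OF M smooth_manifold_prod[OF vector_bundleD(2)[OF E] smooth_manifold_euc] vector_bundleD(1)[OF E]
        smooth_at_Pair[OF M vector_bundleD(2)[OF E] smooth_manifold_euc b l x] vb_trivD(9)[OF t] x])
    (use bU x in auto)

lemma vb_closed:
  assumes E: "vector_bundle E" and e: "e \<in> points (total E)"
  shows "vscale E r e \<in> points (total E)" "proj E (vscale E r e) = proj E e"
    "e' \<in> points (total E) \<Longrightarrow> proj E e' = proj E e \<Longrightarrow> vadd E e e' \<in> points (total E)"
    "e' \<in> points (total E) \<Longrightarrow> proj E e' = proj E e \<Longrightarrow> proj E (vadd E e e') = proj E e"
  using vector_bundleD(4)[OF E vector_bundle_proj(1)[OF E e]] e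
  unfolding real_vector_space_on_def fibre_def by auto

lemma vb_fibre_coord:
  fixes E :: "('a, 'e::euclidean_space, 'b, 'f::euclidean_space) vbundle"
  assumes E: "vector_bundle E" and b: "b \<in> points (base E)"
  obtains \<tau> :: "'a \<Rightarrow> 'e" where "inj_on \<tau> (fibre E b)" "\<And>e e'. e \<in> fibre E b \<Longrightarrow> e' \<in> fibre E b \<Longrightarrow> \<tau> (vadd E e e') = \<tau> e + \<tau> e'"
    "\<And>r e. e \<in> fibre E b \<Longrightarrow> \<tau> (vscale E r e) = r *\<^sub>R \<tau> e"
proof -
  obtain U L \<tau> \<theta> where bU: "b \<in> U" and t: "vb_triv E U L \<tau> \<theta>" using vector_bundle_triv[OF E b] .
  show ?thesis
  proof (rule that[of \<tau>])
    show "inj_on \<tau> (fibre E b)"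
      by (rule inj_on_inverseI[of _ "\<lambda>l. \<theta> (b, l)"]) (use vb_trivD(5)[OF t] bU in \<open>auto simp: fibre_def\<close>)
  qed (use vb_trivD(10,11)[OF t] bU in \<open>auto simp: fibre_def\<close>)
qed

text \<open>In a trivialization this is an ordinary linear combination of coordinates. Addition and
  scaling are treated together because this is the shape of the partial sums of cleavages and of the
  corrected sections below.\<close>

lemma smooth_at_vb_lin:
  assumes E: "vector_bundle E" and M: "smooth_manifold M"
    and f: "smooth_at M S (total E) f x" and g: "smooth_at M S (total E) g x" and c: "smooth_at M S euc c x"
    and x: "x \<in> S" and eq: "\<And>y. y \<in> S \<Longrightarrow> f y \<in> points (total E) \<and> g y \<in> points (total E) \<and> proj E (f y) = proj E (g y)"
  shows "smooth_at M S (total E) (\<lambda>y. vadd E (f y) (vscale E (c y) (g y))) x"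
proof -
  note T = vector_bundleD(1)[OF E] and B = vector_bundleD(2)[OF E]
  have fx: "f x \<in> points (total E)" using eq[OF x] by blast
  obtain U L \<tau> \<theta> where bU: "proj E (f x) \<in> U" and t: "vb_triv E U L \<tau> \<theta>"
    using vector_bundle_triv[OF E vector_bundle_proj(1)[OF E fx]] .
  have pf: "smooth_at M S (base E) (\<lambda>y. proj E (f y)) x"
    by (rule smooth_at_compose[OF M T B f vector_bundle_proj(2)[OF E fx] x order_refl])
  obtain O1 where O1: "openin (mtop M) O1" "x \<in> O1" "(\<lambda>y. proj E (f y)) ` (S \<inter> O1) \<subseteq> U"
    using smooth_at_nbhd[OF M B pf x vb_trivD(1)[OF t] bU] .
  let ?S = "S \<inter> O1"
  have xS: "x \<in> ?S" using x O1 by blast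
  have sub: "?S \<subseteq> S" by blast
  have in1: "f y \<in> points (total E) \<and> proj E (f y) \<in> U" if "y \<in> ?S" for y using eq O1(3) that by blast
  have in2: "g y \<in> points (total E) \<and> proj E (g y) \<in> U" if "y \<in> ?S" for y using eq[of y] O1(3) that by auto
  have 1: "smooth_at M ?S euc (\<lambda>y. \<tau> (f y)) x" by (rule smooth_at_vb_coord[OF E t M smooth_at_mono[OF f sub] xS in1])
  have 2: "smooth_at M ?S euc (\<lambda>y. \<tau> (g y)) x" by (rule smooth_at_vb_coord[OF E t M smooth_at_mono[OF g sub] xS in2])
  have 3: "smooth_at M ?S euc (\<lambda>y. \<tau> (f y) + c y *\<^sub>R \<tau> (g y)) x"
    by (rule smooth_at_add[OF M 1 smooth_at_scaleR[OF M smooth_at_mono[OF c sub] 2 xS] xS])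
  have cl: "vadd E (f y) (vscale E (c y) (g y)) \<in> points (total E)" "proj E (vadd E (f y) (vscale E (c y) (g y))) = proj E (f y)"
      "\<tau> (vadd E (f y) (vscale E (c y) (g y))) = \<tau> (f y) + c y *\<^sub>R \<tau> (g y)" if "y \<in> ?S" for y
    using that eq[of y] in1[OF that] in2[OF that] vb_closed[OF E] vb_trivD(10,11)[OF t] by auto
  have "smooth_at M ?S (total E) (\<lambda>y. \<theta> (proj E (f y), \<tau> (f y) + c y *\<^sub>R \<tau> (g y))) x"
  proof (rule smooth_at_vb_point[OF E t M smooth_at_mono[OF pf sub] 3 xS])
    fix y assume y: "y \<in> ?S"
    show "proj E (f y) \<in> U \<and> \<tau> (f y) + c y *\<^sub>R \<tau> (g y) \<in> L"
      using vb_trivD(4)[OF t cl(1)[OF y]] cl(2,3)[OF y] in1[OF y] by auto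
  qed
  then have "smooth_at M ?S (total E) (\<lambda>y. vadd E (f y) (vscale E (c y) (g y))) x"
  proof (rule smooth_at_cong[OF _ _ xS])
    fix y assume y: "y \<in> ?S"
    show "\<theta> (proj E (f y), \<tau> (f y) + c y *\<^sub>R \<tau> (g y)) = vadd E (f y) (vscale E (c y) (g y))"
      using vb_trivD(5)[OF t cl(1)[OF y]] cl(2,3)[OF y] in1[OF y] by auto
  qed
  then show ?thesis by (rule smooth_at_local[OF _ O1(1,2)])
qed

text \<open>The choice is harmless: the fibres of a vector bundle are nonempty, and \<open>0 e\<close> does not depend on \<open>e\<close>.\<close>

definition vzero :: "('a, 'e, 'b, 'f) vbundle \<Rightarrow> 'b \<Rightarrow> 'a" where
  "vzero E b = vscale E 0 (SOME e. e \<in> fibre E b)"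

lemma vzero:
  fixes E :: "('a, 'e::euclidean_space, 'b, 'f::euclidean_space) vbundle"
  assumes E: "vector_bundle E" and b: "b \<in> points (base E)"
  shows "vzero E b \<in> points (total E)" "proj E (vzero E b) = b"
    "e \<in> points (total E) \<Longrightarrow> proj E e = b \<Longrightarrow> vscale E 0 e = vzero E b"
proof -
  have "\<exists>e. e \<in> fibre E b" using vector_bundleD(4)[OF E b] unfolding real_vector_space_on_def
    by (elim conjE bexE) (rule exI)
  then have e0: "(SOME e. e \<in> fibre E b) \<in> fibre E b" by (rule someI_ex)
  then have e1: "(SOME e. e \<in> fibre E b) \<in> points (total E)" "proj E (SOME e. e \<in> fibre E b) = b" by (auto simp: fibre_def)
  show "vzero E b \<in> points (total E)" "proj E (vzero E b) = b"
    unfolding vzero_def using vb_closed[OF E e1(1)] e1(2) by auto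
  assume e: "e \<in> points (total E)" "proj E e = b"
  obtain \<tau> :: "'a \<Rightarrow> 'e" where \<tau>: "inj_on \<tau> (fibre E b)" "\<And>e e'. e \<in> fibre E b \<Longrightarrow> e' \<in> fibre E b \<Longrightarrow> \<tau> (vadd E e e') = \<tau> e + \<tau> e'"
    "\<And>r e. e \<in> fibre E b \<Longrightarrow> \<tau> (vscale E r e) = r *\<^sub>R \<tau> e" using vb_fibre_coord[OF E b] by blast
  have "e \<in> fibre E b" using e by (simp add: fibre_def)
  then have "\<tau> (vscale E 0 e) = \<tau> (vzero E b)" unfolding vzero_def using \<tau>(3) e0 by simp
  then show "vscale E 0 e = vzero E b"
    by (rule inj_onD[OF \<tau>(1)]) (use e vb_closed[OF E e(1)] \<open>vzero E b \<in> points (total E)\<close> \<open>proj E (vzero E b) = b\<close> in \<open>auto simp: fibre_def\<close>)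
qed

lemma vzero_triv:
  assumes E: "vector_bundle E" and t: "vb_triv E U L \<tau> \<theta>" and b: "b \<in> U"
  shows "\<tau> (vzero E b) = 0" "vzero E b = \<theta> (b, 0)"
proof -
  have bB: "b \<in> points (base E)" using b openin_subset[OF vb_trivD(1)[OF t]] by blast
  note z = vzero(1,2)[OF E bB]
  have "vscale E 0 (vzero E b) = vzero E b" by (rule vzero(3)[OF E bB z])
  then have "\<tau> (vzero E b) = 0 *\<^sub>R \<tau> (vzero E b)" using vb_trivD(11)[OF t z(1), of 0] z b by simp
  then show 0: "\<tau> (vzero E b) = 0" by simp
  show "vzero E b = \<theta> (b, 0)" using vb_trivD(5)[OF t z(1)] z b 0 by simp
qed

text \<open>In a trivialization the zero section has constant fibre coordinate 0.\<close>

lemma smooth_at_vzero: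
  assumes E: "vector_bundle E" and M: "smooth_manifold M" and b: "smooth_at M S (base E) b x" and x: "x \<in> S"
  shows "smooth_at M S (total E) (\<lambda>y. vzero E (b y)) x"
proof -
  note T = vector_bundleD(1)[OF E] and B = vector_bundleD(2)[OF E]
  have bx: "b x \<in> points (base E)" "x \<in> points M" using smooth_at_points[OF b] by auto
  obtain U L \<tau> \<theta> where bU: "b x \<in> U" and t: "vb_triv E U L \<tau> \<theta>" using vector_bundle_triv[OF E bx(1)] .
  obtain O1 where O1: "openin (mtop M) O1" "x \<in> O1" "b ` (S \<inter> O1) \<subseteq> U"
    using smooth_at_nbhd[OF M B b x vb_trivD(1)[OF t] bU] .
  have xS: "x \<in> S \<inter> O1" using x O1 by blast
  have 0: "0 \<in> L" using vb_trivD(2)[OF t] by (simp add: subspace_0)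
  have "smooth_at M (S \<inter> O1) (total E) (\<lambda>y. \<theta> (b y, 0)) x"
    by (rule smooth_at_vb_point[OF E t M smooth_at_mono[OF b] smooth_at_const[OF M bx(2) smooth_manifold_euc] xS]) (use O1(3) 0 in auto)
  then have "smooth_at M (S \<inter> O1) (total E) (\<lambda>y. vzero E (b y)) x"
    by (rule smooth_at_cong[OF _ _ xS]) (use vzero_triv(2)[OF E t] O1(3) in auto)
  then show ?thesis by (rule smooth_at_local[OF _ O1(1,2)])
qed

lemma smooth_at_linear_family:
  assumes M: "smooth_manifold M" and x: "x \<in> S" "x \<in> points M" and lin: "\<And>y. y \<in> S \<Longrightarrow> linear (A y)"
    and A: "\<And>b. smooth_at M S euc (\<lambda>y. A y b) x" and f: "smooth_at M S euc f x"
  shows "smooth_at M S euc (\<lambda>y. A y (f y)) x"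
proof (rule smooth_at_cong[OF _ _ x(1)])
  show "smooth_at M S euc (\<lambda>y. \<Sum>b\<in>Basis. (f y \<bullet> b) *\<^sub>R A y b) x"
  proof (rule smooth_at_sum[OF M x], rule smooth_at_scaleR[OF M _ A x(1)])
    show "smooth_at M S euc (\<lambda>y. f y \<bullet> b) x" for b
      by (rule smooth_at_compose_Cinf[OF M f x(1) open_UNIV UNIV_I Cinf_inner_const[OF Cinf_id]])
  qed
  show "(\<Sum>b\<in>Basis. (f y \<bullet> b) *\<^sub>R A y b) = A y (f y)" if "y \<in> S" for y
    using linear_eq_sum_Basis[OF lin[OF that], of "f y"] by simp
qed

lemma smooth_at_euc_differentiable:
  fixes k :: "'e::euclidean_space \<Rightarrow> 'f::euclidean_space"
  assumes k: "smooth_at euc S euc k x" and S: "open S" "x \<in> S"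
  shows "\<exists>k'. (k has_derivative k') (at x)"
proof -
  obtain O1 where O1: "openin (mtop (euc :: ('e, 'e) manifold)) O1" "x \<in> O1" "locally_smooth (S \<inter> O1) id (\<lambda>y. id (k y)) x"
    using smooth_at_charts[OF smooth_manifold_euc smooth_manifold_euc k S(2) linear_chart[OF subspace_UNIV] UNIV_I linear_chart[OF subspace_UNIV] UNIV_I] .
  then obtain W h where h: "open W" "x \<in> W" "Cinf W h" "\<And>y. y \<in> S \<inter> O1 \<Longrightarrow> y \<in> W \<Longrightarrow> k y = h y"
    unfolding locally_smooth_def by auto
  obtain h' where "\<And>y. y \<in> W \<Longrightarrow> (h has_derivative h' y) (at y)" using Cinf_derivative[OF h(3,1)] by metis
  then have d: "(h has_derivative h' x) (at x)" using h(2) by blast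
  have o: "open (S \<inter> O1 \<inter> W)" using O1(1) S h(1) by (auto simp: linear_manifold_def)
  have "(k has_derivative h' x) (at x)"
    by (rule has_derivative_transform_within_open[OF d o]) (use S O1 h in auto)
  then show ?thesis by blast
qed

section \<open>Linear algebra in the fibres\<close>

lemma vb_triv_inv_linear:
  assumes E: "vector_bundle E" and t: "vb_triv E U L \<tau> \<theta>" and b: "b \<in> U" and l: "l \<in> L"
  shows "l' \<in> L \<Longrightarrow> \<theta> (b, l + l') = vadd E (\<theta> (b, l)) (\<theta> (b, l'))"
    "\<theta> (b, r *\<^sub>R l) = vscale E r (\<theta> (b, l))"
proof -
  note d = vb_trivD[OF t]
  note a = d(6,7,8)[OF b l]
  show "\<theta> (b, r *\<^sub>R l) = vscale E r (\<theta> (b, l))"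
    using d(5)[OF vb_closed(1)[OF E a(1)], of r] vb_closed(2)[OF E a(1)] a b d(11)[OF a(1)] by simp
  assume "l' \<in> L"
  note a' = d(6,7,8)[OF b this]
  show "\<theta> (b, l + l') = vadd E (\<theta> (b, l)) (\<theta> (b, l'))"
    using d(5)[OF vb_closed(3)[OF E a(1) a'(1)]] vb_closed(4)[OF E a(1) a'(1)] a a' b d(10)[OF a(1) a'(1)] by simp
qed

text \<open>A fibre has its vector space structure only as bare operations on a set. Testing an
  equation under an arbitrary additive and homogeneous function moves it to a Euclidean space, where
  it can be simplified; this suffices because trivializations are injective on fibres.\<close>

lemma vb_eqI:
  fixes E :: "('a, 'e::euclidean_space, 'b, 'f::euclidean_space) vbundle"
  assumes E: "vector_bundle E" and e: "e \<in> points (total E)" "e' \<in> points (total E)" "proj E e' = proj E e"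
    and eq: "\<And>\<tau> :: 'a \<Rightarrow> 'e. (\<And>a b. a \<in> points (total E) \<Longrightarrow> b \<in> points (total E) \<Longrightarrow> proj E a = proj E e \<Longrightarrow> proj E b = proj E e \<Longrightarrow> \<tau> (vadd E a b) = \<tau> a + \<tau> b) \<Longrightarrow>
      (\<And>r a. a \<in> points (total E) \<Longrightarrow> proj E a = proj E e \<Longrightarrow> \<tau> (vscale E r a) = r *\<^sub>R \<tau> a) \<Longrightarrow> \<tau> e = \<tau> e'"
  shows "e = e'"
proof -
  obtain \<tau> :: "'a \<Rightarrow> 'e" where \<tau>: "inj_on \<tau> (fibre E (proj E e))" "\<And>a b. a \<in> fibre E (proj E e) \<Longrightarrow> b \<in> fibre E (proj E e) \<Longrightarrow> \<tau> (vadd E a b) = \<tau> a + \<tau> b"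
    "\<And>r a. a \<in> fibre E (proj E e) \<Longrightarrow> \<tau> (vscale E r a) = r *\<^sub>R \<tau> a"
    using vb_fibre_coord[OF E vector_bundle_proj(1)[OF E e(1)]] by blast
  have "\<tau> e = \<tau> e'" by (rule eq) (use \<tau>(2,3) in \<open>auto simp: fibre_def\<close>)
  then show ?thesis by (rule inj_onD[OF \<tau>(1)]) (use e in \<open>auto simp: fibre_def\<close>)
qed

lemma vb_algebra:
  assumes E: "vector_bundle E" and a: "a \<in> points (total E)"
  shows "vadd E (vscale E r a) (vscale E q a) = vscale E (r + q) a"
    "vscale E 1 a = a"
    "b \<in> points (total E) \<Longrightarrow> proj E b = proj E a \<Longrightarrow> vadd E a (vscale E 0 b) = a"
    "b \<in> points (total E) \<Longrightarrow> proj E b = proj E a \<Longrightarrow> vadd E (vscale E r a) (vscale E q (vscale E r b)) = vscale E r (vadd E a (vscale E q b))"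
    "b \<in> points (total E) \<Longrightarrow> proj E b = proj E a \<Longrightarrow> c \<in> points (total E) \<Longrightarrow> proj E c = proj E a \<Longrightarrow> d \<in> points (total E) \<Longrightarrow> proj E d = proj E a \<Longrightarrow>
      vadd E (vadd E a b) (vscale E r (vadd E c d)) = vadd E (vadd E a (vscale E r c)) (vadd E b (vscale E r d))"
  by (rule vb_eqI[OF E], simp_all add: vb_closed[OF E] a algebra_simps)+

lemma vb_mapD:
  assumes "vb_map E F f f'" and e: "e \<in> points (total E)"
  shows "proj F (f e) = f' (proj E e)"
    "proj E e \<in> points (base E) \<Longrightarrow> e' \<in> points (total E) \<Longrightarrow> proj E e' = proj E e \<Longrightarrow> f (vadd E e e') = vadd F (f e) (f e')"
    "f (vscale E r e) = vscale F r (f e)"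
  using assms unfolding vb_map_def fibre_def by auto

lemma vb_mapI:
  assumes "smooth_map (total E) (total F) f" "smooth_map (base E) (base F) f'"
    "\<And>e. e \<in> points (total E) \<Longrightarrow> proj F (f e) = f' (proj E e)"
    "\<And>e e'. e \<in> points (total E) \<Longrightarrow> e' \<in> points (total E) \<Longrightarrow> proj E e' = proj E e \<Longrightarrow> f (vadd E e e') = vadd F (f e) (f e')"
    "\<And>r e. e \<in> points (total E) \<Longrightarrow> f (vscale E r e) = vscale F r (f e)"
  shows "vb_map E F f f'"
  using assms unfolding vb_map_def fibre_def by simp

lemma real_vector_space_on_transfer:
  assumes V: "real_vector_space_on S add smul"
    and \<Psi>: "\<And>a. a \<in> S' \<Longrightarrow> \<Psi> a \<in> S \<and> J (\<Psi> a) = a" and J: "\<And>s. s \<in> S \<Longrightarrow> J s \<in> S' \<and> \<Psi> (J s) = s"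
    and op: "\<And>a b. a \<in> S' \<Longrightarrow> b \<in> S' \<Longrightarrow> add' a b = J (add (\<Psi> a) (\<Psi> b))" "\<And>r a. a \<in> S' \<Longrightarrow> smul' r a = J (smul r (\<Psi> a))"
  shows "real_vector_space_on S' add' smul'"
proof -
  note V' = V[unfolded real_vector_space_on_def]
  note r = V'[THEN conjunct2, THEN conjunct2]
  note cl = V'[THEN conjunct1] V'[THEN conjunct2, THEN conjunct1]
  obtain z where z: "z \<in> S" "\<And>x. x \<in> S \<Longrightarrow> add z x = x" "\<And>x. x \<in> S \<Longrightarrow> \<exists>y\<in>S. add x y = z"
    using V'[THEN conjunct2, THEN conjunct2, THEN conjunct2, THEN conjunct2, THEN conjunct1] by (elim bexE conjE) blast
  have "\<exists>y\<in>S'. add' x y = J z" if x: "x \<in> S'" for x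
  proof -
    obtain y where "y \<in> S" "add (\<Psi> x) y = z" using z(3) \<Psi>[OF x] by blast
    then show ?thesis using J op(1)[OF x] by (intro bexI[of _ "J y"]) auto
  qed
  then have "\<exists>z\<in>S'. (\<forall>x\<in>S'. add' z x = x) \<and> (\<forall>x\<in>S'. \<exists>y\<in>S'. add' x y = z)"
    using z \<Psi> J op(1) by (intro bexI[of _ "J z"]) auto
  moreover have "\<forall>x\<in>S'. \<forall>y\<in>S'. add' x y \<in> S'" "\<forall>c. \<forall>x\<in>S'. smul' c x \<in> S'" using \<Psi> J op cl by auto
  moreover have "\<forall>x\<in>S'. \<forall>y\<in>S'. \<forall>z\<in>S'. add' (add' x y) z = add' x (add' y z)"
    using \<Psi> J op(1) cl(1) r[THEN conjunct1] by simp
  moreover have "\<forall>x\<in>S'. \<forall>y\<in>S'. add' x y = add' y x"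
    using \<Psi> op(1) r[THEN conjunct2, THEN conjunct1] by metis
  moreover have "\<forall>c. \<forall>x\<in>S'. \<forall>y\<in>S'. smul' c (add' x y) = add' (smul' c x) (smul' c y)"
      "\<forall>c d. \<forall>x\<in>S'. smul' (c + d) x = add' (smul' c x) (smul' d x)"
      "\<forall>c d. \<forall>x\<in>S'. smul' c (smul' d x) = smul' (c * d) x" "\<forall>x\<in>S'. smul' 1 x = x"
    using \<Psi> J op cl r[THEN conjunct2, THEN conjunct2, THEN conjunct2] by simp_all
  ultimately show ?thesis unfolding real_vector_space_on_def by (intro conjI)
qed

section \<open>Groupoids\<close>

locale algebraic_gpd =
  fixes H :: "('o, 'e::euclidean_space, 'a, 'f::euclidean_space) groupoid"
  assumes alg: "algebraic_groupoid H"
begin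

lemma st_closed: "g \<in> points (Arr H) \<Longrightarrow> src H g \<in> points (Obj H)" "g \<in> points (Arr H) \<Longrightarrow> tgt H g \<in> points (Obj H)"
  using alg unfolding algebraic_groupoid_def by blast+

lemma unit_closed: "x \<in> points (Obj H) \<Longrightarrow> unit H x \<in> points (Arr H)"
    "x \<in> points (Obj H) \<Longrightarrow> src H (unit H x) = x" "x \<in> points (Obj H) \<Longrightarrow> tgt H (unit H x) = x"
  using alg unfolding algebraic_groupoid_def by blast+

lemma mult_closed:
  assumes "g \<in> points (Arr H)" "h \<in> points (Arr H)" "src H g = tgt H h"
  shows "mult H g h \<in> points (Arr H)" "src H (mult H g h) = src H h" "tgt H (mult H g h) = tgt H g"
  using alg assms unfolding algebraic_groupoid_def by blast+

lemma assoc: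
  assumes "g \<in> points (Arr H)" "h \<in> points (Arr H)" "k \<in> points (Arr H)" "src H g = tgt H h" "src H h = tgt H k"
  shows "mult H (mult H g h) k = mult H g (mult H h k)"
  using alg assms unfolding algebraic_groupoid_def by blast

lemma unit_laws:
  assumes "g \<in> points (Arr H)"
  shows "mult H g (unit H (src H g)) = g" "mult H (unit H (tgt H g)) g = g"
  using alg assms unfolding algebraic_groupoid_def by blast+

text \<open>\<open>c = c (a b) = (c a) b = b\<close>. Uniqueness is what gives the description in
  \<open>ginv\<close> its meaning.\<close>

lemma left_inverse_unique:
  assumes a: "a \<in> points (Arr H)" "is_inverse H a b" and c: "c \<in> points (Arr H)" "src H c = tgt H a" "tgt H c = src H a" "mult H c a = unit H (src H a)"
  shows "c = b"
proof -
  have b: "b \<in> points (Arr H)" "src H b = tgt H a" "tgt H b = src H a" "mult H a b = unit H (tgt H a)"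
    using a(2) unfolding is_inverse_def by auto
  have "c = mult H c (mult H a b)" using unit_laws(1)[OF c(1)] c(2) b(4) by simp
  also have "\<dots> = mult H (mult H c a) b" using assoc[OF c(1) a(1) b(1)] c b by simp
  also have "\<dots> = b" using unit_laws(2)[OF b(1)] b(3) c(4) by simp
  finally show ?thesis .
qed

lemma ginv_is_inverse: "a \<in> points (Arr H) \<Longrightarrow> is_inverse H a (ginv H a)"
proof -
  assume a: "a \<in> points (Arr H)"
  then obtain b where b: "is_inverse H a b" using alg unfolding algebraic_groupoid_def by blast
  have "c = b" if "is_inverse H a c" for c
    using left_inverse_unique[OF a b, of c] that unfolding is_inverse_def by blast
  then show ?thesis unfolding ginv_def using theI[of "is_inverse H a" b] b by blast
qed

lemma ginv:
  assumes "a \<in> points (Arr H)"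
  shows "ginv H a \<in> points (Arr H)" "src H (ginv H a) = tgt H a" "tgt H (ginv H a) = src H a"
    "mult H (ginv H a) a = unit H (src H a)" "mult H a (ginv H a) = unit H (tgt H a)"
  using ginv_is_inverse[OF assms] unfolding is_inverse_def by auto

lemma ginv_eqI:
  assumes "a \<in> points (Arr H)" "c \<in> points (Arr H)" "src H c = tgt H a" "tgt H c = src H a" "mult H c a = unit H (src H a)"
  shows "ginv H a = c"
  using left_inverse_unique[OF assms(1) ginv_is_inverse[OF assms(1)] assms(2-5)] by simp

lemma ginv_unit: "x \<in> points (Obj H) \<Longrightarrow> ginv H (unit H x) = unit H x"
  using unit_closed[of x] unit_laws(1)[of "unit H x"] by (intro ginv_eqI) auto

lemma cancel:
  assumes "a \<in> points (Arr H)" "b \<in> points (Arr H)"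
  shows "src H a = tgt H b \<Longrightarrow> mult H (ginv H a) (mult H a b) = b"
    "tgt H a = tgt H b \<Longrightarrow> mult H a (mult H (ginv H a) b) = b"
    "src H b = tgt H a \<Longrightarrow> mult H (mult H b a) (ginv H a) = b"
    "src H b = src H a \<Longrightarrow> mult H (mult H b (ginv H a)) a = b"
proof -
  note i = ginv[OF assms(1)]
  show "src H a = tgt H b \<Longrightarrow> mult H (ginv H a) (mult H a b) = b"
    using assoc[OF i(1) assms] i unit_laws(2)[OF assms(2)] by simp
  show "tgt H a = tgt H b \<Longrightarrow> mult H a (mult H (ginv H a) b) = b"
    using assoc[OF assms(1) i(1) assms(2)] i unit_laws(2)[OF assms(2)] by simp
  show "src H b = tgt H a \<Longrightarrow> mult H (mult H b a) (ginv H a) = b"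
    using assoc[OF assms(2,1) i(1)] i unit_laws(1)[OF assms(2)] by simp
  show "src H b = src H a \<Longrightarrow> mult H (mult H b (ginv H a)) a = b"
    using assoc[OF assms(2) i(1) assms(1)] i unit_laws(1)[OF assms(2)] by simp
qed

lemma ginv_ginv: "a \<in> points (Arr H) \<Longrightarrow> ginv H (ginv H a) = a"
  using ginv[of a] by (intro ginv_eqI) auto

lemma ginv_mult:
  assumes a: "a \<in> points (Arr H)" and b: "b \<in> points (Arr H)" and ab: "src H a = tgt H b"
  shows "ginv H (mult H a b) = mult H (ginv H b) (ginv H a)"
proof (rule ginv_eqI)
  note i = ginv[OF a] and j = ginv[OF b] and m = mult_closed[OF a b ab]
  note ji = mult_closed[OF j(1) i(1)]
  show "mult H a b \<in> points (Arr H)" "mult H (ginv H b) (ginv H a) \<in> points (Arr H)"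
    "src H (mult H (ginv H b) (ginv H a)) = tgt H (mult H a b)" "tgt H (mult H (ginv H b) (ginv H a)) = src H (mult H a b)"
    using m ji i j ab by simp_all
  have "mult H (mult H (ginv H b) (ginv H a)) (mult H a b) = mult H (ginv H b) (mult H (ginv H a) (mult H a b))"
    by (rule assoc) (use m i j ab in simp_all)
  also have "\<dots> = unit H (src H b)" using cancel(1)[OF a b ab] j by simp
  finally show "mult H (mult H (ginv H b) (ginv H a)) (mult H a b) = unit H (src H (mult H a b))" using m by simp
qed

lemma unit_left: "a \<in> points (Arr H) \<Longrightarrow> tgt H a = x \<Longrightarrow> mult H (unit H x) a = a"
  using unit_laws(2) by blast

lemma unit_right: "a \<in> points (Arr H) \<Longrightarrow> src H a = x \<Longrightarrow> mult H a (unit H x) = a"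
  using unit_laws(1) by blast

text \<open>As rewrite rules these bring words in a groupoid to reduced, right-associated form.\<close>

lemmas word_simps = st_closed mult_closed ginv assoc cancel(1,2) unit_left unit_right ginv_mult ginv_ginv ginv_unit unit_closed

end

section \<open>Lie groupoids and smooth composition\<close>

locale lie_gpd =
  fixes H :: "('o, 'e::euclidean_space, 'a, 'f::euclidean_space) groupoid"
  assumes lie: "lie_groupoid H"
begin

sublocale algebraic_gpd H
  using lie by unfold_locales (simp add: lie_groupoid_def)

lemma mfd: "smooth_manifold (Obj H)" "smooth_manifold (Arr H)"
  using lie by (auto simp: lie_groupoid_def)

lemma smooth_maps: "smooth_map (Arr H) (Obj H) (src H)" "smooth_map (Arr H) (Obj H) (tgt H)"
    "smooth_map (Obj H) (Arr H) (unit H)" "smooth_map (Arr H) (Arr H) (ginv H)"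
  using lie by (auto simp: lie_groupoid_def submersion_def)

lemma smooth_src: "v \<in> points (Arr H) \<Longrightarrow> smooth_at (Arr H) S (Obj H) (src H) v"
  by (rule smooth_map_smooth_at[OF mfd(2,1) smooth_maps(1)])

lemma smooth_tgt: "v \<in> points (Arr H) \<Longrightarrow> smooth_at (Arr H) S (Obj H) (tgt H) v"
  by (rule smooth_map_smooth_at[OF mfd(2,1) smooth_maps(2)])

lemma smooth_unit: "v \<in> points (Obj H) \<Longrightarrow> smooth_at (Obj H) S (Arr H) (unit H) v"
  by (rule smooth_map_smooth_at[OF mfd smooth_maps(3)])

lemma smooth_ginv: "v \<in> points (Arr H) \<Longrightarrow> smooth_at (Arr H) S (Arr H) (ginv H) v"
  by (rule smooth_map_smooth_at[OF mfd(2,2) smooth_maps(4)])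

lemma smooth_at_src:
  assumes "smooth_manifold M" "smooth_at M S (Arr H) f x" "x \<in> S"
  shows "smooth_at M S (Obj H) (\<lambda>y. src H (f y)) x"
  by (rule smooth_at_compose[OF assms(1) mfd(2,1) assms(2) smooth_src assms(3) order_refl])
    (rule smooth_at_points[OF assms(2), THEN conjunct2])

lemma smooth_at_tgt:
  assumes "smooth_manifold M" "smooth_at M S (Arr H) f x" "x \<in> S"
  shows "smooth_at M S (Obj H) (\<lambda>y. tgt H (f y)) x"
  by (rule smooth_at_compose[OF assms(1) mfd(2,1) assms(2) smooth_tgt assms(3) order_refl])
    (rule smooth_at_points[OF assms(2), THEN conjunct2])

lemma smooth_at_unit:
  assumes "smooth_manifold M" "smooth_at M S (Obj H) f x" "x \<in> S"
  shows "smooth_at M S (Arr H) (\<lambda>y. unit H (f y)) x"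
  by (rule smooth_at_compose[OF assms(1) mfd assms(2) smooth_unit assms(3) order_refl])
    (rule smooth_at_points[OF assms(2), THEN conjunct2])

lemma smooth_at_ginv:
  assumes "smooth_manifold M" "smooth_at M S (Arr H) f x" "x \<in> S"
  shows "smooth_at M S (Arr H) (\<lambda>y. ginv H (f y)) x"
  by (rule smooth_at_compose[OF assms(1) mfd(2,2) assms(2) smooth_ginv assms(3) order_refl])
    (rule smooth_at_points[OF assms(2), THEN conjunct2])

definition cset :: "('a \<times> 'a) set" where
  "cset = {(g, h). g \<in> points (Arr H) \<and> h \<in> points (Arr H) \<and> src H g = tgt H h}"

lemma composable_pairs_eq: "composable_pairs H = submanifold (prod_manifold (Arr H) (Arr H)) cset"
  by (simp add: composable_pairs_def cset_def)

text \<open>The composable pairs are the fibre product of the source, a submersion, with the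
  target.\<close>

lemma embedded_cset: "embedded (prod_manifold (Arr H) (Arr H)) cset"
  unfolding cset_def
  by (rule embedded_fibre_product[OF mfd(2,1,2)]) (use lie in \<open>auto simp: lie_groupoid_def submersion_def\<close>)

lemma composable_manifold: "smooth_manifold (composable_pairs H)" "points (composable_pairs H) = cset"
  unfolding composable_pairs_eq
  using smooth_manifold_submanifold[OF smooth_manifold_prod[OF mfd(2,2)] embedded_cset] embedded_points[OF embedded_cset] by auto

lemma smooth_at_mult:
  assumes M: "smooth_manifold M" and f: "smooth_at M S (Arr H) f x" and g: "smooth_at M S (Arr H) g x" and x: "x \<in> S"
    and c: "\<And>y. y \<in> S \<Longrightarrow> f y \<in> points (Arr H) \<and> g y \<in> points (Arr H) \<and> src H (f y) = tgt H (g y)"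
  shows "smooth_at M S (Arr H) (\<lambda>y. mult H (f y) (g y)) x"
proof -
  note PA = smooth_manifold_prod[OF mfd(2,2)]
  have sm: "smooth_map (composable_pairs H) (Arr H) (\<lambda>(g, h). mult H g h)" using lie by (simp add: lie_groupoid_def)
  have cx: "(f x, g x) \<in> cset" using c[OF x] by (simp add: cset_def)
  have "smooth_at (submanifold (prod_manifold (Arr H) (Arr H)) cset) cset (Arr H) (\<lambda>(g, h). mult H g h) (f x, g x)"
    unfolding composable_pairs_eq[symmetric]
    by (rule smooth_map_smooth_at[OF composable_manifold(1) mfd(2) sm]) (simp add: composable_manifold(2) cx)
  then have "smooth_at (prod_manifold (Arr H) (Arr H)) cset (Arr H) (\<lambda>(g, h). mult H g h) (f x, g x)"
    by (rule smooth_at_from_submanifold[OF PA mfd(2) embedded_cset order_refl cx, THEN iffD1])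
  from smooth_at_compose[OF M PA mfd(2) smooth_at_Pair[OF M mfd(2,2) f g x] this x]
  show ?thesis using c by (auto simp: cset_def)
qed

end

text \<open>Every axiom of \<open>H'\<close> is checked after applying \<Psi>, so an injective map
  that respects the operations is enough. It is applied twice: to the inclusion of the arrows over
  units into \<open>V\<close>, and to the bijection between the action groupoid and
  \<open>V\<close>.\<close>

lemma algebraic_transfer:
  fixes H :: "('o, 'e::euclidean_space, 'a, 'f::euclidean_space) groupoid"
    and H' :: "('o, 'p::euclidean_space, 'b, 'h::euclidean_space) groupoid"
  assumes alg: "algebraic_groupoid H" and ob: "points (Obj H') = points (Obj H)"
    and \<Psi>: "\<And>a. a \<in> points (Arr H') \<Longrightarrow> \<Psi> a \<in> points (Arr H) \<and> src H' a = src H (\<Psi> a) \<and> tgt H' a = tgt H (\<Psi> a)"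
    and inj: "inj_on \<Psi> (points (Arr H'))"
    and un: "\<And>x. x \<in> points (Obj H) \<Longrightarrow> unit H' x \<in> points (Arr H') \<and> \<Psi> (unit H' x) = unit H x"
    and mu: "\<And>a b. a \<in> points (Arr H') \<Longrightarrow> b \<in> points (Arr H') \<Longrightarrow> src H (\<Psi> a) = tgt H (\<Psi> b) \<Longrightarrow>
      mult H' a b \<in> points (Arr H') \<and> \<Psi> (mult H' a b) = mult H (\<Psi> a) (\<Psi> b)"
    and iv: "\<And>a. a \<in> points (Arr H') \<Longrightarrow> I a \<in> points (Arr H') \<and> \<Psi> (I a) = ginv H (\<Psi> a)"
  shows "algebraic_groupoid H'" "\<And>a. a \<in> points (Arr H') \<Longrightarrow> ginv H' a = I a"
proof -
  interpret algebraic_gpd H using alg by unfold_locales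
  have eqI: "a = b" if "a \<in> points (Arr H')" "b \<in> points (Arr H')" "\<Psi> a = \<Psi> b" for a b
    using inj that by (auto dest: inj_onD)
  have inv: "is_inverse H' a (I a)" if a: "a \<in> points (Arr H')" for a
  proof -
    note p = \<Psi>[OF a] iv[OF a] \<Psi>[OF conjunct1[OF iv[OF a]]]
    have pa: "\<Psi> a \<in> points (Arr H)" using p by blast
    note g = ginv[OF pa] and s = st_closed[OF pa]
    show ?thesis unfolding is_inverse_def
    proof (intro conjI)
      show "I a \<in> points (Arr H')" "src H' (I a) = tgt H' a" "tgt H' (I a) = src H' a" using p g by auto
      show "mult H' (I a) a = unit H' (src H' a)"
        by (rule eqI) (use a p g s un mu[of "I a" a] in auto)
      show "mult H' a (I a) = unit H' (tgt H' a)"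
        by (rule eqI) (use a p g s un mu[of a "I a"] in auto)
    qed
  qed
  show alg': "algebraic_groupoid H'"
    unfolding algebraic_groupoid_def
  proof (intro conjI ballI impI)
    fix g assume g: "g \<in> points (Arr H')"
    note p = \<Psi>[OF g]
    have pg: "\<Psi> g \<in> points (Arr H)" using p by blast
    note s = st_closed[OF pg] and ul = unit_laws[OF pg]
    show "src H' g \<in> points (Obj H')" "tgt H' g \<in> points (Obj H')" using p s ob by auto
    note us = un[OF s(1)] and ut = un[OF s(2)]
    have c1: "src H (\<Psi> g) = tgt H (\<Psi> (unit H' (src H (\<Psi> g))))" and c2: "src H (\<Psi> (unit H' (tgt H (\<Psi> g)))) = tgt H (\<Psi> g)"
      using us ut unit_closed[OF s(1)] unit_closed[OF s(2)] by simp_all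
    show "mult H' g (unit H' (src H' g)) = g"
      by (rule eqI) (use mu[OF g conjunct1[OF us] c1] us ul p g in auto)
    show "mult H' (unit H' (tgt H' g)) g = g"
      by (rule eqI) (use mu[OF conjunct1[OF ut] g c2] ut ul p g in auto)
    show "\<exists>h. is_inverse H' g h" using inv[OF g] by blast
  next
    fix x assume "x \<in> points (Obj H')"
    then have x: "x \<in> points (Obj H)" using ob by simp
    show "unit H' x \<in> points (Arr H')" "src H' (unit H' x) = x" "tgt H' (unit H' x) = x"
      using un[OF x] \<Psi>[of "unit H' x"] unit_closed[OF x] by auto
  next
    fix g h assume g: "g \<in> points (Arr H')" and h: "h \<in> points (Arr H')" and c: "src H' g = tgt H' h"
    have c': "src H (\<Psi> g) = tgt H (\<Psi> h)" using \<Psi>[OF g] \<Psi>[OF h] c by simp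
    note m = mu[OF g h c'] and mm = mult_closed[of "\<Psi> g" "\<Psi> h"]
    show "mult H' g h \<in> points (Arr H')" "src H' (mult H' g h) = src H' h" "tgt H' (mult H' g h) = tgt H' g"
      using m \<Psi>[OF conjunct1[OF m]] mm \<Psi>[OF g] \<Psi>[OF h] c' by auto
    fix k assume k: "k \<in> points (Arr H')" and d: "src H' h = tgt H' k"
    have d': "src H (\<Psi> h) = tgt H (\<Psi> k)" using \<Psi>[OF h] \<Psi>[OF k] d by simp
    note n = mu[OF h k d']
    have P: "\<Psi> g \<in> points (Arr H)" "\<Psi> h \<in> points (Arr H)" "\<Psi> k \<in> points (Arr H)" using \<Psi> g h k by auto
    note mm = mult_closed[OF P(1,2) c'] and nn = mult_closed[OF P(2,3) d']
    have e1: "src H (\<Psi> (mult H' g h)) = tgt H (\<Psi> k)" and e2: "src H (\<Psi> g) = tgt H (\<Psi> (mult H' h k))"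
      using m n mm nn c' d' by simp_all
    show "mult H' (mult H' g h) k = mult H' g (mult H' h k)"
      by (rule eqI) (use mu[OF conjunct1[OF m] k e1] mu[OF g conjunct1[OF n] e2] m n assoc[OF P c' d'] in auto)
  qed
  interpret H': algebraic_gpd H' using alg' by unfold_locales
  show "ginv H' a = I a" if "a \<in> points (Arr H')" for a
    using inv[OF that] unfolding is_inverse_def by (intro H'.ginv_eqI[OF that]) auto
qed

lemma lie_groupoid_trivial:
  assumes M: "smooth_manifold M"
  shows "lie_groupoid (trivial_groupoid M)"
    "smooth_map (composable_pairs (trivial_groupoid M)) M (\<lambda>(g, h). g)"
    "x \<in> points M \<Longrightarrow> ginv (trivial_groupoid M) x = x"
proof -
  let ?T = "trivial_groupoid M"
  have [simp]: "Obj ?T = M" "Arr ?T = M" "src ?T = id" "tgt ?T = id" "unit ?T = id" "mult ?T = (\<lambda>a b. a)"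
    by (simp_all add: trivial_groupoid_def)
  have alg: "algebraic_groupoid ?T"
    unfolding algebraic_groupoid_def is_inverse_def by auto
  interpret algebraic_gpd ?T using alg by unfold_locales
  have gi: "ginv ?T x = x" if "x \<in> points M" for x using ginv_eqI[of x x] that by simp
  then show "x \<in> points M \<Longrightarrow> ginv ?T x = x" .
  have id: "smooth_map M M id" unfolding smooth_map_iff[OF M M] id_def using smooth_at_id[OF M] by blast
  have sub: "submersion M M id"
  proof (rule submersionI[OF M M id])
    fix x assume x: "x \<in> points M"
    show "\<exists>O' c. openin (mtop M) O' \<and> id x \<in> O' \<and> smooth_at M O' M c (id x) \<and> c (id x) = x \<and> (\<forall>n\<in>O'. id (c n) = n)"
      by (intro exI[of _ "points M"] exI[of _ "\<lambda>x. x"]) (use x smooth_at_id[OF M x] in auto)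
  qed
  show mu: "smooth_map (composable_pairs ?T) M (\<lambda>(g, h). g)"
    unfolding composable_pairs_def
  proof (rule smooth_map_submanifoldI)
    show "smooth_manifold (prod_manifold (Arr ?T) (Arr ?T))" using smooth_manifold_prod[OF M M] by simp
    fix z assume "z \<in> {(g, h). g \<in> points (Arr ?T) \<and> h \<in> points (Arr ?T) \<and> src ?T g = tgt ?T h}"
    then have z: "z \<in> points M \<times> points M" by auto
    show "smooth_at (prod_manifold (Arr ?T) (Arr ?T)) {(g, h). g \<in> points (Arr ?T) \<and> h \<in> points (Arr ?T) \<and> src ?T g = tgt ?T h} M (\<lambda>(g, h). g) z"
      using smooth_at_fst[OF M M z] by (simp add: case_prod_unfold)
  qed (rule M)
  have "smooth_map M M (ginv ?T)" unfolding smooth_map_iff[OF M M]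
    by (intro ballI smooth_at_cong[OF smooth_at_id[OF M]]) (use gi in auto)
  then show "lie_groupoid ?T" unfolding lie_groupoid_def using alg M sub id mu by simp
qed

lemma trivial_simps [simp]:
  "Obj (trivial_groupoid M) = M" "Arr (trivial_groupoid M) = M" "src (trivial_groupoid M) = id" "tgt (trivial_groupoid M) = id"
  "unit (trivial_groupoid M) = id" "mult (trivial_groupoid M) = (\<lambda>a b. a)"
  by (simp_all add: trivial_groupoid_def)

lemma lie_groupoid_mapI:
  assumes "smooth_map (Obj G) (Obj H) f0" "smooth_map (Arr G) (Arr H) f1"
    "\<And>g. g \<in> points (Arr G) \<Longrightarrow> src H (f1 g) = f0 (src G g)" "\<And>g. g \<in> points (Arr G) \<Longrightarrow> tgt H (f1 g) = f0 (tgt G g)"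
    "\<And>x. x \<in> points (Obj G) \<Longrightarrow> f1 (unit G x) = unit H (f0 x)"
    "\<And>g h. g \<in> points (Arr G) \<Longrightarrow> h \<in> points (Arr G) \<Longrightarrow> src G g = tgt G h \<Longrightarrow> f1 (mult G g h) = mult H (f1 g) (f1 h)"
  shows "lie_groupoid_map G H f0 f1"
  using assms unfolding lie_groupoid_map_def by blast

section \<open>VB-groupoids\<close>

lemma total_groupoid_simps [simp]:
  "Obj (total_groupoid V) = total (objb V)" "Arr (total_groupoid V) = total (arrb V)"
  "src (total_groupoid V) = vsrc V" "tgt (total_groupoid V) = vtgt V"
  "unit (total_groupoid V) = vunit V" "mult (total_groupoid V) = vmult V"
  by (simp_all add: total_groupoid_def)

locale vb_gpd =
  fixes G :: "('g0, 'd0::euclidean_space, 'g1, 'd1::euclidean_space) groupoid"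
    and V :: "('v0, 'e0::euclidean_space, 'g0, 'd0, 'v1, 'e1::euclidean_space, 'g1, 'd1) vbg"
  assumes vbg: "vb_groupoid G V"
begin

abbreviation "X0 \<equiv> total (objb V)"
abbreviation "X1 \<equiv> total (arrb V)"
abbreviation "P0 \<equiv> points X0"
abbreviation "P1 \<equiv> points X1"
abbreviation "p0 \<equiv> proj (objb V)"
abbreviation "p1 \<equiv> proj (arrb V)"
abbreviation "add0 \<equiv> vadd (objb V)"
abbreviation "add1 \<equiv> vadd (arrb V)"
abbreviation "sc0 \<equiv> vscale (objb V)"
abbreviation "sc1 \<equiv> vscale (arrb V)"
abbreviation "vinv \<equiv> ginv (total_groupoid V)"
abbreviation "PM \<equiv> prod_manifold (Arr G) X0"

sublocale G: lie_gpd G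
  using vbg by unfold_locales (simp add: vb_groupoid_def)

sublocale V: lie_gpd "total_groupoid V"
  rewrites "Obj (total_groupoid V) = X0" and "Arr (total_groupoid V) = X1"
    and "src (total_groupoid V) = vsrc V" and "tgt (total_groupoid V) = vtgt V"
    and "unit (total_groupoid V) = vunit V" and "mult (total_groupoid V) = vmult V"
  using vbg by (unfold_locales, simp_all add: vb_groupoid_def)

lemma E0: "vector_bundle (objb V)" "base (objb V) = Obj G"
  and E1: "vector_bundle (arrb V)" "base (arrb V) = Arr G"
  using vbg by (auto simp: vb_groupoid_def)

lemma p0: "x \<in> P0 \<Longrightarrow> p0 x \<in> points (Obj G)"
  using vector_bundle_proj(1)[OF E0(1)] E0(2) by simp

lemma p1: "x \<in> P1 \<Longrightarrow> p1 x \<in> points (Arr G)"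
  using vector_bundle_proj(1)[OF E1(1)] E1(2) by simp

lemma vb_maps: "vb_map (arrb V) (objb V) (vsrc V) (src G)" "vb_map (arrb V) (objb V) (vtgt V) (tgt G)"
     "vb_map (objb V) (arrb V) (vunit V) (unit G)"
     "vb_map (composable_bundle G V) (arrb V) (\<lambda>(v, w). vmult V v w) (\<lambda>(g, h). mult G g h)"
     "vb_map (arrb V) (arrb V) vinv (ginv G)"
  using vbg by (auto simp: vb_groupoid_def)

lemma proj_src: "v \<in> P1 \<Longrightarrow> p0 (vsrc V v) = src G (p1 v)"
  and proj_tgt: "v \<in> P1 \<Longrightarrow> p0 (vtgt V v) = tgt G (p1 v)"
  and proj_unit: "x \<in> P0 \<Longrightarrow> p1 (vunit V x) = unit G (p0 x)"
  and proj_inv: "v \<in> P1 \<Longrightarrow> p1 (vinv v) = ginv G (p1 v)"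
  using vb_mapD(1)[OF vb_maps(1)] vb_mapD(1)[OF vb_maps(2)] vb_mapD(1)[OF vb_maps(3)] vb_mapD(1)[OF vb_maps(5)] by auto

lemma proj_mult: "v \<in> P1 \<Longrightarrow> w \<in> P1 \<Longrightarrow> vsrc V v = vtgt V w \<Longrightarrow> p1 (vmult V v w) = mult G (p1 v) (p1 w)"
  using vbg by (simp add: vb_groupoid_def lie_groupoid_map_def)

lemma linear_src: "v \<in> P1 \<Longrightarrow> w \<in> P1 \<Longrightarrow> p1 w = p1 v \<Longrightarrow> vsrc V (add1 v w) = add0 (vsrc V v) (vsrc V w)"
    "v \<in> P1 \<Longrightarrow> vsrc V (sc1 r v) = sc0 r (vsrc V v)"
  and linear_tgt: "v \<in> P1 \<Longrightarrow> w \<in> P1 \<Longrightarrow> p1 w = p1 v \<Longrightarrow> vtgt V (add1 v w) = add0 (vtgt V v) (vtgt V w)"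
    "v \<in> P1 \<Longrightarrow> vtgt V (sc1 r v) = sc0 r (vtgt V v)"
  and linear_unit: "x \<in> P0 \<Longrightarrow> y \<in> P0 \<Longrightarrow> p0 y = p0 x \<Longrightarrow> vunit V (add0 x y) = add1 (vunit V x) (vunit V y)"
    "x \<in> P0 \<Longrightarrow> vunit V (sc0 r x) = sc1 r (vunit V x)"
  and linear_inv: "v \<in> P1 \<Longrightarrow> w \<in> P1 \<Longrightarrow> p1 w = p1 v \<Longrightarrow> vinv (add1 v w) = add1 (vinv v) (vinv w)"
    "v \<in> P1 \<Longrightarrow> vinv (sc1 r v) = sc1 r (vinv v)"
  using vb_mapD(2,3)[OF vb_maps(1)] vb_mapD(2,3)[OF vb_maps(2)] vb_mapD(2,3)[OF vb_maps(3)] vb_mapD(2,3)[OF vb_maps(5)]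
    p0 p1 E0(2) E1(2) by simp_all

lemma composable_bundle_points:
  "points (total (composable_bundle G V)) = {(v, w). v \<in> P1 \<and> w \<in> P1 \<and> vsrc V v = vtgt V w}"
  using V.composable_manifold(2) by (simp add: composable_bundle_def V.cset_def)

lemma linear_mult:
  assumes v: "v \<in> P1" "w \<in> P1" "vsrc V v = vtgt V w"
  shows "v' \<in> P1 \<Longrightarrow> w' \<in> P1 \<Longrightarrow> vsrc V v' = vtgt V w' \<Longrightarrow> p1 v' = p1 v \<Longrightarrow> p1 w' = p1 w \<Longrightarrow>
      vmult V (add1 v v') (add1 w w') = add1 (vmult V v w) (vmult V v' w')"
    "vmult V (sc1 r v) (sc1 r w) = sc1 r (vmult V v w)"
proof -
  let ?C = "composable_bundle G V"
  have vw: "(v, w) \<in> points (total ?C)" using v by (simp add: composable_bundle_points)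
  have st: "src G (p1 v) = tgt G (p1 w)" using proj_src[OF v(1)] proj_tgt[OF v(2)] v(3) by simp
  have b: "proj ?C (v, w) \<in> points (base ?C)"
    using p1 v st by (simp add: composable_bundle_def G.composable_manifold(2) G.cset_def)
  show "vmult V (sc1 r v) (sc1 r w) = sc1 r (vmult V v w)"
    using vb_mapD(3)[OF vb_maps(4) vw, of r] by (simp add: composable_bundle_def)
  assume v': "v' \<in> P1" "w' \<in> P1" "vsrc V v' = vtgt V w'" "p1 v' = p1 v" "p1 w' = p1 w"
  have "(v', w') \<in> points (total ?C)" using v' by (simp add: composable_bundle_points)
  then show "vmult V (add1 v v') (add1 w w') = add1 (vmult V v w) (vmult V v' w')"
    using vb_mapD(2)[OF vb_maps(4) vw b, of "(v', w')"] v' by (simp add: composable_bundle_def)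
qed

lemma smooth_p0: "smooth_manifold M \<Longrightarrow> smooth_at M S X0 f x \<Longrightarrow> x \<in> S \<Longrightarrow> smooth_at M S (Obj G) (\<lambda>y. p0 (f y)) x"
  using smooth_at_compose[OF _ V.mfd(1) G.mfd(1) _ vector_bundle_proj(2)[OF E0(1), unfolded E0(2)] _ order_refl] smooth_at_points by metis

lemma smooth_p1: "smooth_manifold M \<Longrightarrow> smooth_at M S X1 f x \<Longrightarrow> x \<in> S \<Longrightarrow> smooth_at M S (Arr G) (\<lambda>y. p1 (f y)) x"
  using smooth_at_compose[OF _ V.mfd(2) G.mfd(2) _ vector_bundle_proj(2)[OF E1(1), unfolded E1(2)] _ order_refl] smooth_at_points by metis

section \<open>Surjectivity of the source map on fibres\<close>

lemma src_triv:
  assumes "vb_triv (arrb V) U1 L1 \<tau>1 \<theta>1" "h \<in> U1" "m \<in> L1"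
  shows "p0 (vsrc V (\<theta>1 (h, m))) = src G h" "vsrc V (\<theta>1 (h, m)) \<in> P0"
  using proj_src vb_trivD(6,7)[OF assms] V.st_closed(1) by auto

text \<open>The source map over a fixed arrow, in trivializations. The projection \<open>q\<close>
  onto the typical fibre makes it a linear map on the whole Euclidean space, as required for
  families of matrices.\<close>

lemma src_triv_linear:
  assumes t0: "vb_triv (objb V) U0 L0 \<tau>0 \<theta>0" and t1: "vb_triv (arrb V) U1 L1 \<tau>1 \<theta>1"
    and q: "linear q" "\<And>v. q v \<in> L1" and h: "h \<in> U1" "src G h \<in> U0"
  shows "linear (\<lambda>m. \<tau>0 (vsrc V (\<theta>1 (h, q m))))"
proof (rule linearI)
  fix m m' and r :: real
  note d0 = vb_trivD[OF t0] and d1 = vb_trivD[OF t1] and srcl = src_triv[OF t1]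
  note a = d1(6,7,8)[OF h(1) q(2)[of m]] and a' = d1(6,7,8)[OF h(1) q(2)[of m']]
  show "\<tau>0 (vsrc V (\<theta>1 (h, q (m + m')))) = \<tau>0 (vsrc V (\<theta>1 (h, q m))) + \<tau>0 (vsrc V (\<theta>1 (h, q m')))"
    using linear_src(1)[OF a(1) a'(1)] a a' d0(10) srcl[OF h(1) q(2)] h(2)
    by (simp add: linear_add[OF q(1)] vb_triv_inv_linear(1)[OF E1(1) t1 h(1) q(2) q(2)])
  show "\<tau>0 (vsrc V (\<theta>1 (h, q (r *\<^sub>R m)))) = r *\<^sub>R \<tau>0 (vsrc V (\<theta>1 (h, q m)))"
    using linear_src(2)[OF a(1)] d0(11) srcl[OF h(1) q(2)] h(2)
    by (simp add: linear_cmul[OF q(1)] vb_triv_inv_linear(2)[OF E1(1) t1 h(1) q(2)])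
qed

text \<open>Differentiate \<open>s (c (\<epsilon> x)) = \<epsilon> x\<close> for a local section \<open>c\<close>
  of the submersion \<open>s\<close> through a zero vector.\<close>

lemma src_fibre_surj:
  assumes g: "g \<in> points (Arr G)" and x: "x \<in> P0" "p0 x = src G g"
  obtains v where "v \<in> P1" "p1 v = g" "vsrc V v = x"
proof -
  define b where "b = src G g"
  have b: "b \<in> points (Obj G)" unfolding b_def by (rule G.st_closed[OF g])
  have bB: "b \<in> points (base (objb V))" and gB: "g \<in> points (base (arrb V))" using b g E0(2) E1(2) by auto
  define v0 where "v0 = vzero (arrb V) g"
  have v0: "v0 \<in> P1" "p1 v0 = g" unfolding v0_def using vzero(1,2)[OF E1(1) gB] by auto
  have sv0: "vsrc V v0 = vzero (objb V) b"
  proof -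
    have "vsrc V v0 = vsrc V (sc1 0 v0)" using vzero(3)[OF E1(1) gB v0] by (simp add: v0_def)
    also have "\<dots> = sc0 0 (vsrc V v0)" using linear_src(2)[OF v0(1)] .
    also have "\<dots> = vzero (objb V) b"
      by (rule vzero(3)[OF E0(1) bB]) (use V.st_closed[OF v0(1)] proj_src[OF v0(1)] v0 in \<open>auto simp: b_def\<close>)
    finally show ?thesis .
  qed
  have sub: "submersion X1 X0 (vsrc V)" using V.lie by (simp add: lie_groupoid_def)
  obtain O' c where c: "openin (mtop X0) O'" "vsrc V v0 \<in> O'" "smooth_at X0 O' X1 c (vsrc V v0)" "c (vsrc V v0) = v0"
    "\<forall>n\<in>O'. c n \<in> P1 \<and> vsrc V (c n) = n"
    using submersion_local_section[OF V.mfd(2,1) sub v0(1)] by metis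
  obtain U0 L0 \<tau>0 \<theta>0 where t0: "b \<in> U0" "vb_triv (objb V) U0 L0 \<tau>0 \<theta>0" using vector_bundle_triv[OF E0(1) bB] .
  obtain U1 L1 \<tau>1 \<theta>1 where t1: "g \<in> U1" "vb_triv (arrb V) U1 L1 \<tau>1 \<theta>1" using vector_bundle_triv[OF E1(1) gB] .
  note d0 = vb_trivD[OF t0(2)] and d1 = vb_trivD[OF t1(2)]
  have xU: "p0 x \<in> U0" "p0 x = b" using x t0 by (simp_all add: b_def)
  define l where "l = \<tau>0 x"
  have lL: "\<epsilon> *\<^sub>R l \<in> L0" for \<epsilon> using d0(4)[OF x(1) xU(1)] d0(2) by (simp add: l_def subspace_scale)
  \<comment> \<open>The line spanned by \<open>x\<close> in its fibre; it passes through the zero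
    vector at 0.\<close>
  define y where "y \<epsilon> = \<theta>0 (b, \<epsilon> *\<^sub>R l)" for \<epsilon> :: real
  have y: "y \<epsilon> \<in> P0" "p0 (y \<epsilon>) = b" "\<tau>0 (y \<epsilon>) = \<epsilon> *\<^sub>R l" for \<epsilon>
    using d0(6,7,8)[OF t0(1) lL] by (simp_all add: y_def)
  have y0: "y 0 = vsrc V v0" using vzero_triv(2)[OF E0(1) t0(2,1)] sv0 by (simp add: y_def)
  have sy: "smooth_at euc S X0 y \<epsilon>" if "\<epsilon> \<in> S" for S \<epsilon>
    unfolding y_def
  proof (rule smooth_at_vb_point[OF E0(1) t0(2) smooth_manifold_euc _ _ that])
    show "smooth_at euc S (base (objb V)) (\<lambda>y. b) \<epsilon>"
      using smooth_at_const[OF smooth_manifold_euc _ G.mfd(1) b] E0(2) by simp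
    show "smooth_at euc S euc (\<lambda>\<epsilon>. \<epsilon> *\<^sub>R l) \<epsilon>"
      by (rule smooth_at_euc_Cinf[OF open_UNIV UNIV_I Cinf_scaleR[OF Cinf_id Cinf_const]])
  qed (use t0 lL in auto)
  define S where "S = {\<epsilon>\<in>UNIV. y \<epsilon> \<in> O'}"
  have "openin (mtop euc) S" unfolding S_def
    by (rule smooth_at_open_preimage[OF sy _ c(1)]) (auto simp: linear_manifold_def)
  then have S: "open S" by (simp add: linear_manifold_def)
  have S0: "0 \<in> S" using y0 c(2) by (simp add: S_def)
  have sc: "smooth_at euc S X1 (\<lambda>\<epsilon>. c (y \<epsilon>)) 0"
    by (rule smooth_at_compose[OF smooth_manifold_euc V.mfd sy[OF S0] _ S0, of O']) (use c(3) y0 in \<open>auto simp: S_def\<close>)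
  have spc: "smooth_at euc S (Arr G) (\<lambda>\<epsilon>. p1 (c (y \<epsilon>))) 0" by (rule smooth_p1[OF smooth_manifold_euc sc S0])
  have oU1: "openin (mtop (Arr G)) U1" using d1(1) E1(2) by simp
  have "p1 (c (y 0)) \<in> U1" using y0 c(4) v0 t1 by simp
  then obtain O1 where O1: "openin (mtop euc) O1" "0 \<in> O1" "(\<lambda>\<epsilon>. p1 (c (y \<epsilon>))) ` (S \<inter> O1) \<subseteq> U1"
    using smooth_at_nbhd[OF smooth_manifold_euc G.mfd(2) spc S0 oU1] by blast
  define T where "T = S \<inter> O1"
  have T: "open T" using S O1(1) by (auto simp: T_def linear_manifold_def)
  have T0: "0 \<in> T" using S0 O1 by (simp add: T_def)
  have TS: "T \<subseteq> S" by (simp add: T_def)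
  have cT: "c (y \<epsilon>) \<in> P1" "p1 (c (y \<epsilon>)) \<in> U1" "vsrc V (c (y \<epsilon>)) = y \<epsilon>" if "\<epsilon> \<in> T" for \<epsilon>
    using that c(5) O1(3) by (auto simp: T_def S_def)
  define k where "k \<epsilon> = \<tau>1 (c (y \<epsilon>))" for \<epsilon>
  have sk: "smooth_at euc T euc k 0" unfolding k_def
    by (rule smooth_at_vb_coord[OF E1(1) t1(2) smooth_manifold_euc smooth_at_mono[OF sc TS] T0]) (use cT in auto)
  obtain k' where k': "(k has_derivative k') (at 0)" using smooth_at_euc_differentiable[OF sk T T0] by blast
  have k0: "k 0 = 0" using vzero_triv(1)[OF E1(1) t1(2,1)] y0 c(4) by (simp add: k_def v0_def)
  obtain q where q: "linear q" "\<And>v. q v \<in> L1" "\<And>v. v \<in> L1 \<Longrightarrow> q v = v"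
    using linear_projection_exists[OF d1(2)] by metis
  note srcl = src_triv[OF t1(2)] and linS = src_triv_linear[OF t0(2) t1(2) q(1,2)]
  \<comment> \<open>The section need not stay in the fibre over \<open>g\<close>, so the matrix of
    the source map in the trivializations varies with \<epsilon>.\<close>
  define w where "w \<epsilon> m = \<tau>0 (vsrc V (\<theta>1 (p1 (c (y \<epsilon>)), q m)))" for \<epsilon> m
  have srcb: "src G (p1 (c (y \<epsilon>))) = b" if "\<epsilon> \<in> T" for \<epsilon> using proj_src[OF cT(1)[OF that]] cT(3)[OF that] y by simp
  have linw: "linear (w \<epsilon>)" if "\<epsilon> \<in> T" for \<epsilon>
    unfolding w_def by (rule linS[OF cT(2)[OF that]]) (simp add: srcb[OF that] t0)
  have sw: "smooth_at euc T euc (\<lambda>\<epsilon>. w \<epsilon> m) 0" for m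
    unfolding w_def
  proof (rule smooth_at_vb_coord[OF E0(1) t0(2) smooth_manifold_euc _ T0])
    have "smooth_at euc T X1 (\<lambda>\<epsilon>. \<theta>1 (p1 (c (y \<epsilon>)), q m)) 0"
      by (rule smooth_at_vb_point[OF E1(1) t1(2) smooth_manifold_euc _ smooth_at_const[OF smooth_manifold_euc _ smooth_manifold_euc] T0])
        (use smooth_at_mono[OF spc TS] E1(2) cT q(2) in auto)
    then show "smooth_at euc T X0 (\<lambda>\<epsilon>. vsrc V (\<theta>1 (p1 (c (y \<epsilon>)), q m))) 0"
      by (rule V.smooth_at_src[OF smooth_manifold_euc _ T0])
  qed (use srcl cT q(2) srcb t0(1) in auto)
  have kw: "w \<epsilon> (k \<epsilon>) = \<epsilon> *\<^sub>R l" if e: "\<epsilon> \<in> T" for \<epsilon>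
  proof -
    have "q (k \<epsilon>) = k \<epsilon>" using d1(4)[OF cT(1,2)[OF e]] q(3) by (simp add: k_def)
    then have "\<theta>1 (p1 (c (y \<epsilon>)), q (k \<epsilon>)) = c (y \<epsilon>)" using d1(5)[OF cT(1,2)[OF e]] by (simp add: k_def)
    then show ?thesis using cT(3)[OF e] y(3) by (simp add: w_def)
  qed
  have "\<exists>w'. ((\<lambda>\<epsilon>. w \<epsilon> m) has_derivative w') (at 0)" for m by (rule smooth_at_euc_differentiable[OF sw T T0])
  then obtain w' where w': "\<And>m. ((\<lambda>\<epsilon>. w \<epsilon> m) has_derivative w' m) (at 0)" by metis
  \<comment> \<open>Because \<open>k 0 = 0\<close>, the terms of the product rule with the
    derivative of the matrix drop out and only the matrix at 0, the source map on the fibre over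
    \<open>g\<close>, is left.\<close>
  have "((\<lambda>\<epsilon>. \<Sum>m\<in>Basis. (k \<epsilon> \<bullet> m) *\<^sub>R w \<epsilon> m) has_derivative
      (\<lambda>u. \<Sum>m\<in>Basis. (k 0 \<bullet> m) *\<^sub>R w' m u + (k' u \<bullet> m) *\<^sub>R w 0 m)) (at 0)"
    by (intro has_derivative_sum has_derivative_scaleR w' has_derivative_inner_left k')
  then have 1: "((\<lambda>\<epsilon>. \<epsilon> *\<^sub>R l) has_derivative (\<lambda>u. \<Sum>m\<in>Basis. (k' u \<bullet> m) *\<^sub>R w 0 m)) (at 0)"
    unfolding k0 inner_zero_left scaleR_zero_left add_0_left
  proof (rule has_derivative_transform_within_open[OF _ T T0])
    show "(\<Sum>m\<in>Basis. (k \<epsilon> \<bullet> m) *\<^sub>R w \<epsilon> m) = \<epsilon> *\<^sub>R l" if "\<epsilon> \<in> T" for \<epsilon>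
      using linear_eq_sum_Basis[OF linw[OF that], of "k \<epsilon>"] kw[OF that] by simp
  qed
  have 2: "((\<lambda>\<epsilon>. \<epsilon> *\<^sub>R l) has_derivative (\<lambda>u. u *\<^sub>R l)) (at 0)" by (auto intro!: derivative_eq_intros)
  have "1 *\<^sub>R l = (\<Sum>m\<in>Basis. (k' 1 \<bullet> m) *\<^sub>R w 0 m)"
    using fun_cong[OF has_derivative_unique[OF 2 1], of 1] by simp
  also have "\<dots> = w 0 (k' 1)" using linear_eq_sum_Basis[OF linw[OF T0], of "k' 1"] by simp
  finally have l: "l = \<tau>0 (vsrc V (\<theta>1 (g, q (k' 1))))" using y0 c(4) v0 by (simp add: w_def)
  define v where "v = \<theta>1 (g, q (k' 1))"
  have v: "v \<in> P1" "p1 v = g" using d1(6,7)[OF t1(1) q(2)] by (simp_all add: v_def)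
  have "vsrc V v \<in> P0" "p0 (vsrc V v) = b" using V.st_closed[OF v(1)] proj_src[OF v(1)] v by (simp_all add: b_def)
  then have "vsrc V v = \<theta>0 (b, \<tau>0 (vsrc V v))" using d0(5)[of "vsrc V v"] t0 by simp
  also have "\<dots> = x" using d0(5)[OF x(1) xU(1)] l xU(2) by (simp add: v_def l_def)
  finally show ?thesis using that v by blast
qed

section \<open>Cleavages\<close>

definition D :: "('g1 \<times> 'v0) set" where
  "D = {(g, x). g \<in> points (Arr G) \<and> x \<in> P0 \<and> src G g = p0 x}"

text \<open>The set \<open>O'\<close> of arrows is a parameter so that local pieces and the global
  object are instances of one notion. As \<open>D\<close> is not open in \<open>PM\<close>,
  smoothness is relative to the part of \<open>D\<close> over \<open>O'\<close>.\<close>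

definition cleavage_on :: "'g1 set \<Rightarrow> ('g1 \<times> 'v0 \<Rightarrow> 'v1) \<Rightarrow> bool" where
  "cleavage_on O' \<sigma> \<longleftrightarrow>
    (\<forall>g x. (g, x) \<in> D \<longrightarrow> g \<in> O' \<longrightarrow> \<sigma> (g, x) \<in> P1 \<and> p1 (\<sigma> (g, x)) = g \<and> vsrc V (\<sigma> (g, x)) = x \<and>
       smooth_at PM (D \<inter> O' \<times> UNIV) X1 \<sigma> (g, x)) \<and>
    (\<forall>g x x'. (g, x) \<in> D \<longrightarrow> (g, x') \<in> D \<longrightarrow> g \<in> O' \<longrightarrow> \<sigma> (g, add0 x x') = add1 (\<sigma> (g, x)) (\<sigma> (g, x'))) \<and>
    (\<forall>g x r. (g, x) \<in> D \<longrightarrow> g \<in> O' \<longrightarrow> \<sigma> (g, sc0 r x) = sc1 r (\<sigma> (g, x))) \<and>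
    (\<forall>x\<in>P0. unit G (p0 x) \<in> O' \<longrightarrow> \<sigma> (unit G (p0 x), x) = vunit V x)"

lemma PM: "smooth_manifold PM"
  by (rule smooth_manifold_prod[OF G.mfd(2) V.mfd(1)])

lemma D_points: "z \<in> D \<Longrightarrow> z \<in> points (Arr G) \<times> P0" "(g, x) \<in> D \<Longrightarrow> g \<in> points (Arr G)" "(g, x) \<in> D \<Longrightarrow> x \<in> P0" "(g, x) \<in> D \<Longrightarrow> src G g = p0 x"
  by (auto simp: D_def)

text \<open>Given any smooth family \<open>E g\<close> which splits \<open>S g\<close> at \<open>g0\<close>, the family \<open>E g (S g E g)\<^sup>-\<^sup>1\<close> splits \<open>S g\<close> near \<open>g0\<close>.\<close>

lemma local_cleavage_from_splitting:
  fixes E :: "'g1 \<Rightarrow> 'e0 \<Rightarrow> 'e1"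
  assumes t0: "vb_triv (objb V) U0 L0 \<tau>0 \<theta>0" and t1: "vb_triv (arrb V) U1 L1 \<tau>1 \<theta>1"
    and O1: "openin (mtop (Arr G)) O1" "g0 \<in> O1" "O1 \<subseteq> U1" "\<And>g. g \<in> O1 \<Longrightarrow> src G g \<in> U0"
    and E: "\<And>g. linear (E g)" "\<And>g l. g \<in> O1 \<Longrightarrow> l \<in> L0 \<Longrightarrow> E g l \<in> L1"
      "\<And>g l. g \<in> O1 \<Longrightarrow> smooth_at (Arr G) O1 euc (\<lambda>g. E g l) g"
    and S0: "\<And>l. l \<in> L0 \<Longrightarrow> \<tau>0 (vsrc V (\<theta>1 (g0, E g0 l))) = l"
    and un: "\<And>b l. b \<in> points (Obj G) \<Longrightarrow> unit G b \<in> O1 \<Longrightarrow> l \<in> L0 \<Longrightarrow> \<theta>1 (unit G b, E (unit G b) l) = vunit V (\<theta>0 (b, l))"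
  obtains O' \<sigma> where "openin (mtop (Arr G)) O'" "g0 \<in> O'" "cleavage_on O' \<sigma>"
proof -
  note d0 = vb_trivD[OF t0] and d1 = vb_trivD[OF t1]
  obtain q0 where q0: "linear q0" "\<And>v. q0 v \<in> L0" "\<And>v. v \<in> L0 \<Longrightarrow> q0 v = v"
    using linear_projection_exists[OF d0(2)] by metis
  obtain q1 where q1: "linear q1" "\<And>v. q1 v \<in> L1" "\<And>v. v \<in> L1 \<Longrightarrow> q1 v = v"
    using linear_projection_exists[OF d1(2)] by metis
  have O1p: "O1 \<subseteq> points (Arr G)" using openin_subset[OF O1(1)] .
  define S where "S g m = \<tau>0 (vsrc V (\<theta>1 (g, q1 m)))" for g m
  \<comment> \<open>\<open>N g\<close> is the composite \<open>S g \<circ> E g\<close> on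
    \<open>L0\<close> and the identity on the kernel of \<open>q0\<close>. It acts on the whole
    Euclidean space, where invertibility near \<open>g0\<close> can be deduced from invertibility at
    \<open>g0\<close>.\<close>
  define N where "N g z = S g (E g (q0 z)) + (z - q0 z)" for g z
  have linS: "linear (S g)" if "g \<in> O1" for g
    unfolding S_def by (rule src_triv_linear[OF t0 t1 q1(1,2)]) (use that O1 in auto)
  have SL: "S g m \<in> L0" if g: "g \<in> O1" for g m
  proof -
    note s = src_triv[OF t1, of g "q1 m"]
    show ?thesis unfolding S_def by (rule d0(4)) (use s g O1 q1(2) in auto)
  qed
  have linN: "linear (N g)" if "g \<in> O1" for g
    unfolding N_def
    using linear_compose[OF linear_compose[OF q0(1) E(1)[of g]] linS[OF that]] q0(1)
    by (intro linear_compose_add linear_compose_sub linear_id[unfolded id_def]) (auto simp: o_def)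
  have smS: "smooth_at (Arr G) O1 euc (\<lambda>g. S g m) g" if g: "g \<in> O1" for g m
    unfolding S_def
  proof (rule smooth_at_vb_coord[OF E0(1) t0 G.mfd(2) _ g])
    have "smooth_at (Arr G) O1 X1 (\<lambda>h. \<theta>1 (h, q1 m)) g"
      by (rule smooth_at_vb_point[OF E1(1) t1 G.mfd(2) _ smooth_at_const[OF G.mfd(2) _ smooth_manifold_euc] g])
        (use smooth_at_id[OF G.mfd(2)] E1(2) g O1p O1(3) q1(2) in auto)
    then show "smooth_at (Arr G) O1 X0 (\<lambda>h. vsrc V (\<theta>1 (h, q1 m))) g"
      by (rule V.smooth_at_src[OF G.mfd(2) _ g])
  qed (use src_triv[OF t1] O1 q1(2) in auto)
  have smN: "smooth_at (Arr G) O1 euc (\<lambda>g. N g z) g" if g: "g \<in> O1" for g z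
    unfolding N_def
  proof (rule smooth_at_add[OF G.mfd(2) _ _ g])
    have gp: "g \<in> points (Arr G)" using g O1p by blast
    show "smooth_at (Arr G) O1 euc (\<lambda>g. S g (E g (q0 z))) g"
      by (rule smooth_at_linear_family[OF G.mfd(2) g gp linS smS[OF g] E(3)[OF g]])
    show "smooth_at (Arr G) O1 euc (\<lambda>h. z - q0 z) g"
      by (rule smooth_at_const[OF G.mfd(2) gp smooth_manifold_euc]) simp
  qed
  have "N g0 = (\<lambda>z. z)"
  proof (rule ext)
    fix z
    have "q1 (E g0 (q0 z)) = E g0 (q0 z)" by (rule q1(3)[OF E(2)[OF O1(2) q0(2)]])
    then have "S g0 (E g0 (q0 z)) = q0 z" unfolding S_def using S0[OF q0(2)] by simp
    then show "N g0 z = z" by (simp add: N_def)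
  qed
  then have bij0: "bij (N g0)" using bij_id by (simp add: id_def)
  obtain O2 where O2: "openin (mtop (Arr G)) O2" "g0 \<in> O2" "\<And>g. g \<in> O1 \<Longrightarrow> g \<in> O2 \<Longrightarrow> bij (N g)"
    using smooth_at_inv_family[OF G.mfd(2) O1(2) _ linN bij0 smN[OF O1(2)]] O1(2) O1p by (metis subsetD)
  define O' where "O' = O1 \<inter> O2"
  have O': "openin (mtop (Arr G)) O'" "g0 \<in> O'" "O' \<subseteq> O1" using O1 O2 by (auto simp: O'_def)
  have bij: "bij (N g)" if "g \<in> O'" for g using O2(3) that by (auto simp: O'_def)
  define I where "I g = inv (N g)" for g
  have I: "N g (I g z) = z" "I g (N g z) = z" "linear (I g)" if g: "g \<in> O'" for g z
  proof -
    show "N g (I g z) = z" "I g (N g z) = z"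
      using bij[OF g] unfolding I_def by (simp_all add: bij_is_surj bij_is_inj surj_f_inv_f)
    have "linear (N g)" using linN g O'(3) by blast
    then show "linear (I g)"
      unfolding I_def using bij[OF g] by (metis bij_is_inj inj_linear_imp_inv_bounded_linear linear_conv_bounded_linear)
  qed
  have smI: "smooth_at (Arr G) O1 euc (\<lambda>g. I g z) g" if g: "g \<in> O'" for g z
  proof -
    have g1: "g \<in> O1" "g \<in> points (Arr G)" using g O' O1p by auto
    show ?thesis unfolding I_def
      using smooth_at_inv_family[OF G.mfd(2) g1 linN bij[OF g] smN[OF g1(1)]] by metis
  qed
  \<comment> \<open>\<open>N g z - z\<close> always lies in \<open>L0\<close>, so the inverse of
    \<open>N g\<close> maps \<open>L0\<close> to itself.\<close>
  have SEI: "I g l \<in> L0 \<and> S g (E g (I g l)) = l" if g: "g \<in> O'" and l: "l \<in> L0" for g l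
  proof -
    have g1: "g \<in> O1" using g O' by blast
    have e: "S g (E g (q0 (I g l))) + (I g l - q0 (I g l)) = l" using I(1)[OF g, of l] by (simp add: N_def)
    have e': "I g l = l - S g (E g (q0 (I g l))) + q0 (I g l)" using e by (simp add: algebra_simps)
    have "l - S g (E g (q0 (I g l))) + q0 (I g l) \<in> L0"
      by (intro subspace_add subspace_diff d0(2) l SL g1 q0(2))
    with e' have "I g l \<in> L0" by simp
    then show ?thesis using e q0(3) by simp
  qed
  define \<sigma> where "\<sigma> z = \<theta>1 (fst z, E (fst z) (I (fst z) (\<tau>0 (snd z))))" for z
  have tau: "\<tau>0 x \<in> L0" "p0 x \<in> U0" "g \<in> U1" "g \<in> O1" "E g (I g (\<tau>0 x)) \<in> L1" if "(g, x) \<in> D" "g \<in> O'" for g x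
  proof -
    show g: "g \<in> O1" "g \<in> U1" using that O' O1 by auto
    show u: "p0 x \<in> U0" using O1(4)[OF g(1)] D_points(4)[OF that(1)] by simp
    show l: "\<tau>0 x \<in> L0" by (rule d0(4)[OF D_points(3)[OF that(1)] u])
    show "E g (I g (\<tau>0 x)) \<in> L1" using E(2)[OF g(1)] SEI[OF that(2) l] by blast
  qed
  have sig: "\<sigma> (g, x) \<in> P1" "p1 (\<sigma> (g, x)) = g" "vsrc V (\<sigma> (g, x)) = x" if gx: "(g, x) \<in> D" "g \<in> O'" for g x
  proof -
    note t = tau[OF gx]
    show 1: "\<sigma> (g, x) \<in> P1" "p1 (\<sigma> (g, x)) = g" using d1(6,7)[OF t(3,5)] by (simp_all add: \<sigma>_def)
    have "S g (E g (I g (\<tau>0 x))) = \<tau>0 x" using SEI[OF gx(2) t(1)] by blast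
    then have e: "\<tau>0 (vsrc V (\<sigma> (g, x))) = \<tau>0 x" unfolding S_def \<sigma>_def using q1(3)[OF t(5)] by simp
    have s: "vsrc V (\<sigma> (g, x)) \<in> P0" "p0 (vsrc V (\<sigma> (g, x))) = p0 x"
      using V.st_closed(1)[OF 1(1)] proj_src[OF 1(1)] 1(2) D_points(4)[OF gx(1)] by auto
    then show "vsrc V (\<sigma> (g, x)) = x"
      using d0(5)[OF s(1)] d0(5)[OF D_points(3)[OF gx(1)] t(2)] t(2) e by simp
  qed
  have "cleavage_on O' \<sigma>"
    unfolding cleavage_on_def
  proof (intro conjI allI impI ballI)
    fix g x assume gx: "(g, x) \<in> D" "g \<in> O'"
    show "\<sigma> (g, x) \<in> P1" "p1 (\<sigma> (g, x)) = g" "vsrc V (\<sigma> (g, x)) = x" by (rule sig[OF gx])+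
    let ?D = "D \<inter> O' \<times> UNIV"
    have z: "(g, x) \<in> ?D" "(g, x) \<in> points PM" "(g, x) \<in> points (Arr G) \<times> P0" using gx D_points by auto
    have tau': "\<tau>0 (snd z) \<in> L0 \<and> snd z \<in> P0 \<and> p0 (snd z) \<in> U0 \<and> fst z \<in> U1 \<and> fst z \<in> O1 \<and> fst z \<in> O' \<and> E (fst z) (I (fst z) (\<tau>0 (snd z))) \<in> L1" if "z \<in> ?D" for z
      using tau[of "fst z" "snd z"] D_points(3)[of "fst z" "snd z"] that by (cases z) auto
    have sf: "smooth_at PM ?D (Arr G) fst (g, x)" by (rule smooth_at_fst[OF G.mfd(2) V.mfd(1) z(3)])
    have st: "smooth_at PM ?D euc (\<lambda>z. \<tau>0 (snd z)) (g, x)"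
      by (rule smooth_at_vb_coord[OF E0(1) t0 PM smooth_at_snd[OF G.mfd(2) V.mfd(1) z(3)] z(1)]) (use tau' in blast)
    have sI: "smooth_at PM ?D euc (\<lambda>z. I (fst z) v) (g, x)" for v
      by (rule smooth_at_compose[OF PM G.mfd(2) smooth_manifold_euc sf _ z(1), of O1]) (use smI gx tau' in auto)
    have sE: "smooth_at PM ?D euc (\<lambda>z. E (fst z) v) (g, x)" for v
      by (rule smooth_at_compose[OF PM G.mfd(2) smooth_manifold_euc sf _ z(1), of O1]) (use E(3) gx O' tau' in auto)
    have "smooth_at PM ?D euc (\<lambda>z. I (fst z) (\<tau>0 (snd z))) (g, x)"
      by (rule smooth_at_linear_family[OF PM z(1,2) I(3) sI st]) (use tau' in blast)
    then have sEI: "smooth_at PM ?D euc (\<lambda>z. E (fst z) (I (fst z) (\<tau>0 (snd z)))) (g, x)"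
      by (rule smooth_at_linear_family[OF PM z(1,2) E(1) sE])
    show "smooth_at PM ?D X1 \<sigma> (g, x)"
      unfolding \<sigma>_def
    proof (rule smooth_at_vb_point[OF E1(1) t1 PM _ sEI z(1)])
      show "smooth_at PM ?D (base (arrb V)) fst (g, x)" using sf E1(2) by simp
    qed (use tau' in blast)
  next
    fix g x x' assume gx: "(g, x) \<in> D" and gx': "(g, x') \<in> D" and g: "g \<in> O'"
    note t = tau[OF gx g] and t' = tau[OF gx' g]
    have "p0 x = p0 x'" using D_points(4)[OF gx] D_points(4)[OF gx'] by simp
    then have "\<tau>0 (add0 x x') = \<tau>0 x + \<tau>0 x'"
      using d0(10) D_points(3)[OF gx] D_points(3)[OF gx'] t(2) by blast
    then show "\<sigma> (g, add0 x x') = add1 (\<sigma> (g, x)) (\<sigma> (g, x'))"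
      by (simp add: \<sigma>_def linear_add[OF I(3)[OF g]] linear_add[OF E(1)] vb_triv_inv_linear(1)[OF E1(1) t1 t(3,5) t'(5)])
  next
    fix g x r assume gx: "(g, x) \<in> D" and g: "g \<in> O'"
    note t = tau[OF gx g]
    have "\<tau>0 (sc0 r x) = r *\<^sub>R \<tau>0 x" using d0(11) D_points(3)[OF gx] t(2) by blast
    then show "\<sigma> (g, sc0 r x) = sc1 r (\<sigma> (g, x))"
      by (simp add: \<sigma>_def linear_cmul[OF I(3)[OF g]] linear_cmul[OF E(1)] vb_triv_inv_linear(2)[OF E1(1) t1 t(3,5)])
  next
    fix x assume x: "x \<in> P0" and u: "unit G (p0 x) \<in> O'"
    let ?g = "unit G (p0 x)"
    have gx: "(?g, x) \<in> D" using x G.unit_closed[OF p0[OF x]] by (simp add: D_def)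
    note t = tau[OF gx u]
    have e: "\<theta>1 (?g, E ?g (\<tau>0 x)) = vunit V x"
      using un[OF p0[OF x] t(4,1)] d0(5)[OF x t(2)] by simp
    \<comment> \<open>At a unit the given family already splits the source map, so the correction
      \<open>I\<close> does not move the coordinate and the identity arrow is retained.\<close>
    have "S ?g (E ?g (\<tau>0 x)) = \<tau>0 x"
      unfolding S_def using q1(3)[OF E(2)[OF t(4,1)]] e V.unit_closed(2)[OF x] by simp
    then have "N ?g (\<tau>0 x) = \<tau>0 x" using q0(3)[OF t(1)] by (simp add: N_def)
    then have "I ?g (\<tau>0 x) = \<tau>0 x" using I(2)[OF u] by metis
    then show "\<sigma> (?g, x) = vunit V x" using e by (simp add: \<sigma>_def)
  qed
  then show ?thesis using that O' by blast
qed

text \<open>An arrow is a unit exactly when it equals \<open>unit G (src G g)\<close>, and the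
  coincidence set of two continuous maps into a Hausdorff space is closed. Hence near a non-unit
  arrow the condition at units can be avoided.\<close>

lemma units_closed: "openin (mtop (Arr G)) {g \<in> points (Arr G). g \<noteq> unit G (src G g)}"
proof -
  have c: "continuous_map (mtop (Arr G)) (mtop (Arr G)) (\<lambda>g. unit G (src G g))"
    using continuous_map_compose[of "mtop (Arr G)" "mtop (Obj G)" "src G" "mtop (Arr G)" "unit G"] G.smooth_maps
    unfolding smooth_map_def o_def by blast
  have "closedin (mtop (Arr G)) {g \<in> points (Arr G). id g = unit G (src G g)}"
    by (rule closedin_continuous_maps_eq[OF _ continuous_map_id c])
      (use G.mfd(2) in \<open>simp add: smooth_manifold_def\<close>)
  then have "openin (mtop (Arr G)) (points (Arr G) - {g \<in> points (Arr G). id g = unit G (src G g)})"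
    by (rule openin_diff[OF openin_topspace])
  moreover have "points (Arr G) - {g \<in> points (Arr G). id g = unit G (src G g)} = {g \<in> points (Arr G). g \<noteq> unit G (src G g)}" by auto
  ultimately show ?thesis by simp
qed

text \<open>A splitting with smooth dependence is needed only as a starting family, since it is
  corrected afterwards. What differs between the two cases is the behaviour at units: none are
  present in the first, and in the second they dictate the family.\<close>

lemma local_cleavage:
  assumes g0: "g0 \<in> points (Arr G)"
  obtains O' \<sigma> where "openin (mtop (Arr G)) O'" "g0 \<in> O'" "cleavage_on O' \<sigma>"
proof -
  have b0: "src G g0 \<in> points (base (objb V))" using G.st_closed(1)[OF g0] E0(2) by simp
  have g0B: "g0 \<in> points (base (arrb V))" using g0 E1(2) by simp
  obtain U0 L0 \<tau>0 \<theta>0 where t0: "src G g0 \<in> U0" "vb_triv (objb V) U0 L0 \<tau>0 \<theta>0" using vector_bundle_triv[OF E0(1) b0] .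
  obtain U1 L1 \<tau>1 \<theta>1 where t1: "g0 \<in> U1" "vb_triv (arrb V) U1 L1 \<tau>1 \<theta>1" using vector_bundle_triv[OF E1(1) g0B] .
  note d0 = vb_trivD[OF t0(2)] and d1 = vb_trivD[OF t1(2)]
  have oU0: "openin (mtop (Obj G)) U0" and oU1: "openin (mtop (Arr G)) U1" using d0(1) d1(1) E0(2) E1(2) by auto
  have U1p: "U1 \<subseteq> points (Arr G)" using openin_subset[OF oU1] .
  obtain q0 where q0: "linear q0" "\<And>v. q0 v \<in> L0" "\<And>v. v \<in> L0 \<Longrightarrow> q0 v = v"
    using linear_projection_exists[OF d0(2)] by metis
  obtain q1 where q1: "linear q1" "\<And>v. q1 v \<in> L1" "\<And>v. v \<in> L1 \<Longrightarrow> q1 v = v"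
    using linear_projection_exists[OF d1(2)] by metis
  define O2 where "O2 = {g \<in> U1. src G g \<in> U0}"
  have O2: "openin (mtop (Arr G)) O2"
    unfolding O2_def by (rule smooth_at_open_preimage[OF G.smooth_src oU1 oU0]) (use U1p in blast)
  show ?thesis
  proof (cases "g0 = unit G (src G g0)")
    case False
    \<comment> \<open>Without units in \<open>O1\<close> the condition at units holds
      vacuously.\<close>
    define O1 where "O1 = O2 \<inter> {g \<in> points (Arr G). g \<noteq> unit G (src G g)}"
    have O1: "openin (mtop (Arr G)) O1" unfolding O1_def using O2 units_closed by blast
    define S where "S m = \<tau>0 (vsrc V (\<theta>1 (g0, q1 m)))" for m
    have linS: "linear S" unfolding S_def by (rule src_triv_linear[OF t0(2) t1(2) q1(1,2) t1(1) t0(1)])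
    have onto: "L0 \<subseteq> S ` L1"
    proof
      fix l assume l: "l \<in> L0"
      let ?x = "\<theta>0 (src G g0, l)"
      obtain v where v: "v \<in> P1" "p1 v = g0" "vsrc V v = ?x"
        using src_fibre_surj[OF g0 d0(6,7)[OF t0(1) l]] .
      have m: "\<tau>1 v \<in> L1" "\<theta>1 (g0, \<tau>1 v) = v" using d1(4,5)[OF v(1)] v(2) t1(1) by auto
      then have "S (\<tau>1 v) = l" unfolding S_def using q1(3) v(3) d0(8)[OF t0(1) l] by simp
      then show "l \<in> S ` L1" using m by blast
    qed
    \<comment> \<open>A right inverse at \<open>g0\<close> alone; it serves as a family constant in
      \<open>g\<close>. It exists because the source map is onto on the fibre over
      \<open>g0\<close>.\<close>
    have "\<exists>R. R ` UNIV \<subseteq> L1 \<and> linear R \<and> (\<forall>v\<in>S ` L1. S (R v) = v)"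
      by (rule linear_exists_right_inverse_on[OF linS d1(2)])
    then obtain R where R: "\<And>v. R v \<in> L1" "linear R" "\<And>v. v \<in> L0 \<Longrightarrow> S (R v) = v"
      using onto by (metis UNIV_I image_subset_iff subsetD)
    show ?thesis
    proof (rule local_cleavage_from_splitting[OF t0(2) t1(2) O1, of g0 "\<lambda>g. R"])
      show "g0 \<in> O1" using False g0 t0(1) t1(1) by (simp add: O1_def O2_def)
      show "smooth_at (Arr G) O1 euc (\<lambda>h. R l) g" if "g \<in> O1" for g l
        by (rule smooth_at_const[OF G.mfd(2) _ smooth_manifold_euc]) (use that in \<open>auto simp: O1_def\<close>)
      show "\<tau>0 (vsrc V (\<theta>1 (g0, R l))) = l" if "l \<in> L0" for l
        using R(3)[OF that] q1(3)[OF R(1)] by (simp add: S_def)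
      show "\<theta>1 (unit G b, R l) = vunit V (\<theta>0 (b, l))" if "b \<in> points (Obj G)" "unit G b \<in> O1" for b l
        using that G.unit_closed(2)[of b] by (simp add: O1_def)
    qed (use R that in \<open>auto simp: O1_def O2_def\<close>)
  next
    case True
    define O1 where "O1 = {g \<in> O2. unit G (src G g) \<in> U1}"
    have O2p: "g \<in> points (Arr G)" if "g \<in> O2" for g using that U1p by (auto simp: O2_def)
    have O1: "openin (mtop (Arr G)) O1"
      unfolding O1_def
      by (rule smooth_at_open_preimage[OF _ O2 oU1], rule G.smooth_at_unit[OF G.mfd(2) G.smooth_src]) (use O2p in auto)
    \<comment> \<open>The identity arrow at a vector over the source of \<open>g\<close> lies over
      \<open>unit G (src G g)\<close>; its fibre coordinate, read over \<open>g\<close> in the same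
      trivialization, gives a smooth family that is exact whenever \<open>g\<close> is a
      unit.\<close>
    define E where "E g l = \<tau>1 (vunit V (\<theta>0 (src G g, q0 l)))" for g l
    have un: "vunit V (\<theta>0 (src G g, l)) \<in> P1" "p1 (vunit V (\<theta>0 (src G g, l))) = unit G (src G g)" if "g \<in> O1" "l \<in> L0" for g l
    proof -
      have "src G g \<in> U0" using that by (auto simp: O1_def O2_def)
      note a = d0(6,7)[OF this that(2)]
      show "vunit V (\<theta>0 (src G g, l)) \<in> P1" "p1 (vunit V (\<theta>0 (src G g, l))) = unit G (src G g)"
        using V.unit_closed(1)[OF a(1)] proj_unit[OF a(1)] a(2) by auto
    qed
    \<comment> \<open>Linearity is required for every arrow, so the family is set to zero where the
      trivializations say nothing.\<close>
    define E' where "E' g = (if g \<in> O1 then E g else (\<lambda>_. 0))" for g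
    have linE: "linear (E' g)" for g
    proof (cases "g \<in> O1")
      case g: True
      then have gg: "src G g \<in> U0" "unit G (src G g) \<in> U1" by (auto simp: O1_def O2_def)
      have "linear (E g)"
      proof (rule linearI)
        fix m m' :: 'e0 and r :: real
        note a = d0(6,7)[OF gg(1) q0(2)[of m]] and a' = d0(6,7)[OF gg(1) q0(2)[of m']]
        show "E g (m + m') = E g m + E g m'"
          unfolding E_def linear_add[OF q0(1)] vb_triv_inv_linear(1)[OF E0(1) t0(2) gg(1) q0(2) q0(2)]
          using linear_unit(1)[OF a(1) a'(1)] a a' d1(10)[OF un(1)[OF g q0(2)] un(1)[OF g q0(2)]] un(2)[OF g q0(2)] gg(2) by simp
        show "E g (r *\<^sub>R m) = r *\<^sub>R E g m"
          unfolding E_def linear_cmul[OF q0(1)] vb_triv_inv_linear(2)[OF E0(1) t0(2) gg(1) q0(2)]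
          using linear_unit(2)[OF a(1)] d1(11)[OF un(1)[OF g q0(2)]] un(2)[OF g q0(2)] gg(2) by simp
      qed
      then show ?thesis using g by (simp add: E'_def)
    qed (simp add: E'_def linear_zero)
    have g0O: "g0 \<in> O1" using t0(1) t1(1) True by (simp add: O1_def O2_def)
    have thE: "\<theta>1 (unit G b, E' (unit G b) l) = vunit V (\<theta>0 (b, l))" if b: "b \<in> points (Obj G)" "unit G b \<in> O1" "l \<in> L0" for b l
    proof -
      have s: "src G (unit G b) = b" by (rule G.unit_closed(2)[OF b(1)])
      have "unit G b \<in> U1" using b(2) by (auto simp: O1_def O2_def)
      then show ?thesis using d1(5)[OF un(1)[OF b(2,3)]] un(2)[OF b(2,3)] s q0(3)[OF b(3)] b(2) by (simp add: E'_def E_def)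
    qed
    show ?thesis
    proof (rule local_cleavage_from_splitting[OF t0(2) t1(2) O1 g0O, of E'])
      show "linear (E' g)" for g by (rule linE)
      show "\<theta>1 (unit G b, E' (unit G b) l) = vunit V (\<theta>0 (b, l))" if "b \<in> points (Obj G)" "unit G b \<in> O1" "l \<in> L0" for b l
        by (rule thE[OF that])
      show "\<tau>0 (vsrc V (\<theta>1 (g0, E' g0 l))) = l" if l: "l \<in> L0" for l
      proof -
        have "\<theta>1 (g0, E' g0 l) = vunit V (\<theta>0 (src G g0, l))"
          using thE[OF G.st_closed(1)[OF g0] _ l] True g0O by simp
        then show ?thesis using V.unit_closed(2)[OF d0(6)[OF t0(1) l]] d0(8)[OF t0(1) l] by simp
      qed
      show "E' g l \<in> L1" if g: "g \<in> O1" for g l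
      proof -
        have "unit G (src G g) \<in> U1" using g by (auto simp: O1_def)
        then show ?thesis using d1(4)[OF un(1)[OF g q0(2)]] un(2)[OF g q0(2)] g by (simp add: E'_def E_def)
      qed
      show "smooth_at (Arr G) O1 euc (\<lambda>g. E' g l) g" if g: "g \<in> O1" for g l
      proof (rule smooth_at_cong[OF _ _ g])
        have gp: "g \<in> points (Arr G)" using g O2p by (auto simp: O1_def)
        have "smooth_at (Arr G) O1 X0 (\<lambda>g. \<theta>0 (src G g, q0 l)) g"
          by (rule smooth_at_vb_point[OF E0(1) t0(2) G.mfd(2) G.smooth_src[OF gp, folded E0(2)] smooth_at_const[OF G.mfd(2) gp smooth_manifold_euc] g])
            (use q0(2) in \<open>auto simp: O1_def O2_def\<close>)
        then have "smooth_at (Arr G) O1 X1 (\<lambda>g. vunit V (\<theta>0 (src G g, q0 l))) g"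
          by (rule V.smooth_at_unit[OF G.mfd(2) _ g])
        then have "smooth_at (Arr G) O1 euc (\<lambda>g. \<tau>1 (vunit V (\<theta>0 (src G g, q0 l)))) g"
          by (rule smooth_at_vb_coord[OF E1(1) t1(2) G.mfd(2) _ g]) (use un q0(2) in \<open>auto simp: O1_def\<close>)
        then show "smooth_at (Arr G) O1 euc (\<lambda>g. E g l) g" by (simp add: E_def)
      qed (simp add: E'_def)
    qed (use that in \<open>auto simp: O1_def O2_def\<close>)
  qed
qed

section \<open>Gluing local cleavages\<close>

lemma vzero_linear:
  assumes g: "g \<in> points (Arr G)"
  shows "vzero (arrb V) g \<in> P1" "p1 (vzero (arrb V) g) = g" "v \<in> P1 \<Longrightarrow> p1 v = g \<Longrightarrow> sc1 0 v = vzero (arrb V) g"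
    "sc1 r (vzero (arrb V) g) = vzero (arrb V) g" "add1 (vzero (arrb V) g) (vzero (arrb V) g) = vzero (arrb V) g"
proof -
  have g': "g \<in> points (base (arrb V))" using g E1(2) by simp
  note z = vzero[OF E1(1) g']
  show z1: "vzero (arrb V) g \<in> P1" "p1 (vzero (arrb V) g) = g" "v \<in> P1 \<Longrightarrow> p1 v = g \<Longrightarrow> sc1 0 v = vzero (arrb V) g"
    using z by auto
  have z0: "sc1 0 (vzero (arrb V) g) = vzero (arrb V) g" by (rule z(3)[OF z(1,2)])
  show "sc1 r (vzero (arrb V) g) = vzero (arrb V) g"
  proof -
    have "sc1 r (sc1 0 (vzero (arrb V) g)) = sc1 0 (vzero (arrb V) g)"
      by (rule vb_eqI[OF E1(1)]) (simp_all add: vb_closed[OF E1(1)] z1)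
    then show ?thesis using z0 by simp
  qed
  show "add1 (vzero (arrb V) g) (vzero (arrb V) g) = vzero (arrb V) g"
    using vb_algebra(3)[OF E1(1) z(1) z(1)] z0 by simp
qed

lemma src_vzero:
  assumes g: "g \<in> points (Arr G)" and x: "x \<in> P0" "p0 x = src G g"
  shows "vsrc V (vzero (arrb V) g) = sc0 0 x"
proof -
  note z = vzero_linear[OF g]
  have b: "src G g \<in> points (base (objb V))" using G.st_closed(1)[OF g] E0(2) by simp
  have "vsrc V (vzero (arrb V) g) = vsrc V (sc1 0 (vzero (arrb V) g))" using z(4) by simp
  also have "\<dots> = sc0 0 (vsrc V (vzero (arrb V) g))" by (rule linear_src(2)[OF z(1)])
  also have "\<dots> = vzero (objb V) (src G g)"
    by (rule vzero(3)[OF E0(1) b V.st_closed(1)[OF z(1)]]) (use proj_src[OF z(1)] z(2) in simp)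
  also have "\<dots> = sc0 0 x" using vzero(3)[OF E0(1) b x] by simp
  finally show ?thesis .
qed

lemma open_PM: "openin (mtop (Arr G)) O' \<Longrightarrow> openin (mtop PM) (O' \<times> P0)"
  by (simp add: prod_manifold_def openin_prod_Times_iff)

text \<open>Convexity enters through the source and the units: the weighted sum has source
  \<open>x\<close>, and equals the identity arrow at a unit, because the weights add up to one.
  Partial sums are formed by recursion from a zero vector, as addition in \<open>V\<close> makes
  sense only within a fibre.\<close>

lemma global_cleavage: obtains \<sigma> where "cleavage_on (points (Arr G)) \<sigma>"
proof (cases "points (Arr G) = {}")
  case True
  then show ?thesis using that by (simp add: cleavage_on_def)
next
  case False
  show ?thesis
  proof (rule smooth_partition[OF G.mfd(2) False, where P="\<lambda>O'. \<exists>\<sigma>. cleavage_on O' \<sigma>"])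
  show "\<exists>O'. openin (mtop (Arr G)) O' \<and> g \<in> O' \<and> (\<exists>\<sigma>. cleavage_on O' \<sigma>)" if g: "g \<in> points (Arr G)" for g
    by (rule local_cleavage[OF g]) blast
  next
  fix f :: "nat \<Rightarrow> 'g1 \<Rightarrow> real" and C W assume
    f: "\<And>n y. y \<in> points (Arr G) \<Longrightarrow> smooth_at (Arr G) (points (Arr G)) euc (f n) y"
    and W: "\<And>n. openin (mtop (Arr G)) (W n)" "\<And>n. \<exists>\<sigma>. cleavage_on (W n) \<sigma>"
    and C: "\<And>n. closedin (mtop (Arr G)) (C n)" "\<And>n. C n \<subseteq> W n" "\<And>n y. y \<notin> C n \<Longrightarrow> f n y = 0"
    and fin: "\<And>x. x \<in> points (Arr G) \<Longrightarrow> \<exists>O' N. openin (mtop (Arr G)) O' \<and> x \<in> O' \<and> (\<forall>y\<in>O'. (\<forall>n\<ge>N. f n y = 0) \<and> (\<Sum>i<N. f i y) = 1)"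
  obtain t where t: "\<And>n. cleavage_on (W n) (t n)" using W(2) by metis
  \<comment> \<open>Outside \<open>W n\<close> the local cleavage has no meaning; the zero vector
    keeps the sum in the right fibre, and the weight \<open>f n\<close> vanishes there.\<close>
  define t' where "t' n z = (if fst z \<in> W n then t n z else vzero (arrb V) (fst z))" for n z
  define sg where "sg = rec_nat (\<lambda>z :: 'g1 \<times> 'v0. vzero (arrb V) (fst z)) (\<lambda>n s z. add1 (s z) (sc1 (f n (fst z)) (t' n z)))"
  have sg0: "sg 0 z = vzero (arrb V) (fst z)" and sgS: "sg (Suc n) z = add1 (sg n z) (sc1 (f n (fst z)) (t' n z))" for n z
    by (simp_all add: sg_def)
  have t1: "t n (g, x) \<in> P1" "p1 (t n (g, x)) = g" "vsrc V (t n (g, x)) = x" "smooth_at PM (D \<inter> W n \<times> UNIV) X1 (t n) (g, x)"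
    if "(g, x) \<in> D" "g \<in> W n" for n g x
    using t[of n] that unfolding cleavage_on_def by blast+
  have t'P: "t' n (g, x) \<in> P1" "p1 (t' n (g, x)) = g" if gx: "(g, x) \<in> D" for n g x
    using t1[OF gx] vzero_linear(1,2)[OF D_points(2)[OF gx]] by (auto simp: t'_def)
  have sgP: "sg n (g, x) \<in> P1 \<and> p1 (sg n (g, x)) = g" if gx: "(g, x) \<in> D" for n g x
    by (induction n) (use vzero_linear(1,2)[OF D_points(2)[OF gx]] t'P[OF gx] in \<open>simp_all add: sg0 sgS vb_closed[OF E1(1)]\<close>)
  have f0: "f n g = 0" if "g \<notin> W n" for n g using C that by blast
  have srcterm: "vsrc V (sc1 (f n g) (t' n (g, x))) = sc0 (f n g) x" if gx: "(g, x) \<in> D" for n g x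
  proof (cases "g \<in> W n")
    case True
    then show ?thesis using linear_src(2)[OF t1(1)[OF gx True]] t1(3)[OF gx True] by (simp add: t'_def)
  next
    case False
    then show ?thesis using f0[OF False] vzero_linear(4)[OF D_points(2)[OF gx]] src_vzero[OF D_points(2,3)[OF gx]] D_points(4)[OF gx]
      by (simp add: t'_def)
  qed
  have sgsrc: "vsrc V (sg n (g, x)) = sc0 (\<Sum>i<n. f i g) x" if gx: "(g, x) \<in> D" for n g x
  proof (induction n)
    case 0
    then show ?case using src_vzero[OF D_points(2,3)[OF gx]] D_points(4)[OF gx] by (simp add: sg0)
  next
    case (Suc n)
    have "vsrc V (sg (Suc n) (g, x)) = add0 (vsrc V (sg n (g, x))) (vsrc V (sc1 (f n g) (t' n (g, x))))"
      using linear_src(1) sgP[OF gx] t'P[OF gx] vb_closed[OF E1(1)] by (simp add: sgS)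
    then show ?case using Suc srcterm[OF gx] vb_algebra(1)[OF E0(1) D_points(3)[OF gx]] by simp
  qed
  have stab: "sg (Suc n) (g, x) = sg n (g, x)" if gx: "(g, x) \<in> D" and "f n g = 0" for n g x
    using vb_algebra(3)[OF E1(1), of "sg n (g, x)" "t' n (g, x)"] sgP[OF gx] t'P[OF gx] that(2) by (simp add: sgS)
  have sgsm: "smooth_at PM D X1 (sg n) (g, x)" if gx: "(g, x) \<in> D" for n g x
  proof (induction n)
    case 0
    have "smooth_at PM D X1 (\<lambda>z. vzero (arrb V) (fst z)) (g, x)"
      by (rule smooth_at_vzero[OF E1(1) PM _ gx]) (use smooth_at_fst[OF G.mfd(2) V.mfd(1) D_points(1)[OF gx]] E1(2) in simp)
    then show ?case by (simp add: sg0[abs_def])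
  next
    case (Suc n)
    have gP: "(g, x) \<in> points (Arr G) \<times> P0" using D_points(1)[OF gx] .
    \<comment> \<open>Over \<open>W n\<close> the new summand is smooth. Outside \<open>W n\<close>
      the arrow has a neighbourhood off the closed set \<open>C n\<close>, where the new summand is
      zero and the partial sum does not change.\<close>
    show ?case
    proof (cases "g \<in> W n")
      case True
      let ?S = "D \<inter> (W n \<times> P0)"
      have zS: "(g, x) \<in> ?S" using gx True D_points by blast
      have sub: "?S \<subseteq> D" "?S \<subseteq> D \<inter> W n \<times> UNIV" by auto
      have ff: "smooth_at PM ?S euc (\<lambda>z. f n (fst z)) (g, x)"
        by (rule smooth_at_compose[OF PM G.mfd(2) smooth_manifold_euc smooth_at_fst[OF G.mfd(2) V.mfd(1) gP] _ zS, of "points (Arr G)"])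
          (use f gP D_points in auto)
      have "smooth_at PM ?S X1 (\<lambda>z. add1 (sg n z) (sc1 (f n (fst z)) (t n z))) (g, x)"
      proof (rule smooth_at_vb_lin[OF E1(1) PM smooth_at_mono[OF Suc sub(1)] smooth_at_mono[OF t1(4)[OF gx True] sub(2)] ff zS])
        fix z assume "z \<in> ?S"
        then show "sg n z \<in> P1 \<and> t n z \<in> P1 \<and> p1 (sg n z) = p1 (t n z)"
          using sgP[of "fst z" "snd z"] t1(1,2)[of "fst z" "snd z"] by (cases z) auto
      qed
      then have "smooth_at PM ?S X1 (sg (Suc n)) (g, x)"
        by (rule smooth_at_cong[OF _ _ zS]) (auto simp: sgS t'_def)
      then show ?thesis by (rule smooth_at_local[OF _ open_PM[OF W(1)]]) (use zS in blast)
    next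
      case False
      let ?O = "points (Arr G) - C n"
      have o: "openin (mtop (Arr G)) ?O" using C(1) by (simp add: closedin_def)
      have gO: "(g, x) \<in> ?O \<times> P0" using gP False C(2) by blast
      then have zS: "(g, x) \<in> D \<inter> ?O \<times> P0" using gx by blast
      have "smooth_at PM (D \<inter> ?O \<times> P0) X1 (sg n) (g, x)" by (rule smooth_at_mono[OF Suc]) blast
      then have "smooth_at PM (D \<inter> ?O \<times> P0) X1 (sg (Suc n)) (g, x)"
        by (rule smooth_at_cong[OF _ _ zS]) (use stab C(3) in auto)
      then show ?thesis by (rule smooth_at_local[OF _ open_PM[OF o] gO])
    qed
  qed
  have sgadd: "sg n (g, add0 x x') = add1 (sg n (g, x)) (sg n (g, x'))" if gx: "(g, x) \<in> D" "(g, x') \<in> D" for n g x x'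
  proof (induction n)
    case 0
    then show ?case using vzero_linear(5)[OF D_points(2)[OF gx(1)]] by (simp add: sg0)
  next
    case (Suc n)
    have "t' n (g, add0 x x') = add1 (t' n (g, x)) (t' n (g, x'))"
      using t[of n] gx vzero_linear(5)[OF D_points(2)[OF gx(1)]] unfolding t'_def cleavage_on_def by auto
    then show ?case
      using Suc vb_algebra(5)[OF E1(1), of "sg n (g, x)" "sg n (g, x')" "t' n (g, x)" "t' n (g, x')"]
        sgP[OF gx(1)] sgP[OF gx(2)] t'P[OF gx(1)] t'P[OF gx(2)] by (simp add: sgS)
  qed
  have sgsc: "sg n (g, sc0 r x) = sc1 r (sg n (g, x))" if gx: "(g, x) \<in> D" for n g x r
  proof (induction n)
    case 0
    then show ?case using vzero_linear(4)[OF D_points(2)[OF gx]] by (simp add: sg0)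
  next
    case (Suc n)
    have "t' n (g, sc0 r x) = sc1 r (t' n (g, x))"
      using t[of n] gx vzero_linear(4)[OF D_points(2)[OF gx]] unfolding t'_def cleavage_on_def by auto
    then show ?case
      using Suc vb_algebra(4)[OF E1(1), of "sg n (g, x)" "t' n (g, x)"] sgP[OF gx] t'P[OF gx] by (simp add: sgS)
  qed
  have sgun: "sg n (unit G (p0 x), x) = sc1 (\<Sum>i<n. f i (unit G (p0 x))) (vunit V x)" if x: "x \<in> P0" for n x
  proof -
    let ?u = "unit G (p0 x)"
    have ux: "(?u, x) \<in> D" using x G.unit_closed[OF p0[OF x]] by (simp add: D_def)
    have vu: "vunit V x \<in> P1" "p1 (vunit V x) = ?u" using V.unit_closed(1)[OF x] proj_unit[OF x] by auto
    show ?thesis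
    proof (induction n)
      case 0
      then show ?case using vzero_linear(3)[OF D_points(2)[OF ux] vu] by (simp add: sg0)
    next
      case (Suc n)
      show ?case
      proof (cases "?u \<in> W n")
        case True
        then have "t' n (?u, x) = vunit V x" using t[of n] x unfolding t'_def cleavage_on_def by auto
        then show ?thesis using Suc vb_algebra(1)[OF E1(1) vu(1)] by (simp add: sgS)
      next
        case False
        then show ?thesis using Suc stab[OF ux f0[OF False]] f0[OF False] by simp
      qed
    qed
  qed
  \<comment> \<open>The index at which the partial sums become constant depends on the arrow. Any
    later index gives the same value, so near a point one common index, and hence one smooth partial
    sum, may be used.\<close>
  define N where "N g = (LEAST N. \<forall>n\<ge>N. f n g = 0)" for g
  have stabN: "sg m (g, x) = sg N' (g, x) \<and> (\<Sum>i<m. f i g) = (\<Sum>i<N'. f i g)" if gx: "(g, x) \<in> D" and N': "\<forall>n\<ge>N'. f n g = 0" "m \<ge> N'" for g x N' m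
    using N'(2)
  proof (induction m rule: dec_induct)
    case (step m)
    then show ?case using stab[OF gx, of m] N'(1) by simp
  qed simp
  define \<sigma> where "\<sigma> z = sg (N (fst z)) z" for z
  have \<sigma>N: "\<sigma> (g, x) = sg N' (g, x)" if gx: "(g, x) \<in> D" and N': "\<forall>n\<ge>N'. f n g = 0" for g x N'
  proof -
    have 1: "\<forall>n\<ge>N g. f n g = 0" unfolding N_def by (rule LeastI) (rule N')
    have "N g \<le> N'" unfolding N_def by (rule Least_le) (rule N')
    from conjunct1[OF stabN[OF gx 1 this]] show ?thesis unfolding \<sigma>_def fst_conv by (rule sym)
  qed
  have ex: "\<exists>N'. (\<forall>n\<ge>N'. f n g = 0) \<and> (\<Sum>i<N'. f i g) = 1" if "g \<in> points (Arr G)" for g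
    using fin[OF that] by blast
  have "cleavage_on (points (Arr G)) \<sigma>"
    unfolding cleavage_on_def
  proof (intro conjI allI impI ballI)
    fix g x assume gx: "(g, x) \<in> D" and g: "g \<in> points (Arr G)"
    obtain O' N' where O': "openin (mtop (Arr G)) O'" "g \<in> O'" "\<And>y. y \<in> O' \<Longrightarrow> (\<forall>n\<ge>N'. f n y = 0) \<and> (\<Sum>i<N'. f i y) = 1"
      using fin[OF g] by metis
    have s: "\<sigma> (y, z) = sg N' (y, z)" if "(y, z) \<in> D" "y \<in> O'" for y z using \<sigma>N[OF that(1)] O'(3)[OF that(2)] by blast
    show "\<sigma> (g, x) \<in> P1" "p1 (\<sigma> (g, x)) = g" using s[OF gx O'(2)] sgP[OF gx] by auto
    show "vsrc V (\<sigma> (g, x)) = x"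
      using s[OF gx O'(2)] sgsrc[OF gx] O'(3)[OF O'(2)] vb_algebra(2)[OF E0(1) D_points(3)[OF gx]] by simp
    have eq: "D \<inter> points (Arr G) \<times> UNIV = D" using D_points by blast
    have zS: "(g, x) \<in> D \<inter> O' \<times> P0" using gx O' D_points by blast
    have "smooth_at PM (D \<inter> O' \<times> P0) X1 (sg N') (g, x)" by (rule smooth_at_mono[OF sgsm[OF gx]]) blast
    then have "smooth_at PM (D \<inter> O' \<times> P0) X1 \<sigma> (g, x)"
      by (rule smooth_at_cong[OF _ _ zS]) (use s in auto)
    then show "smooth_at PM (D \<inter> points (Arr G) \<times> UNIV) X1 \<sigma> (g, x)"
      unfolding eq by (rule smooth_at_local[OF _ open_PM[OF O'(1)]]) (use zS in blast)
  next
    fix g x x' assume gx: "(g, x) \<in> D" "(g, x') \<in> D" "g \<in> points (Arr G)"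
    have gxx: "(g, add0 x x') \<in> D"
      using gx vb_closed(3,4)[OF E0(1), of x x'] by (auto simp: D_def)
    obtain N' where "\<forall>n\<ge>N'. f n g = 0" using ex[OF gx(3)] by blast
    then show "\<sigma> (g, add0 x x') = add1 (\<sigma> (g, x)) (\<sigma> (g, x'))"
      using \<sigma>N[OF gx(1)] \<sigma>N[OF gx(2)] \<sigma>N[OF gxx] sgadd[OF gx(1,2)] by simp
  next
    fix g x r assume gx: "(g, x) \<in> D" "g \<in> points (Arr G)"
    have gxx: "(g, sc0 r x) \<in> D"
      using gx vb_closed(1,2)[OF E0(1), of x] by (auto simp: D_def)
    obtain N' where "\<forall>n\<ge>N'. f n g = 0" using ex[OF gx(2)] by blast
    then show "\<sigma> (g, sc0 r x) = sc1 r (\<sigma> (g, x))"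
      using \<sigma>N[OF gx(1)] \<sigma>N[OF gxx] sgsc[OF gx(1)] by simp
  next
    fix x assume x: "x \<in> P0" and u: "unit G (p0 x) \<in> points (Arr G)"
    have ux: "(unit G (p0 x), x) \<in> D" using x G.unit_closed[OF p0[OF x]] by (simp add: D_def)
    obtain N' where N': "\<forall>n\<ge>N'. f n (unit G (p0 x)) = 0" "(\<Sum>i<N'. f i (unit G (p0 x))) = 1" using ex[OF u] by blast
    then show "\<sigma> (unit G (p0 x), x) = vunit V x"
      using \<sigma>N[OF ux N'(1)] sgun[OF x] vb_algebra(2)[OF E1(1) V.unit_closed(1)[OF x]] by simp
  qed
  then show ?thesis by (rule that)
  qed
qed

end

section \<open>Transport of the arrow bundle along a bijection\<close>

text \<open>The linear embedding \<open>\<iota>\<close>, with left inverse \<open>\<kappa>\<close>, carries the typical fibres of \<open>V\<close> to the coordinate space of \<open>MA\<close>.\<close>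

locale vbg_transport = vb_gpd G V
  for G :: "('g0, 'd0::euclidean_space, 'g1, 'd1::euclidean_space) groupoid"
    and V :: "('v0, 'e0::euclidean_space, 'g0, 'd0, 'v1, 'e1::euclidean_space, 'g1, 'd1) vbg" +
  fixes MA :: "('w, 'm::euclidean_space) manifold" and SA :: "'w set" and \<Psi> :: "'w \<Rightarrow> 'v1" and J :: "'v1 \<Rightarrow> 'w"
    and W :: "('v0, 'e0, 'g0, 'd0, 'w, 'm, 'g1, 'd1) vbg" and \<iota> :: "'e1 \<Rightarrow> 'm" and \<kappa> :: "'m \<Rightarrow> 'e1"
  assumes MA: "smooth_manifold MA" and SA: "SA \<subseteq> points MA"
    and \<Psi>: "\<And>a. a \<in> SA \<Longrightarrow> \<Psi> a \<in> P1" "\<And>a. a \<in> SA \<Longrightarrow> J (\<Psi> a) = a" "\<And>a. a \<in> SA \<Longrightarrow> smooth_at MA SA X1 \<Psi> a"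
    and J: "\<And>w. w \<in> P1 \<Longrightarrow> J w \<in> SA" "\<And>w. w \<in> P1 \<Longrightarrow> \<Psi> (J w) = w" "\<And>w. w \<in> P1 \<Longrightarrow> smooth_at X1 P1 MA J w"
    and W: "objb W = objb V" "total (arrb W) = submanifold MA SA" "base (arrb W) = Arr G"
    and W1: "\<And>a. a \<in> SA \<Longrightarrow> proj (arrb W) a = p1 (\<Psi> a)" "\<And>a. a \<in> SA \<Longrightarrow> vsrc W a = vsrc V (\<Psi> a)"
      "\<And>a. a \<in> SA \<Longrightarrow> vtgt W a = vtgt V (\<Psi> a)" "\<And>x. x \<in> P0 \<Longrightarrow> vunit W x = J (vunit V x)"
      "\<And>r a. a \<in> SA \<Longrightarrow> vscale (arrb W) r a = J (sc1 r (\<Psi> a))"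
    and W2: "\<And>a b. a \<in> SA \<Longrightarrow> b \<in> SA \<Longrightarrow> vsrc V (\<Psi> a) = vtgt V (\<Psi> b) \<Longrightarrow> vmult W a b = J (vmult V (\<Psi> a) (\<Psi> b))"
      "\<And>a b. a \<in> SA \<Longrightarrow> b \<in> SA \<Longrightarrow> p1 (\<Psi> b) = p1 (\<Psi> a) \<Longrightarrow> vadd (arrb W) a b = J (add1 (\<Psi> a) (\<Psi> b))"
    and \<iota>: "linear \<iota>" "linear \<kappa>" "\<And>l. \<kappa> (\<iota> l) = l"
begin

lemma embedded_SA: "embedded MA SA"
proof (rule embedded_retract[OF MA SA])
  fix a assume a: "a \<in> SA"
  \<comment> \<open>\<Psi> is smooth only relative to \<open>SA\<close>; it is extended to an open
    set first, and \<open>J\<close>, defined on all of \<open>P1\<close>, brings the extended values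
    back into \<open>SA\<close>.\<close>
  obtain O' h where O': "openin (mtop MA) O'" "a \<in> O'" "\<And>y. y \<in> O' \<Longrightarrow> smooth_at MA O' X1 h y" "\<And>y. y \<in> SA \<Longrightarrow> y \<in> O' \<Longrightarrow> h y = \<Psi> y"
    using smooth_at_extend[OF MA V.mfd(2) \<Psi>(3)[OF a] a] by blast
  have h: "h y \<in> P1" if "y \<in> O'" for y using smooth_at_points[OF O'(3)[OF that]] by blast
  have "smooth_at MA O' MA (\<lambda>y. J (h y)) a"
    by (rule smooth_at_compose[OF MA V.mfd(2) MA O'(3)[OF O'(2)] J(3)[OF h[OF O'(2)]] O'(2)]) (use h in blast)
  moreover have "(\<lambda>y. J (h y)) ` O' \<subseteq> SA" using h J(1) by blast
  moreover have "\<forall>y\<in>O' \<inter> SA. J (h y) = y" using O'(4) \<Psi>(2) by simp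
  ultimately show "\<exists>O' r. openin (mtop MA) O' \<and> a \<in> O' \<and> smooth_at MA O' MA r a \<and> r ` O' \<subseteq> SA \<and> (\<forall>y\<in>O' \<inter> SA. r y = y)"
    using O'(1,2) by blast
qed

abbreviation "XA \<equiv> submanifold MA SA"

lemma XA: "smooth_manifold XA" "points XA = SA"
  by (rule smooth_manifold_submanifold[OF MA embedded_SA], rule embedded_points[OF embedded_SA])

lemma smooth_map_Psi: "smooth_map XA X1 \<Psi>"
  by (rule smooth_map_submanifoldI[OF MA V.mfd(2) \<Psi>(3)])

lemma smooth_map_J: "smooth_map X1 XA J"
  by (rule smooth_map_into_submanifoldI[OF V.mfd(2) MA embedded_SA J(3,1)])

lemma smooth_at_Psi:
  assumes "smooth_manifold M" "smooth_at M S XA f x" "x \<in> S"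
  shows "smooth_at M S X1 (\<lambda>y. \<Psi> (f y)) x"
  using smooth_at_compose[OF assms(1) XA(1) V.mfd(2) assms(2)
      smooth_map_smooth_at[OF XA(1) V.mfd(2) smooth_map_Psi, of _ UNIV] assms(3)] smooth_at_points[OF assms(2)] by blast

lemma smooth_at_J:
  assumes "smooth_manifold M" "smooth_at M S X1 f x" "x \<in> S"
  shows "smooth_at M S XA (\<lambda>y. J (f y)) x"
  using smooth_at_compose[OF assms(1) V.mfd(2) XA(1) assms(2)
      smooth_map_smooth_at[OF V.mfd(2) XA(1) smooth_map_J, of _ UNIV] assms(3)] smooth_at_points[OF assms(2)] by blast

lemma smooth_map_comp_Psi:
  assumes N: "smooth_manifold N" and f: "smooth_map X1 N f" and h: "\<And>a. a \<in> SA \<Longrightarrow> h a = f (\<Psi> a)"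
  shows "smooth_map XA N h"
  unfolding smooth_map_iff[OF XA(1) N] XA(2)
proof
  fix a assume a: "a \<in> SA"
  have p: "smooth_at XA SA X1 \<Psi> a" by (rule smooth_map_smooth_at[OF XA(1) V.mfd(2) smooth_map_Psi]) (simp add: XA(2) a)
  have "smooth_at XA SA N (\<lambda>a. f (\<Psi> a)) a"
    by (rule smooth_at_compose[OF XA(1) V.mfd(2) N p smooth_map_smooth_at[OF V.mfd(2) N f \<Psi>(1)[OF a], of UNIV] a]) simp
  then show "smooth_at XA SA N h a" by (rule smooth_at_cong[OF _ _ a]) (simp add: h)
qed

lemma smooth_map_J_comp:
  assumes N: "smooth_manifold N" and f: "smooth_map N X1 f" and h: "\<And>a. a \<in> points N \<Longrightarrow> h a = J (f a)"
  shows "smooth_map N XA h"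
  unfolding smooth_map_iff[OF N XA(1)]
proof
  fix a assume a: "a \<in> points N"
  have "smooth_at N (points N) XA (\<lambda>a. J (f a)) a"
    by (rule smooth_at_J[OF N smooth_map_smooth_at[OF N V.mfd(2) f a] a])
  then show "smooth_at N (points N) XA h a" by (rule smooth_at_cong[OF _ _ a]) (simp add: h)
qed

text \<open>By \<open>submersionI\<close> only local sections are needed, and composing a section of
  \<open>f\<close> with \<open>J\<close> gives one of the composite.\<close>

lemma submersion_comp_Psi:
  assumes f: "submersion X1 X0 f" and h: "\<And>a. a \<in> SA \<Longrightarrow> h a = f (\<Psi> a)"
  shows "submersion XA X0 h"
proof (rule submersionI[OF XA(1) V.mfd(1)])
  have "smooth_map X1 X0 f" using f by (simp add: submersion_def)
  then show "smooth_map XA X0 h" by (rule smooth_map_comp_Psi[OF V.mfd(1)]) (rule h)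
  fix a assume "a \<in> points XA"
  then have a: "a \<in> SA" by (simp add: XA(2))
  obtain O' c where c: "openin (mtop X0) O'" "f (\<Psi> a) \<in> O'" "smooth_at X0 O' X1 c (f (\<Psi> a))" "c (f (\<Psi> a)) = \<Psi> a"
    "\<forall>n\<in>O'. c n \<in> P1 \<and> f (c n) = n"
    using submersion_local_section[OF V.mfd(2,1) f \<Psi>(1)[OF a]] by metis
  have "smooth_at X0 O' XA (\<lambda>n. J (c n)) (f (\<Psi> a))" by (rule smooth_at_J[OF V.mfd(1) c(3,2)])
  then show "\<exists>O' c. openin (mtop X0) O' \<and> h a \<in> O' \<and> smooth_at X0 O' XA c (h a) \<and> c (h a) = a \<and> (\<forall>n\<in>O'. h (c n) = n)"
    using c J \<Psi>(2)[OF a] by (intro exI[of _ O'] exI[of _ "\<lambda>n. J (c n)"]) (simp add: h a)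
qed

section \<open>\<open>W\<close> as a VB-groupoid isomorphic to \<open>V\<close>\<close>

lemma Psi_ops:
  shows "x \<in> P0 \<Longrightarrow> vunit W x \<in> SA" "x \<in> P0 \<Longrightarrow> \<Psi> (vunit W x) = vunit V x"
    "a \<in> SA \<Longrightarrow> vscale (arrb W) r a \<in> SA" "a \<in> SA \<Longrightarrow> \<Psi> (vscale (arrb W) r a) = sc1 r (\<Psi> a)"
    "a \<in> SA \<Longrightarrow> b \<in> SA \<Longrightarrow> vsrc V (\<Psi> a) = vtgt V (\<Psi> b) \<Longrightarrow> vmult W a b \<in> SA"
    "a \<in> SA \<Longrightarrow> b \<in> SA \<Longrightarrow> vsrc V (\<Psi> a) = vtgt V (\<Psi> b) \<Longrightarrow> \<Psi> (vmult W a b) = vmult V (\<Psi> a) (\<Psi> b)"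
    "a \<in> SA \<Longrightarrow> b \<in> SA \<Longrightarrow> p1 (\<Psi> b) = p1 (\<Psi> a) \<Longrightarrow> vadd (arrb W) a b \<in> SA"
    "a \<in> SA \<Longrightarrow> b \<in> SA \<Longrightarrow> p1 (\<Psi> b) = p1 (\<Psi> a) \<Longrightarrow> \<Psi> (vadd (arrb W) a b) = add1 (\<Psi> a) (\<Psi> b)"
  using W1(4,5) W2 J(1,2) \<Psi>(1) V.unit_closed(1)[of x] vb_closed[OF E1(1), of "\<Psi> a"] V.mult_closed(1)[of "\<Psi> a" "\<Psi> b"] by simp_all

lemma algebraic_W: "algebraic_groupoid (total_groupoid W)"
  and ginv_W: "a \<in> SA \<Longrightarrow> ginv (total_groupoid W) a = J (vinv (\<Psi> a))"
proof -
  note * = algebraic_transfer[of "total_groupoid V" "total_groupoid W" \<Psi> "\<lambda>a. J (vinv (\<Psi> a))", simplified, unfolded W(1,2) XA(2)]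
  have inj: "inj_on \<Psi> SA" using \<Psi>(2) by (rule inj_on_inverseI)
  show "algebraic_groupoid (total_groupoid W)"
    by (rule *(1)) (use V.alg inj Psi_ops W1(2,3) \<Psi>(1) J(1,2) V.ginv(1) in auto)
  show "a \<in> SA \<Longrightarrow> ginv (total_groupoid W) a = J (vinv (\<Psi> a))"
    by (rule *(2)) (use V.alg inj Psi_ops W1(2,3) \<Psi>(1) J(1,2) V.ginv(1) in auto)
qed

definition CA :: "('w \<times> 'w) set" where
  "CA = {(a, b). a \<in> SA \<and> b \<in> SA \<and> vsrc V (\<Psi> a) = vtgt V (\<Psi> b)}"

lemma composable_W: "composable_pairs (total_groupoid W) = submanifold (prod_manifold XA XA) CA"
  "points (composable_pairs (total_groupoid W)) = CA"
proof -
  have "{(a, b). a \<in> SA \<and> b \<in> SA \<and> vsrc W a = vtgt W b} = CA" using W1(2,3) by (auto simp: CA_def)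
  then show e: "composable_pairs (total_groupoid W) = submanifold (prod_manifold XA XA) CA"
    by (simp add: composable_pairs_def W(2) XA(2))
  show "points (composable_pairs (total_groupoid W)) = CA"
    unfolding e by (rule points_submanifold) (auto simp: CA_def XA(2))
qed

lemma smooth_mult_W: "smooth_map (composable_pairs (total_groupoid W)) XA (\<lambda>(a, b). vmult W a b)"
  unfolding composable_W(1)
proof (rule smooth_map_submanifoldI)
  show AA: "smooth_manifold (prod_manifold XA XA)" by (rule smooth_manifold_prod[OF XA(1) XA(1)])
  show "smooth_manifold XA" by (rule XA(1))
  fix z assume z: "z \<in> CA"
  then have zp: "z \<in> points XA \<times> points XA" by (auto simp: CA_def XA(2))
  have "smooth_at (prod_manifold XA XA) CA X1 (\<lambda>z. vmult V (\<Psi> (fst z)) (\<Psi> (snd z))) z"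
    by (rule V.smooth_at_mult[OF AA smooth_at_Psi[OF AA smooth_at_fst[OF XA(1) XA(1) zp] z] smooth_at_Psi[OF AA smooth_at_snd[OF XA(1) XA(1) zp] z] z])
      (auto simp: CA_def \<Psi>(1))
  then have "smooth_at (prod_manifold XA XA) CA XA (\<lambda>z. J (vmult V (\<Psi> (fst z)) (\<Psi> (snd z)))) z"
    by (rule smooth_at_J[OF AA _ z])
  then show "smooth_at (prod_manifold XA XA) CA XA (\<lambda>(a, b). vmult W a b) z"
    by (rule smooth_at_cong[OF _ _ z]) (auto simp: CA_def W2(1))
qed

lemma smooth_maps_W:
  "submersion XA X0 (vsrc W)" "submersion XA X0 (vtgt W)" "smooth_map X0 XA (vunit W)"
  "smooth_map XA XA (ginv (total_groupoid W))" "smooth_map XA (Arr G) (proj (arrb W))"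
proof -
  have "submersion X1 X0 (vsrc V)" "submersion X1 X0 (vtgt V)" using V.lie by (simp_all add: lie_groupoid_def)
  then show "submersion XA X0 (vsrc W)" "submersion XA X0 (vtgt W)" using submersion_comp_Psi W1(2,3) by blast+
  show "smooth_map X0 XA (vunit W)" by (rule smooth_map_J_comp[OF V.mfd(1)]) (use V.smooth_maps(3) W1(4) in simp_all)
  have "smooth_map XA X1 (\<lambda>a. vinv (\<Psi> a))" by (rule smooth_map_comp_Psi[OF V.mfd(2) V.smooth_maps(4)]) simp
  then show "smooth_map XA XA (ginv (total_groupoid W))" by (rule smooth_map_J_comp[OF XA(1)]) (simp add: XA(2) ginv_W)
  have "smooth_map X1 (Arr G) p1" using vector_bundleD(3)[OF E1(1)] E1(2) by simp
  then show "smooth_map XA (Arr G) (proj (arrb W))" by (rule smooth_map_comp_Psi[OF G.mfd(2)]) (rule W1(1))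
qed

lemma lie_groupoid_W: "lie_groupoid (total_groupoid W)"
  unfolding lie_groupoid_def
  using algebraic_W V.mfd(1) XA(1) smooth_maps_W smooth_mult_W by (simp add: W(1,2))

lemma vector_bundle_W: "vector_bundle (arrb W)"
proof (rule vector_bundleI)
  show "smooth_manifold (total (arrb W))" "smooth_manifold (base (arrb W))" "smooth_map (total (arrb W)) (base (arrb W)) (proj (arrb W))"
    using XA(1) G.mfd(2) smooth_maps_W(5) by (simp_all add: W)
  fix b assume "b \<in> points (base (arrb W))"
  then have b: "b \<in> points (base (arrb V))" by (simp add: W E1(2))
  show "real_vector_space_on (fibre (arrb W) b) (vadd (arrb W)) (vscale (arrb W))"
    by (rule real_vector_space_on_transfer[OF vector_bundleD(4)[OF E1(1) b], where \<Psi>=\<Psi> and J=J])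
      (auto simp: fibre_def W(2) XA(2) \<Psi>(1,2) J(1,2) W1(1,5) W2(2))
  obtain U1 L1 \<tau>1 \<theta>1 where t1: "b \<in> U1" "vb_triv (arrb V) U1 L1 \<tau>1 \<theta>1" using vector_bundle_triv[OF E1(1) b] .
  note d1 = vb_trivD[OF t1(2)]
  define L where "L = \<iota> ` L1"
  define \<tau> where "\<tau> a = \<iota> (\<tau>1 (\<Psi> a))" for a
  define \<theta> where "\<theta> z = J (\<theta>1 (fst z, \<kappa> (snd z)))" for z
  have L: "\<kappa> l \<in> L1" "\<iota> (\<kappa> l) = l" if "l \<in> L" for l using that \<iota>(3) by (auto simp: L_def)
  have sL: "subspace L" unfolding L_def by (rule linear_subspace_image[OF \<iota>(1) d1(2)])
  let ?S = "{a \<in> SA. proj (arrb W) a \<in> U1}"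
  note GE = smooth_manifold_prod[OF G.mfd(2) smooth_manifold_euc]
  have "vb_triv (arrb W) U1 L \<tau> \<theta>"
    unfolding vb_triv_def W XA(2)
  proof (intro conjI ballI impI allI)
    show "openin (mtop (Arr G)) U1" "subspace L" using d1(1) E1(2) sL by auto
  next
    fix a assume a: "a \<in> SA" "proj (arrb W) a \<in> U1"
    then have p: "p1 (\<Psi> a) \<in> U1" by (simp add: W1(1))
    have aS: "a \<in> ?S" using a by simp
    have "smooth_at XA ?S X1 \<Psi> a" by (rule smooth_map_smooth_at[OF XA(1) V.mfd(2) smooth_map_Psi]) (simp add: XA(2) a)
    then have "smooth_at XA ?S euc (\<lambda>a. \<tau>1 (\<Psi> a)) a"
      by (rule smooth_at_vb_coord[OF E1(1) t1(2) XA(1) _ aS]) (auto simp: \<Psi>(1) W1(1))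
    then show "smooth_at XA ?S euc \<tau> a"
      unfolding \<tau>_def[abs_def] by (rule smooth_at_compose_Cinf[OF XA(1) _ aS open_UNIV UNIV_I Cinf_linear[OF \<iota>(1)]])
    show "\<tau> a \<in> L" "\<theta> (proj (arrb W) a, \<tau> a) = a"
      using d1(4,5)[OF \<Psi>(1)[OF a(1)] p] \<iota>(3) \<Psi>(2)[OF a(1)] by (auto simp: \<tau>_def \<theta>_def L_def W1(1)[OF a(1)])
  next
    fix c l assume cl: "c \<in> U1" "l \<in> L"
    note t = d1(6-8)[OF cl(1) L(1)[OF cl(2)]]
    show "\<theta> (c, l) \<in> SA" "proj (arrb W) (\<theta> (c, l)) = c" "\<tau> (\<theta> (c, l)) = l"
      using t J L(2)[OF cl(2)] by (simp_all add: \<theta>_def \<tau>_def W1(1))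
    have clS: "(c, l) \<in> U1 \<times> L" using cl by simp
    have cp: "(c, l) \<in> points (Arr G) \<times> points euc" using cl d1(1) openin_subset by (fastforce simp: E1(2) linear_manifold_def)
    have "smooth_at (prod_manifold (Arr G) euc) (U1 \<times> L) X1 (\<lambda>z. \<theta>1 (fst z, \<kappa> (snd z))) (c, l)"
    proof (rule smooth_at_vb_point[OF E1(1) t1(2) GE _ _ clS])
      show "smooth_at (prod_manifold (Arr G) euc) (U1 \<times> L) (base (arrb V)) fst (c, l)"
        unfolding E1(2) by (rule smooth_at_fst[OF G.mfd(2) smooth_manifold_euc cp])
      show "smooth_at (prod_manifold (Arr G) euc) (U1 \<times> L) euc (\<lambda>z. \<kappa> (snd z)) (c, l)"
        by (rule smooth_at_compose_Cinf[OF GE smooth_at_snd[OF G.mfd(2) smooth_manifold_euc cp] clS open_UNIV UNIV_I Cinf_linear[OF \<iota>(2)]])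
    qed (use L(1) in auto)
    then show "smooth_at (prod_manifold (Arr G) euc) (U1 \<times> L) XA \<theta> (c, l)"
      unfolding \<theta>_def[abs_def] by (rule smooth_at_J[OF GE _ clS])
  next
    fix c a assume c: "c \<in> U1" and "a \<in> fibre (arrb W) c"
    then have a: "a \<in> SA" "p1 (\<Psi> a) = c" using W1(1) by (auto simp: fibre_def W XA(2))
    note aP = \<Psi>(1)[OF a(1)]
    show "\<tau> (vscale (arrb W) r a) = r *\<^sub>R \<tau> a" for r
      using d1(11)[OF aP] a c by (simp add: \<tau>_def Psi_ops linear_cmul[OF \<iota>(1)])
    fix a' assume "a' \<in> fibre (arrb W) c"
    then have a': "a' \<in> SA" "p1 (\<Psi> a') = c" using W1(1) by (auto simp: fibre_def W XA(2))
    show "\<tau> (vadd (arrb W) a a') = \<tau> a + \<tau> a'"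
      using d1(10)[OF aP \<Psi>(1)[OF a'(1)]] a a' c by (simp add: \<tau>_def Psi_ops linear_add[OF \<iota>(1)])
  qed
  then show "\<exists>U L \<tau> \<theta>. b \<in> U \<and> vb_triv (arrb W) U L \<tau> \<theta>" using t1(1) by blast
qed

lemma vb_groupoid_W: "vb_groupoid G W"
proof -
  note sG = G.smooth_maps and sW = smooth_maps_W
  have "lie_groupoid_map (total_groupoid W) G p0 (proj (arrb W))"
    by (rule lie_groupoid_mapI)
      (use sW(5) vector_bundleD(3)[OF E0(1)] in \<open>simp_all add: W XA(2) W1(1-3) Psi_ops E0(2) \<Psi>(1) proj_src proj_tgt proj_unit proj_mult\<close>)
  moreover have "vb_map (arrb W) (objb V) (vsrc W) (src G)"
    by (rule vb_mapI) (use sW(1) sG in \<open>simp_all add: W XA(2) submersion_def E0(2) W1(1-3) Psi_ops \<Psi>(1) proj_src linear_src\<close>)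
  moreover have "vb_map (arrb W) (objb V) (vtgt W) (tgt G)"
    by (rule vb_mapI) (use sW(2) sG in \<open>simp_all add: W XA(2) submersion_def E0(2) W1(1-3) Psi_ops \<Psi>(1) proj_tgt linear_tgt\<close>)
  moreover have "vb_map (objb V) (arrb W) (vunit W) (unit G)"
    by (rule vb_mapI) (use sW(3) sG in \<open>simp_all add: W XA(2) E0(2) W1 W2 J \<Psi>(1) Psi_ops proj_unit linear_unit vb_closed[OF E0(1)] V.unit_closed(1)\<close>)
  moreover have "vb_map (arrb W) (arrb W) (ginv (total_groupoid W)) (ginv G)"
    by (rule vb_mapI) (use sW(4) sG in \<open>simp_all add: W XA(2) ginv_W W1(1,5) W2(2) J(1,2) \<Psi>(1) V.ginv(1) proj_inv linear_inv vb_closed[OF E1(1)]\<close>)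
  moreover have "vb_map (composable_bundle G W) (arrb W) (\<lambda>(v, w). vmult W v w) (\<lambda>(g, h). mult G g h)"
  proof (rule vb_mapI)
    have ct: "total (composable_bundle G W) = composable_pairs (total_groupoid W)" by (simp add: composable_bundle_def)
    have pt: "points (total (composable_bundle G W)) = CA" unfolding ct by (rule composable_W(2))
    show "smooth_map (total (composable_bundle G W)) (total (arrb W)) (\<lambda>(v, w). vmult W v w)"
      unfolding ct using smooth_mult_W by (simp add: W)
    show "smooth_map (base (composable_bundle G W)) (base (arrb W)) (\<lambda>(g, h). mult G g h)"
      using G.lie by (simp add: composable_bundle_def W lie_groupoid_def)
    fix e assume "e \<in> points (total (composable_bundle G W))"
    then obtain a b where e: "e = (a, b)" "a \<in> SA" "b \<in> SA" "vsrc V (\<Psi> a) = vtgt V (\<Psi> b)" unfolding pt CA_def by blast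
    note P = \<Psi>(1)[OF e(2)] \<Psi>(1)[OF e(3)]
    show "proj (arrb W) (case e of (v, w) \<Rightarrow> vmult W v w) = (case proj (composable_bundle G W) e of (g, h) \<Rightarrow> mult G g h)"
      using e(2-4) P by (simp add: e(1) composable_bundle_def W1(1) Psi_ops proj_mult)
    show "(case vscale (composable_bundle G W) r e of (v, w) \<Rightarrow> vmult W v w) = vscale (arrb W) r (case e of (v, w) \<Rightarrow> vmult W v w)" for r
      using e(2-4) P linear_src(2)[OF P(1)] linear_tgt(2)[OF P(2)] linear_mult(2)[OF P e(4)]
      by (simp add: e(1) composable_bundle_def W1(5) W2(1) Psi_ops J \<Psi> vb_closed[OF E1(1)] V.mult_closed(1))
    fix e' assume "e' \<in> points (total (composable_bundle G W))" and p: "proj (composable_bundle G W) e' = proj (composable_bundle G W) e"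
    then obtain a' b' where e': "e' = (a', b')" "a' \<in> SA" "b' \<in> SA" "vsrc V (\<Psi> a') = vtgt V (\<Psi> b')" unfolding pt CA_def by blast
    note P' = \<Psi>(1)[OF e'(2)] \<Psi>(1)[OF e'(3)]
    have q: "p1 (\<Psi> a') = p1 (\<Psi> a)" "p1 (\<Psi> b') = p1 (\<Psi> b)" using p e(2,3) e'(2,3) by (simp_all add: e(1) e'(1) composable_bundle_def W1(1))
    note m = linear_mult(1)[OF P e(4) P' e'(4) q]
    have s: "vsrc V (add1 (\<Psi> a) (\<Psi> a')) = vtgt V (add1 (\<Psi> b) (\<Psi> b'))"
      using linear_src(1)[OF P(1) P'(1) q(1)] linear_tgt(1)[OF P(2) P'(2) q(2)] e(4) e'(4) by simp
    have "vmult W (vadd (arrb W) a a') (vadd (arrb W) b b') = J (add1 (vmult V (\<Psi> a) (\<Psi> b)) (vmult V (\<Psi> a') (\<Psi> b')))"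
      using W2(1)[OF Psi_ops(7)[OF e(2) e'(2) q(1)] Psi_ops(7)[OF e(3) e'(3) q(2)]] s e(2,3) e'(2,3) q m by (simp add: Psi_ops)
    also have "\<dots> = vadd (arrb W) (vmult W a b) (vmult W a' b')"
      using e(2-4) e'(2-4) P P' q by (subst W2(2)) (simp_all add: Psi_ops proj_mult)
    finally show "(case vadd (composable_bundle G W) e e' of (v, w) \<Rightarrow> vmult W v w) =
       vadd (arrb W) (case e of (v, w) \<Rightarrow> vmult W v w) (case e' of (v, w) \<Rightarrow> vmult W v w)"
      by (simp add: e(1) e'(1) composable_bundle_def)
  qed
  ultimately show ?thesis
    unfolding vb_groupoid_def using G.lie lie_groupoid_W E0 vector_bundle_W by (simp add: W)
qed

lemma isomorphic_W:
  assumes V: "vb_groupoid G V"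
  shows "vb_groupoid_isomorphic G W V"
proof -
  have idm: "smooth_map (Obj G) (Obj G) id" "smooth_map (Arr G) (Arr G) id" "smooth_map X0 X0 id"
    using smooth_map_id[OF G.mfd(1)] smooth_map_id[OF G.mfd(2)] smooth_map_id[OF V.mfd(1)] by (simp_all add: id_def)
  have o: "vb_map (objb V) (objb V) id id" by (rule vb_mapI) (use idm E0(2) in simp_all)
  have "vbg_map W V id \<Psi> id id"
    unfolding vbg_map_def
  proof (intro conjI)
    show "lie_groupoid_map (total_groupoid W) (total_groupoid V) id \<Psi>"
      by (rule lie_groupoid_mapI) (use idm smooth_map_Psi in \<open>simp_all add: W XA(2) W1(2,3) Psi_ops\<close>)
    show "vb_map (objb W) (objb V) id id" using o by (simp add: W)
    show "vb_map (arrb W) (arrb V) \<Psi> id"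
      by (rule vb_mapI) (use idm smooth_map_Psi E1(2) in \<open>simp_all add: W XA(2) W1(1) Psi_ops\<close>)
  qed
  moreover have "vbg_map V W id J id id"
    unfolding vbg_map_def
  proof (intro conjI)
    show "lie_groupoid_map (total_groupoid V) (total_groupoid W) id J"
      by (rule lie_groupoid_mapI) (use idm smooth_map_J in \<open>simp_all add: W J W1 W2\<close>)
    show "vb_map (objb V) (objb W) id id" using o by (simp add: W)
    show "vb_map (arrb V) (arrb W) J id"
      by (rule vb_mapI) (use idm smooth_map_J E1(2) in \<open>simp_all add: W J W1 W2\<close>)
  qed
  ultimately show ?thesis
    unfolding vb_groupoid_isomorphic_def using V vb_groupoid_W \<Psi> J
    by (intro conjI exI[of _ id] exI[of _ \<Psi>] exI[of _ J]) (simp_all add: W XA(2))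
qed

end

section \<open>The weak representation defined by a cleavage\<close>

locale vbg_cleavage = vb_gpd G V
  for G :: "('g0, 'd0::euclidean_space, 'g1, 'd1::euclidean_space) groupoid"
    and V :: "('v0, 'e0::euclidean_space, 'g0, 'd0, 'v1, 'e1::euclidean_space, 'g1, 'd1) vbg" +
  fixes \<sigma> :: "'g1 \<times> 'v0 \<Rightarrow> 'v1"
  assumes cleavage: "cleavage_on (points (Arr G)) \<sigma>"
begin

text \<open>\<open>K\<close> is the restriction of \<open>V\<close> to the units of \<open>G\<close>.\<close>

definition pK :: "'v1 \<Rightarrow> 'g0" where
  "pK v = src G (p1 v)"

definition S1 :: "'v1 set" where
  "S1 = {v \<in> P1. p1 v = unit G (pK v)}"

definition K :: "('v0, 'e0, 'g0, 'd0, 'v1, 'e1, 'g0, 'd0) vbg" where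
  "K = \<lparr>objb = objb V,
    arrb = \<lparr>total = submanifold X1 S1, base = Obj G, proj = pK, vadd = add1, vscale = sc1\<rparr>,
    vsrc = vsrc V, vtgt = vtgt V, vunit = vunit V, vmult = vmult V\<rparr>"

abbreviation "K1 \<equiv> submanifold X1 S1"

lemma K_simps [simp]: "objb K = objb V" "total (arrb K) = K1" "base (arrb K) = Obj G" "proj (arrb K) = pK"
  "vadd (arrb K) = add1" "vscale (arrb K) = sc1" "vsrc K = vsrc V" "vtgt K = vtgt V" "vunit K = vunit V" "vmult K = vmult V"
  by (simp_all add: K_def)

lemma S1: "v \<in> S1 \<Longrightarrow> v \<in> P1" "v \<in> S1 \<Longrightarrow> p1 v = unit G (pK v)" "v \<in> S1 \<Longrightarrow> pK v \<in> points (Obj G)"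
  "v \<in> S1 \<Longrightarrow> src G (p1 v) = pK v" "v \<in> S1 \<Longrightarrow> tgt G (p1 v) = pK v"
  "v \<in> S1 \<Longrightarrow> p0 (vsrc V v) = pK v" "v \<in> S1 \<Longrightarrow> p0 (vtgt V v) = pK v"
  "v \<in> S1 \<Longrightarrow> vsrc V v \<in> P0" "v \<in> S1 \<Longrightarrow> vtgt V v \<in> P0"
proof -
  assume v: "v \<in> S1"
  show 1: "v \<in> P1" "p1 v = unit G (pK v)" using v by (auto simp: S1_def)
  show 2: "pK v \<in> points (Obj G)" unfolding pK_def by (rule G.st_closed(1)[OF p1[OF 1(1)]])
  show 3: "src G (p1 v) = pK v" by (simp add: pK_def)
  show 4: "tgt G (p1 v) = pK v" using 1 G.unit_closed(3)[OF 2] by simp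
  show "p0 (vsrc V v) = pK v" "p0 (vtgt V v) = pK v" using proj_src[OF 1(1)] proj_tgt[OF 1(1)] 3 4 by auto
  show "vsrc V v \<in> P0" "vtgt V v \<in> P0" using V.st_closed[OF 1(1)] by auto
qed

lemma S1I: "v \<in> P1 \<Longrightarrow> b \<in> points (Obj G) \<Longrightarrow> p1 v = unit G b \<Longrightarrow> v \<in> S1 \<and> pK v = b"
  using G.unit_closed(2)[of b] by (simp add: S1_def pK_def)

lemma smooth_pK: "v \<in> P1 \<Longrightarrow> smooth_at X1 S (Obj G) pK v"
proof -
  assume v: "v \<in> P1"
  have 1: "smooth_at X1 UNIV X1 (\<lambda>v. v) v" by (rule smooth_at_id[OF V.mfd(2) v])
  have "smooth_at X1 UNIV (Obj G) (\<lambda>v. src G (p1 v)) v"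
    by (rule G.smooth_at_src[OF V.mfd(2) smooth_p1[OF V.mfd(2) 1 UNIV_I] UNIV_I])
  then show ?thesis unfolding pK_def[abs_def] by (rule smooth_at_mono) simp
qed

text \<open>In a trivialization, keep the fibre coordinate and replace the base arrow
  \<open>g\<close> by the unit at its source: this retracts a neighbourhood onto the arrows over
  units.\<close>

lemma embedded_S1: "embedded X1 S1"
proof (rule embedded_retract[OF V.mfd(2)])
  show "S1 \<subseteq> P1" using S1(1) by blast
  fix v assume v: "v \<in> S1"
  have gB: "p1 v \<in> points (base (arrb V))" using p1[OF S1(1)[OF v]] E1(2) by simp
  obtain U1 L1 \<tau>1 \<theta>1 where t1: "p1 v \<in> U1" "vb_triv (arrb V) U1 L1 \<tau>1 \<theta>1" using vector_bundle_triv[OF E1(1) gB] .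
  note d1 = vb_trivD[OF t1(2)]
  have oU1: "openin (mtop (Arr G)) U1" using d1(1) E1(2) by simp
  have su: "smooth_at X1 S (Arr G) (\<lambda>w. unit G (pK w)) w" if "w \<in> P1" "w \<in> S" for S w
    by (rule G.smooth_at_unit[OF V.mfd(2) smooth_pK[OF that(1)] that(2)])
  define O1 where "O1 = {w \<in> P1. p1 w \<in> U1}"
  have O1: "openin (mtop X1) O1"
    unfolding O1_def by (rule smooth_at_open_preimage[OF _ openin_topspace oU1]) (rule smooth_p1[OF V.mfd(2) smooth_at_id[OF V.mfd(2)]], auto)
  \<comment> \<open>Both the base arrow and the unit that replaces it must lie in the domain of the
    same trivialization.\<close>
  define O' where "O' = {w \<in> O1. unit G (pK w) \<in> U1}"
  have O': "openin (mtop X1) O'"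
    unfolding O'_def by (rule smooth_at_open_preimage[OF su O1 oU1]) (auto simp: O1_def)
  have vO: "v \<in> O'" using v t1(1) S1(2)[OF v] by (auto simp: O'_def O1_def S1(1))
  have inO: "w \<in> P1" "p1 w \<in> U1" "unit G (pK w) \<in> U1" "pK w \<in> points (Obj G)" if "w \<in> O'" for w
    using that G.st_closed(1)[OF p1] by (auto simp: O'_def O1_def pK_def)
  let ?r = "\<lambda>w. \<theta>1 (unit G (pK w), \<tau>1 w)"
  have "smooth_at X1 O' X1 ?r v"
  proof (rule smooth_at_vb_point[OF E1(1) t1(2) V.mfd(2) _ _ vO])
    show "smooth_at X1 O' (base (arrb V)) (\<lambda>y. unit G (pK y)) v" using su[OF S1(1)[OF v] vO] E1(2) by simp
    show "smooth_at X1 O' euc \<tau>1 v"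
      by (rule smooth_at_mono[OF d1(3)[OF S1(1)[OF v] t1(1)]]) (auto simp: O'_def O1_def)
  qed (use inO d1(4) in auto)
  moreover have "?r ` O' \<subseteq> S1"
  proof (rule image_subsetI)
    fix w assume w: "w \<in> O'"
    note a = d1(6,7)[OF inO(3)[OF w] d1(4)[OF inO(1,2)[OF w]]]
    show "?r w \<in> S1" using S1I[OF a(1) inO(4)[OF w] a(2)] by blast
  qed
  moreover have "\<forall>y\<in>O' \<inter> S1. ?r y = y" using d1(5)[OF inO(1,2)] S1(2) by fastforce
  ultimately show "\<exists>O' r. openin (mtop X1) O' \<and> v \<in> O' \<and> smooth_at X1 O' X1 r v \<and> r ` O' \<subseteq> S1 \<and> (\<forall>y\<in>O' \<inter> S1. r y = y)"
    using O' vO by blast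
qed

lemma K1: "smooth_manifold K1" "points K1 = S1"
  by (rule smooth_manifold_submanifold[OF V.mfd(2) embedded_S1], rule embedded_points[OF embedded_S1])

lemma into_K1:
  assumes M: "smooth_manifold M" and f: "smooth_at M T X1 f x" and x: "x \<in> T" and S: "\<And>y. y \<in> T \<Longrightarrow> f y \<in> S1"
  shows "smooth_at M T K1 f x"
  by (rule smooth_at_into_submanifold[OF M V.mfd(2) embedded_S1 x, THEN iffD2]) (use f S in auto)

lemma from_K1:
  assumes M: "smooth_manifold M" and f: "smooth_at M T K1 f x" and x: "x \<in> T" and S: "\<And>y. y \<in> T \<Longrightarrow> f y \<in> S1"
  shows "smooth_at M T X1 f x"
  by (rule smooth_at_into_submanifold[OF M V.mfd(2) embedded_S1 x, THEN iffD1]) (use f S in auto)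

lemma fibre_K: "b \<in> points (Obj G) \<Longrightarrow> fibre (arrb K) b = fibre (arrb V) (unit G b)"
  unfolding fibre_def by (auto simp: K1(2) dest: S1(1,2) S1I)

text \<open>\<open>K\<close> is the pullback of the arrow bundle along the unit map: the fibre over
  \<open>b\<close> is that of \<open>V\<close> over the unit at \<open>b\<close>, and a
  trivialization of \<open>V\<close> restricts with the same typical fibre.\<close>

lemma vector_bundle_K: "vector_bundle (arrb K)"
proof (rule vector_bundleI)
  show "smooth_manifold (total (arrb K))" "smooth_manifold (base (arrb K))" using K1(1) G.mfd(1) by auto
  show "smooth_map (total (arrb K)) (base (arrb K)) (proj (arrb K))"
    using smooth_map_submanifoldI[OF V.mfd(2) G.mfd(1) smooth_pK[OF S1(1)]] by simp
  fix b assume "b \<in> points (base (arrb K))"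
  then have b: "b \<in> points (Obj G)" by simp
  have uB: "unit G b \<in> points (base (arrb V))" using G.unit_closed(1)[OF b] E1(2) by simp
  show "real_vector_space_on (fibre (arrb K) b) (vadd (arrb K)) (vscale (arrb K))"
    using vector_bundleD(4)[OF E1(1) uB] fibre_K[OF b] by simp
  obtain U1 L1 \<tau>1 \<theta>1 where t1: "unit G b \<in> U1" "vb_triv (arrb V) U1 L1 \<tau>1 \<theta>1" using vector_bundle_triv[OF E1(1) uB] .
  note d1 = vb_trivD[OF t1(2)]
  have oU1: "openin (mtop (Arr G)) U1" using d1(1) E1(2) by simp
  define U where "U = {c \<in> points (Obj G). unit G c \<in> U1}"
  have U: "openin (mtop (Obj G)) U"
    unfolding U_def by (rule smooth_at_open_preimage[OF G.smooth_unit openin_topspace oU1])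
  define \<theta> where "\<theta> z = \<theta>1 (unit G (fst z), snd z)" for z
  have th: "\<theta> (c, l) \<in> S1" "pK (\<theta> (c, l)) = c" "\<tau>1 (\<theta> (c, l)) = l" if "c \<in> U" "l \<in> L1" for c l
  proof -
    have c: "c \<in> points (Obj G)" "unit G c \<in> U1" using that by (auto simp: U_def)
    show "\<theta> (c, l) \<in> S1" "pK (\<theta> (c, l)) = c" "\<tau>1 (\<theta> (c, l)) = l"
      using S1I[OF d1(6)[OF c(2) that(2)] c(1) d1(7)[OF c(2) that(2)]] d1(8)[OF c(2) that(2)] by (simp_all add: \<theta>_def)
  qed
  have inU: "p1 e \<in> U1" "e \<in> P1" "\<theta> (pK e, \<tau>1 e) = e" if "e \<in> S1" "pK e \<in> U" for e
  proof -
    show 1: "p1 e \<in> U1" "e \<in> P1" using that S1(1,2) by (auto simp: U_def)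
    show "\<theta> (pK e, \<tau>1 e) = e" using d1(5)[OF 1(2,1)] S1(2)[OF that(1)] by (simp add: \<theta>_def)
  qed
  have pe: "smooth_manifold (prod_manifold (Obj G) (euc :: ('e1, 'e1) manifold))" by (rule smooth_manifold_prod[OF G.mfd(1) smooth_manifold_euc])
  have "vb_triv (arrb K) U L1 \<tau>1 \<theta>"
    unfolding vb_triv_def
  proof (intro conjI ballI impI allI)
    show "openin (mtop (base (arrb K))) U" "subspace L1" using U d1(2) by auto
    fix e assume "e \<in> points (total (arrb K))" "proj (arrb K) e \<in> U"
    then have e: "e \<in> S1" "pK e \<in> U" by (simp_all add: K1(2))
    have sub: "{e \<in> S1. pK e \<in> U} \<subseteq> {e \<in> P1. p1 e \<in> U1}" using inU by blast
    have "smooth_at K1 {e \<in> S1. pK e \<in> U} euc \<tau>1 e"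
      by (rule smooth_at_from_submanifold[OF V.mfd(2) smooth_manifold_euc embedded_S1, THEN iffD2])
        (use e smooth_at_mono[OF d1(3)[OF inU(2,1)[OF e]] sub] in auto)
    then show "smooth_at (total (arrb K)) {e \<in> points (total (arrb K)). proj (arrb K) e \<in> U} euc \<tau>1 e" by (simp add: K1(2))
    show "\<tau>1 e \<in> L1" by (rule d1(4)[OF inU(2,1)[OF e]])
    show "\<theta> (proj (arrb K) e, \<tau>1 e) = e" using inU(3)[OF e] by simp
  next
    fix c l assume cl: "c \<in> U" "l \<in> L1"
    show "\<theta> (c, l) \<in> points (total (arrb K))" "proj (arrb K) (\<theta> (c, l)) = c" "\<tau>1 (\<theta> (c, l)) = l"
      using th[OF cl] by (simp_all add: K1(2))
    have z: "(c, l) \<in> U \<times> L1" "(c, l) \<in> points (Obj G) \<times> points euc" using cl by (auto simp: U_def)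
    have "smooth_at (prod_manifold (Obj G) euc) (U \<times> L1) X1 \<theta> (c, l)"
      unfolding \<theta>_def
    proof (rule smooth_at_vb_point[OF E1(1) t1(2) pe _ smooth_at_snd[OF G.mfd(1) smooth_manifold_euc z(2)] z(1)])
      show "smooth_at (prod_manifold (Obj G) euc) (U \<times> L1) (base (arrb V)) (\<lambda>y. unit G (fst y)) (c, l)"
        using G.smooth_at_unit[OF pe smooth_at_fst[OF G.mfd(1) smooth_manifold_euc z(2)] z(1)] E1(2) by simp
    qed (auto simp: U_def)
    then show "smooth_at (prod_manifold (base (arrb K)) euc) (U \<times> L1) (total (arrb K)) \<theta> (c, l)"
      using into_K1[OF pe _ z(1)] th by auto
  next
    fix c e e' r assume c: "c \<in> U" and e: "e \<in> fibre (arrb K) c"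
    then have e1: "e \<in> P1" "p1 e = unit G c" "unit G c \<in> U1" using fibre_K[of c] by (auto simp: fibre_def U_def)
    show "\<tau>1 (vscale (arrb K) r e) = r *\<^sub>R \<tau>1 e" using d1(11)[OF e1(1)] e1 by simp
    assume "e' \<in> fibre (arrb K) c"
    then have e2: "e' \<in> P1" "p1 e' = unit G c" using fibre_K[of c] c by (auto simp: fibre_def U_def)
    show "\<tau>1 (vadd (arrb K) e e') = \<tau>1 e + \<tau>1 e'" using d1(10)[OF e1(1) e2(1)] e1 e2 by simp
  qed
  moreover have "b \<in> U" using b t1(1) by (simp add: U_def)
  ultimately show "\<exists>U L \<tau> \<theta>. b \<in> U \<and> vb_triv (arrb K) U L \<tau> \<theta>" by blast
qed

section \<open>The groupoid structure of \<open>K\<close>\<close>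

lemma S1_unit: "x \<in> P0 \<Longrightarrow> vunit V x \<in> S1" "x \<in> P0 \<Longrightarrow> pK (vunit V x) = p0 x"
  using S1I[OF V.unit_closed(1) p0 proj_unit] by auto

lemma S1_mult:
  assumes "v \<in> S1" "w \<in> S1" "vsrc V v = vtgt V w"
  shows "vmult V v w \<in> S1" "pK (vmult V v w) = pK v" "pK w = pK v"
proof -
  note v = S1[OF assms(1)] and w = S1[OF assms(2)]
  show e: "pK w = pK v" using v(6) w(7) assms(3) by simp
  have "mult G (unit G (pK v)) (unit G (pK v)) = unit G (pK v)"
    using G.unit_laws(1)[OF G.unit_closed(1)[OF v(3)]] G.unit_closed(2)[OF v(3)] by simp
  then have "p1 (vmult V v w) = unit G (pK v)" using proj_mult[OF v(1) w(1) assms(3)] v(2) w(2) e by simp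
  then show "vmult V v w \<in> S1" "pK (vmult V v w) = pK v"
    using S1I[OF V.mult_closed(1)[OF v(1) w(1) assms(3)] v(3)] by auto
qed

lemma S1_inv: "v \<in> S1 \<Longrightarrow> vinv v \<in> S1" "v \<in> S1 \<Longrightarrow> pK (vinv v) = pK v"
proof -
  assume v: "v \<in> S1"
  have "p1 (vinv v) = unit G (pK v)" using proj_inv[OF S1(1)[OF v]] S1(2)[OF v] G.ginv_unit[OF S1(3)[OF v]] by simp
  then show "vinv v \<in> S1" "pK (vinv v) = pK v" using S1I[OF V.ginv(1)[OF S1(1)[OF v]] S1(3)[OF v]] by auto
qed

lemma S1_lin: "v \<in> S1 \<Longrightarrow> sc1 r v \<in> S1" "v \<in> S1 \<Longrightarrow> pK (sc1 r v) = pK v"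
  "v \<in> S1 \<Longrightarrow> w \<in> S1 \<Longrightarrow> pK w = pK v \<Longrightarrow> add1 v w \<in> S1" "v \<in> S1 \<Longrightarrow> w \<in> S1 \<Longrightarrow> pK w = pK v \<Longrightarrow> pK (add1 v w) = pK v"
  using vb_closed[OF vector_bundle_K, of v] by (simp_all add: K1(2))

lemma S1_same: "v \<in> S1 \<Longrightarrow> w \<in> S1 \<Longrightarrow> pK w = pK v \<Longrightarrow> p1 w = p1 v"
  using S1(2) by simp

lemma linear_S1:
  assumes "v \<in> S1" "w \<in> S1" "pK w = pK v"
  shows "vsrc V (add1 v w) = add0 (vsrc V v) (vsrc V w)" "vtgt V (add1 v w) = add0 (vtgt V v) (vtgt V w)"
    "vinv (add1 v w) = add1 (vinv v) (vinv w)"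
  using linear_src(1) linear_tgt(1) linear_inv(1) S1(1)[OF assms(1)] S1(1)[OF assms(2)] S1_same[OF assms] by blast+

lemma scale_S1:
  assumes "v \<in> S1"
  shows "vsrc V (sc1 r v) = sc0 r (vsrc V v)" "vtgt V (sc1 r v) = sc0 r (vtgt V v)" "vinv (sc1 r v) = sc1 r (vinv v)"
  using linear_src(2) linear_tgt(2) linear_inv(2) S1(1)[OF assms] by blast+

lemma algebraic_K: "algebraic_groupoid (total_groupoid K)"
  and ginv_K: "v \<in> S1 \<Longrightarrow> ginv (total_groupoid K) v = vinv v"
proof -
  note * = algebraic_transfer[of "total_groupoid V" "total_groupoid K" "\<lambda>v. v" vinv, simplified, unfolded K1(2)]
  show "algebraic_groupoid (total_groupoid K)"
    by (rule *(1)) (use V.alg S1(1) S1_unit S1_mult S1_inv in auto)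
  show "v \<in> S1 \<Longrightarrow> ginv (total_groupoid K) v = vinv v"
    by (rule *(2)) (use V.alg S1(1) S1_unit S1_mult S1_inv in auto)
qed

text \<open>The source and the target of \<open>K\<close> are linear and restrict to the identity
  along units; this is all that is used. A local section through \<open>v0\<close> extends
  \<open>v0\<close> with constant fibre coordinate and then corrects the resulting error by an
  identity arrow.\<close>

lemma submersion_K:
  assumes f: "\<And>v. v \<in> S1 \<Longrightarrow> f v \<in> P0 \<and> p0 (f v) = pK v"
    and lin: "\<And>v w. v \<in> S1 \<Longrightarrow> w \<in> S1 \<Longrightarrow> pK w = pK v \<Longrightarrow> f (add1 v w) = add0 (f v) (f w)" "\<And>v r. v \<in> S1 \<Longrightarrow> f (sc1 r v) = sc0 r (f v)"
    and un: "\<And>x. x \<in> P0 \<Longrightarrow> f (vunit V x) = x"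
    and sm: "\<And>v S. v \<in> P1 \<Longrightarrow> smooth_at X1 S X0 f v"
  shows "submersion K1 X0 f"
proof (rule submersionI[OF K1(1) V.mfd(1)])
  show "smooth_map K1 X0 f" by (rule smooth_map_submanifoldI[OF V.mfd(2,1) sm[OF S1(1)]])
  fix v0 assume "v0 \<in> points K1"
  then have v0: "v0 \<in> S1" using K1(2) by simp
  have uB: "p1 v0 \<in> points (base (arrb V))" using p1[OF S1(1)[OF v0]] E1(2) by simp
  obtain U1 L1 \<tau>1 \<theta>1 where t1: "p1 v0 \<in> U1" "vb_triv (arrb V) U1 L1 \<tau>1 \<theta>1" using vector_bundle_triv[OF E1(1) uB] .
  note d1 = vb_trivD[OF t1(2)]
  have oU1: "openin (mtop (Arr G)) U1" using d1(1) E1(2) by simp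
  define l where "l = \<tau>1 v0"
  have l: "l \<in> L1" unfolding l_def by (rule d1(4)[OF S1(1)[OF v0] t1(1)])
  have su: "smooth_at X0 S (Arr G) (\<lambda>x. unit G (p0 x)) x" if "x \<in> P0" "x \<in> S" for x S
    by (rule G.smooth_at_unit[OF V.mfd(1) smooth_p0[OF V.mfd(1) smooth_at_id[OF V.mfd(1) that(1)] that(2)] that(2)])
  define O' where "O' = {x \<in> P0. unit G (p0 x) \<in> U1}"
  have O': "openin (mtop X0) O'"
    unfolding O'_def by (rule smooth_at_open_preimage[OF su openin_topspace oU1])
  define w where "w x = \<theta>1 (unit G (p0 x), l)" for x
  have w: "w x \<in> S1" "pK (w x) = p0 x" if "x \<in> O'" for x
  proof -
    have x: "x \<in> P0" "unit G (p0 x) \<in> U1" using that by (auto simp: O'_def)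
    show "w x \<in> S1" "pK (w x) = p0 x"
      unfolding w_def using S1I[OF d1(6)[OF x(2) l] p0[OF x(1)] d1(7)[OF x(2) l]] by auto
  qed
  \<comment> \<open>The error \<open>x - f (w x)\<close>; as \<open>f\<close> is additive and sends
    identity arrows to their objects, adding the identity arrow at \<open>y x\<close> to
    \<open>w x\<close> gives an arrow with value \<open>x\<close>.\<close>
  define y where "y x = add0 x (sc0 (- 1) (f (w x)))" for x
  have y: "y x \<in> P0" "p0 (y x) = p0 x" "sc0 (- 1) (f (w x)) \<in> P0" "p0 (sc0 (- 1) (f (w x))) = p0 x" "f (w x) \<in> P0" "p0 (f (w x)) = p0 x" if "x \<in> O'" for x
  proof -
    have x: "x \<in> P0" using that by (auto simp: O'_def)
    show a: "f (w x) \<in> P0" "p0 (f (w x)) = p0 x" using f[OF w(1)[OF that]] w(2)[OF that] by auto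
    then show b: "sc0 (- 1) (f (w x)) \<in> P0" "p0 (sc0 (- 1) (f (w x))) = p0 x" using vb_closed[OF E0(1)] by auto
    show "y x \<in> P0" "p0 (y x) = p0 x" unfolding y_def using vb_closed(3,4)[OF E0(1) x b] by auto
  qed
  \<comment> \<open>The factor 1 only brings the sum to the shape of
    \<open>smooth_at_vb_lin\<close>.\<close>
  define c where "c x = add1 (w x) (sc1 1 (vunit V (y x)))" for x
  define x0 where "x0 = f v0"
  have x0: "x0 \<in> P0" "p0 x0 = pK v0" using f[OF v0] by (simp_all add: x0_def)
  have x0O: "x0 \<in> O'" using x0 S1(2)[OF v0] t1(1) by (simp add: O'_def)
  have uy: "vunit V (y x) \<in> S1" "pK (vunit V (y x)) = p0 x" if "x \<in> O'" for x
    using S1_unit[OF y(1)[OF that]] y(2)[OF that] by auto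
  have cS: "c x \<in> S1" if "x \<in> O'" for x
    unfolding c_def using S1_lin(1,2)[OF uy(1)[OF that]] S1_lin(3)[OF w(1)[OF that]] w(2)[OF that] uy(2)[OF that] by simp
  have wx0: "w x0 = v0" unfolding w_def l_def using d1(5)[OF S1(1)[OF v0] t1(1)] x0(2) S1(2)[OF v0] by simp
  have "smooth_at X0 O' X1 c x0"
    unfolding c_def
  proof (rule smooth_at_vb_lin[OF E1(1) V.mfd(1) _ _ smooth_at_const[OF V.mfd(1) x0(1) smooth_manifold_euc] x0O])
    show sw: "smooth_at X0 O' X1 w x0"
      unfolding w_def
    proof (rule smooth_at_vb_point[OF E1(1) t1(2) V.mfd(1) _ smooth_at_const[OF V.mfd(1) x0(1) smooth_manifold_euc] x0O])
      show "smooth_at X0 O' (base (arrb V)) (\<lambda>x. unit G (p0 x)) x0" using su[OF x0(1) x0O] E1(2) by simp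
    qed (use l in \<open>auto simp: O'_def\<close>)
    have "smooth_at X0 O' X0 (\<lambda>x. f (w x)) x0"
      by (rule smooth_at_compose[OF V.mfd(1,2,1) sw sm[OF S1(1)[OF w(1)[OF x0O]]] x0O order_refl])
    then have "smooth_at X0 O' X0 y x0"
      unfolding y_def
      by (rule smooth_at_vb_lin[OF E0(1) V.mfd(1) smooth_at_id[OF V.mfd(1) x0(1)] _ smooth_at_const[OF V.mfd(1) x0(1) smooth_manifold_euc] x0O])
        (use y in \<open>auto simp: O'_def\<close>)
    then show "smooth_at X0 O' X1 (\<lambda>x. vunit V (y x)) x0" by (rule V.smooth_at_unit[OF V.mfd(1) _ x0O])
    show "w x \<in> P1 \<and> vunit V (y x) \<in> P1 \<and> p1 (w x) = p1 (vunit V (y x))" if "x \<in> O'" for x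
      using w[OF that] uy[OF that] S1(1,2) by auto
  qed simp
  then have sc: "smooth_at X0 O' K1 c x0" by (rule into_K1[OF V.mfd(1) _ x0O cS])
  have fc: "f (c x) = x" if x: "x \<in> O'" for x
  proof -
    have xP: "x \<in> P0" using x by (auto simp: O'_def)
    have "f (c x) = add0 (f (w x)) (sc0 1 (y x))"
      unfolding c_def using lin(1)[OF w(1)[OF x] S1_lin(1)[OF uy(1)[OF x]]] lin(2)[OF uy(1)[OF x]] S1_lin(2)[OF uy(1)[OF x]] w(2)[OF x] uy(2)[OF x] un[OF y(1)[OF x]] by simp
    also have "\<dots> = x"
      unfolding y_def using y[OF x] xP by (intro vb_eqI[OF E0(1)]) (simp_all add: vb_closed[OF E0(1)])
    finally show ?thesis .
  qed
  have "c x0 = v0"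
  proof -
    have u0: "vunit V x0 \<in> P1" "p1 (vunit V x0) = p1 v0"
      using S1(1,2)[OF S1_unit(1)[OF x0(1)]] S1_unit(2)[OF x0(1)] S1(2)[OF v0] x0(2) by auto
    have "vunit V (y x0) = add1 (vunit V x0) (sc1 (- 1) (vunit V x0))"
      using linear_unit(1)[OF x0(1) y(3)[OF x0O] y(4)[OF x0O]] linear_unit(2)[OF x0(1)] by (simp add: y_def wx0 x0_def[symmetric])
    then have "c x0 = add1 v0 (sc1 1 (add1 (vunit V x0) (sc1 (- 1) (vunit V x0))))" by (simp add: c_def wx0)
    also have "\<dots> = v0"
      using u0 S1(1)[OF v0] by (intro vb_eqI[OF E1(1)]) (simp_all add: vb_closed[OF E1(1)])
    finally show ?thesis .
  qed
  then show "\<exists>O' c. openin (mtop X0) O' \<and> f v0 \<in> O' \<and> smooth_at X0 O' K1 c (f v0) \<and> c (f v0) = v0 \<and> (\<forall>n\<in>O'. f (c n) = n)"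
    using O' x0O sc fc unfolding x0_def by blast
qed

lemma smooth_maps_K: "smooth_map K1 N f" if "\<And>v. v \<in> S1 \<Longrightarrow> smooth_at X1 S1 N f v" "smooth_manifold N" for N :: "('n, 'h::euclidean_space) manifold" and f
  by (rule smooth_map_submanifoldI[OF V.mfd(2) that(2) that(1)])

lemma submersion_K_src_tgt: "submersion K1 X0 (vsrc V)" "submersion K1 X0 (vtgt V)"
proof -
  show "submersion K1 X0 (vsrc V)"
    by (rule submersion_K) (simp_all add: S1(6-9) linear_S1 scale_S1 V.unit_closed V.smooth_src)
  show "submersion K1 X0 (vtgt V)"
    by (rule submersion_K) (simp_all add: S1(6-9) linear_S1 scale_S1 V.unit_closed V.smooth_tgt)
qed

lemma smooth_unit_K: "smooth_map X0 K1 (vunit V)"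
  unfolding smooth_map_iff[OF V.mfd(1) K1(1)]
  by (intro ballI into_K1[OF V.mfd(1)] V.smooth_unit) (auto simp: S1_unit)

definition CK :: "('v1 \<times> 'v1) set" where
  "CK = {(v, w). v \<in> S1 \<and> w \<in> S1 \<and> vsrc V v = vtgt V w}"

lemma composable_K: "composable_pairs (total_groupoid K) = submanifold (prod_manifold K1 K1) CK"
  "points (composable_pairs (total_groupoid K)) = CK"
proof -
  show e: "composable_pairs (total_groupoid K) = submanifold (prod_manifold K1 K1) CK"
    by (simp add: composable_pairs_def CK_def K1(2))
  show "points (composable_pairs (total_groupoid K)) = CK"
    unfolding e by (rule points_submanifold) (auto simp: CK_def K1(2))
qed

lemma smooth_mult_K: "smooth_map (composable_pairs (total_groupoid K)) K1 (\<lambda>(v, w). vmult V v w)"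
  unfolding composable_K(1)
proof (rule smooth_map_submanifoldI)
  show KK: "smooth_manifold (prod_manifold K1 K1)" by (rule smooth_manifold_prod[OF K1(1) K1(1)])
  show "smooth_manifold K1" by (rule K1(1))
  fix z assume z: "z \<in> CK"
  then have zp: "z \<in> points K1 \<times> points K1" by (auto simp: CK_def K1(2))
  have "smooth_at (prod_manifold K1 K1) CK X1 fst z"
    by (rule from_K1[OF KK smooth_at_fst[OF K1(1) K1(1) zp] z]) (auto simp: CK_def)
  moreover have "smooth_at (prod_manifold K1 K1) CK X1 snd z"
    by (rule from_K1[OF KK smooth_at_snd[OF K1(1) K1(1) zp] z]) (auto simp: CK_def)
  ultimately have "smooth_at (prod_manifold K1 K1) CK X1 (\<lambda>z. vmult V (fst z) (snd z)) z"
    by (rule V.smooth_at_mult[OF KK _ _ z]) (auto simp: CK_def S1)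
  then have "smooth_at (prod_manifold K1 K1) CK K1 (\<lambda>z. vmult V (fst z) (snd z)) z"
    by (rule into_K1[OF KK _ z]) (auto simp: CK_def S1_mult)
  then show "smooth_at (prod_manifold K1 K1) CK K1 (\<lambda>(v, w). vmult V v w) z" by (simp add: case_prod_unfold)
qed

lemma smooth_ginv_K: "smooth_map K1 K1 (ginv (total_groupoid K))"
proof (rule smooth_maps_K[OF _ K1(1)])
  fix v assume v: "v \<in> S1"
  have "smooth_at X1 S1 K1 vinv v" by (rule into_K1[OF V.mfd(2) V.smooth_ginv[OF S1(1)[OF v]] v]) (rule S1_inv)
  then show "smooth_at X1 S1 K1 (ginv (total_groupoid K)) v"
    by (rule smooth_at_cong[OF _ _ v]) (simp add: ginv_K)
qed

lemma lie_groupoid_K: "lie_groupoid (total_groupoid K)"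
  unfolding lie_groupoid_def
  using algebraic_K V.mfd(1) K1(1) submersion_K_src_tgt smooth_unit_K smooth_mult_K smooth_ginv_K by simp

lemma smooth_map_p0: "smooth_map X0 (Obj G) p0"
  using vector_bundleD(3)[OF E0(1)] E0(2) by simp

lemma smooth_map_pK: "smooth_map K1 (Obj G) pK"
  using vector_bundleD(3)[OF vector_bundle_K] by simp

text \<open>All structure is inherited from \<open>V\<close>. Over the trivial groupoid two arrows
  of \<open>K\<close> lie in the same fibre when \<open>pK\<close> agrees, and then their
  projections to \<open>G\<close> are the same unit, so linearity in \<open>V\<close>
  applies.\<close>

lemma linear_lie_groupoid_bundle_K: "linear_lie_groupoid_bundle (Obj G) K"
proof -
  let ?T = "trivial_groupoid (Obj G)"
  note triv = lie_groupoid_trivial[OF G.mfd(1)]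
  have idm: "smooth_map (Obj G) (Obj G) id" using smooth_map_id[OF G.mfd(1)] by (simp add: id_def)
  have "lie_groupoid_map (total_groupoid K) ?T p0 pK"
    by (rule lie_groupoid_mapI)
      (use smooth_map_p0 smooth_map_pK in \<open>simp_all add: K1(2) S1(6,7) S1_unit S1_mult\<close>)
  moreover have "vb_map (arrb K) (objb K) (vsrc V) id"
    by (rule vb_mapI) (use submersion_K_src_tgt idm E0(2) in \<open>simp_all add: K1(2) submersion_def S1(6-9) linear_S1 scale_S1\<close>)
  moreover have "vb_map (arrb K) (objb K) (vtgt V) id"
    by (rule vb_mapI) (use submersion_K_src_tgt idm E0(2) in \<open>simp_all add: K1(2) submersion_def S1(6-9) linear_S1 scale_S1\<close>)
  moreover have "vb_map (objb K) (arrb K) (vunit V) id"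
    by (rule vb_mapI) (use smooth_unit_K idm E0(2) in \<open>simp_all add: S1_unit linear_unit\<close>)
  moreover have "vb_map (composable_bundle ?T K) (arrb K) (\<lambda>(v, w). vmult V v w) (\<lambda>(g, h). g)"
  proof (rule vb_mapI)
    have ct: "total (composable_bundle ?T K) = composable_pairs (total_groupoid K)" by (simp add: composable_bundle_def)
    have pt: "points (total (composable_bundle ?T K)) = CK" unfolding ct by (rule composable_K(2))
    show "smooth_map (total (composable_bundle ?T K)) (total (arrb K)) (\<lambda>(v, w). vmult V v w)"
      unfolding ct using smooth_mult_K by simp
    show "smooth_map (base (composable_bundle ?T K)) (base (arrb K)) (\<lambda>(g, h). g)"
      using triv(2) by (simp add: composable_bundle_def)
    fix e assume "e \<in> points (total (composable_bundle ?T K))"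
    then obtain v w where e: "e = (v, w)" "v \<in> S1" "w \<in> S1" "vsrc V v = vtgt V w" unfolding pt CK_def by blast
    show "proj (arrb K) (case e of (v, w) \<Rightarrow> vmult V v w) = (case proj (composable_bundle ?T K) e of (g, h) \<Rightarrow> g)"
      using S1_mult[OF e(2-4)] by (simp add: e composable_bundle_def)
    show "(case vscale (composable_bundle ?T K) r e of (v, w) \<Rightarrow> vmult V v w) = vscale (arrb K) r (case e of (v, w) \<Rightarrow> vmult V v w)" for r
      using linear_mult(2)[OF S1(1)[OF e(2)] S1(1)[OF e(3)] e(4)] by (simp add: e composable_bundle_def)
    fix e' assume "e' \<in> points (total (composable_bundle ?T K))" and p: "proj (composable_bundle ?T K) e' = proj (composable_bundle ?T K) e"
    then obtain v' w' where e': "e' = (v', w')" "v' \<in> S1" "w' \<in> S1" "vsrc V v' = vtgt V w'" unfolding pt CK_def by blast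
    have "pK v' = pK v" "pK w' = pK w" using p by (simp_all add: e e' composable_bundle_def)
    then have "p1 v' = p1 v" "p1 w' = p1 w" using S1_same[OF e(2) e'(2)] S1_same[OF e(3) e'(3)] by blast+
    then show "(case vadd (composable_bundle ?T K) e e' of (v, w) \<Rightarrow> vmult V v w) =
       vadd (arrb K) (case e of (v, w) \<Rightarrow> vmult V v w) (case e' of (v, w) \<Rightarrow> vmult V v w)"
      using linear_mult(1)[OF S1(1)[OF e(2)] S1(1)[OF e(3)] e(4) S1(1)[OF e'(2)] S1(1)[OF e'(3)] e'(4)] by (simp add: e e' composable_bundle_def)
  qed
  moreover have "vb_map (arrb K) (arrb K) (ginv (total_groupoid K)) (ginv ?T)"
  proof (rule vb_mapI)
    show "smooth_map (base (arrb K)) (base (arrb K)) (ginv ?T)" using triv(1) by (simp add: lie_groupoid_def)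
  qed (use smooth_ginv_K triv(3) in \<open>simp_all add: K1(2) ginv_K S1(3) S1_inv S1_lin linear_S1 scale_S1\<close>)
  ultimately show ?thesis
    unfolding linear_lie_groupoid_bundle_def vb_groupoid_def
    using triv(1) lie_groupoid_K E0 vector_bundle_K by simp
qed

section \<open>The action and its associator\<close>

definition A0 :: "'g1 \<times> 'v0 \<Rightarrow> 'v0" where
  "A0 z = vtgt V (\<sigma> z)"

text \<open>The word \<open>a b c\<^sup>-\<^sup>1\<close>, the common shape of the action on arrows
  and of \<alpha>. Its end points, projection, linearity and smoothness are settled once for
  both.\<close>

definition conj3 :: "'v1 \<Rightarrow> 'v1 \<Rightarrow> 'v1 \<Rightarrow> 'v1" where
  "conj3 a b c = vmult V (vmult V a b) (vinv c)"

definition A1 :: "'g1 \<times> 'v1 \<Rightarrow> 'v1" where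
  "A1 z = conj3 (\<sigma> (fst z, vtgt V (snd z))) (snd z) (\<sigma> (fst z, vsrc V (snd z)))"

text \<open>Read from the right: back along the lift of \<open>g\<close>, back along the lift of
  \<open>k\<close>, then forward along the lift of the product, all through objects determined by
  \<open>x\<close>.\<close>

definition \<alpha> :: "'g1 \<Rightarrow> 'g1 \<Rightarrow> 'v0 \<Rightarrow> 'v1" where
  "\<alpha> g k x = conj3 (\<sigma> (mult G g k, x)) (vinv (\<sigma> (k, x))) (\<sigma> (g, A0 (k, x)))"

lemma sig:
  assumes "g \<in> points (Arr G)" "x \<in> P0" "src G g = p0 x"
  shows "\<sigma> (g, x) \<in> P1" "p1 (\<sigma> (g, x)) = g" "vsrc V (\<sigma> (g, x)) = x" "vtgt V (\<sigma> (g, x)) = A0 (g, x)"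
    "A0 (g, x) \<in> P0" "p0 (A0 (g, x)) = tgt G g"
proof -
  have D: "(g, x) \<in> D" using assms by (simp add: D_def)
  show 1: "\<sigma> (g, x) \<in> P1" "p1 (\<sigma> (g, x)) = g" "vsrc V (\<sigma> (g, x)) = x"
    using cleavage D assms(1) unfolding cleavage_on_def by blast+
  show "vtgt V (\<sigma> (g, x)) = A0 (g, x)" by (simp add: A0_def)
  show "A0 (g, x) \<in> P0" "p0 (A0 (g, x)) = tgt G g"
    unfolding A0_def using V.st_closed(2)[OF 1(1)] proj_tgt[OF 1(1)] 1(2) by auto
qed

lemma sig_linear:
  assumes "g \<in> points (Arr G)" "x \<in> P0" "src G g = p0 x"
  shows "y \<in> P0 \<Longrightarrow> p0 y = p0 x \<Longrightarrow> \<sigma> (g, add0 x y) = add1 (\<sigma> (g, x)) (\<sigma> (g, y))"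
    "\<sigma> (g, sc0 r x) = sc1 r (\<sigma> (g, x))"
  using cleavage assms unfolding cleavage_on_def by (auto simp: D_def)

lemma sig_unit: "x \<in> P0 \<Longrightarrow> \<sigma> (unit G (p0 x), x) = vunit V x"
  using cleavage G.unit_closed(1)[OF p0] unfolding cleavage_on_def by blast

lemma smooth_sig:
  assumes M: "smooth_manifold M" and f: "smooth_at M S (Arr G) f x" and h: "smooth_at M S X0 h x" and x: "x \<in> S"
    and D: "\<And>y. y \<in> S \<Longrightarrow> f y \<in> points (Arr G) \<and> h y \<in> P0 \<and> src G (f y) = p0 (h y)"
  shows "smooth_at M S X1 (\<lambda>y. \<sigma> (f y, h y)) x"
proof (rule smooth_at_compose[OF M PM V.mfd(2) smooth_at_Pair[OF M G.mfd(2) V.mfd(1) f h x] _ x])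
  have "(f x, h x) \<in> D" using D[OF x] by (simp add: D_def)
  then show "smooth_at PM (D \<inter> points (Arr G) \<times> UNIV) X1 \<sigma> (f x, h x)"
    using cleavage D[OF x] unfolding cleavage_on_def by blast
  show "(\<lambda>y. (f y, h y)) ` S \<subseteq> D \<inter> points (Arr G) \<times> UNIV" using D by (auto simp: D_def)
qed

lemma smooth_A0:
  assumes M: "smooth_manifold M" and f: "smooth_at M S (Arr G) f x" and h: "smooth_at M S X0 h x" and x: "x \<in> S"
    and D: "\<And>y. y \<in> S \<Longrightarrow> f y \<in> points (Arr G) \<and> h y \<in> P0 \<and> src G (f y) = p0 (h y)"
  shows "smooth_at M S X0 (\<lambda>y. A0 (f y, h y)) x"
  unfolding A0_def by (rule V.smooth_at_tgt[OF M smooth_sig[OF M f h x D] x])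

lemma A0_linear:
  assumes "g \<in> points (Arr G)" "x \<in> P0" "src G g = p0 x"
  shows "y \<in> P0 \<Longrightarrow> p0 y = p0 x \<Longrightarrow> A0 (g, add0 x y) = add0 (A0 (g, x)) (A0 (g, y))"
    "A0 (g, sc0 r x) = sc0 r (A0 (g, x))"
proof -
  note s = sig[OF assms]
  show "A0 (g, sc0 r x) = sc0 r (A0 (g, x))"
    unfolding A0_def sig_linear(2)[OF assms] by (rule linear_tgt(2)[OF s(1)])
  assume y: "y \<in> P0" "p0 y = p0 x"
  then have "src G g = p0 y" using assms(3) by simp
  note t = sig[OF assms(1) y(1) this]
  show "A0 (g, add0 x y) = add0 (A0 (g, x)) (A0 (g, y))"
    unfolding A0_def sig_linear(1)[OF assms y] using linear_tgt(1)[OF s(1) t(1)] s(2) t(2) by simp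
qed

lemma conj3:
  assumes "a \<in> P1" "b \<in> P1" "c \<in> P1" "vsrc V a = vtgt V b" "vsrc V b = vsrc V c"
  shows "conj3 a b c \<in> P1" "vsrc V (conj3 a b c) = vtgt V c" "vtgt V (conj3 a b c) = vtgt V a"
    "p1 (conj3 a b c) = mult G (mult G (p1 a) (p1 b)) (ginv G (p1 c))"
    "conj3 (sc1 r a) (sc1 r b) (sc1 r c) = sc1 r (conj3 a b c)"
proof -
  note m = V.mult_closed[OF assms(1,2,4)] and i = V.ginv[OF assms(3)]
  have e: "vsrc V (vmult V a b) = vtgt V (vinv c)" using m i assms(5) by simp
  show "conj3 a b c \<in> P1" "vsrc V (conj3 a b c) = vtgt V c" "vtgt V (conj3 a b c) = vtgt V a"
    unfolding conj3_def using V.mult_closed[OF m(1) i(1) e] m i by auto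
  show "p1 (conj3 a b c) = mult G (mult G (p1 a) (p1 b)) (ginv G (p1 c))"
    unfolding conj3_def using proj_mult[OF m(1) i(1) e] proj_mult[OF assms(1,2,4)] proj_inv[OF assms(3)] by simp
  show "conj3 (sc1 r a) (sc1 r b) (sc1 r c) = sc1 r (conj3 a b c)"
    unfolding conj3_def linear_mult(2)[OF assms(1,2,4)] linear_inv(2)[OF assms(3)] by (rule linear_mult(2)[OF m(1) i(1) e])
qed

lemma conj3_add:
  assumes "a \<in> P1" "b \<in> P1" "c \<in> P1" "vsrc V a = vtgt V b" "vsrc V b = vsrc V c"
    and "a' \<in> P1" "b' \<in> P1" "c' \<in> P1" "vsrc V a' = vtgt V b'" "vsrc V b' = vsrc V c'"
    and "p1 a' = p1 a" "p1 b' = p1 b" "p1 c' = p1 c"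
  shows "conj3 (add1 a a') (add1 b b') (add1 c c') = add1 (conj3 a b c) (conj3 a' b' c')"
proof -
  note m = V.mult_closed[OF assms(1,2,4)] and i = V.ginv[OF assms(3)]
  note m' = V.mult_closed[OF assms(6,7,9)] and i' = V.ginv[OF assms(8)]
  have e: "vsrc V (vmult V a b) = vtgt V (vinv c)" using m i assms(5) by simp
  have e': "vsrc V (vmult V a' b') = vtgt V (vinv c')" using m' i' assms(10) by simp
  have p: "p1 (vmult V a' b') = p1 (vmult V a b)" "p1 (vinv c') = p1 (vinv c)"
    using proj_mult[OF assms(1,2,4)] proj_mult[OF assms(6,7,9)] proj_inv[OF assms(3)] proj_inv[OF assms(8)] assms(11-13) by simp_all
  show ?thesis
    unfolding conj3_def linear_mult(1)[OF assms(1,2,4) assms(6,7,9) assms(11,12)] linear_inv(1)[OF assms(3,8,13)]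
    by (rule linear_mult(1)[OF m(1) i(1) e m'(1) i'(1) e' p])
qed

lemma smooth_conj3:
  assumes M: "smooth_manifold M" and a: "smooth_at M S X1 a x" and b: "smooth_at M S X1 b x" and c: "smooth_at M S X1 c x" and x: "x \<in> S"
    and D: "\<And>y. y \<in> S \<Longrightarrow> a y \<in> P1 \<and> b y \<in> P1 \<and> c y \<in> P1 \<and> vsrc V (a y) = vtgt V (b y) \<and> vsrc V (b y) = vsrc V (c y)"
  shows "smooth_at M S X1 (\<lambda>y. conj3 (a y) (b y) (c y)) x"
  unfolding conj3_def
proof (rule V.smooth_at_mult[OF M _ _ x])
  show "smooth_at M S X1 (\<lambda>y. vmult V (a y) (b y)) x" by (rule V.smooth_at_mult[OF M a b x]) (use D in blast)
  show "smooth_at M S X1 (\<lambda>y. vinv (c y)) x" by (rule V.smooth_at_ginv[OF M c x])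
  show "vmult V (a y) (b y) \<in> P1 \<and> vinv (c y) \<in> P1 \<and> vsrc V (vmult V (a y) (b y)) = vtgt V (vinv (c y))" if "y \<in> S" for y
    using D[OF that] V.mult_closed[of "a y" "b y"] V.ginv[of "c y"] by simp
qed

lemma A1_args:
  assumes "g \<in> points (Arr G)" "v \<in> S1" "src G g = pK v"
  shows "\<sigma> (g, vtgt V v) \<in> P1" "v \<in> P1" "\<sigma> (g, vsrc V v) \<in> P1" "vsrc V (\<sigma> (g, vtgt V v)) = vtgt V v" "vsrc V v = vsrc V (\<sigma> (g, vsrc V v))"
  using assms sig[of g "vtgt V v"] sig[of g "vsrc V v"] S1[of v] by simp_all

lemma A1:
  assumes "g \<in> points (Arr G)" "v \<in> S1" "src G g = pK v"
  shows "A1 (g, v) \<in> S1" "pK (A1 (g, v)) = tgt G g" "vsrc V (A1 (g, v)) = A0 (g, vsrc V v)" "vtgt V (A1 (g, v)) = A0 (g, vtgt V v)"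
    "A1 (g, sc1 r v) = sc1 r (A1 (g, v))"
proof -
  note a = A1_args[OF assms] and v = S1[OF assms(2)]
  note c = conj3[OF a]
  have e: "A1 (g, v) = conj3 (\<sigma> (g, vtgt V v)) v (\<sigma> (g, vsrc V v))" by (simp add: A1_def)
  have s: "src G g = p0 (vtgt V v)" "src G g = p0 (vsrc V v)" using v assms(3) by auto
  note st = sig[OF assms(1) v(9) s(1)] and ss = sig[OF assms(1) v(8) s(2)]
  have "p1 (A1 (g, v)) = mult G (mult G g (unit G (pK v))) (ginv G g)"
    unfolding e c(4) using st(2) ss(2) v(2) by simp
  also have "\<dots> = unit G (tgt G g)" using assms(1,3) by (simp add: G.word_simps)
  finally have "A1 (g, v) \<in> S1 \<and> pK (A1 (g, v)) = tgt G g"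
    by (intro S1I) (use c(1) e G.st_closed(2)[OF assms(1)] in auto)
  then show "A1 (g, v) \<in> S1" "pK (A1 (g, v)) = tgt G g" by auto
  show "vsrc V (A1 (g, v)) = A0 (g, vsrc V v)" "vtgt V (A1 (g, v)) = A0 (g, vtgt V v)"
    unfolding e c(2,3) A0_def by auto
  show "A1 (g, sc1 r v) = sc1 r (A1 (g, v))"
    using c(5)[of r] sig_linear(2)[OF assms(1) v(9) s(1)] sig_linear(2)[OF assms(1) v(8) s(2)] scale_S1[OF assms(2)]
    by (simp add: A1_def)
qed

lemma A1_add:
  assumes g: "g \<in> points (Arr G)" and v: "v \<in> S1" "src G g = pK v" and w: "w \<in> S1" "pK w = pK v"
  shows "A1 (g, add1 v w) = add1 (A1 (g, v)) (A1 (g, w))"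
proof -
  have w2: "src G g = pK w" using v w by simp
  note a = A1_args[OF g v] and a' = A1_args[OF g w(1) w2] and sv = S1[OF v(1)] and sw = S1[OF w(1)]
  have s: "src G g = p0 (vtgt V v)" "src G g = p0 (vsrc V v)" "src G g = p0 (vtgt V w)" "src G g = p0 (vsrc V w)" using sv sw v(2) w2 by auto
  note st = sig[OF g sv(9) s(1)] sig[OF g sv(8) s(2)] sig[OF g sw(9) s(3)] sig[OF g sw(8) s(4)]
  have "conj3 (add1 (\<sigma> (g, vtgt V v)) (\<sigma> (g, vtgt V w))) (add1 v w) (add1 (\<sigma> (g, vsrc V v)) (\<sigma> (g, vsrc V w)))
     = add1 (A1 (g, v)) (A1 (g, w))"
    unfolding A1_def fst_conv snd_conv by (rule conj3_add[OF a a']) (use st S1_same[OF v(1) w(1) w(2)] in auto)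
  then show ?thesis
    unfolding A1_def fst_conv snd_conv linear_S1[OF v(1) w]
    using sig_linear(1)[OF g sv(9) s(1) sw(9)] sig_linear(1)[OF g sv(8) s(2) sw(8)] sv sw w(2) by simp
qed

text \<open>The inner factors \<open>\<sigma> (g, s v)\<^sup>-\<^sup>1\<close> and
  \<open>\<sigma> (g, t w)\<close> cancel because the source of \<open>v\<close> is the target of
  \<open>w\<close>.\<close>

lemma A1_mult:
  assumes g: "g \<in> points (Arr G)" and v: "v \<in> S1" "src G g = pK v" and w: "w \<in> S1" "vsrc V v = vtgt V w"
  shows "A1 (g, vmult V v w) = vmult V (A1 (g, v)) (A1 (g, w))"
proof -
  have w2: "src G g = pK w" using S1_mult(3)[OF v(1) w] v by simp
  note a = A1_args[OF g v] and a' = A1_args[OF g w(1) w2]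
  show ?thesis using a a' w(2) V.mult_closed[OF a(2) a'(2) w(2)]
    by (simp add: A1_def conj3_def V.word_simps)
qed

lemma A1_unit:
  assumes "g \<in> points (Arr G)" "x \<in> P0" "src G g = p0 x"
  shows "A1 (g, vunit V x) = vunit V (A0 (g, x))"
  using sig[OF assms] assms by (simp add: A1_def conj3_def V.word_simps)

text \<open>A cleavage takes identity arrows as values over units, so transporting along a unit does
  nothing and the conjugation is by identities.\<close>

lemma A_unital: "x \<in> P0 \<Longrightarrow> A0 (unit G (p0 x), x) = x" "v \<in> S1 \<Longrightarrow> A1 (unit G (pK v), v) = v"
proof -
  show "x \<in> P0 \<Longrightarrow> A0 (unit G (p0 x), x) = x" by (simp add: A0_def sig_unit V.unit_closed)
  assume v: "v \<in> S1"
  note s = S1[OF v]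
  have "\<sigma> (unit G (pK v), vtgt V v) = vunit V (vtgt V v)" "\<sigma> (unit G (pK v), vsrc V v) = vunit V (vsrc V v)"
    using sig_unit[OF s(9)] sig_unit[OF s(8)] s(6,7) by auto
  then show "A1 (unit G (pK v), v) = v" using s by (simp add: A1_def conj3_def V.word_simps)
qed

lemma smooth_A1:
  assumes M: "smooth_manifold M" and f: "smooth_at M S (Arr G) f x" and h: "smooth_at M S X1 h x" and x: "x \<in> S"
    and D: "\<And>y. y \<in> S \<Longrightarrow> f y \<in> points (Arr G) \<and> h y \<in> S1 \<and> src G (f y) = pK (h y)"
  shows "smooth_at M S X1 (\<lambda>y. A1 (f y, h y)) x"
  unfolding A1_def fst_conv snd_conv
proof (rule smooth_conj3[OF M _ h _ x])
  show "smooth_at M S X1 (\<lambda>y. \<sigma> (f y, vtgt V (h y))) x"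
    by (rule smooth_sig[OF M f V.smooth_at_tgt[OF M h x] x]) (use D S1 in auto)
  show "smooth_at M S X1 (\<lambda>y. \<sigma> (f y, vsrc V (h y))) x"
    by (rule smooth_sig[OF M f V.smooth_at_src[OF M h x] x]) (use D S1 in auto)
  fix y assume y: "y \<in> S"
  have "f y \<in> points (Arr G)" "h y \<in> S1" "src G (f y) = pK (h y)" using D[OF y] by auto
  note a = A1_args[OF this]
  show "\<sigma> (f y, vtgt V (h y)) \<in> P1 \<and> h y \<in> P1 \<and> \<sigma> (f y, vsrc V (h y)) \<in> P1 \<and>
      vsrc V (\<sigma> (f y, vtgt V (h y))) = vtgt V (h y) \<and> vsrc V (h y) = vsrc V (\<sigma> (f y, vsrc V (h y)))"
    by (intro conjI a)
qed

section \<open>Assembling the weak representation\<close>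

text \<open>The action and the two composites joined by \<alpha> are all maps from a pullback of
  \<open>K\<close> to \<open>K\<close>, over \<open>Arr G\<close> or over the composable pairs. The
  obligations are reduced here to pointwise ones, with smoothness of the arrow part into
  \<open>V\<close>; the passage to \<open>K\<close> is made inside.\<close>

lemma vbg_map_pullback:
  fixes N :: "('n, 'h::euclidean_space) manifold"
  defines "DP0 q \<equiv> {(n, x). n \<in> points N \<and> x \<in> P0 \<and> q n = p0 x}" and "DP1 q \<equiv> {(n, v). n \<in> points N \<and> v \<in> S1 \<and> q n = pK v}"
  assumes N: "smooth_manifold N" and b: "smooth_map N (Obj G) b"
    and F0: "\<And>n x. n \<in> points N \<Longrightarrow> x \<in> P0 \<Longrightarrow> q n = p0 x \<Longrightarrow> F0 (n, x) \<in> P0 \<and> p0 (F0 (n, x)) = b n"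
    and F1: "\<And>n v. n \<in> points N \<Longrightarrow> v \<in> S1 \<Longrightarrow> q n = pK v \<Longrightarrow> F1 (n, v) \<in> S1 \<and> pK (F1 (n, v)) = b n"
    and sm: "\<And>z. z \<in> DP0 q \<Longrightarrow> smooth_at (prod_manifold N X0) (DP0 q) X0 F0 z"
      "\<And>z. z \<in> DP1 q \<Longrightarrow> smooth_at (prod_manifold N K1) (DP1 q) X1 F1 z"
    and add: "\<And>n x y. n \<in> points N \<Longrightarrow> x \<in> P0 \<Longrightarrow> q n = p0 x \<Longrightarrow> y \<in> P0 \<Longrightarrow> p0 y = p0 x \<Longrightarrow> F0 (n, add0 x y) = add0 (F0 (n, x)) (F0 (n, y))"
      "\<And>n v w. n \<in> points N \<Longrightarrow> v \<in> S1 \<Longrightarrow> q n = pK v \<Longrightarrow> w \<in> S1 \<Longrightarrow> pK w = pK v \<Longrightarrow> F1 (n, add1 v w) = add1 (F1 (n, v)) (F1 (n, w))"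
    and sc: "\<And>n x r. n \<in> points N \<Longrightarrow> x \<in> P0 \<Longrightarrow> q n = p0 x \<Longrightarrow> F0 (n, sc0 r x) = sc0 r (F0 (n, x))"
      "\<And>n v r. n \<in> points N \<Longrightarrow> v \<in> S1 \<Longrightarrow> q n = pK v \<Longrightarrow> F1 (n, sc1 r v) = sc1 r (F1 (n, v))"
    and fu: "\<And>n v. n \<in> points N \<Longrightarrow> v \<in> S1 \<Longrightarrow> q n = pK v \<Longrightarrow> vsrc V (F1 (n, v)) = F0 (n, vsrc V v) \<and> vtgt V (F1 (n, v)) = F0 (n, vtgt V v)"
      "\<And>n x. n \<in> points N \<Longrightarrow> x \<in> P0 \<Longrightarrow> q n = p0 x \<Longrightarrow> F1 (n, vunit V x) = vunit V (F0 (n, x))"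
      "\<And>n v w. n \<in> points N \<Longrightarrow> v \<in> S1 \<Longrightarrow> q n = pK v \<Longrightarrow> w \<in> S1 \<Longrightarrow> vsrc V v = vtgt V w \<Longrightarrow> F1 (n, vmult V v w) = vmult V (F1 (n, v)) (F1 (n, w))"
  shows "vbg_map (pullback_llgb N q K) K F0 F1 b b"
proof -
  let ?P = "pullback_llgb N q K"
  have pk: "{(n, e). n \<in> points N \<and> e \<in> points K1 \<and> q n = pK e} = DP1 q" by (simp add: DP1_def K1(2))
  have o: "total (objb ?P) = submanifold (prod_manifold N X0) (DP0 q)"
    and a: "total (arrb ?P) = submanifold (prod_manifold N K1) (DP1 q)"
    by (simp_all add: pullback_llgb_def pullback_vb_def DP0_def pk)
  have po: "points (total (objb ?P)) = DP0 q" unfolding o by (rule points_submanifold) (auto simp: DP0_def)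
  have pa: "points (total (arrb ?P)) = DP1 q" unfolding a by (rule points_submanifold) (auto simp: DP1_def K1(2))
  have f: "base (objb ?P) = N" "base (arrb ?P) = N" "proj (objb ?P) = fst" "proj (arrb ?P) = fst"
     "vadd (objb ?P) = (\<lambda>(n, e) (n', e'). (n, add0 e e'))" "vadd (arrb ?P) = (\<lambda>(n, e) (n', e'). (n, add1 e e'))"
     "vscale (objb ?P) = (\<lambda>r (n, e). (n, sc0 r e))" "vscale (arrb ?P) = (\<lambda>r (n, e). (n, sc1 r e))"
     "vsrc ?P = map_prod id (vsrc V)" "vtgt ?P = map_prod id (vtgt V)" "vunit ?P = map_prod id (vunit V)"
     "vmult ?P = (\<lambda>(n, v) (n', v'). (n, vmult V v v'))"
    by (simp_all add: pullback_llgb_def pullback_vb_def)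
  have NX: "smooth_manifold (prod_manifold N X0)" and NK: "smooth_manifold (prod_manifold N K1)"
    using smooth_manifold_prod[OF N V.mfd(1)] smooth_manifold_prod[OF N K1(1)] .
  have s0: "smooth_map (total (objb ?P)) X0 F0"
    unfolding o by (rule smooth_map_submanifoldI[OF NX V.mfd(1) sm(1)])
  have s1: "smooth_map (total (arrb ?P)) K1 F1"
    unfolding a by (rule smooth_map_submanifoldI[OF NK K1(1)], rule into_K1[OF NK sm(2)]) (use F1 in \<open>auto simp: DP1_def\<close>)
  have "lie_groupoid_map (total_groupoid ?P) (total_groupoid K) F0 F1"
  proof (rule lie_groupoid_mapI, simp_all add: s0 s1 po pa f)
    show "vsrc V (F1 g) = F0 (map_prod id (vsrc V) g)" "vtgt V (F1 g) = F0 (map_prod id (vtgt V) g)" if "g \<in> DP1 q" for g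
      using that fu(1) by (auto simp: DP1_def)
    show "F1 (map_prod id (vunit V) x) = vunit V (F0 x)" if "x \<in> DP0 q" for x
      using that fu(2) by (auto simp: DP0_def)
    show "F1 ((case g of (n, v) \<Rightarrow> \<lambda>(n', v'). (n, vmult V v v')) h) = vmult V (F1 g) (F1 h)"
      if "g \<in> DP1 q" "h \<in> DP1 q" "map_prod id (vsrc V) g = map_prod id (vtgt V) h" for g h
      using that fu(3) by (auto simp: DP1_def)
  qed
  moreover have "vb_map (objb ?P) (objb K) F0 b"
    by (rule vb_mapI) (use s0 b F0 add(1) sc(1) E0(2) in \<open>auto simp: po f DP0_def\<close>)
  moreover have "vb_map (arrb ?P) (arrb K) F1 b"
    by (rule vb_mapI) (use s1 b F1 add(2) sc(2) in \<open>auto simp: pa f DP1_def\<close>)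
  ultimately show ?thesis unfolding vbg_map_def by blast
qed

lemma alpha_args:
  assumes g: "g \<in> points (Arr G)" and k: "k \<in> points (Arr G)" and gk: "src G g = tgt G k" and x: "x \<in> P0" "src G k = p0 x"
  shows "\<sigma> (mult G g k, x) \<in> P1" "vinv (\<sigma> (k, x)) \<in> P1" "\<sigma> (g, A0 (k, x)) \<in> P1"
    "vsrc V (\<sigma> (mult G g k, x)) = vtgt V (vinv (\<sigma> (k, x)))" "vsrc V (vinv (\<sigma> (k, x))) = vsrc V (\<sigma> (g, A0 (k, x)))"
proof -
  note m = G.mult_closed[OF g k gk]
  note sk = sig[OF k x]
  note i = V.ginv[OF sk(1)]
  have s1: "src G g = p0 (A0 (k, x))" using gk sk(6) by simp
  have s2: "src G (mult G g k) = p0 x" using m x by simp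
  note sg = sig[OF g sk(5) s1] and sm = sig[OF m(1) x(1) s2]
  show "\<sigma> (mult G g k, x) \<in> P1" "vinv (\<sigma> (k, x)) \<in> P1" "\<sigma> (g, A0 (k, x)) \<in> P1"
    "vsrc V (\<sigma> (mult G g k, x)) = vtgt V (vinv (\<sigma> (k, x)))" "vsrc V (vinv (\<sigma> (k, x))) = vsrc V (\<sigma> (g, A0 (k, x)))"
    using sk i sg sm by simp_all
qed

lemma alpha:
  assumes g: "g \<in> points (Arr G)" and k: "k \<in> points (Arr G)" and gk: "src G g = tgt G k" and x: "x \<in> P0" "src G k = p0 x"
  shows "\<alpha> g k x \<in> S1" "pK (\<alpha> g k x) = tgt G g" "vsrc V (\<alpha> g k x) = A0 (g, A0 (k, x))" "vtgt V (\<alpha> g k x) = A0 (mult G g k, x)"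
    "\<alpha> g k (sc0 r x) = sc1 r (\<alpha> g k x)"
proof -
  note a = alpha_args[OF assms] and sk = sig[OF k x]
  note c = conj3[OF a]
  note m = G.mult_closed[OF g k gk]
  have s1: "src G g = p0 (A0 (k, x))" using gk sk(6) by simp
  have s2: "src G (mult G g k) = p0 x" using m x by simp
  note sg = sig[OF g sk(5) s1] and sm = sig[OF m(1) x(1) s2]
  have "p1 (\<alpha> g k x) = mult G (mult G (mult G g k) (ginv G k)) (ginv G g)"
    unfolding \<alpha>_def c(4) using sg sm sk proj_inv[OF sk(1)] by simp
  also have "\<dots> = unit G (tgt G g)" using g k gk by (simp add: G.word_simps)
  finally have "\<alpha> g k x \<in> S1 \<and> pK (\<alpha> g k x) = tgt G g"
    by (intro S1I) (use c(1) G.st_closed(2)[OF g] in \<open>auto simp: \<alpha>_def\<close>)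
  then show "\<alpha> g k x \<in> S1" "pK (\<alpha> g k x) = tgt G g" by auto
  show "vsrc V (\<alpha> g k x) = A0 (g, A0 (k, x))" "vtgt V (\<alpha> g k x) = A0 (mult G g k, x)"
    using c(2,3) sg(4) sm(4) by (simp_all add: \<alpha>_def)
  show "\<alpha> g k (sc0 r x) = sc1 r (\<alpha> g k x)"
    unfolding \<alpha>_def A0_linear(2)[OF k x] sig_linear(2)[OF k x] sig_linear(2)[OF g sk(5) s1] sig_linear(2)[OF m(1) x(1) s2] linear_inv(2)[OF sk(1)]
    by (rule c(5))
qed

lemma alpha_add:
  assumes g: "g \<in> points (Arr G)" and k: "k \<in> points (Arr G)" and gk: "src G g = tgt G k" and x: "x \<in> P0" "src G k = p0 x"
    and y: "y \<in> P0" "p0 y = p0 x"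
  shows "\<alpha> g k (add0 x y) = add1 (\<alpha> g k x) (\<alpha> g k y)"
proof -
  have ky: "src G k = p0 y" using x y by simp
  note a = alpha_args[OF g k gk x] and b = alpha_args[OF g k gk y(1) ky] and sk = sig[OF k x] and tk = sig[OF k y(1) ky]
  note m = G.mult_closed[OF g k gk]
  have s1: "src G g = p0 (A0 (k, x))" "src G g = p0 (A0 (k, y))" using gk sk(6) tk(6) by simp_all
  have s2: "src G (mult G g k) = p0 x" "src G (mult G g k) = p0 y" using m x ky by simp_all
  note sg = sig[OF g sk(5) s1(1)] and sm = sig[OF m(1) x(1) s2(1)] and tg = sig[OF g tk(5) s1(2)] and tm = sig[OF m(1) y(1) s2(2)]
  have q: "p0 (A0 (k, y)) = p0 (A0 (k, x))" "p1 (\<sigma> (k, y)) = p1 (\<sigma> (k, x))" using s1 sk tk by simp_all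
  show ?thesis
    unfolding \<alpha>_def A0_linear(1)[OF k x y] sig_linear(1)[OF k x y] sig_linear(1)[OF g sk(5) s1(1) tk(5) q(1)]
      sig_linear(1)[OF m(1) x(1) s2(1) y] linear_inv(1)[OF sk(1) tk(1) q(2)]
    by (rule conj3_add[OF a b]) (use sm tm sg tg sk tk proj_inv in simp_all)
qed

text \<open>Both sides reduce to the word \<open>\<sigma> (g k l, x) \<sigma> (l, x)\<^sup>-\<^sup>1
  \<sigma> (k, l \<cdot> x)\<^sup>-\<^sup>1 \<sigma> (g, k \<cdot> (l \<cdot>
  x))\<^sup>-\<^sup>1\<close>.\<close>

lemma alpha_coherence:
  assumes g: "g \<in> points (Arr G)" and k: "k \<in> points (Arr G)" and l: "l \<in> points (Arr G)" and x: "x \<in> P0"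
    and c: "src G g = tgt G k" "src G k = tgt G l" "src G l = p0 x"
  shows "vmult V (\<alpha> g (mult G k l) x) (A1 (g, \<alpha> k l x)) = vmult V (\<alpha> (mult G g k) l x) (\<alpha> g k (A0 (l, x)))"
proof -
  note kl = G.mult_closed[OF k l c(2)] and gk = G.mult_closed[OF g k c(1)]
  have c1: "src G g = tgt G (mult G k l)" "src G (mult G g k) = tgt G l" using kl gk c by simp_all
  note gkl = G.mult_closed[OF g kl(1) c1(1)]
  have as: "mult G (mult G g k) l = mult G g (mult G k l)" by (rule G.assoc[OF g k l c(1,2)])
  have c2: "src G (mult G k l) = p0 x" "src G (mult G g (mult G k l)) = p0 x" using kl gkl c by simp_all
  note s = sig[OF l x c(3)]
  have c3: "src G k = p0 (A0 (l, x))" "src G (mult G g k) = p0 (A0 (l, x))" using s(6) c gk by simp_all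
  note s1 = sig[OF kl(1) x c2(1)] and s2 = sig[OF gkl(1) x c2(2)] and s3 = sig[OF k s(5) c3(1)] and s4 = sig[OF gk(1) s(5) c3(2)]
  have c4: "src G g = p0 (A0 (mult G k l, x))" "src G g = p0 (A0 (k, A0 (l, x)))" using s1(6) s3(6) kl c by simp_all
  note s5 = sig[OF g s1(5) c4(1)] and s6 = sig[OF g s3(5) c4(2)]
  have "vtgt V (\<alpha> k l x) = A0 (mult G k l, x)" "vsrc V (\<alpha> k l x) = A0 (k, A0 (l, x))"
    using alpha[OF k l c(2) x c(3)] by auto
  then have "A1 (g, \<alpha> k l x) = conj3 (\<sigma> (g, A0 (mult G k l, x))) (\<alpha> k l x) (\<sigma> (g, A0 (k, A0 (l, x))))"
    by (simp add: A1_def)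
  then show ?thesis
    using s s1 s2 s3 s4 s5 s6 by (simp add: \<alpha>_def conj3_def as V.word_simps)
qed

text \<open>Both sides reduce to \<open>\<sigma> (g k, t v) v \<sigma> (k, s v)\<^sup>-\<^sup>1
  \<sigma> (g, k \<cdot> s v)\<^sup>-\<^sup>1\<close>.\<close>

lemma alpha_natural:
  assumes g: "g \<in> points (Arr G)" and k: "k \<in> points (Arr G)" and gk: "src G g = tgt G k" and v: "v \<in> S1" "src G k = pK v"
  shows "vmult V (\<alpha> g k (vtgt V v)) (A1 (g, A1 (k, v))) = vmult V (A1 (mult G g k, v)) (\<alpha> g k (vsrc V v))"
proof -
  note m = G.mult_closed[OF g k gk] and sv = S1[OF v(1)] and a = A1[OF k v]
  have s: "src G k = p0 (vtgt V v)" "src G k = p0 (vsrc V v)" using sv v(2) by simp_all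
  have sm: "src G (mult G g k) = p0 (vtgt V v)" "src G (mult G g k) = p0 (vsrc V v)" using m s by simp_all
  note t = sig[OF k sv(9) s(1)] sig[OF k sv(8) s(2)] sig[OF m(1) sv(9) sm(1)] sig[OF m(1) sv(8) sm(2)]
  have c: "src G g = p0 (A0 (k, vtgt V v))" "src G g = p0 (A0 (k, vsrc V v))" using gk t by simp_all
  note u = sig[OF g t(5) c(1)] sig[OF g t(11) c(2)]
  have "A1 (g, A1 (k, v)) = conj3 (\<sigma> (g, A0 (k, vtgt V v))) (A1 (k, v)) (\<sigma> (g, A0 (k, vsrc V v)))"
    using a by (simp add: A1_def)
  then show ?thesis
    using sv t u by (simp add: \<alpha>_def A1_def conj3_def V.word_simps)
qed

text \<open>When one argument is a unit, its lift is an identity arrow and what remains is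
  \<open>\<sigma> (g, x) \<sigma> (g, x)\<^sup>-\<^sup>1\<close>.\<close>

lemma alpha_unital:
  assumes g: "g \<in> points (Arr G)" and x: "x \<in> P0" "src G g = p0 x"
  shows "\<alpha> g (unit G (p0 x)) x = vunit V (A0 (g, x))" "\<alpha> (unit G (tgt G g)) g x = vunit V (A0 (g, x))"
proof -
  note s = sig[OF g x]
  have "mult G g (unit G (p0 x)) = g" using G.unit_right[OF g] x by simp
  then show "\<alpha> g (unit G (p0 x)) x = vunit V (A0 (g, x))"
    using s x A_unital(1)[OF x(1)] sig_unit[OF x(1)] by (simp add: \<alpha>_def conj3_def V.word_simps)
  have "mult G (unit G (tgt G g)) g = g" using G.unit_left[OF g] by simp
  moreover have "\<sigma> (unit G (tgt G g), A0 (g, x)) = vunit V (A0 (g, x))" using sig_unit[OF s(5)] s(6) by simp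
  ultimately show "\<alpha> (unit G (tgt G g)) g x = vunit V (A0 (g, x))"
    using s by (simp add: \<alpha>_def conj3_def V.word_simps)
qed

lemma smooth_composable:
  assumes M: "smooth_manifold M" and f: "smooth_at M S (composable_pairs G) f x" and x: "x \<in> S" and D: "f ` S \<subseteq> G.cset"
  shows "smooth_at M S (Arr G) (\<lambda>y. fst (f y)) x" "smooth_at M S (Arr G) (\<lambda>y. snd (f y)) x"
proof -
  note GG = smooth_manifold_prod[OF G.mfd(2) G.mfd(2)]
  have 1: "smooth_at M S (prod_manifold (Arr G) (Arr G)) f x"
    by (rule smooth_at_into_submanifold[OF M GG G.embedded_cset x D, THEN iffD1]) (use f in \<open>simp add: G.composable_pairs_eq\<close>)
  then have fx: "f x \<in> points (Arr G) \<times> points (Arr G)" using smooth_at_points[OF 1] by simp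
  show "smooth_at M S (Arr G) (\<lambda>y. fst (f y)) x"
    by (rule smooth_at_compose[OF M GG G.mfd(2) 1 smooth_at_fst[OF G.mfd(2) G.mfd(2) fx] x order_refl])
  show "smooth_at M S (Arr G) (\<lambda>y. snd (f y)) x"
    by (rule smooth_at_compose[OF M GG G.mfd(2) 1 smooth_at_snd[OF G.mfd(2) G.mfd(2) fx] x order_refl])
qed

lemma smooth_maps_composable:
  "smooth_map (composable_pairs G) (Obj G) (\<lambda>(g, k). tgt G g)"
  unfolding smooth_map_iff[OF G.composable_manifold(1) G.mfd(1)] G.composable_manifold(2)
proof
  fix z assume z: "z \<in> G.cset"
  then have zp: "z \<in> points (composable_pairs G)" by (simp add: G.composable_manifold(2))
  have "smooth_at (composable_pairs G) G.cset (Obj G) (\<lambda>z. tgt G (fst z)) z"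
    by (rule G.smooth_at_tgt[OF G.composable_manifold(1) smooth_composable(1)[OF G.composable_manifold(1) smooth_at_id[OF G.composable_manifold(1) zp] z] z]) simp
  then show "smooth_at (composable_pairs G) G.cset (Obj G) (\<lambda>(g, k). tgt G g) z" by (simp add: case_prod_unfold)
qed

lemma llgb_map_A: "vbg_map (pullback_llgb (Arr G) (src G) K) K A0 A1 (tgt G) (tgt G)"
proof (rule vbg_map_pullback[OF G.mfd(2) G.smooth_maps(2)])
  note NX = smooth_manifold_prod[OF G.mfd(2) V.mfd(1)] and NK = smooth_manifold_prod[OF G.mfd(2) K1(1)]
  let ?D0 = "{(n, x). n \<in> points (Arr G) \<and> x \<in> P0 \<and> src G n = p0 x}"
  let ?D1 = "{(n, v). n \<in> points (Arr G) \<and> v \<in> S1 \<and> src G n = pK v}"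
  show "smooth_at (prod_manifold (Arr G) X0) ?D0 X0 A0 z" if z: "z \<in> ?D0" for z
  proof -
    have zp: "z \<in> points (Arr G) \<times> P0" using z by auto
    have "smooth_at (prod_manifold (Arr G) X0) ?D0 X0 (\<lambda>z. A0 (fst z, snd z)) z"
      by (rule smooth_A0[OF NX smooth_at_fst[OF G.mfd(2) V.mfd(1) zp] smooth_at_snd[OF G.mfd(2) V.mfd(1) zp] z]) auto
    then show ?thesis by simp
  qed
  show "smooth_at (prod_manifold (Arr G) K1) ?D1 X1 A1 z" if z: "z \<in> ?D1" for z
  proof -
    have zp: "z \<in> points (Arr G) \<times> points K1" using z by (auto simp: K1(2))
    have "smooth_at (prod_manifold (Arr G) K1) ?D1 X1 (\<lambda>z. A1 (fst z, snd z)) z"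
      by (rule smooth_A1[OF NK smooth_at_fst[OF G.mfd(2) K1(1) zp] from_K1[OF NK smooth_at_snd[OF G.mfd(2) K1(1) zp] z] z]) auto
    then show ?thesis by simp
  qed
qed (simp_all add: sig A1 A0_linear A1_add A1_unit A1_mult)

lemma cset_iff: "(g, k) \<in> G.cset \<longleftrightarrow> g \<in> points (Arr G) \<and> k \<in> points (Arr G) \<and> src G g = tgt G k"
  by (simp add: G.cset_def)

lemma llgb_map_AA:
  "vbg_map (pullback_llgb (composable_pairs G) (\<lambda>(g, k). src G k) K) K
     (\<lambda>((g, k), x). A0 (g, A0 (k, x))) (\<lambda>((g, k), v). A1 (g, A1 (k, v))) (\<lambda>(g, k). tgt G g) (\<lambda>(g, k). tgt G g)"
proof (rule vbg_map_pullback[OF G.composable_manifold(1) smooth_maps_composable], unfold G.composable_manifold(2))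
  note C = G.composable_manifold(1)
  note NX = smooth_manifold_prod[OF C V.mfd(1)] and NK = smooth_manifold_prod[OF C K1(1)]
  let ?D0 = "{(n, x). n \<in> G.cset \<and> x \<in> P0 \<and> (case n of (g, k) \<Rightarrow> src G k) = p0 x}"
  let ?D1 = "{(n, v). n \<in> G.cset \<and> v \<in> S1 \<and> (case n of (g, k) \<Rightarrow> src G k) = pK v}"
  show "smooth_at (prod_manifold (composable_pairs G) X0) ?D0 X0 (\<lambda>((g, k), x). A0 (g, A0 (k, x))) z" if z: "z \<in> ?D0" for z
  proof -
    have zp: "z \<in> points (composable_pairs G) \<times> P0" using z by (auto simp: G.composable_manifold(2))
    have sub: "fst ` ?D0 \<subseteq> G.cset" by auto
    note sc = smooth_composable[OF NX smooth_at_fst[OF C V.mfd(1) zp] z sub]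
    have "smooth_at (prod_manifold (composable_pairs G) X0) ?D0 X0 (\<lambda>z. A0 (snd (fst z), snd z)) z"
      by (rule smooth_A0[OF NX sc(2) smooth_at_snd[OF C V.mfd(1) zp] z]) (auto simp: cset_iff)
    then have "smooth_at (prod_manifold (composable_pairs G) X0) ?D0 X0 (\<lambda>z. A0 (fst (fst z), A0 (snd (fst z), snd z))) z"
      by (rule smooth_A0[OF NX sc(1) _ z]) (auto simp: cset_iff sig)
    then show ?thesis by (simp add: case_prod_unfold)
  qed
  show "smooth_at (prod_manifold (composable_pairs G) K1) ?D1 X1 (\<lambda>((g, k), v). A1 (g, A1 (k, v))) z" if z: "z \<in> ?D1" for z
  proof -
    have zp: "z \<in> points (composable_pairs G) \<times> points K1" using z by (auto simp: G.composable_manifold(2) K1(2))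
    have sub: "fst ` ?D1 \<subseteq> G.cset" by auto
    note sc = smooth_composable[OF NK smooth_at_fst[OF C K1(1) zp] z sub]
    have "smooth_at (prod_manifold (composable_pairs G) K1) ?D1 X1 (\<lambda>z. A1 (snd (fst z), snd z)) z"
      by (rule smooth_A1[OF NK sc(2) from_K1[OF NK smooth_at_snd[OF C K1(1) zp] z] z]) (auto simp: cset_iff)
    then have "smooth_at (prod_manifold (composable_pairs G) K1) ?D1 X1 (\<lambda>z. A1 (fst (fst z), A1 (snd (fst z), snd z))) z"
      by (rule smooth_A1[OF NK sc(1) _ z]) (auto simp: cset_iff A1)
    then show ?thesis by (simp add: case_prod_unfold)
  qed
  fix n v w assume n: "n \<in> G.cset" and v: "v \<in> S1" "(case n of (g, k) \<Rightarrow> src G k) = pK v" and w: "w \<in> S1" "vsrc V v = vtgt V w"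
  then show "(\<lambda>((g, k), v). A1 (g, A1 (k, v))) (n, vmult V v w) = vmult V ((\<lambda>((g, k), v). A1 (g, A1 (k, v))) (n, v)) ((\<lambda>((g, k), v). A1 (g, A1 (k, v))) (n, w))"
    using S1_mult(3)[OF v(1) w] by (cases n) (auto simp: cset_iff A1 A1_mult)
qed (auto simp: cset_iff sig A1 A0_linear A1_add A1_unit A1_mult)

lemma llgb_map_A_mult:
  "vbg_map (pullback_llgb (composable_pairs G) (\<lambda>(g, k). src G k) K) K
     (\<lambda>((g, k), x). A0 (mult G g k, x)) (\<lambda>((g, k), v). A1 (mult G g k, v)) (\<lambda>(g, k). tgt G g) (\<lambda>(g, k). tgt G g)"
proof (rule vbg_map_pullback[OF G.composable_manifold(1) smooth_maps_composable], unfold G.composable_manifold(2))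
  note C = G.composable_manifold(1)
  note NX = smooth_manifold_prod[OF C V.mfd(1)] and NK = smooth_manifold_prod[OF C K1(1)]
  let ?D0 = "{(n, x). n \<in> G.cset \<and> x \<in> P0 \<and> (case n of (g, k) \<Rightarrow> src G k) = p0 x}"
  let ?D1 = "{(n, v). n \<in> G.cset \<and> v \<in> S1 \<and> (case n of (g, k) \<Rightarrow> src G k) = pK v}"
  show "smooth_at (prod_manifold (composable_pairs G) X0) ?D0 X0 (\<lambda>((g, k), x). A0 (mult G g k, x)) z" if z: "z \<in> ?D0" for z
  proof -
    have zp: "z \<in> points (composable_pairs G) \<times> P0" using z by (auto simp: G.composable_manifold(2))
    have sub: "fst ` ?D0 \<subseteq> G.cset" by auto
    note sc = smooth_composable[OF NX smooth_at_fst[OF C V.mfd(1) zp] z sub]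
    have "smooth_at (prod_manifold (composable_pairs G) X0) ?D0 (Arr G) (\<lambda>z. mult G (fst (fst z)) (snd (fst z))) z"
      by (rule G.smooth_at_mult[OF NX sc z]) (auto simp: cset_iff)
    then have "smooth_at (prod_manifold (composable_pairs G) X0) ?D0 X0 (\<lambda>z. A0 (mult G (fst (fst z)) (snd (fst z)), snd z)) z"
      by (rule smooth_A0[OF NX _ smooth_at_snd[OF C V.mfd(1) zp] z]) (auto simp: cset_iff G.mult_closed)
    then show ?thesis by (simp add: case_prod_unfold)
  qed
  show "smooth_at (prod_manifold (composable_pairs G) K1) ?D1 X1 (\<lambda>((g, k), v). A1 (mult G g k, v)) z" if z: "z \<in> ?D1" for z
  proof -
    have zp: "z \<in> points (composable_pairs G) \<times> points K1" using z by (auto simp: G.composable_manifold(2) K1(2))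
    have sub: "fst ` ?D1 \<subseteq> G.cset" by auto
    note sc = smooth_composable[OF NK smooth_at_fst[OF C K1(1) zp] z sub]
    have "smooth_at (prod_manifold (composable_pairs G) K1) ?D1 (Arr G) (\<lambda>z. mult G (fst (fst z)) (snd (fst z))) z"
      by (rule G.smooth_at_mult[OF NK sc z]) (auto simp: cset_iff)
    then have "smooth_at (prod_manifold (composable_pairs G) K1) ?D1 X1 (\<lambda>z. A1 (mult G (fst (fst z)) (snd (fst z)), snd z)) z"
      by (rule smooth_A1[OF NK _ from_K1[OF NK smooth_at_snd[OF C K1(1) zp] z] z]) (auto simp: cset_iff G.mult_closed)
    then show ?thesis by (simp add: case_prod_unfold)
  qed
qed (auto simp: cset_iff sig A1 A0_linear A1_add A1_unit A1_mult G.mult_closed)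

lemma vb_map_alpha:
  "vb_map (objb (pullback_llgb (composable_pairs G) (\<lambda>(g, k). src G k) K)) (arrb K) (\<lambda>((g, k), x). \<alpha> g k x) (\<lambda>(g, k). tgt G g)"
proof -
  note C = G.composable_manifold(1)
  note NX = smooth_manifold_prod[OF C V.mfd(1)]
  let ?P = "objb (pullback_llgb (composable_pairs G) (\<lambda>(g, k). src G k) K)"
  let ?D0 = "{(n, x). n \<in> G.cset \<and> x \<in> P0 \<and> (case n of (g, k) \<Rightarrow> src G k) = p0 x}"
  have o: "total ?P = submanifold (prod_manifold (composable_pairs G) X0) ?D0"
    by (simp add: pullback_llgb_def pullback_vb_def G.composable_manifold(2))
  have po: "points (total ?P) = ?D0" unfolding o by (rule points_submanifold) (auto simp: G.composable_manifold(2))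
  have f: "base ?P = composable_pairs G" "proj ?P = fst" "vadd ?P = (\<lambda>(n, e) (n', e'). (n, add0 e e'))" "vscale ?P = (\<lambda>r (n, e). (n, sc0 r e))"
    by (simp_all add: pullback_llgb_def pullback_vb_def)
  have sm: "smooth_map (total ?P) K1 (\<lambda>((g, k), x). \<alpha> g k x)"
    unfolding o
  proof (rule smooth_map_submanifoldI[OF NX K1(1)])
    fix z assume z: "z \<in> ?D0"
    have zp: "z \<in> points (composable_pairs G) \<times> P0" using z by (auto simp: G.composable_manifold(2))
    have sub: "fst ` ?D0 \<subseteq> G.cset" by auto
    note sc = smooth_composable[OF NX smooth_at_fst[OF C V.mfd(1) zp] z sub] and sn = smooth_at_snd[OF C V.mfd(1) zp, of ?D0]
    have d: "fst (fst y) \<in> points (Arr G)" "snd (fst y) \<in> points (Arr G)" "src G (fst (fst y)) = tgt G (snd (fst y))" "snd y \<in> P0" "src G (snd (fst y)) = p0 (snd y)"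
      if "y \<in> ?D0" for y using that by (auto simp: cset_iff)
    have "smooth_at (prod_manifold (composable_pairs G) X0) ?D0 X1 (\<lambda>z. \<alpha> (fst (fst z)) (snd (fst z)) (snd z)) z"
      unfolding \<alpha>_def
    proof (rule smooth_conj3[OF NX _ _ _ z])
      show "smooth_at (prod_manifold (composable_pairs G) X0) ?D0 X1 (\<lambda>z. \<sigma> (mult G (fst (fst z)) (snd (fst z)), snd z)) z"
        by (rule smooth_sig[OF NX G.smooth_at_mult[OF NX sc z] sn z]) (use d G.mult_closed in auto)
      show "smooth_at (prod_manifold (composable_pairs G) X0) ?D0 X1 (\<lambda>z. vinv (\<sigma> (snd (fst z), snd z))) z"
        by (rule V.smooth_at_ginv[OF NX smooth_sig[OF NX sc(2) sn z] z]) (use d in auto)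
      have "smooth_at (prod_manifold (composable_pairs G) X0) ?D0 X0 (\<lambda>z. A0 (snd (fst z), snd z)) z"
        by (rule smooth_A0[OF NX sc(2) sn z]) (use d in auto)
      then show "smooth_at (prod_manifold (composable_pairs G) X0) ?D0 X1 (\<lambda>z. \<sigma> (fst (fst z), A0 (snd (fst z), snd z))) z"
        by (rule smooth_sig[OF NX sc(1) _ z]) (use d sig in auto)
      fix y assume y: "y \<in> ?D0"
      note dy = d[OF y]
      show "\<sigma> (mult G (fst (fst y)) (snd (fst y)), snd y) \<in> P1 \<and> vinv (\<sigma> (snd (fst y), snd y)) \<in> P1 \<and>
          \<sigma> (fst (fst y), A0 (snd (fst y), snd y)) \<in> P1 \<and>
          vsrc V (\<sigma> (mult G (fst (fst y)) (snd (fst y)), snd y)) = vtgt V (vinv (\<sigma> (snd (fst y), snd y))) \<and>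
          vsrc V (vinv (\<sigma> (snd (fst y), snd y))) = vsrc V (\<sigma> (fst (fst y), A0 (snd (fst y), snd y)))"
        by (intro conjI alpha_args[OF dy])
    qed
    then have "smooth_at (prod_manifold (composable_pairs G) X0) ?D0 K1 (\<lambda>z. \<alpha> (fst (fst z)) (snd (fst z)) (snd z)) z"
      by (rule into_K1[OF NX _ z]) (intro alpha d)
    then show "smooth_at (prod_manifold (composable_pairs G) X0) ?D0 K1 (\<lambda>((g, k), x). \<alpha> g k x) z" by (simp add: case_prod_unfold)
  qed
  show ?thesis
    by (rule vb_mapI) (use sm smooth_maps_composable in \<open>auto simp: po f cset_iff alpha alpha_add\<close>)
qed

lemma weak_representation: "weak_representation G K A0 A1 \<alpha>"
  unfolding weak_representation_def
proof (intro conjI ballI impI)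
  let ?P = "pullback_llgb (composable_pairs G) (\<lambda>(g, k). src G k) K"
  show "llgb_natural_transformation ?P K
       (\<lambda>((g, k), x). A0 (g, A0 (k, x))) (\<lambda>((g, k), v). A1 (g, A1 (k, v)))
       (\<lambda>((g, k), x). A0 (mult G g k, x)) (\<lambda>((g, k), v). A1 (mult G g k, v))
       (\<lambda>(g, k). tgt G g) (\<lambda>((g, k), x). \<alpha> g k x)"
    unfolding llgb_natural_transformation_def
  proof (intro conjI llgb_map_AA llgb_map_A_mult vb_map_alpha)
    have po: "points (total (objb ?P)) = {(n, x). n \<in> G.cset \<and> x \<in> P0 \<and> (case n of (g, k) \<Rightarrow> src G k) = p0 x}"
      unfolding pullback_llgb_def pullback_vb_def vbundle.simps vbg.simps K_simps G.composable_manifold(2)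
      by (rule points_submanifold) (auto simp: G.composable_manifold(2))
    have pa: "points (total (arrb ?P)) = {(n, x). n \<in> G.cset \<and> x \<in> S1 \<and> (case n of (g, k) \<Rightarrow> src G k) = pK x}"
      unfolding pullback_llgb_def pullback_vb_def vbundle.simps vbg.simps K_simps G.composable_manifold(2) K1(2)
      by (rule points_submanifold) (auto simp: G.composable_manifold(2) K1(2))
    have fu: "vsrc ?P = map_prod id (vsrc V)" "vtgt ?P = map_prod id (vtgt V)" by (simp_all add: pullback_llgb_def)
    show "natural_transformation (total_groupoid ?P) (total_groupoid K) (\<lambda>((g, k), x). A0 (g, A0 (k, x))) (\<lambda>((g, k), v). A1 (g, A1 (k, v)))
       (\<lambda>((g, k), x). A0 (mult G g k, x)) (\<lambda>((g, k), v). A1 (mult G g k, v)) (\<lambda>((g, k), x). \<alpha> g k x)"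
      unfolding natural_transformation_def
      by (auto simp: po pa fu K1(2) cset_iff alpha alpha_natural)
  qed
qed (use llgb_map_A in \<open>simp_all add: K1(2) A_unital alpha_coherence alpha_unital\<close>)

section \<open>The isomorphism between the action groupoid and \<open>V\<close>\<close>

abbreviation "MA \<equiv> prod_manifold (Arr G) (prod_manifold X0 K1)"

definition SA :: "('g1 \<times> 'v0 \<times> 'v1) set" where
  "SA = {(g, x, v). g \<in> points (Arr G) \<and> x \<in> P0 \<and> v \<in> S1 \<and> src G g = p0 x \<and> vtgt V v = A0 (g, x)}"

definition \<Psi> :: "'g1 \<times> 'v0 \<times> 'v1 \<Rightarrow> 'v1" where
  "\<Psi> = (\<lambda>(g, x, v). vmult V (vinv v) (\<sigma> (g, x)))"

text \<open>The discrepancy between \<open>w\<close> and the lift with the same projection and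
  source: an arrow of \<open>K\<close>, an identity exactly when \<open>w\<close> is that lift. It
  is not the core of a VB-groupoid in the usual sense of the kernel of the source map over the
  units.\<close>

definition core :: "'v1 \<Rightarrow> 'v1" where
  "core w = vmult V (\<sigma> (p1 w, vsrc V w)) (vinv w)"

definition J :: "'v1 \<Rightarrow> 'g1 \<times> 'v0 \<times> 'v1" where
  "J w = (p1 w, vsrc V w, core w)"

lemma MA: "smooth_manifold (prod_manifold X0 K1)" "smooth_manifold MA"
  using smooth_manifold_prod[OF G.mfd(2) smooth_manifold_prod[OF V.mfd(1) K1(1)]] smooth_manifold_prod[OF V.mfd(1) K1(1)] by auto

lemma sig_src:
  assumes "w \<in> P1"
  shows "\<sigma> (p1 w, vsrc V w) \<in> P1" "p1 (\<sigma> (p1 w, vsrc V w)) = p1 w" "vsrc V (\<sigma> (p1 w, vsrc V w)) = vsrc V w"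
    "vtgt V (\<sigma> (p1 w, vsrc V w)) = A0 (p1 w, vsrc V w)"
  using sig[OF p1[OF assms] V.st_closed(1)[OF assms]] proj_src[OF assms] by simp_all

lemma core:
  assumes w: "w \<in> P1"
  shows "core w \<in> S1" "pK (core w) = tgt G (p1 w)" "vsrc V (core w) = vtgt V w" "vtgt V (core w) = A0 (p1 w, vsrc V w)"
    "core (sc1 r w) = sc1 r (core w)"
proof -
  note s = sig_src[OF w] and i = V.ginv[OF w]
  have e: "vsrc V (\<sigma> (p1 w, vsrc V w)) = vtgt V (vinv w)" using s i by simp
  note m = V.mult_closed[OF s(1) i(1) e]
  have "p1 (core w) = unit G (tgt G (p1 w))"
    unfolding core_def proj_mult[OF s(1) i(1) e] using s proj_inv[OF w] G.ginv(5)[OF p1[OF w]] by simp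
  then show "core w \<in> S1" "pK (core w) = tgt G (p1 w)"
    using S1I[OF _ G.st_closed(2)[OF p1[OF w]]] m(1) by (simp_all add: core_def)
  show "vsrc V (core w) = vtgt V w" "vtgt V (core w) = A0 (p1 w, vsrc V w)"
    using m s i by (simp_all add: core_def)
  show "core (sc1 r w) = sc1 r (core w)"
    using linear_mult(2)[OF s(1) i(1) e] linear_src(2)[OF w] linear_inv(2)[OF w] vb_closed(2)[OF E1(1) w]
      sig_linear(2)[OF p1[OF w] V.st_closed(1)[OF w]] proj_src[OF w] by (simp add: core_def)
qed

lemma core_add:
  assumes w: "w \<in> P1" and w': "w' \<in> P1" "p1 w' = p1 w"
  shows "core (add1 w w') = add1 (core w) (core w')"
proof -
  note s = sig_src[OF w] sig_src[OF w'(1)] and i = V.ginv[OF w] V.ginv[OF w'(1)]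
  have e: "vsrc V (\<sigma> (p1 w, vsrc V w)) = vtgt V (vinv w)" "vsrc V (\<sigma> (p1 w', vsrc V w')) = vtgt V (vinv w')" using s i by simp_all
  have q: "p1 (\<sigma> (p1 w', vsrc V w')) = p1 (\<sigma> (p1 w, vsrc V w))" "p1 (vinv w') = p1 (vinv w)"
    using s w'(2) proj_inv[OF w] proj_inv[OF w'(1)] by simp_all
  show ?thesis
    using linear_mult(1)[OF s(1) i(1) e(1) s(5) i(6) e(2) q] linear_src(1)[OF w w'] linear_inv(1)[OF w w'] vb_closed(4)[OF E1(1) w w']
      sig_linear(1)[OF p1[OF w] V.st_closed(1)[OF w] _ V.st_closed(1)[OF w'(1)]] proj_src[OF w] proj_src[OF w'(1)] w'(2)
    by (simp add: core_def)
qed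

lemma Psi:
  assumes a: "(g, x, v) \<in> SA"
  shows "\<Psi> (g, x, v) \<in> P1" "p1 (\<Psi> (g, x, v)) = g" "vsrc V (\<Psi> (g, x, v)) = x" "vtgt V (\<Psi> (g, x, v)) = vsrc V v"
    "J (\<Psi> (g, x, v)) = (g, x, v)"
proof -
  have d: "g \<in> points (Arr G)" "x \<in> P0" "v \<in> S1" "src G g = p0 x" "vtgt V v = A0 (g, x)" using a by (auto simp: SA_def)
  note s = sig[OF d(1,2,4)] and v = S1[OF d(3)]
  note i = V.ginv[OF v(1)] and iS = S1_inv[OF d(3)]
  have e: "vsrc V (vinv v) = vtgt V (\<sigma> (g, x))" using i s d by simp
  note m = V.mult_closed[OF i(1) s(1) e]
  have t: "pK v = tgt G g" using v(7) d(5) s(6) by simp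
  show 1: "\<Psi> (g, x, v) \<in> P1" "vsrc V (\<Psi> (g, x, v)) = x" "vtgt V (\<Psi> (g, x, v)) = vsrc V v"
    using m s i by (simp_all add: \<Psi>_def)
  show 2: "p1 (\<Psi> (g, x, v)) = g"
    using proj_mult[OF i(1) s(1) e] s S1(2)[OF iS(1)] iS(2) t G.unit_laws(2)[OF d(1)] by (simp add: \<Psi>_def)
  show "J (\<Psi> (g, x, v)) = (g, x, v)"
    unfolding J_def core_def 1 2 using s i v e d(5) by (simp add: \<Psi>_def V.word_simps)
qed

lemma J:
  assumes w: "w \<in> P1"
  shows "J w \<in> SA" "\<Psi> (J w) = w"
proof -
  note c = core[OF w] and s = sig_src[OF w]
  show "J w \<in> SA" using c p1[OF w] V.st_closed(1)[OF w] proj_src[OF w] by (simp add: J_def SA_def)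
  show "\<Psi> (J w) = w" using s w by (simp add: J_def \<Psi>_def core_def V.word_simps)
qed

lemma smooth_Psi:
  assumes a: "a \<in> SA"
  shows "smooth_at MA SA X1 \<Psi> a"
proof -
  have ap: "a \<in> points (Arr G) \<times> points (prod_manifold X0 K1)" "snd a \<in> P0 \<times> points K1" using a by (auto simp: SA_def K1(2))
  note s = smooth_at_snd[OF G.mfd(2) MA(1) ap(1), of SA]
  have sg: "smooth_at MA SA X1 (\<lambda>a. \<sigma> (fst a, fst (snd a))) a"
  proof (rule smooth_sig[OF MA(2) smooth_at_fst[OF G.mfd(2) MA(1) ap(1)] _ a])
    show "smooth_at MA SA X0 (\<lambda>a. fst (snd a)) a"
      by (rule smooth_at_compose[OF MA(2,1) V.mfd(1) s smooth_at_fst[OF V.mfd(1) K1(1) ap(2)] a order_refl])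
  qed (auto simp: SA_def)
  have "smooth_at MA SA K1 (\<lambda>a. snd (snd a)) a"
    by (rule smooth_at_compose[OF MA(2,1) K1(1) s smooth_at_snd[OF V.mfd(1) K1(1) ap(2)] a order_refl])
  then have "smooth_at MA SA X1 (\<lambda>a. snd (snd a)) a" by (rule from_K1[OF MA(2) _ a]) (auto simp: SA_def)
  then have "smooth_at MA SA X1 (\<lambda>a. vinv (snd (snd a))) a" by (rule V.smooth_at_ginv[OF MA(2) _ a])
  then have "smooth_at MA SA X1 (\<lambda>a. vmult V (vinv (snd (snd a))) (\<sigma> (fst a, fst (snd a)))) a"
    by (rule V.smooth_at_mult[OF MA(2) _ sg a]) (auto simp: SA_def sig S1(1) V.ginv)
  then show ?thesis by (simp add: \<Psi>_def case_prod_unfold)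
qed

lemma smooth_J:
  assumes w: "w \<in> P1"
  shows "smooth_at X1 P1 MA J w"
proof -
  note p = smooth_p1[OF V.mfd(2) smooth_at_id[OF V.mfd(2) w] w] and s = V.smooth_src[OF w, of P1]
  have "smooth_at X1 P1 X1 core w"
    unfolding core_def[abs_def]
    by (rule V.smooth_at_mult[OF V.mfd(2) smooth_sig[OF V.mfd(2) p s w] V.smooth_ginv[OF w] w])
      (use p1 V.st_closed proj_src sig_src V.ginv in auto)
  then have c: "smooth_at X1 P1 K1 core w" by (rule into_K1[OF V.mfd(2) _ w]) (rule core(1))
  show ?thesis
    unfolding J_def[abs_def]
    by (rule smooth_at_Pair[OF V.mfd(2) G.mfd(2) MA(1) p smooth_at_Pair[OF V.mfd(2,1) K1(1) s c w] w])
qed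

abbreviation "W \<equiv> action_groupoid G K A0 A1 \<alpha>"

lemma W_simps:
  "objb W = objb V" "total (arrb W) = submanifold MA SA" "base (arrb W) = Arr G" "proj (arrb W) (g, x, v) = g"
  "vsrc W (g, x, v) = x" "vtgt W (g, x, v) = vsrc V v" "vunit W x = (unit G (p0 x), x, vunit V x)"
  "vadd (arrb W) (g, x, v) (g', x', v') = (g, add0 x x', add1 v v')" "vscale (arrb W) r (g, x, v) = (g, sc0 r x, sc1 r v)"
  "vmult W (g, x, v) (g', x', v') = (mult G g g', x', vmult V (vmult V (\<alpha> g g' x') (A1 (g, v'))) v)"
  by (simp_all add: action_groupoid_def SA_def K1(2))

text \<open>This accounts for the multiplication of the action groupoid. With the arrows written as
  \<open>v\<^sup>-\<^sup>1 \<sigma> (g, x)\<close> and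
  \<open>v'\<^sup>-\<^sup>1 \<sigma> (g', x')\<close>, the last component of their product is
  \<open>\<sigma> (g g', x') \<sigma> (g', x')\<^sup>-\<^sup>1 v' \<sigma> (g, x)\<^sup>-\<^sup>1
  v\<close>. Inserting \<open>\<sigma> (g, g' \<cdot> x')\<close> and its inverse before
  \<open>v'\<close> separates \<alpha> from the action on \<open>v'\<close>.\<close>

lemma J_mult:
  assumes a: "(g, x, v) \<in> SA" and a': "(g', x', v') \<in> SA" and c: "vsrc V (\<Psi> (g, x, v)) = vtgt V (\<Psi> (g', x', v'))"
  shows "J (vmult V (\<Psi> (g, x, v)) (\<Psi> (g', x', v'))) = (mult G g g', x', vmult V (vmult V (\<alpha> g g' x') (A1 (g, v'))) v)"
proof -
  have d: "g \<in> points (Arr G)" "x \<in> P0" "v \<in> S1" "src G g = p0 x" "vtgt V v = A0 (g, x)" using a by (auto simp: SA_def)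
  have d': "g' \<in> points (Arr G)" "x' \<in> P0" "v' \<in> S1" "src G g' = p0 x'" "vtgt V v' = A0 (g', x')" using a' by (auto simp: SA_def)
  note P = Psi[OF a] and P' = Psi[OF a']
  have x: "x = vsrc V v'" using c P P' by simp
  note m = V.mult_closed[OF P(1) P'(1) c] and s = sig[OF d(1,2,4)] and s' = sig[OF d'(1,2,4)] and v = S1[OF d(3)] and v' = S1[OF d'(3)]
  have gg: "src G g = tgt G g'" using d(4) x v'(6,7) d'(5) s'(6) by simp
  note mg = G.mult_closed[OF d(1) d'(1) gg]
  have mx: "src G (mult G g g') = p0 x'" using mg d' by simp
  have gx: "src G g = p0 (A0 (g', x'))" using gg s'(6) by simp
  note t = sig[OF mg(1) d'(2) mx] and t' = sig[OF d(1) s'(5) gx]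
  have "core (vmult V (\<Psi> (g, x, v)) (\<Psi> (g', x', v'))) = vmult V (vmult V (\<alpha> g g' x') (A1 (g, v'))) v"
    unfolding core_def m proj_mult[OF P(1) P'(1) c] P(2) P'(2,3)
    using s s' v v' t t' d(5) d'(5) x by (simp add: \<Psi>_def \<alpha>_def A1_def conj3_def V.word_simps)
  then show ?thesis unfolding J_def m proj_mult[OF P(1) P'(1) c] P(2) P'(2,3) by simp
qed

lemma action_groupoid_isomorphic:
  assumes "vb_groupoid G V"
  shows "vb_groupoid_isomorphic G W V"
proof -
  \<comment> \<open>The coordinate space of the action groupoid is a product with three factors; the
    typical fibres of \<open>V\<close> are placed in the last one.\<close>
  interpret T: vbg_transport G V MA SA \<Psi> J W "\<lambda>l. (0, 0, l)" "\<lambda>m. snd (snd m)"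
  proof (intro vbg_transport.intro vbg_transport_axioms.intro vb_gpd_axioms)
    show "smooth_manifold MA" by (rule MA(2))
    show "SA \<subseteq> points MA" by (auto simp: SA_def K1(2))
    show "objb W = objb V" "total (arrb W) = submanifold MA SA" "base (arrb W) = Arr G" by (simp_all add: W_simps)
    show "linear (\<lambda>l. (0::'d1, 0::'e0, l::'e1))" "linear (\<lambda>m::'d1 \<times> 'e0 \<times> 'e1. snd (snd m))" "snd (snd (0::'d1, 0::'e0, l::'e1)) = l" for l
      by (auto intro!: linearI)
  next
    fix w assume w: "w \<in> P1"
    show "J w \<in> SA" "\<Psi> (J w) = w" "smooth_at X1 P1 MA J w" using J[OF w] smooth_J[OF w] by auto
  next
    fix x assume x: "x \<in> P0"
    show "vunit W x = J (vunit V x)"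
      using x V.unit_closed[OF x] proj_unit[OF x] sig_unit[OF x] by (simp add: W_simps J_def core_def V.word_simps)
  next
    fix a assume aS: "a \<in> SA"
    obtain g x v where a: "a = (g, x, v)" by (cases a)
    note P = Psi[OF aS[unfolded a]]
    show "\<Psi> a \<in> P1" "J (\<Psi> a) = a" "smooth_at MA SA X1 \<Psi> a" "proj (arrb W) a = p1 (\<Psi> a)" "vsrc W a = vsrc V (\<Psi> a)" "vtgt W a = vtgt V (\<Psi> a)"
      using smooth_Psi[OF aS] P by (simp_all add: a W_simps)
    show "vscale (arrb W) r a = J (sc1 r (\<Psi> a))" for r
      using P(5) core(5)[OF P(1)] linear_src(2)[OF P(1)] vb_closed(2)[OF E1(1) P(1)] P(2,3) by (simp add: a W_simps J_def)
    fix b assume bS: "b \<in> SA"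
    obtain g' x' v' where b: "b = (g', x', v')" by (cases b)
    note Q = Psi[OF bS[unfolded b]]
    show "vmult W a b = J (vmult V (\<Psi> a) (\<Psi> b))" if "vsrc V (\<Psi> a) = vtgt V (\<Psi> b)"
      using J_mult[OF aS[unfolded a] bS[unfolded b] that[unfolded a b]] by (simp add: a b W_simps)
    show "vadd (arrb W) a b = J (add1 (\<Psi> a) (\<Psi> b))" if "p1 (\<Psi> b) = p1 (\<Psi> a)"
      using P(2,3,5) Q(2,3,5) that core_add[OF P(1) Q(1)] linear_src(1)[OF P(1) Q(1)] vb_closed(4)[OF E1(1) P(1) Q(1)]
      by (simp add: a b W_simps J_def)
  qed
  show ?thesis by (rule T.isomorphic_W[OF assms])
qed

end

theorem lemma5p6:
  fixes G :: "('g0, 'd0::euclidean_space, 'g1, 'd1::euclidean_space) groupoid"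
    and V :: "('v0, 'e0::euclidean_space, 'g0, 'd0, 'v1, 'e1::euclidean_space, 'g1, 'd1) vbg"
  assumes "lie_groupoid G"
    and "vb_groupoid G V"
  shows "\<exists>(K :: ('v0, 'e0, 'g0, 'd0, 'v1, 'e1, 'g0, 'd0) vbg) A0 A1 \<alpha>.
           linear_lie_groupoid_bundle (Obj G) K \<and>
           weak_representation G K A0 A1 \<alpha> \<and>
           vb_groupoid_isomorphic G (action_groupoid G K A0 A1 \<alpha>) V"
proof -
  interpret vb_gpd G V using assms(2) by unfold_locales
  obtain \<sigma> where \<sigma>: "cleavage_on (points (Arr G)) \<sigma>" using global_cleavage .
  interpret vbg_cleavage G V \<sigma> using \<sigma> by unfold_locales
  show ?thesis
    using linear_lie_groupoid_bundle_K weak_representation action_groupoid_isomorphic[OF assms(2)] by blast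
qed

end
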